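(* For $N$ large enough, there exists a probability space $(\mathcal{O}_3,\mathcal{F}_3,Q_3)$ on which one can define two random fields $(M_x)_{x\in A_2}$ and $(\widetilde M_x)_{x\in A_2}$ with values in $[0,\infty)^{A_2}$ such that $(M_x)_{x\in A_2}$ has the law of $(L^{\eta_1}_x)_{x\in A_2}$, $(\widetilde M_x)_{x\in A_2}$ has the law of $(L^{\eta_2}_x)_{x\in A_2}$, and $$Q_3\big[M_x\geq\widetilde M_x\text{ for all }x\in A_2\big]\geq1-e^{-N^c}.$$
   Context: Standing setting. $d\geq3$; $P_x$ law of continuous-time simple random walk $(X_t)$ on $\mathbb{Z}^d$ with jump rate 1; $P_\beta=\sum_x\beta(x)P_x$; $H_K=\inf\{t\geq0:X_t\in K\}$, $T_K=\inf\{t\geq0:X_t\notin K\}$; $\widetilde H_K$ first time after the first jump in $K$; $e_K(x)=P_x[\widetilde H_K=\infty]\mathbf{1}_K(x)$, $\mathrm{cap}(K)=\sum_xe_K(x)$, $\widetilde e_K=e_K/\mathrm{cap}(K)$. $\Gamma(U)$ is the space of right-continuous piecewise constant functions $[0,\infty)\to U$ with finitely many jumps on compacts. $B_r\subseteq\mathbb{R}^d$ open Euclidean ball at $0$; $B(x,r)=\{y\in\mathbb{Z}^d:|y-x|_\infty\leq r\}$; $x\sim y$ iff $|x-y|=1$. $D\subseteq\mathbb{R}^d$ is either the closure of a smooth bounded domain containing $0$ or the closure of an open sup-norm ball containing $0$; $r_D=\sup\{|x|:x\in D\}$; $D^\delta$ its closed $\delta$-neighbourhood. Let $\mathfrak{r}\geq0$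 be an integer, $F:[0,\infty)^{B(0,\mathfrak{r})}\to[0,\infty)$ measurable with $F(0)=0$, $F\not\equiv0$, $F$ non-decreasing in each argument, and $F(\ell+\ell')\leq F(\ell)+c_1(\mathbf{1}_{\{\ell'\neq0\}}+\sum_{|x|_\infty\leq\mathfrak{r}}\ell'_x)$; $\vartheta(u)=\mathbb{E}[F((\mathcal{L}^u_y)_{y\in B(0,\mathfrak{r})})]$ with $(\mathcal{L}^u_x)$ the occupation-time field of continuous-time random interlacements at level $u$; $\vartheta_\infty=\lim_{u\to\infty}\vartheta(u)$; $\mathcal{I}_D(\mu)=\inf\{\frac{1}{2d}\int|\nabla\psi|^2:\psi\in D^{1,2}(\mathbb{R}^d),\frac{1}{|D|}\int_D\vartheta(\psi^2)\geq\mu\}$. Fix $\nu\in(0,\vartheta_\infty)$, $\delta\in(0,1\wedge(r_D/2))$, an integer $\mathcal{R}>4r_D$, and $\varphi:\mathbb{R}^d\to\mathbb{R}$ with: $\varphi\in C^\infty(\overline{B_{\mathcal{R}}})$, $\mathrm{supp}\,\varphi=\overline{B_{\mathcal{R}}}$, $\varphi>0$ on $B_{\mathcal{R}}$; $\varphi$ harmonic on $B_{\mathcal{R}}\setminus D^\delta$; $\nu(1+\delta)\leq\frac{1}{|D|}\int_D\vartheta(\varphi^2)\leq\nu(1+2\delta)$ and $\mathcal{I}_D(\nu+\delta)\leq\frac{1}{2d}\int|\nabla\varphi|^2\leq\mathcal{I}_D(\nu+2\delta)$. Fix $\varepsilon\in(0,1)$. For $N\geq1$: $\varphi_N(x)=\varphi(x/N)$,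 $f=\varphi_N/\|\varphi_N\|_{\ell^2(\mathbb{Z}^d)}$, $\pi=f^2$, $U^N=(NB_{\mathcal{R}})\cap\mathbb{Z}^d$. The confined walk $(\overline P_x)_{x\in U^N}$ is the continuous-time Markov chain on $U^N$ with generator $\mathscr{L}_fg(x)=\frac{1}{2d}\sum_{y\in U^N,y\sim x}\frac{f(y)}{f(x)}(g(y)-g(x))$; $\overline P_\beta=\sum_x\beta(x)\overline P_x$. Fix $\eta\in(0,\mathcal{R}/100)$, $x_0\in(ND^\delta)\cap\mathbb{Z}^d$, reals $0<r_1<\dots<r_5<\frac14$ with $r_1(d-2)+r_5<1$, $r_1<\frac{d-2}{d-1}r_2$, and small $\widetilde\delta>0$; $A_j=B(x_0,\lfloor N^{r_j}\rfloor)$, $1\leq j\leq5$, $A_6=B(x_0,\lfloor\widetilde\delta N/100\rfloor)\subseteq(NB_{\mathcal{R}-\eta})\cap\mathbb{Z}^d$ for all $N$. Quasi-stationary distribution $\sigma$ on $U^N\setminus A_2$: with $\mathscr{L}^{U^N\setminus A_2}g=\mathscr{L}_f\widetilde g$ on $U^N\setminus A_2$ ($\widetilde g$ the extension of $g$ by $0$ on $A_2$), $f_1\geq0$ a Perron–Frobenius eigenfunction of $-\mathscr{L}^{U^N\setminus A_2}$ for its smallest eigenvalue, $\sigma(y)=f_1(y)\pi(y)/\sum_{z\in U^N\setminus A_2}f_1(z)\pi(z)$. Let $W=H_{A_1}+T_{A_2}\circ\theta_{H_{A_1}}$ ($\theta$ the time shift); $\kappa_1$ is the law on $\Gamma(U^N)$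 of $X_{(H_{A_1}+\cdot)\wedge W}$ under $\overline P_\sigma$; $\kappa_2$ is the law on $\Gamma(U^N)$ of $X_{\cdot\wedge T_{A_2}}$ under $P_{\widetilde e_{A_1}}$. Let $\eta_1,\eta_2$ be Poisson point processes on $\Gamma(U^N)$ with intensity measures $(1+\frac{\varepsilon}{3})\varphi_N^2(x_0)\mathrm{cap}(A_1)\kappa_1$ and $(1+\frac{\varepsilon}{4})\varphi_N^2(x_0)\mathrm{cap}(A_1)\kappa_2$ respectively, and $L^{\eta_j}_x$ the total time spent at $x$ by the trajectories of $\eta_j$. Constants may depend on $d,\varphi,\delta,\mathcal{R},\varepsilon,\eta,(r_j),\widetilde\delta$ but not on $N$ or $x_0$. *)

theory Defs
  imports "HOL-Probability.Probability"
begin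

definition rv :: "int^'d \<Rightarrow> real^'d" where
  "rv z = (\<chi> i. real_of_int (z $ i))"

definition nbr :: "int^'d \<Rightarrow> int^'d \<Rightarrow> bool" where
  "nbr x y \<longleftrightarrow> norm (rv x - rv y) = 1"

definition nbrs :: "int^'d \<Rightarrow> (int^'d) set" where
  "nbrs x = {y. nbr x y}"

definition supbox :: "int^'d \<Rightarrow> int \<Rightarrow> (int^'d) set" where
  "supbox x r = {y. \<forall>i. \<bar>y $ i - x $ i\<bar> \<le> r}"

definition rD :: "(real^'d) set \<Rightarrow> real" where
  "rD D = Sup (norm ` D)"

definition nbhd :: "(real^'d) set \<Rightarrow> real \<Rightarrow> (real^'d) set" where
  "nbhd D \<delta> = {x. \<exists>y\<in>D. dist x y \<le> \<delta>}"

fun pd :: "'d list \<Rightarrow> (real^'d \<Rightarrow> real) \<Rightarrow> real^'d \<Rightarrow> real" where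
  "pd [] g = g"
| "pd (i # is) g = (\<lambda>x. deriv (\<lambda>t. pd is g (x + t *\<^sub>R axis i 1)) 0)"

definition smooth_on :: "(real^'d) set \<Rightarrow> (real^'d \<Rightarrow> real) \<Rightarrow> bool" where
  "smooth_on S g \<longleftrightarrow> open S \<and>
     (\<forall>is. continuous_on S (pd is g) \<and>
        (\<forall>i. \<forall>x\<in>S. (\<lambda>t. pd is g (x + t *\<^sub>R axis i 1)) differentiable (at 0)))"

definition smooth_closure :: "(real^'d) set \<Rightarrow> (real^'d \<Rightarrow> real) \<Rightarrow> bool" where
  "smooth_closure K g \<longleftrightarrow> (\<exists>S h. K \<subseteq> S \<and> smooth_on S h \<and> (\<forall>x\<in>K. h x = g x))"

definition harmonic_on :: "(real^'d) set \<Rightarrow> (real^'d \<Rightarrow> real) \<Rightarrow> bool" where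
  "harmonic_on S g \<longleftrightarrow> smooth_on S g \<and> (\<forall>x\<in>S. (\<Sum>i\<in>UNIV. pd [i, i] g x) = 0)"

definition phiN :: "(real^'d \<Rightarrow> real) \<Rightarrow> nat \<Rightarrow> int^'d \<Rightarrow> real" where
  "phiN \<phi> N z = \<phi> (inverse (real N) *\<^sub>R rv z)"

definition fN :: "(real^'d \<Rightarrow> real) \<Rightarrow> nat \<Rightarrow> int^'d \<Rightarrow> real" where
  "fN \<phi> N z = phiN \<phi> N z / sqrt (infsum (\<lambda>w. (phiN \<phi> N w)\<^sup>2) UNIV)"

definition Uball :: "real \<Rightarrow> nat \<Rightarrow> (int^'d) set" where
  "Uball R N = {z. norm (rv z) < real N * R}"

text \<open>jump rates of the confined walk with generator L_f\<close>
definition crate :: "(int^'d \<Rightarrow> real) \<Rightarrow> (int^'d) set \<Rightarrow> int^'d \<Rightarrow> int^'d \<Rightarrow> real" where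
  "crate f U x y = (if y \<in> U \<and> nbr x y then f y / (2 * real CARD('d) * f x) else 0)"

definition cq :: "(int^'d \<Rightarrow> real) \<Rightarrow> (int^'d) set \<Rightarrow> int^'d \<Rightarrow> real" where
  "cq f U x = (\<Sum>y\<in>nbrs x. crate f U x y)"

definition cjump :: "(int^'d \<Rightarrow> real) \<Rightarrow> (int^'d) set \<Rightarrow> int^'d \<Rightarrow> int^'d \<Rightarrow> real" where
  "cjump f U x y = crate f U x y / cq f U x"

text \<open>L^V g = L_f (g extended by 0 off V), evaluated on V\<close>
definition genV :: "(int^'d \<Rightarrow> real) \<Rightarrow> (int^'d) set \<Rightarrow> (int^'d) set
                     \<Rightarrow> (int^'d \<Rightarrow> real) \<Rightarrow> int^'d \<Rightarrow> real" where
  "genV f U V g x = (\<Sum>y\<in>nbrs x. crate f U x y * ((if y \<in> V then g y else 0) - g x))"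

definition is_eigval :: "(int^'d \<Rightarrow> real) \<Rightarrow> (int^'d) set \<Rightarrow> (int^'d) set \<Rightarrow> real \<Rightarrow> bool" where
  "is_eigval f U V \<mu> \<longleftrightarrow>
     (\<exists>g. (\<exists>x\<in>V. g x \<noteq> 0) \<and> (\<forall>x\<in>V. - genV f U V g x = \<mu> * g x))"

definition is_PF :: "(int^'d \<Rightarrow> real) \<Rightarrow> (int^'d) set \<Rightarrow> (int^'d) set \<Rightarrow> (int^'d \<Rightarrow> real) \<Rightarrow> bool" where
  "is_PF f U V f1 \<longleftrightarrow> (\<forall>x\<in>V. 0 \<le> f1 x) \<and> (\<exists>x\<in>V. f1 x \<noteq> 0) \<and>
     (\<exists>lam. (\<forall>x\<in>V. - genV f U V f1 x = lam * f1 x) \<and> (\<forall>\<mu>. is_eigval f U V \<mu> \<longrightarrow> lam \<le> \<mu>))"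

text \<open>quasi-stationary distribution sigma(y) = f1(y) pi(y) / sum, with pi = f^2\<close>
definition qsd :: "(int^'d \<Rightarrow> real) \<Rightarrow> (int^'d) set \<Rightarrow> (int^'d \<Rightarrow> real) \<Rightarrow> int^'d \<Rightarrow> real" where
  "qsd f V f1 y = (if y \<in> V then f1 y * (f y)\<^sup>2 / (\<Sum>z\<in>V. f1 z * (f z)\<^sup>2) else 0)"

definition pw :: "('a \<Rightarrow> real) \<Rightarrow> ('a \<Rightarrow> 'a \<Rightarrow> real) \<Rightarrow> 'a list \<Rightarrow> real" where
  "pw init P ys = (case ys of [] \<Rightarrow> 0
       | y # _ \<Rightarrow> init y * (\<Prod>i<length ys - 1. P (ys ! i) (ys ! Suc i)))"

text \<open>jump chain of the rate-1 continuous-time simple random walk\<close>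
definition srwP :: "int^'d \<Rightarrow> int^'d \<Rightarrow> real" where
  "srwP x y = (if nbr x y then 1 / (2 * real CARD('d)) else 0)"

text \<open>P_x[tilde H_K < infinity]: the jump chain visits K at some step \<ge> 1\<close>
definition retp :: "(int^'d) set \<Rightarrow> int^'d \<Rightarrow> real" where
  "retp K x = infsum (pw (\<lambda>y. if y = x then 1 else 0) srwP)
      {ys. 2 \<le> length ys \<and> hd ys = x \<and> last ys \<in> K \<and>
           (\<forall>i. 0 < i \<and> i < length ys - 1 \<longrightarrow> ys ! i \<notin> K)}"

definition eqm :: "(int^'d) set \<Rightarrow> int^'d \<Rightarrow> real" where
  "eqm K x = (if x \<in> K then 1 - retp K x else 0)"

definition cap :: "(int^'d) set \<Rightarrow> real" where
  "cap K = (\<Sum>x\<in>K. eqm K x)"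

definition eqm_norm :: "(int^'d) set \<Rightarrow> int^'d \<Rightarrow> real" where
  "eqm_norm K x = eqm K x / cap K"

text \<open>law of a sum of k independent Exp(r) variables (point mass at 0 if k = 0)\<close>
definition gamma_law :: "nat \<Rightarrow> real \<Rightarrow> real measure" where
  "gamma_law k r = (if k = 0 then return borel 0 else density lborel (erlang_density (k - 1) r))"

text \<open>law on [0,oo)^A of the occupation field of one trajectory: mixture over skeletons s
  (with weight w s) of independent holding-time sums (cnt s z visits at site z, rate q z)\<close>
definition occ_mix :: "('s \<Rightarrow> real) \<Rightarrow> ('s \<Rightarrow> 'a \<Rightarrow> nat) \<Rightarrow> ('a \<Rightarrow> real) \<Rightarrow> 'a set
                       \<Rightarrow> ('a \<Rightarrow> real) measure" where
  "occ_mix w cnt q A = bind (density (count_space UNIV) (\<lambda>s. ennreal (w s)))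
                        (\<lambda>s. PiM A (\<lambda>z. gamma_law (cnt s z) (q z)))"

fun conv_pow :: "'a set \<Rightarrow> ('a \<Rightarrow> real) measure \<Rightarrow> nat \<Rightarrow> ('a \<Rightarrow> real) measure" where
  "conv_pow A \<mu> 0 = return (PiM A (\<lambda>_. borel)) (\<lambda>z\<in>A. 0)"
| "conv_pow A \<mu> (Suc k) = distr (conv_pow A \<mu> k \<Otimes>\<^sub>M \<mu>) (PiM A (\<lambda>_. borel))
                             (\<lambda>(a, b). \<lambda>z\<in>A. a z + b z)"

text \<open>law of the total occupation field (on A) of a Poisson point process with intensity
  measure a * kappa, where mu is the law of the occupation field of one trajectory under kappa:
  Poisson(a * |mu|) many i.i.d. trajectories with law mu / |mu|\<close>
definition ppp_occ_law :: "'a set \<Rightarrow> real \<Rightarrow> ('a \<Rightarrow> real) measure \<Rightarrow> ('a \<Rightarrow> real) measure" where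
  "ppp_occ_law A a \<mu> =
     (let m = measure \<mu> (space \<mu>); \<rho> = a * m in
      bind (density (count_space (UNIV :: nat set)) (\<lambda>k. ennreal (\<rho> ^ k / fact k * exp (- \<rho>))))
           (\<lambda>k. conv_pow A (scale_measure (ennreal (1 / m)) \<mu>) k))"

definition Abox :: "int^'d \<Rightarrow> nat \<Rightarrow> real \<Rightarrow> (int^'d) set" where
  "Abox x0 N \<rho> = supbox x0 \<lfloor>real N powr \<rho>\<rfloor>"

text \<open>skeletons of X_{(H_{A1}+.) \<and> W} under the confined walk: (pre, seg) with pre the part
  before H_{A1} and seg the jump chain from X_{H_{A1}} up to and including X_W\<close>
definition skel1_ok :: "(int^'d) set \<Rightarrow> (int^'d) set \<Rightarrow> (int^'d) list \<times> (int^'d) list \<Rightarrow> bool" where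
  "skel1_ok A1 A2 s \<longleftrightarrow> (case s of (pre, seg) \<Rightarrow>
      (\<forall>y\<in>set pre. y \<notin> A1) \<and> seg \<noteq> [] \<and> hd seg \<in> A1 \<and>
      (\<forall>y\<in>set (butlast seg). y \<in> A2) \<and> last seg \<notin> A2)"

definition kappa1_occ :: "(real^'d \<Rightarrow> real) \<Rightarrow> real \<Rightarrow> nat \<Rightarrow> int^'d \<Rightarrow> (nat \<Rightarrow> real)
                          \<Rightarrow> (int^'d \<Rightarrow> real) \<Rightarrow> (int^'d \<Rightarrow> real) measure" where
  "kappa1_occ \<phi> R N x0 r f1 =
    (let f = fN \<phi> N; U = Uball R N; A1 = Abox x0 N (r 1); A2 = Abox x0 N (r 2);
         \<sigma> = qsd f (U - A2) f1 in
     occ_mix (\<lambda>s. if skel1_ok A1 A2 s then pw \<sigma> (cjump f U) (fst s @ snd s) else 0)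
             (\<lambda>s z. length (filter (\<lambda>y. y = z) (butlast (snd s))))
             (cq f U) A2)"

text \<open>skeletons of X_{. \<and> T_{A2}} under the simple random walk\<close>
definition skel2_ok :: "(int^'d) set \<Rightarrow> (int^'d) list \<Rightarrow> bool" where
  "skel2_ok A2 ys \<longleftrightarrow> ys \<noteq> [] \<and> (\<forall>y\<in>set (butlast ys). y \<in> A2) \<and> last ys \<notin> A2"

definition kappa2_occ :: "int^'d \<Rightarrow> nat \<Rightarrow> (nat \<Rightarrow> real) \<Rightarrow> (int^'d \<Rightarrow> real) measure" where
  "kappa2_occ x0 N r =
    (let A1 = Abox x0 N (r 1); A2 = Abox x0 N (r 2) in
     occ_mix (\<lambda>ys. if skel2_ok A2 ys then pw (eqm_norm A1) srwP ys else 0)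
             (\<lambda>ys z. length (filter (\<lambda>y. y = z) (butlast ys)))
             (\<lambda>_. 1) A2)"

definition law_eta1 :: "(real^'d \<Rightarrow> real) \<Rightarrow> real \<Rightarrow> nat \<Rightarrow> int^'d \<Rightarrow> (nat \<Rightarrow> real) \<Rightarrow> real
                        \<Rightarrow> (int^'d \<Rightarrow> real) \<Rightarrow> (int^'d \<Rightarrow> real) measure" where
  "law_eta1 \<phi> R N x0 r \<epsilon> f1 =
     ppp_occ_law (Abox x0 N (r 2))
       ((1 + \<epsilon> / 3) * (phiN \<phi> N x0)\<^sup>2 * cap (Abox x0 N (r 1))) (kappa1_occ \<phi> R N x0 r f1)"

definition law_eta2 :: "(real^'d \<Rightarrow> real) \<Rightarrow> nat \<Rightarrow> int^'d \<Rightarrow> (nat \<Rightarrow> real) \<Rightarrow> real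
                        \<Rightarrow> (int^'d \<Rightarrow> real) measure" where
  "law_eta2 \<phi> N x0 r \<epsilon> =
     ppp_occ_law (Abox x0 N (r 2))
       ((1 + \<epsilon> / 4) * (phiN \<phi> N x0)\<^sup>2 * cap (Abox x0 N (r 1))) (kappa2_occ x0 N r)"

end

theory Submission
  imports Defs "HOL-Real_Asymp.Real_Asymp"
begin

text \<open>Both trajectory laws consist of an entrance point in \<open>A1\<close> followed by the walk until it leaves \<open>A2\<close>, so two
  things have to be compared. Inside \<open>A2\<close> the jump rates of the confined walk are those of the simple random walk up
  to a factor \<open>1 + O(1/N)\<close> (the confined walk is a Doob transform by a slowly varying \<open>f\<close>); since the time spent in \<open>A2\<close>
  exceeds \<open>N powr (3/4)\<close> only with stretched exponentially small probability, the occupation law of the confined walk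
  dominates \<open>1 - o(1)\<close> times that of the simple random walk off a tiny set of long excursions. The entrance point of the
  confined walk started outside \<open>A2\<close> is distributed as \<open>1 + o(1)\<close> times the normalized equilibrium measure: for
  the simple random walk started on an intermediate shell this is Green's second identity, applied to the escape probability
  from \<open>A1\<close> and the Green function of \<open>A2\<close>, which is nearly constant on \<open>A1\<close> by a gradient estimate for
  harmonic functions; it carries over to the confined walk on \<open>A2\<close> and propagates to all starting points by the maximum
  principle. As \<open>1 + \<epsilon>/4 < (1 + \<epsilon>/3) (1 - o(1))\<close>, the first intensity dominates the second off the
  tiny set, and superposition of Poisson processes gives the coupling.\<close>

section \<open>Poisson superposition\<close>

text \<open>The bound \<open>r 2 < 1/4\<close> opens the window used throughout: leaving
  \<open>A2\<close> takes about \<open>N powr (2 * r 2)\<close> steps, less than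
  \<open>N powr (1/2)\<close>, while jump weights and rates err by \<open>C / N\<close> per step. At
  the cutoff \<open>N powr (3/4)\<close> the accumulated error is still
  \<open>O(N powr (-1/4))\<close>, and exceeding it has probability
  \<open>exp (- const * N powr (1/4))\<close>. That only has to beat polynomial quantities:
  equilibrium weights at least \<open>1 / N^2\<close> on the inner boundary of \<open>A1\<close> and
  entrance multipliers at least \<open>N powr (- (d + 1))\<close>. Sharp Green function asymptotics
  are avoided. Barriers with an exponent slightly below or above the Newtonian one lose a small
  power of \<open>N\<close>, and the gradient estimate between separated scales gains a larger one.
  Poisson fields are handled through their action on functions, where superposition reads exp(S + T)
  = exp S exp T for commuting operators. Changing the holding rates cancels the normalisation of the
  jump chain exactly, so the occupation laws are compared with no error that grows with the number
  of steps.\<close>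

definition addf :: "'a set \<Rightarrow> ('a \<Rightarrow> real) \<Rightarrow> ('a \<Rightarrow> real) \<Rightarrow> 'a \<Rightarrow> real" where
  "addf A x y = (\<lambda>z\<in>A. x z + y z)"

definition zerof :: "'a set \<Rightarrow> 'a \<Rightarrow> real" where
  "zerof A = (\<lambda>z\<in>A. 0)"

abbreviation fieldM :: "'a set \<Rightarrow> ('a \<Rightarrow> real) measure" where
  "fieldM A \<equiv> PiM A (\<lambda>_. borel)"

text \<open>As an operator on functions, convolution with \<open>L\<close> can be iterated, commuted
  and summed as plain algebra. Values in \<open>ennreal\<close> spare integrability side
  conditions.\<close>

definition transl :: "'a set \<Rightarrow> ('a \<Rightarrow> real) measure \<Rightarrow> (('a \<Rightarrow> real) \<Rightarrow> ennreal) \<Rightarrow> ('a \<Rightarrow> real) \<Rightarrow> ennreal" where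
  "transl A L F x = (\<integral>\<^sup>+y. F (addf A x y) \<partial>L)"

lemma zerof_in_space [simp]: "zerof A \<in> space (fieldM A)"
  by (auto simp: zerof_def space_PiM)

lemma addf_commute: "addf A x y = addf A y x"
  by (auto simp: addf_def fun_eq_iff)

lemma addf_assoc: "addf A (addf A x y) z = addf A x (addf A y z)"
  by (auto simp: addf_def fun_eq_iff)

lemma addf_zerof: "x \<in> space (fieldM A) \<Longrightarrow> addf A x (zerof A) = x"
  by (auto simp: addf_def zerof_def fun_eq_iff space_PiM PiE_def extensional_def)

lemma measurable_addf_right [measurable]: "addf A x \<in> fieldM A \<rightarrow>\<^sub>M fieldM A"
  unfolding addf_def by measurable

lemma measurable_addf_pair: "(\<lambda>p. addf A (fst p) (snd p)) \<in> fieldM A \<Otimes>\<^sub>M fieldM A \<rightarrow>\<^sub>M fieldM A"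
  unfolding addf_def by measurable

lemma measurable_addf [measurable (raw)]:
  assumes "f \<in> M \<rightarrow>\<^sub>M fieldM A" "g \<in> M \<rightarrow>\<^sub>M fieldM A"
  shows "(\<lambda>w. addf A (f w) (g w)) \<in> M \<rightarrow>\<^sub>M fieldM A"
  using measurable_compose[OF measurable_Pair[OF assms] measurable_addf_pair] by simp

locale finite_field_measure = finite_measure L for L :: "('a \<Rightarrow> real) measure" +
  fixes A :: "'a set"
  assumes sets_eq [simp, measurable_cong]: "sets L = sets (fieldM A)"
begin

lemma space_eq [simp]: "space L = space (fieldM A)"
  by (rule sets_eq_imp_space_eq) simp

lemma transl_measurable [measurable]:
  assumes [measurable]: "F \<in> borel_measurable (fieldM A)"
  shows "transl A L F \<in> borel_measurable (fieldM A)"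
  unfolding transl_def by measurable

lemma transl_pow_measurable [measurable]:
  assumes [measurable]: "F \<in> borel_measurable (fieldM A)"
  shows "(transl A L ^^ k) F \<in> borel_measurable (fieldM A)"
  by (induction k) auto

lemma transl_cmult:
  assumes [measurable]: "F \<in> borel_measurable (fieldM A)"
  shows "transl A L (\<lambda>y. c * F y) = (\<lambda>x. c * transl A L F x)"
  unfolding transl_def by (intro ext nn_integral_cmult) measurable

lemma transl_sum:
  assumes [measurable]: "\<And>i. i \<in> I \<Longrightarrow> F i \<in> borel_measurable (fieldM A)"
  shows "transl A L (\<lambda>y. \<Sum>i\<in>I. F i y) = (\<lambda>x. \<Sum>i\<in>I. transl A L (F i) x)"
  unfolding transl_def by (intro ext nn_integral_sum) measurable

lemma transl_shift: "transl A L (\<lambda>y. F (addf A x y)) = (\<lambda>y. transl A L F (addf A x y))"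
  unfolding transl_def by (simp add: addf_assoc)

lemma transl_pow_shift: "(transl A L ^^ k) (\<lambda>y. F (addf A x y)) = (\<lambda>y. (transl A L ^^ k) F (addf A x y))"
  by (induction k) (auto simp: transl_shift)

lemma conv_pow_finite: "finite_field_measure (conv_pow A L k) A"
proof (induction k)
  case 0
  have "prob_space (return (fieldM A) (\<lambda>z\<in>A. 0 :: real))"
    by (rule prob_space_return) (auto simp: space_PiM)
  then show ?case
    unfolding finite_field_measure_def finite_field_measure_axioms_def
    by (auto intro: prob_space.finite_measure)
next
  case (Suc k)
  interpret C: finite_field_measure "conv_pow A L k" A by (rule Suc)
  interpret P: pair_sigma_finite "conv_pow A L k" L ..
  have "finite_measure (conv_pow A L k \<Otimes>\<^sub>M L)"
    by (rule finite_measure_pair_measure) unfold_locales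
  then have "finite_measure (conv_pow A L (Suc k))"
    unfolding conv_pow.simps by (rule finite_measure.finite_measure_distr)
      (use measurable_addf_pair[of A] in \<open>simp add: addf_def split_def cong: measurable_cong_sets sets_pair_measure_cong\<close>)
  then show ?case
    by (simp add: finite_field_measure_def finite_field_measure_axioms_def)
qed

text \<open>The passage from measures to operators: by Tonelli each convolution factor acts as one
  application of \<open>transl\<close>, and the point mass that starts the recursion evaluates at
  the zero field.\<close>

lemma nn_integral_conv_pow:
  assumes [measurable]: "F \<in> borel_measurable (fieldM A)"
  shows "(\<integral>\<^sup>+x. F x \<partial>conv_pow A L k) = (transl A L ^^ k) F (zerof A)"
  using assms
proof (induction k arbitrary: F)
  case 0
  have "(\<integral>\<^sup>+x. F x \<partial>conv_pow A L 0) = F (zerof A)"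
    unfolding conv_pow.simps zerof_def by (rule nn_integral_return) (use 0 in \<open>auto simp: space_PiM\<close>)
  then show ?case by simp
next
  case (Suc k)
  note [measurable] = Suc.prems
  interpret C: finite_field_measure "conv_pow A L k" A by (rule conv_pow_finite)
  have meas: "(\<lambda>p. addf A (fst p) (snd p)) \<in> conv_pow A L k \<Otimes>\<^sub>M L \<rightarrow>\<^sub>M fieldM A" by measurable
  have "(\<integral>\<^sup>+x. F x \<partial>conv_pow A L (Suc k)) =
     (\<integral>\<^sup>+x. F x \<partial>distr (conv_pow A L k \<Otimes>\<^sub>M L) (fieldM A) (\<lambda>p. addf A (fst p) (snd p)))"
    by (simp add: addf_def split_def)
  also have "\<dots> = (\<integral>\<^sup>+p. F (addf A (fst p) (snd p)) \<partial>(conv_pow A L k \<Otimes>\<^sub>M L))"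
    by (subst nn_integral_distr[OF meas]) (auto simp: Suc.prems)
  also have "\<dots> = (\<integral>\<^sup>+a. transl A L F a \<partial>conv_pow A L k)"
    using nn_integral_fst[OF measurable_compose[OF meas Suc.prems]] by (simp add: transl_def)
  also have "\<dots> = (transl A L ^^ k) (transl A L F) (zerof A)"
    by (rule Suc.IH) measurable
  finally show ?case by (simp add: funpow_swap1)
qed

text \<open>\<open>bind\<close> asks for a kernel of subprobability measures; the mass bound is read
  off from the operator applied to the constant one.\<close>

lemma subprob_conv_pow:
  assumes "emeasure L (space L) \<le> 1"
  shows "conv_pow A L k \<in> space (subprob_algebra (fieldM A))"
proof -
  interpret C: finite_field_measure "conv_pow A L k" A by (rule conv_pow_finite)
  have "(transl A L ^^ k) (\<lambda>_. 1) x \<le> 1" for x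
  proof (induction k arbitrary: x)
    case (Suc k)
    have "(transl A L ^^ Suc k) (\<lambda>_. 1) x \<le> (\<integral>\<^sup>+y. 1 \<partial>L)"
      unfolding funpow.simps comp_def transl_def[of A L "(transl A L ^^ k) (\<lambda>_. 1)"]
      by (intro nn_integral_mono Suc)
    also have "\<dots> \<le> 1" using assms by simp
    finally show ?case .
  qed auto
  then have "(\<integral>\<^sup>+x. 1 \<partial>conv_pow A L k) \<le> 1"
    by (subst nn_integral_conv_pow) auto
  then have le: "emeasure (conv_pow A L k) (space (conv_pow A L k)) \<le> 1" by simp
  have "space (conv_pow A L k) \<noteq> {}" using zerof_in_space[of A] C.space_eq by force
  then show ?thesis
    using le by (auto simp: space_subprob_algebra intro!: subprob_spaceI)
qed

end

section \<open>Compound Poisson laws as exponentials of convolution operators\<close>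

text \<open>The expectation of \<open>F (x + S)\<close> for a compound Poisson variable \<open>S\<close> with jump measure \<open>L\<close>.\<close>
definition cpint :: "'a set \<Rightarrow> ('a \<Rightarrow> real) measure \<Rightarrow> (('a \<Rightarrow> real) \<Rightarrow> ennreal) \<Rightarrow> ('a \<Rightarrow> real) \<Rightarrow> ennreal" where
  "cpint A L F x = ennreal (exp (- measure L (space L))) *
     (\<Sum>k. ennreal (1 / fact k) * (transl A L ^^ k) F x)"

lemma transl_scale:
  assumes [measurable]: "F \<in> borel_measurable (fieldM A)" and "finite_field_measure L A"
  shows "(transl A (scale_measure c L) ^^ k) F = (\<lambda>x. c ^ k * (transl A L ^^ k) F x)"
proof -
  interpret finite_field_measure L A by fact
  show ?thesis
  proof (induction k)
    case (Suc k)
    have "(transl A (scale_measure c L) ^^ Suc k) F = transl A (scale_measure c L) (\<lambda>x. c ^ k * (transl A L ^^ k) F x)"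
      by (simp add: Suc)
    also have "\<dots> = (\<lambda>x. c * transl A L (\<lambda>x. c ^ k * (transl A L ^^ k) F x) x)"
      unfolding transl_def[of A "scale_measure c L"] transl_def[of A L "(\<lambda>x. c ^ k * (transl A L ^^ k) F x)"]
      by (intro ext nn_integral_scale_measure) measurable
    also have "\<dots> = (\<lambda>x. c ^ Suc k * (transl A L ^^ Suc k) F x)"
      by (subst transl_cmult) (auto simp: mult.assoc)
    finally show ?case .
  qed simp
qed

lemma finite_field_measure_scale:
  assumes "finite_field_measure L A" and "c < \<infinity>"
  shows "finite_field_measure (scale_measure c L) A"
proof -
  interpret finite_field_measure L A by fact
  have "finite_measure (scale_measure c L)"
    by (rule finite_measureI) (use assms(2) in \<open>auto simp: space_scale_measure ennreal_mult_eq_top_iff\<close>)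
  then show ?thesis by (simp add: finite_field_measure_def finite_field_measure_axioms_def)
qed

context finite_field_measure
begin

lemma ppp_kernel_subprob:
  "(\<lambda>k. conv_pow A (scale_measure (ennreal (1 / measure L (space L))) L) k)
     \<in> density (count_space UNIV) f \<rightarrow>\<^sub>M subprob_algebra (fieldM A)"
proof -
  define m where "m = measure L (space L)"
  interpret S: finite_field_measure "scale_measure (ennreal (1/m)) L" A
    by (rule finite_field_measure_scale) (unfold_locales, auto)
  have "emeasure (scale_measure (ennreal (1/m)) L) (space (scale_measure (ennreal (1/m)) L)) \<le> 1"
    unfolding space_scale_measure emeasure_scale_measure emeasure_eq_measure m_def[symmetric]
    by (cases "m = 0") (auto simp: ennreal_mult'[symmetric] m_def)
  from S.subprob_conv_pow[OF this] show ?thesis by (auto simp: m_def)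
qed

lemma sets_ppp: "sets (ppp_occ_law A a L) = sets (fieldM A)"
  unfolding ppp_occ_law_def Let_def
  by (rule sets_bind_measurable[OF ppp_kernel_subprob]) simp

text \<open>The normalisation of the trajectory law cancels against the Poisson weights: the k-th
  term carries \<open>(a * m) ^ k\<close> times \<open>(1 / m) ^ k\<close>, leaving
  \<open>a ^ k\<close> and the unnormalised operator.\<close>

lemma nn_integral_ppp:
  assumes [measurable]: "F \<in> borel_measurable (fieldM A)" and "0 \<le> a"
  shows "(\<integral>\<^sup>+x. F x \<partial>ppp_occ_law A a L) = cpint A (scale_measure (ennreal a) L) F (zerof A)"
proof -
  define m where "m = measure L (space L)"
  interpret S: finite_field_measure "scale_measure (ennreal (1/m)) L" A
    by (rule finite_field_measure_scale) (unfold_locales, auto)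
  have m0: "0 \<le> m" by (simp add: m_def)
  have meas: "measure (scale_measure (ennreal a) L) (space (scale_measure (ennreal a) L)) = a * m"
    using \<open>0 \<le> a\<close> by (simp add: measure_def space_scale_measure enn2real_mult m_def)
  \<comment> \<open>For \<open>m = 0\<close> the cancellation breaks down because
    \<open>1 / m\<close> is then zero, but all terms with \<open>k > 0\<close> vanish since
    \<open>L\<close> is null.\<close>
  have tr: "(transl A L ^^ k) F (zerof A) = 0" if "m = 0" "k > 0" for k
  proof -
    have "emeasure L (space L) = 0" using that by (simp add: m_def emeasure_eq_measure)
    then have "AE x in L. False" by (intro AE_I[where N="space L"]) auto
    then have "transl A L H x = 0" for H x
      unfolding transl_def by (subst nn_integral_cong_AE[where v="\<lambda>_. 0"]) auto
    then show ?thesis using that by (cases k) auto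
  qed
  have "(\<integral>\<^sup>+x. F x \<partial>ppp_occ_law A a L) =
     (\<integral>\<^sup>+k. \<integral>\<^sup>+x. F x \<partial>conv_pow A (scale_measure (ennreal (1/m)) L) k
        \<partial>density (count_space (UNIV :: nat set)) (\<lambda>k. ennreal ((a*m) ^ k / fact k * exp (- (a*m)))))"
    unfolding ppp_occ_law_def Let_def m_def
    by (rule nn_integral_bind[OF assms(1) ppp_kernel_subprob])
  also have "\<dots> = (\<Sum>k. ennreal ((a*m) ^ k / fact k * exp (- (a*m))) *
        (\<integral>\<^sup>+x. F x \<partial>conv_pow A (scale_measure (ennreal (1/m)) L) k))"
    by (subst nn_integral_density) (auto simp: nn_integral_count_space_nat)
  also have "\<dots> = (\<Sum>k. ennreal (exp (- (a*m))) * (ennreal (1 / fact k) * (ennreal a ^ k * (transl A L ^^ k) F (zerof A))))"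
  proof (intro suminf_cong)
    fix k
    have e: "(\<integral>\<^sup>+x. F x \<partial>conv_pow A (scale_measure (ennreal (1/m)) L) k) = ennreal (1/m) ^ k * (transl A L ^^ k) F (zerof A)"
      by (subst S.nn_integral_conv_pow) (use transl_scale[of F A L] finite_field_measure_axioms in \<open>auto simp: fun_eq_iff\<close>)
    show "ennreal ((a*m) ^ k / fact k * exp (- (a*m))) * (\<integral>\<^sup>+x. F x \<partial>conv_pow A (scale_measure (ennreal (1/m)) L) k) =
       ennreal (exp (- (a*m))) * (ennreal (1 / fact k) * (ennreal a ^ k * (transl A L ^^ k) F (zerof A)))"
    proof (cases "m = 0 \<and> k > 0")
      case True
      then show ?thesis using tr by (simp add: e)
    next
      case False
      then have "ennreal ((a*m) ^ k / fact k * exp (- (a*m))) * ennreal (1/m) ^ k =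
         ennreal (exp (- (a*m))) * (ennreal (1 / fact k) * ennreal a ^ k)"
        using m0 \<open>0 \<le> a\<close>
        by (cases "k = 0") (auto simp: ennreal_power ennreal_mult[symmetric] field_simps power_mult_distrib)
      then show ?thesis unfolding e by (metis mult.assoc)
    qed
  qed
  also have "\<dots> = cpint A (scale_measure (ennreal a) L) F (zerof A)"
    unfolding cpint_def meas
    by (subst transl_scale) (auto simp: finite_field_measure_axioms)
  finally show ?thesis .
qed

lemma cpint_measurable [measurable]:
  assumes [measurable]: "F \<in> borel_measurable (fieldM A)"
  shows "cpint A L F \<in> borel_measurable (fieldM A)"
  unfolding cpint_def by measurable

lemma cpint_shift: "cpint A L (\<lambda>y. F (addf A x y)) y = cpint A L F (addf A x y)"
  unfolding cpint_def by (simp add: transl_pow_shift)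

lemma cpint_one: "cpint A L (\<lambda>_. 1) x = 1"
proof -
  have p: "(transl A L ^^ k) (\<lambda>_. 1) x = ennreal (measure L (space L)) ^ k" for k x
  proof (induction k arbitrary: x)
    case (Suc k)
    have "(transl A L ^^ Suc k) (\<lambda>_. 1) x = (\<integral>\<^sup>+y. ennreal (measure L (space L)) ^ k \<partial>L)"
      unfolding funpow.simps comp_def transl_def[of A L "(transl A L ^^ k) (\<lambda>_. 1)"] Suc ..
    then show ?case by (simp add: emeasure_eq_measure mult.commute)
  qed auto
  define m where "m = measure L (space L)"
  have "(\<Sum>k. ennreal (1 / fact k) * ennreal m ^ k) = (\<Sum>k. ennreal (inverse (fact k) * m ^ k))"
    by (intro suminf_cong) (auto simp: ennreal_power m_def ennreal_mult[symmetric] field_simps)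
  also have "\<dots> = ennreal (exp m)"
    using exp_converges[of m] by (intro suminf_ennreal_eq) (auto simp: m_def)
  finally show ?thesis
    unfolding cpint_def p m_def[symmetric] by (simp add: ennreal_mult[symmetric] exp_minus)
qed

lemma prob_space_ppp: "0 \<le> a \<Longrightarrow> prob_space (ppp_occ_law A a L)"
proof -
  assume a: "0 \<le> a"
  interpret S: finite_field_measure "scale_measure (ennreal a) L" A
    by (rule finite_field_measure_scale) (unfold_locales, auto)
  have "(\<integral>\<^sup>+x. 1 \<partial>ppp_occ_law A a L) = 1"
    by (subst nn_integral_ppp) (auto simp: a S.cpint_one)
  then show ?thesis by (intro prob_spaceI) simp
qed

end

text \<open>The three measures are related only on measurable sets, so additivity is carried from
  indicators to measurable functions by the standard induction.\<close>

lemma nn_integral_add_measure: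
  assumes sets: "sets M = sets N" "sets M' = sets N"
    and eq: "\<And>E. E \<in> sets N \<Longrightarrow> emeasure N E = emeasure M E + emeasure M' E"
    and F: "F \<in> borel_measurable N"
  shows "(\<integral>\<^sup>+x. F x \<partial>N) = (\<integral>\<^sup>+x. F x \<partial>M) + (\<integral>\<^sup>+x. F x \<partial>M')"
  using F
proof (induction rule: borel_measurable_induct)
  case (cong f g)
  have "space M = space N" "space M' = space N" using sets by (auto dest: sets_eq_imp_space_eq)
  then have "(\<integral>\<^sup>+x. f x \<partial>N) = (\<integral>\<^sup>+x. g x \<partial>N)" "(\<integral>\<^sup>+x. f x \<partial>M) = (\<integral>\<^sup>+x. g x \<partial>M)" "(\<integral>\<^sup>+x. f x \<partial>M') = (\<integral>\<^sup>+x. g x \<partial>M')"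
    using cong(3) by (auto intro: nn_integral_cong)
  with cong show ?case by simp
next
  case (set E)
  then show ?case using sets by (simp add: eq)
next
  case (mult u c)
  have "u \<in> borel_measurable M" "u \<in> borel_measurable M'"
    using mult sets by (auto cong: measurable_cong_sets)
  with mult show ?case by (simp add: nn_integral_cmult distrib_left)
next
  case (add u v)
  have "u \<in> borel_measurable M" "u \<in> borel_measurable M'" "v \<in> borel_measurable M" "v \<in> borel_measurable M'"
    using add sets by (auto cong: measurable_cong_sets)
  with add show ?case by (simp add: nn_integral_add ac_simps)
next
  case (seq U)
  have m: "U i \<in> borel_measurable M" "U i \<in> borel_measurable M'" for i
    using seq sets by (auto cong: measurable_cong_sets)
  have e: "(SUP i. U i) x = (SUP i. U i x)" for x by (simp add: SUP_apply image_comp)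
  have inc: "incseq (\<lambda>i. \<integral>\<^sup>+x. U i x \<partial>M)" "incseq (\<lambda>i. \<integral>\<^sup>+x. U i x \<partial>M')"
    using seq by (auto simp: incseq_def le_fun_def intro!: nn_integral_mono)
  have "(\<integral>\<^sup>+x. (SUP i. U i x) \<partial>N) = (SUP i. (\<integral>\<^sup>+x. U i x \<partial>M) + (\<integral>\<^sup>+x. U i x \<partial>M'))"
    using seq by (simp add: nn_integral_monotone_convergence_SUP)
  also have "\<dots> = (SUP i. \<integral>\<^sup>+x. U i x \<partial>M) + (SUP i. \<integral>\<^sup>+x. U i x \<partial>M')"
    by (rule ennreal_SUP_add[OF inc])
  also have "\<dots> = (\<integral>\<^sup>+x. (SUP i. U i x) \<partial>M) + (\<integral>\<^sup>+x. (SUP i. U i x) \<partial>M')"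
    using seq m by (simp add: nn_integral_monotone_convergence_SUP)
  finally show ?case by (simp only: e)
qed

locale two_field_measures = L1: finite_field_measure L1 A + L2: finite_field_measure L2 A
  for L1 L2 :: "('a \<Rightarrow> real) measure" and A
begin

text \<open>Tonelli's theorem and commutativity of pointwise addition of fields.\<close>

lemma transl_commute:
  assumes [measurable]: "F \<in> borel_measurable (fieldM A)"
  shows "transl A L1 (transl A L2 F) = transl A L2 (transl A L1 F)"
proof
  fix x
  interpret P: pair_sigma_finite L1 L2 ..
  have m: "(\<lambda>(y, z). F (addf A (addf A x y) z)) \<in> borel_measurable (L1 \<Otimes>\<^sub>M L2)" by measurable
  have "transl A L1 (transl A L2 F) x = (\<integral>\<^sup>+y. \<integral>\<^sup>+z. F (addf A (addf A x y) z) \<partial>L2 \<partial>L1)"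
    by (simp add: transl_def)
  also have "\<dots> = (\<integral>\<^sup>+z. \<integral>\<^sup>+y. F (addf A (addf A x y) z) \<partial>L1 \<partial>L2)"
    using P.Fubini[OF m] by simp
  also have "\<dots> = transl A L2 (transl A L1 F) x"
    unfolding transl_def addf_assoc by (subst (2) addf_commute) simp
  finally show "transl A L1 (transl A L2 F) x = transl A L2 (transl A L1 F) x" .
qed

lemma transl_commute_pow:
  assumes [measurable]: "F \<in> borel_measurable (fieldM A)"
  shows "transl A L2 ((transl A L1 ^^ k) F) = (transl A L1 ^^ k) (transl A L2 F)"
  by (induction k) (auto simp: transl_commute[symmetric])

text \<open>\<open>transl A L3\<close> is the sum of two commuting operators, so this is the
  binomial theorem; the induction step is Pascal's rule after shifting one index.\<close>

lemma transl_binomial: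
  assumes [measurable]: "F \<in> borel_measurable (fieldM A)"
    and sets: "sets L3 = sets (fieldM A)"
    and eq: "\<And>E. E \<in> sets (fieldM A) \<Longrightarrow> emeasure L3 E = emeasure L1 E + emeasure L2 E"
  shows "(transl A L3 ^^ k) F = (\<lambda>x. \<Sum>j\<le>k. of_nat (k choose j) * (transl A L1 ^^ j) ((transl A L2 ^^ (k - j)) F) x)"
proof (induction k)
  case (Suc k)
  have add: "transl A L3 H x = transl A L1 H x + transl A L2 H x" if [measurable]: "H \<in> borel_measurable (fieldM A)" for H x
  proof -
    have "(\<lambda>y. H (addf A x y)) \<in> borel_measurable L3" using sets by (simp cong: measurable_cong_sets)
    then show ?thesis
      unfolding transl_def by (intro nn_integral_add_measure) (auto simp: sets eq)
  qed
  define t where "t j = (transl A L1 ^^ j) ((transl A L2 ^^ (Suc k - j)) F)" for j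
  have [measurable]: "t j \<in> borel_measurable (fieldM A)" for j by (simp add: t_def)
  define s where "s j = (transl A L1 ^^ j) ((transl A L2 ^^ (k - j)) F)" for j
  have [measurable]: "s j \<in> borel_measurable (fieldM A)" for j by (simp add: s_def)
  have s1: "transl A L1 (s j) = t (Suc j)" for j by (simp add: s_def t_def)
  have s2: "transl A L2 (s j) = t j" if "j \<le> k" for j
    unfolding s_def t_def using that by (subst transl_commute_pow) (auto simp: Suc_diff_le)
  have cm: "transl A L1 (\<lambda>y. \<Sum>j\<le>k. of_nat (k choose j) * s j y) = (\<lambda>x. \<Sum>j\<le>k. of_nat (k choose j) * t (Suc j) x)"
    by (subst L1.transl_sum) (auto simp: L1.transl_cmult s1)
  have cm2: "transl A L2 (\<lambda>y. \<Sum>j\<le>k. of_nat (k choose j) * s j y) = (\<lambda>x. \<Sum>j\<le>k. of_nat (k choose j) * t j x)"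
    by (subst L2.transl_sum) (auto simp: L2.transl_cmult s2)
  show ?case
  proof
    fix x
    have "(transl A L3 ^^ Suc k) F x = transl A L3 (\<lambda>y. \<Sum>j\<le>k. of_nat (k choose j) * s j y) x"
      by (simp add: Suc s_def)
    also have "\<dots> = (\<Sum>j\<le>k. of_nat (k choose j) * t (Suc j) x) + (\<Sum>j\<le>k. of_nat (k choose j) * t j x)"
      by (subst add) (auto simp: cm cm2)
    also have "\<dots> = (\<Sum>j\<le>Suc k. of_nat (Suc k choose j) * t j x)"
    proof -
      have "(\<Sum>j\<le>Suc k. of_nat (Suc k choose j) * t j x)
          = t 0 x + (\<Sum>j\<le>k. of_nat (Suc k choose Suc j) * t (Suc j) x)"
        by (subst sum.atMost_Suc_shift) simp
      also have "\<dots> = t 0 x + (\<Sum>j\<le>k. of_nat (k choose j) * t (Suc j) x) + (\<Sum>j\<le>k. of_nat (k choose Suc j) * t (Suc j) x)"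
        by (simp add: sum.distrib distrib_right add.assoc)
      also have "(\<Sum>j\<le>k. of_nat (k choose Suc j) * t (Suc j) x) = (\<Sum>j<k. of_nat (k choose Suc j) * t (Suc j) x)"
        by (simp add: lessThan_Suc_atMost[symmetric])
      also have "t 0 x + (\<Sum>j\<le>k. of_nat (k choose j) * t (Suc j) x) + (\<Sum>j<k. of_nat (k choose Suc j) * t (Suc j) x)
         = (\<Sum>j\<le>k. of_nat (k choose j) * t (Suc j) x) + (t 0 x + (\<Sum>j<k. of_nat (k choose Suc j) * t (Suc j) x))"
        by (simp add: ac_simps)
      also have "t 0 x + (\<Sum>j<k. of_nat (k choose Suc j) * t (Suc j) x) = (\<Sum>j\<le>k. of_nat (k choose j) * t j x)"
        by (cases k) (simp_all add: lessThan_Suc_atMost sum.atMost_Suc_shift del: sum.atMost_Suc)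
      finally show ?thesis by simp
    qed
    finally show "(transl A L3 ^^ Suc k) F x = (\<Sum>j\<le>Suc k. of_nat (Suc k choose j) * (transl A L1 ^^ j) ((transl A L2 ^^ (Suc k - j)) F) x)"
      by (simp only: t_def)
  qed
qed simp

end

text \<open>Cauchy product reindexing along antidiagonals, by Tonelli for counting measures on the
  pairs with \<open>j \<le> k\<close>.\<close>

lemma suminf_ennreal_triangle:
  fixes f :: "nat \<Rightarrow> nat \<Rightarrow> ennreal"
  shows "(\<Sum>k. \<Sum>j\<le>k. f j (k - j)) = (\<Sum>j. \<Sum>i. f j i)"
proof -
  have "(\<Sum>k. \<Sum>j\<le>k. f j (k - j)) = (\<integral>\<^sup>+k. \<integral>\<^sup>+j. (if j \<le> k then f j (k - j) else 0) \<partial>count_space UNIV \<partial>count_space (UNIV :: nat set))"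
  proof -
    have inner: "(\<integral>\<^sup>+j. (if j \<le> k then f j (k - j) else 0) \<partial>count_space UNIV) = (\<Sum>j\<le>k. f j (k - j))" for k
    proof -
      have "(\<integral>\<^sup>+j. (if j \<le> k then f j (k - j) else 0) \<partial>count_space UNIV) = (\<Sum>j\<in>{..k}. (if j \<le> k then f j (k - j) else 0))"
        by (rule nn_integral_count_space') auto
      then show ?thesis by simp
    qed
    show ?thesis unfolding inner by (rule nn_integral_count_space_nat[symmetric])
  qed
  also have "\<dots> = (\<integral>\<^sup>+j. \<integral>\<^sup>+k. (if j \<le> k then f j (k - j) else 0) \<partial>count_space UNIV \<partial>count_space UNIV)"
    using nn_integral_fst_count_space[of "\<lambda>(k,j). if j \<le> k then f j (k - j) else 0"]
      nn_integral_snd_count_space[of "\<lambda>(k,j). if j \<le> k then f j (k - j) else 0"] by simp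
  also have "\<dots> = (\<integral>\<^sup>+j. \<integral>\<^sup>+i. f j i \<partial>count_space UNIV \<partial>count_space UNIV)"
  proof (rule nn_integral_cong)
    fix j :: nat
    have b: "bij_betw (\<lambda>i. i + j) UNIV {j..}"
      by (rule bij_betwI[where g="\<lambda>k. k - j"]) auto
    have "(\<integral>\<^sup>+i. f j i \<partial>count_space UNIV) = (\<integral>\<^sup>+i. f j ((i + j) - j) \<partial>count_space UNIV)" by simp
    also have "\<dots> = (\<integral>\<^sup>+k. f j (k - j) \<partial>count_space {j..})"
      by (rule nn_integral_bij_count_space[OF b])
    also have "\<dots> = (\<integral>\<^sup>+k. f j (k - j) * indicator {j..} k \<partial>count_space UNIV)"
      by (rule nn_integral_count_space_indicator) simp
    also have "\<dots> = (\<integral>\<^sup>+k. (if j \<le> k then f j (k - j) else 0) \<partial>count_space UNIV)"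
      by (intro nn_integral_cong) (auto simp: indicator_def)
    finally show "(\<integral>\<^sup>+k. (if j \<le> k then f j (k - j) else 0) \<partial>count_space UNIV) = (\<integral>\<^sup>+i. f j i \<partial>count_space UNIV)" ..
  qed
  finally show ?thesis by (simp add: nn_integral_count_space_nat)
qed

context two_field_measures
begin

text \<open>The exponential of a sum of commuting operators is the product of the exponentials:
  binomial coefficients cancel the factorials, and the total masses add in the prefactor.\<close>

lemma cpint_add:
  assumes [measurable]: "F \<in> borel_measurable (fieldM A)"
    and sets: "sets L3 = sets (fieldM A)"
    and eq: "\<And>E. E \<in> sets (fieldM A) \<Longrightarrow> emeasure L3 E = emeasure L1 E + emeasure L2 E"
  shows "cpint A L3 F x = cpint A L1 (cpint A L2 F) x"
proof -
  define m1 where "m1 = measure L1 (space L1)"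
  define m2 where "m2 = measure L2 (space L2)"
  have [simp]: "space L3 = space (fieldM A)" using sets by (rule sets_eq_imp_space_eq)
  have m3: "measure L3 (space L3) = m1 + m2"
    by (simp add: measure_def eq m1_def m2_def)
      (subst enn2real_plus, auto simp: less_top[symmetric] L1.emeasure_eq_measure L2.emeasure_eq_measure)
  let ?g = "\<lambda>j i. (transl A L1 ^^ j) ((transl A L2 ^^ i) F) x"
  have lin: "(transl A L1 ^^ j) (\<lambda>y. \<Sum>i. c i * (transl A L2 ^^ i) F y) = (\<lambda>y. \<Sum>i. c i * (transl A L1 ^^ j) ((transl A L2 ^^ i) F) y)" for j c
  proof (induction j)
    case (Suc j)
    show ?case
      unfolding funpow.simps comp_def Suc
      unfolding transl_def[of A L1 "\<lambda>y. \<Sum>i. c i * (transl A L1 ^^ j) ((transl A L2 ^^ i) F) y"]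
      by (subst nn_integral_suminf) (auto simp: nn_integral_cmult transl_def[of A L1 "(transl A L1 ^^ j) ((transl A L2 ^^ i) F)" for i])
  qed simp
  have "cpint A L1 (cpint A L2 F) x = ennreal (exp (- m1)) * (\<Sum>j. ennreal (1 / fact j) *
      (\<Sum>i. (ennreal (exp (- m2)) * ennreal (1 / fact i)) * ?g j i))"
    unfolding cpint_def[of A L1] m1_def[symmetric]
    unfolding cpint_def[of A L2, abs_def] m2_def[symmetric] ennreal_suminf_cmult[symmetric] mult.assoc[symmetric] lin ..
  also have "\<dots> = ennreal (exp (- m1)) * (ennreal (exp (- m2)) * (\<Sum>j. \<Sum>i. ennreal (1 / fact j) * ennreal (1 / fact i) * ?g j i))"
    unfolding ennreal_suminf_cmult[symmetric] by (simp only: ac_simps)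
  also have "\<dots> = ennreal (exp (- (m1 + m2))) * (\<Sum>j. \<Sum>i. ennreal (1 / fact j) * ennreal (1 / fact i) * ?g j i)"
    by (simp add: mult.assoc[symmetric] ennreal_mult[symmetric] exp_add[symmetric])
  also have "(\<Sum>j. \<Sum>i. ennreal (1 / fact j) * ennreal (1 / fact i) * ?g j i)
     = (\<Sum>k. \<Sum>j\<le>k. ennreal (1 / fact j) * ennreal (1 / fact (k - j)) * ?g j (k - j))"
    by (rule suminf_ennreal_triangle[symmetric])
  also have "\<dots> = (\<Sum>k. ennreal (1 / fact k) * (transl A L3 ^^ k) F x)"
  proof (intro suminf_cong)
    fix k
    have "ennreal (1 / fact k) * (transl A L3 ^^ k) F x
        = (\<Sum>j\<le>k. ennreal (1 / fact k) * of_nat (k choose j) * ?g j (k - j))"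
      by (subst transl_binomial[OF _ sets eq]) (auto simp: sum_distrib_left mult.assoc)
    also have "\<dots> = (\<Sum>j\<le>k. ennreal (1 / fact j) * ennreal (1 / fact (k - j)) * ?g j (k - j))"
    proof (intro sum.cong refl)
      fix j assume "j \<in> {..k}"
      then have "1 / fact k * real (k choose j) = 1 / fact j * (1 / fact (k - j))"
        by (simp add: binomial_fact field_simps)
      then have "ennreal (1 / fact k) * of_nat (k choose j) = ennreal (1 / fact j) * ennreal (1 / fact (k - j))"
        by (simp only: ennreal_of_nat_eq_real_of_nat) (simp add: ennreal_mult[symmetric])
      then show "ennreal (1 / fact k) * of_nat (k choose j) * ?g j (k - j) = ennreal (1 / fact j) * ennreal (1 / fact (k - j)) * ?g j (k - j)"
        by simp
    qed
    finally show "(\<Sum>j\<le>k. ennreal (1 / fact j) * ennreal (1 / fact (k - j)) * ?g j (k - j)) = ennreal (1 / fact k) * (transl A L3 ^^ k) F x" ..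
  qed
  finally show ?thesis unfolding cpint_def[of A L3] m3 ..
qed

end

section \<open>Nonnegativity of the fields, void probabilities and the coupling\<close>

lemma nonneg_transl_pow:
  assumes "finite_field_measure L A" and [measurable]: "F \<in> borel_measurable (fieldM A)"
    and AE: "AE y in L. \<forall>z\<in>A. 0 \<le> y z"
    and zero: "\<And>y. (\<forall>z\<in>A. 0 \<le> y z) \<Longrightarrow> F y = 0"
    and x: "\<forall>z\<in>A. 0 \<le> x z"
  shows "(transl A L ^^ k) F x = 0"
  using x
proof (induction k arbitrary: x)
  case (Suc k)
  interpret finite_field_measure L A by fact
  have "AE y in L. (transl A L ^^ k) F (addf A x y) = 0"
    using AE by eventually_elim (rule Suc.IH, use Suc.prems in \<open>auto simp: addf_def\<close>)
  then show ?case
    unfolding funpow.simps comp_def transl_def[of A L "(transl A L ^^ k) F"]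
    by (subst nn_integral_cong_AE[where v="\<lambda>_. 0"]) auto
qed (simp add: zero)

lemma finite_set_in_fieldM:
  "finite A \<Longrightarrow> Measurable.pred (fieldM A) (\<lambda>y. \<forall>z\<in>A. 0 \<le> y z)"
  by (auto intro!: pred_intros_finite)

lemma ppp_AE_nonneg:
  assumes fm: "finite_field_measure L A" and "finite A" "0 \<le> a"
    and AE: "AE y in L. \<forall>z\<in>A. 0 \<le> y z"
  shows "AE y in ppp_occ_law A a L. \<forall>z\<in>A. 0 \<le> y z"
proof -
  interpret finite_field_measure L A by fact
  note [measurable] = finite_set_in_fieldM[OF \<open>finite A\<close>]
  let ?F = "indicator {y \<in> space (fieldM A). \<not> (\<forall>z\<in>A. 0 \<le> y z)} :: _ \<Rightarrow> ennreal"
  have sets: "{y \<in> space (fieldM A). \<not> (\<forall>z\<in>A. 0 \<le> y z)} \<in> sets (fieldM A)" by measurable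
  then have F [measurable]: "?F \<in> borel_measurable (fieldM A)" by (rule borel_measurable_indicator)
  interpret P: prob_space "ppp_occ_law A a L" by (rule prob_space_ppp) fact
  have sp: "space (ppp_occ_law A a L) = space (fieldM A)" using sets_ppp by (rule sets_eq_imp_space_eq)
  have "emeasure (ppp_occ_law A a L) {y \<in> space (fieldM A). \<not> (\<forall>z\<in>A. 0 \<le> y z)} = (\<integral>\<^sup>+y. ?F y \<partial>ppp_occ_law A a L)"
    by (subst nn_integral_indicator) (use sets in \<open>auto simp: sets_ppp\<close>)
  also have "\<dots> = cpint A (scale_measure (ennreal a) L) ?F (zerof A)"
    by (rule nn_integral_ppp) (measurable, fact)
  also have "\<dots> = 0"
    unfolding cpint_def transl_scale[OF F fm]
    by (subst nonneg_transl_pow[OF fm F AE]) (auto simp: zerof_def)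
  finally have null: "emeasure (ppp_occ_law A a L) {y \<in> space (fieldM A). \<not> (\<forall>z\<in>A. 0 \<le> y z)} = 0" .
  from sets have "{y \<in> space (fieldM A). \<not> (\<forall>z\<in>A. 0 \<le> y z)} \<in> sets (ppp_occ_law A a L)" by (simp only: sets_ppp)
  from AE_I[OF _ null this] show ?thesis by (auto simp: sp)
qed

text \<open>Only the term without trajectories is kept; it already places the void probability on
  the zero field.\<close>

lemma ppp_prob_zero:
  assumes fm: "finite_field_measure L A" and "finite A" "0 \<le> a"
  shows "emeasure (ppp_occ_law A a L) {y \<in> space (fieldM A). \<forall>z\<in>A. y z = 0} \<ge> ennreal (exp (- (a * measure L (space L))))"
proof -
  interpret finite_field_measure L A by fact
  let ?Z = "{y \<in> space (fieldM A). \<forall>z\<in>A. y z = 0}"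
  have sets: "?Z \<in> sets (fieldM A)" using \<open>finite A\<close> by measurable
  let ?F = "indicator ?Z :: _ \<Rightarrow> ennreal"
  have [measurable]: "?F \<in> borel_measurable (fieldM A)" using sets by measurable
  have meas: "measure (scale_measure (ennreal a) L) (space (scale_measure (ennreal a) L)) = a * measure L (space L)"
    using \<open>0 \<le> a\<close> by (simp add: measure_def space_scale_measure enn2real_mult)
  have "ennreal (1 / fact 0) * (transl A (scale_measure (ennreal a) L) ^^ 0) ?F (zerof A)
     \<le> (\<Sum>k. ennreal (1 / fact k) * (transl A (scale_measure (ennreal a) L) ^^ k) ?F (zerof A))"
    using sum_le_suminf[of "\<lambda>k. ennreal (1 / fact k) * (transl A (scale_measure (ennreal a) L) ^^ k) ?F (zerof A)" "{0}"]
    by (simp add: summableI)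
  then have "1 \<le> (\<Sum>k. ennreal (1 / fact k) * (transl A (scale_measure (ennreal a) L) ^^ k) ?F (zerof A))"
    by (simp add: zerof_def indicator_def space_PiM)
  then have "ennreal (exp (- (a * measure L (space L)))) * 1 \<le> cpint A (scale_measure (ennreal a) L) ?F (zerof A)"
    unfolding cpint_def meas by (intro mult_left_mono) auto
  also have "\<dots> = (\<integral>\<^sup>+y. ?F y \<partial>ppp_occ_law A a L)"
    by (rule nn_integral_ppp[symmetric]) (measurable, fact)
  also have "\<dots> = emeasure (ppp_occ_law A a L) ?Z"
    by (subst nn_integral_indicator) (use sets in \<open>auto simp: sets_ppp\<close>)
  finally show ?thesis by simp
qed

text \<open>Adding an independent field acts on functions as a second exponential, so
  \<open>cpint_add\<close> identifies the law of the sum.\<close>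

lemma ppp_superposition:
  assumes f1: "finite_field_measure L1 A" and f2: "finite_field_measure L2 A" and f: "finite_field_measure L A"
    and a: "0 \<le> a"
    and eq: "\<And>E. E \<in> sets (fieldM A) \<Longrightarrow> emeasure L1 E + emeasure L2 E = ennreal a * emeasure L E"
    and [measurable]: "F \<in> borel_measurable (fieldM A)"
  shows "(\<integral>\<^sup>+x. \<integral>\<^sup>+y. F (addf A x y) \<partial>ppp_occ_law A 1 L2 \<partial>ppp_occ_law A 1 L1) = (\<integral>\<^sup>+x. F x \<partial>ppp_occ_law A a L)"
proof -
  interpret L1: finite_field_measure L1 A by fact
  interpret L2: finite_field_measure L2 A by fact
  interpret L: finite_field_measure L A by fact
  interpret two_field_measures L1 L2 A ..
  have sp: "space (ppp_occ_law A 1 L1) = space (fieldM A)" using L1.sets_ppp by (rule sets_eq_imp_space_eq)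
  have one: "scale_measure (ennreal 1) M = M" for M :: "('a \<Rightarrow> real) measure" by (simp add: scale_measure_1)
  have "(\<integral>\<^sup>+x. \<integral>\<^sup>+y. F (addf A x y) \<partial>ppp_occ_law A 1 L2 \<partial>ppp_occ_law A 1 L1)
     = (\<integral>\<^sup>+x. cpint A L2 F x \<partial>ppp_occ_law A 1 L1)"
  proof (intro nn_integral_cong)
    fix x assume x: "x \<in> space (ppp_occ_law A 1 L1)"
    have "(\<integral>\<^sup>+y. F (addf A x y) \<partial>ppp_occ_law A 1 L2) = cpint A L2 (\<lambda>y. F (addf A x y)) (zerof A)"
      by (subst L2.nn_integral_ppp) (auto simp: one)
    also have "\<dots> = cpint A L2 F x"
      using x by (simp add: L2.cpint_shift addf_zerof sp)
    finally show "(\<integral>\<^sup>+y. F (addf A x y) \<partial>ppp_occ_law A 1 L2) = cpint A L2 F x" .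
  qed
  also have "\<dots> = cpint A L1 (cpint A L2 F) (zerof A)"
    by (subst L1.nn_integral_ppp) (auto simp: one)
  also have "\<dots> = cpint A (scale_measure (ennreal a) L) F (zerof A)"
    by (rule cpint_add[symmetric]) (auto simp: eq)
  also have "\<dots> = (\<integral>\<^sup>+x. F x \<partial>ppp_occ_law A a L)"
    by (rule L.nn_integral_ppp[symmetric]) (auto simp: a)
  finally show ?thesis .
qed

text \<open>\<open>a2 * \<mu>2\<close> is split into its part \<open>Lg\<close> on \<open>G\<close>
  and the remainder \<open>Lb\<close>, and \<open>a1 * \<mu>1\<close> into the same
  \<open>Lg\<close> and the rest \<open>Lr\<close>, which is a measure by \<open>dom\<close>. With
  independent fields for the three intensities, \<open>M\<close> uses \<open>Lg\<close> and
  \<open>Lr\<close> while \<open>Mt\<close> uses \<open>Lg\<close> and \<open>Lb\<close>; up to null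
  sets the order can fail only if \<open>Lb\<close> contributes something.\<close>

lemma poisson_coupling:
  fixes A :: "'a set"
  assumes A: "finite A"
    and p1: "prob_space \<mu>1" and s1: "sets \<mu>1 = sets (fieldM A)" and n1: "AE y in \<mu>1. \<forall>z\<in>A. 0 \<le> y z"
    and p2: "prob_space \<mu>2" and s2: "sets \<mu>2 = sets (fieldM A)" and n2: "AE y in \<mu>2. \<forall>z\<in>A. 0 \<le> y z"
    and a: "0 \<le> a1" "0 \<le> a2" and G: "G \<in> sets (fieldM A)"
    and dom: "\<And>E. E \<in> sets (fieldM A) \<Longrightarrow> E \<subseteq> G \<Longrightarrow> ennreal a2 * emeasure \<mu>2 E \<le> ennreal a1 * emeasure \<mu>1 E"
  shows "\<exists>Q :: (('a \<Rightarrow> real) \<times> ('a \<Rightarrow> real)) measure. \<exists>M Mt. prob_space Q \<and>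
     M \<in> Q \<rightarrow>\<^sub>M fieldM A \<and> Mt \<in> Q \<rightarrow>\<^sub>M fieldM A \<and>
     (\<forall>\<omega>\<in>space Q. \<forall>x\<in>A. 0 \<le> M \<omega> x \<and> 0 \<le> Mt \<omega> x) \<and>
     distr Q (fieldM A) M = ppp_occ_law A a1 \<mu>1 \<and> distr Q (fieldM A) Mt = ppp_occ_law A a2 \<mu>2 \<and>
     measure Q {\<omega>\<in>space Q. \<forall>x\<in>A. M \<omega> x \<ge> Mt \<omega> x} \<ge> 1 - a2 * measure \<mu>2 (space \<mu>2 - G)"
proof -
  interpret M1: prob_space \<mu>1 by fact
  interpret M2: prob_space \<mu>2 by fact
  have f1: "finite_field_measure \<mu>1 A" "finite_field_measure \<mu>2 A"
    by unfold_locales (auto simp: s1 s2)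
  interpret M1: finite_field_measure \<mu>1 A by fact
  interpret M2: finite_field_measure \<mu>2 A by fact
  have [measurable]: "G \<in> sets (fieldM A)" by fact
  define H where "H = space (fieldM A) - G"
  have [measurable]: "H \<in> sets (fieldM A)" by (auto simp: H_def)
  define Lg where "Lg = scale_measure (ennreal a2) (density \<mu>2 (indicator G))"
  define Lb where "Lb = scale_measure (ennreal a2) (density \<mu>2 (indicator H))"
  define Lr where "Lr = diff_measure (scale_measure (ennreal a1) \<mu>1) Lg"
  have fin_dens: "finite_field_measure (density \<mu>2 (indicator X)) A" if "X \<in> sets (fieldM A)" for X
  proof -
    have "finite_measure (density \<mu>2 (indicator X))"
      by (rule finite_measureI) (use that in \<open>simp add: emeasure_density nn_integral_indicator indicator_inter_arith[symmetric]\<close>)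
    then show ?thesis by (simp add: finite_field_measure_def finite_field_measure_axioms_def)
  qed
  have fg: "finite_field_measure Lg A" and fb: "finite_field_measure Lb A"
    unfolding Lg_def Lb_def by (auto intro!: finite_field_measure_scale fin_dens)
  interpret Lg: finite_field_measure Lg A by fact
  interpret Lb: finite_field_measure Lb A by fact
  have fs: "finite_field_measure (scale_measure (ennreal a1) \<mu>1) A"
    by (rule finite_field_measure_scale[OF f1(1)]) simp
  interpret S: finite_field_measure "scale_measure (ennreal a1) \<mu>1" A by fact
  have eg: "emeasure Lg E = ennreal a2 * emeasure \<mu>2 (E \<inter> G)" if "E \<in> sets (fieldM A)" for E
    unfolding Lg_def using that by (simp add: emeasure_density nn_integral_indicator Int_commute indicator_inter_arith[symmetric])
  have eb: "emeasure Lb E = ennreal a2 * emeasure \<mu>2 (E \<inter> H)" if "E \<in> sets (fieldM A)" for E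
    unfolding Lb_def using that by (simp add: emeasure_density nn_integral_indicator Int_commute indicator_inter_arith[symmetric])
  have le: "emeasure Lg E \<le> emeasure (scale_measure (ennreal a1) \<mu>1) E" if E: "E \<in> sets (fieldM A)" for E
  proof -
    have "emeasure Lg E \<le> ennreal a1 * emeasure \<mu>1 (E \<inter> G)"
      unfolding eg[OF E] using E by (intro dom) auto
    also have "\<dots> \<le> ennreal a1 * emeasure \<mu>1 E"
      using E by (intro mult_left_mono emeasure_mono) auto
    finally show ?thesis by simp
  qed
  have er: "emeasure Lr E = emeasure (scale_measure (ennreal a1) \<mu>1) E - emeasure Lg E" if "E \<in> sets (fieldM A)" for E
    unfolding Lr_def by (rule emeasure_diff_measure) (use that le in \<open>simp_all add: S.finite_measure_axioms Lg.finite_measure_axioms\<close>)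
  have fr: "finite_field_measure Lr A"
  proof -
    have "sets Lr = sets (fieldM A)" by (simp add: Lr_def)
    moreover then have "space Lr = space (fieldM A)" by (rule sets_eq_imp_space_eq)
    moreover have "emeasure Lr (space (fieldM A)) \<le> emeasure (scale_measure (ennreal a1) \<mu>1) (space (fieldM A))"
      by (subst er) auto
    then have "emeasure Lr (space (fieldM A)) \<noteq> \<infinity>"
      using S.emeasure_finite[of "space (fieldM A)"] by (auto simp: top_unique)
    ultimately have "finite_measure Lr" by (intro finite_measureI) simp
    then show ?thesis using \<open>sets Lr = _\<close> by (simp add: finite_field_measure_def finite_field_measure_axioms_def)
  qed
  interpret Lr: finite_field_measure Lr A by fact
  have sum_gr: "emeasure Lg E + emeasure Lr E = ennreal a1 * emeasure \<mu>1 E" if "E \<in> sets (fieldM A)" for E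
    unfolding er[OF that] using le[OF that] by (simp add: add.commute[of "emeasure Lg E"] diff_add_cancel_ennreal)
  have sum_gb: "emeasure Lg E + emeasure Lb E = ennreal a2 * emeasure \<mu>2 E" if E: "E \<in> sets (fieldM A)" for E
  proof -
    have "E \<subseteq> space (fieldM A)" using E by (rule sets.sets_into_space)
    then have *: "(E \<inter> G) \<union> (E \<inter> H) = E" "(E \<inter> G) \<inter> (E \<inter> H) = {}" by (auto simp: H_def)
    have "emeasure \<mu>2 (E \<inter> G) + emeasure \<mu>2 (E \<inter> H) = emeasure \<mu>2 ((E \<inter> G) \<union> (E \<inter> H))"
      using E *(2) by (intro plus_emeasure) auto
    then show ?thesis by (simp add: eg eb E distrib_left[symmetric] *)
  qed
  \<comment> \<open>Nonnegativity is demanded at every sample point, while the laws give it only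
    almost surely; clipping at zero changes neither law.\<close>
  let ?pos = "\<lambda>u. \<lambda>z\<in>A. max 0 (u z :: real)"
  have pos_m [measurable]: "?pos \<in> fieldM A \<rightarrow>\<^sub>M fieldM A" by measurable
  define Pg where "Pg = ppp_occ_law A 1 Lg"
  define Pr where "Pr = ppp_occ_law A 1 Lr"
  define Pb where "Pb = ppp_occ_law A 1 Lb"
  have sP [simp, measurable_cong]: "sets Pg = sets (fieldM A)" "sets Pr = sets (fieldM A)" "sets Pb = sets (fieldM A)"
    by (auto simp: Pg_def Pr_def Pb_def Lg.sets_ppp Lr.sets_ppp Lb.sets_ppp)
  interpret Pg: prob_space Pg unfolding Pg_def by (rule Lg.prob_space_ppp) simp
  interpret Pr: prob_space Pr unfolding Pr_def by (rule Lr.prob_space_ppp) simp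
  interpret Pb: prob_space Pb unfolding Pb_def by (rule Lb.prob_space_ppp) simp
  interpret Prb: pair_prob_space Pr Pb ..
  have PRB: "prob_space (Pr \<Otimes>\<^sub>M Pb)" by unfold_locales
  interpret Pgrb: pair_prob_space Pg "Pr \<Otimes>\<^sub>M Pb" ..
  define W where "W = Pg \<Otimes>\<^sub>M (Pr \<Otimes>\<^sub>M Pb)"
  define h where "h = (\<lambda>w. (addf A (fst w) (fst (snd w)), addf A (fst w) (snd (snd w))))"
  have h_m [measurable]: "h \<in> W \<rightarrow>\<^sub>M fieldM A \<Otimes>\<^sub>M fieldM A" unfolding h_def W_def by measurable
  interpret W: prob_space W unfolding W_def by unfold_locales
  \<comment> \<open>The triple of fields is pushed forward to a pair, the type on which the coupling
    has to live; both marginals are read off there.\<close>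
  define Q where "Q = distr W (fieldM A \<Otimes>\<^sub>M fieldM A) h"
  have pQ: "prob_space Q" unfolding Q_def by (rule W.prob_space_distr) measurable
  define M where "M = (\<lambda>w :: ('a \<Rightarrow> real) \<times> ('a \<Rightarrow> real). ?pos (fst w))"
  define Mt where "Mt = (\<lambda>w :: ('a \<Rightarrow> real) \<times> ('a \<Rightarrow> real). ?pos (snd w))"
  have sQ [simp, measurable_cong]: "sets Q = sets (fieldM A \<Otimes>\<^sub>M fieldM A)" by (simp add: Q_def)
  have M_m [measurable]: "M \<in> Q \<rightarrow>\<^sub>M fieldM A" "Mt \<in> Q \<rightarrow>\<^sub>M fieldM A"
    unfolding M_def Mt_def by measurable
  have int_W: "(\<integral>\<^sup>+w. F w \<partial>W) = (\<integral>\<^sup>+g. \<integral>\<^sup>+r. \<integral>\<^sup>+b. F (g, r, b) \<partial>Pb \<partial>Pr \<partial>Pg)"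
    if [measurable]: "F \<in> borel_measurable W" for F
  proof -
    have mF: "F \<in> borel_measurable (Pg \<Otimes>\<^sub>M (Pr \<Otimes>\<^sub>M Pb))" using that by (simp add: W_def)
    have "(\<integral>\<^sup>+w. F w \<partial>W) = (\<integral>\<^sup>+g. \<integral>\<^sup>+p. F (g, p) \<partial>(Pr \<Otimes>\<^sub>M Pb) \<partial>Pg)"
      unfolding W_def by (rule sigma_finite_measure.nn_integral_fst[OF prob_space_imp_sigma_finite[OF PRB], symmetric]) fact
    also have "\<dots> = (\<integral>\<^sup>+g. \<integral>\<^sup>+r. \<integral>\<^sup>+b. F (g, r, b) \<partial>Pb \<partial>Pr \<partial>Pg)"
    proof (intro nn_integral_cong)
      fix g assume "g \<in> space Pg"
      then have "(\<lambda>p. F (g, p)) \<in> borel_measurable (Pr \<Otimes>\<^sub>M Pb)"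
        by (rule measurable_compose[OF measurable_Pair1' mF])
      from Pb.nn_integral_fst[OF this] show "(\<integral>\<^sup>+p. F (g, p) \<partial>(Pr \<Otimes>\<^sub>M Pb)) = (\<integral>\<^sup>+r. \<integral>\<^sup>+b. F (g, r, b) \<partial>Pb \<partial>Pr)"
        by simp
    qed
    finally show ?thesis .
  qed
  have int_Q: "(\<integral>\<^sup>+w. F w \<partial>Q) = (\<integral>\<^sup>+w. F (h w) \<partial>W)" if "F \<in> borel_measurable Q" for F
    unfolding Q_def by (rule nn_integral_distr[OF h_m]) (use that in \<open>simp add: Q_def\<close>)
  have d1: "distr Q (fieldM A) M = ppp_occ_law A a1 \<mu>1"
  proof (rule measure_eqI)
    show "sets (distr Q (fieldM A) M) = sets (ppp_occ_law A a1 \<mu>1)" by (simp add: M1.sets_ppp)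
    fix E assume "E \<in> sets (distr Q (fieldM A) M)"
    then have E [measurable]: "E \<in> sets (fieldM A)" by simp
    have F [measurable]: "(\<lambda>u. indicator E (?pos u) :: ennreal) \<in> borel_measurable (fieldM A)" by measurable
    have mm: "(\<lambda>w. indicator E (M w) :: ennreal) \<in> borel_measurable Q" by measurable
    have "emeasure (distr Q (fieldM A) M) E = (\<integral>\<^sup>+w. indicator E w \<partial>distr Q (fieldM A) M)"
      by (subst nn_integral_indicator) auto
    also have "\<dots> = (\<integral>\<^sup>+w. indicator E (M w) \<partial>Q)" by (rule nn_integral_distr) measurable
    also have "\<dots> = (\<integral>\<^sup>+w. indicator E (M (h w)) \<partial>W)"
      by (rule int_Q[OF mm])
    also have "\<dots> = (\<integral>\<^sup>+g. \<integral>\<^sup>+r. \<integral>\<^sup>+b. indicator E (?pos (addf A g r)) \<partial>Pb \<partial>Pr \<partial>Pg)"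
      by (subst int_W) (auto simp: M_def h_def W_def)
    also have "\<dots> = (\<integral>\<^sup>+g. \<integral>\<^sup>+r. indicator E (?pos (addf A g r)) \<partial>Pr \<partial>Pg)"
      by (simp add: Pb.emeasure_space_1)
    also have "\<dots> = (\<integral>\<^sup>+u. indicator E (?pos u) \<partial>ppp_occ_law A a1 \<mu>1)"
      unfolding Pg_def Pr_def
      by (rule ppp_superposition[OF fg fr f1(1) a(1) sum_gr F])
    also have "\<dots> = (\<integral>\<^sup>+u. indicator E u \<partial>ppp_occ_law A a1 \<mu>1)"
    proof (rule nn_integral_cong_AE)
      have "AE u in ppp_occ_law A a1 \<mu>1. u \<in> space (fieldM A)"
        using sets_eq_imp_space_eq[OF M1.sets_ppp] by (intro AE_I2) auto
      then show "AE u in ppp_occ_law A a1 \<mu>1. indicator E (?pos u) = (indicator E u :: ennreal)"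
        using ppp_AE_nonneg[OF f1(1) A a(1) n1]
      proof eventually_elim
        case (elim u)
        then have "?pos u = u" by (auto simp: fun_eq_iff space_PiM PiE_def extensional_def)
        then show ?case by simp
      qed
    qed
    also have "\<dots> = emeasure (ppp_occ_law A a1 \<mu>1) E"
      by (subst nn_integral_indicator) (auto simp: M1.sets_ppp)
    finally show "emeasure (distr Q (fieldM A) M) E = emeasure (ppp_occ_law A a1 \<mu>1) E" .
  qed
  have d2: "distr Q (fieldM A) Mt = ppp_occ_law A a2 \<mu>2"
  proof (rule measure_eqI)
    show "sets (distr Q (fieldM A) Mt) = sets (ppp_occ_law A a2 \<mu>2)" by (simp add: M2.sets_ppp)
    fix E assume "E \<in> sets (distr Q (fieldM A) Mt)"
    then have E [measurable]: "E \<in> sets (fieldM A)" by simp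
    have F [measurable]: "(\<lambda>u. indicator E (?pos u) :: ennreal) \<in> borel_measurable (fieldM A)" by measurable
    have mm: "(\<lambda>w. indicator E (Mt w) :: ennreal) \<in> borel_measurable Q" by measurable
    have "emeasure (distr Q (fieldM A) Mt) E = (\<integral>\<^sup>+w. indicator E w \<partial>distr Q (fieldM A) Mt)"
      by (subst nn_integral_indicator) auto
    also have "\<dots> = (\<integral>\<^sup>+w. indicator E (Mt w) \<partial>Q)" by (rule nn_integral_distr) measurable
    also have "\<dots> = (\<integral>\<^sup>+w. indicator E (Mt (h w)) \<partial>W)"
      by (rule int_Q[OF mm])
    also have "\<dots> = (\<integral>\<^sup>+g. \<integral>\<^sup>+r. \<integral>\<^sup>+b. indicator E (?pos (addf A g b)) \<partial>Pb \<partial>Pr \<partial>Pg)"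
      by (subst int_W) (auto simp: Mt_def h_def W_def)
    also have "\<dots> = (\<integral>\<^sup>+g. \<integral>\<^sup>+b. indicator E (?pos (addf A g b)) \<partial>Pb \<partial>Pg)"
      by (simp add: Pr.emeasure_space_1)
    also have "\<dots> = (\<integral>\<^sup>+u. indicator E (?pos u) \<partial>ppp_occ_law A a2 \<mu>2)"
      unfolding Pg_def Pb_def
      by (rule ppp_superposition[OF fg fb f1(2) a(2) sum_gb F])
    also have "\<dots> = (\<integral>\<^sup>+u. indicator E u \<partial>ppp_occ_law A a2 \<mu>2)"
    proof (rule nn_integral_cong_AE)
      have "AE u in ppp_occ_law A a2 \<mu>2. u \<in> space (fieldM A)"
        using sets_eq_imp_space_eq[OF M2.sets_ppp] by (intro AE_I2) auto
      then show "AE u in ppp_occ_law A a2 \<mu>2. indicator E (?pos u) = (indicator E u :: ennreal)"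
        using ppp_AE_nonneg[OF f1(2) A a(2) n2]
      proof eventually_elim
        case (elim u)
        then have "?pos u = u" by (auto simp: fun_eq_iff space_PiM PiE_def extensional_def)
        then show ?case by simp
      qed
    qed
    also have "\<dots> = emeasure (ppp_occ_law A a2 \<mu>2) E"
      by (subst nn_integral_indicator) (auto simp: M2.sets_ppp)
    finally show "emeasure (distr Q (fieldM A) Mt) E = emeasure (ppp_occ_law A a2 \<mu>2) E" .
  qed
  have nonneg_r: "AE y in Pr. \<forall>z\<in>A. 0 \<le> y z"
    unfolding Pr_def
  proof (rule ppp_AE_nonneg[OF fr A])
    let ?N = "{y \<in> space (fieldM A). \<not> (\<forall>z\<in>A. 0 \<le> y z)}"
    have sN: "?N \<in> sets (fieldM A)" using finite_set_in_fieldM[OF A] by measurable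
    have "emeasure \<mu>1 ?N = 0"
      using AE_iff_measurable[of ?N \<mu>1 "\<lambda>y. \<forall>z\<in>A. 0 \<le> y z"] n1 sN by (simp only: M1.sets_eq M1.space_eq simp_thms)
    then have null: "emeasure Lr ?N = 0" by (simp only: er[OF sN] emeasure_scale_measure mult_zero_right) simp
    show "AE y in Lr. \<forall>z\<in>A. 0 \<le> y z"
      by (rule AE_I[OF _ null]) (use sN in \<open>simp_all only: Lr.sets_eq Lr.space_eq subset_refl\<close>)
  qed simp
  let ?E = "{\<omega>\<in>space Q. \<forall>x\<in>A. M \<omega> x \<ge> Mt \<omega> x}"
  let ?Z = "{y \<in> space (fieldM A). \<forall>z\<in>A. y z = 0}"
  have [measurable]: "?Z \<in> sets (fieldM A)" using A by measurable
  have sE [measurable]: "?E \<in> sets Q" using A by measurable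
  then have sE': "?E \<in> sets (fieldM A \<Otimes>\<^sub>M fieldM A)" by (simp only: sQ)
  have hE: "(\<lambda>w. indicator ?E (h w) :: ennreal) \<in> borel_measurable W"
    by (rule measurable_compose[OF h_m borel_measurable_indicator[OF sE']])
  have mLb: "measure Lb (space Lb) = a2 * measure \<mu>2 H"
    using a(2) by (simp add: measure_def eb enn2real_mult Int_absorb1 H_def)
  \<comment> \<open>If the \<open>Lb\<close>-field vanishes, then \<open>Mt\<close> is at most
    \<open>M\<close>, because the \<open>Lr\<close>-field is almost surely nonnegative. Hence the
    void probability of \<open>Lb\<close> bounds the event from below.\<close>
  have "ennreal (exp (- (a2 * measure \<mu>2 H))) \<le> emeasure Pb ?Z"
    using ppp_prob_zero[OF fb A, of 1] by (simp only: Pb_def mLb mult_1 zero_le_one simp_thms)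
  also have "\<dots> = (\<integral>\<^sup>+b. indicator ?Z b \<partial>Pb)" by (subst nn_integral_indicator) auto
  also have "\<dots> = (\<integral>\<^sup>+g. \<integral>\<^sup>+r. \<integral>\<^sup>+b. indicator ?Z b \<partial>Pb \<partial>Pr \<partial>Pg)"
    by (simp add: Pr.emeasure_space_1 Pg.emeasure_space_1)
  also have "\<dots> \<le> (\<integral>\<^sup>+g. \<integral>\<^sup>+r. \<integral>\<^sup>+b. indicator ?E (h (g, r, b)) \<partial>Pb \<partial>Pr \<partial>Pg)"
  proof (rule nn_integral_mono)
    fix g
    show "(\<integral>\<^sup>+r. \<integral>\<^sup>+b. indicator ?Z b \<partial>Pb \<partial>Pr) \<le> (\<integral>\<^sup>+r. \<integral>\<^sup>+b. indicator ?E (h (g, r, b)) \<partial>Pb \<partial>Pr)"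
    proof (rule nn_integral_mono_AE, use nonneg_r in eventually_elim, intro nn_integral_mono)
      fix r b assume "\<forall>z\<in>A. 0 \<le> (r :: 'a \<Rightarrow> real) z"
      have sQ': "space Q = space (fieldM A \<Otimes>\<^sub>M fieldM A)" by (rule sets_eq_imp_space_eq) simp
      show "indicator ?Z b \<le> (indicator ?E (h (g, r, b)) :: ennreal)"
        using \<open>\<forall>z\<in>A. 0 \<le> r z\<close>
        by (auto simp: indicator_def h_def M_def Mt_def sQ' space_pair_measure addf_def[of A g] space_PiM)
    qed
  qed
  also have "\<dots> = (\<integral>\<^sup>+w. indicator ?E (h w) \<partial>W)"
    by (rule int_W[symmetric]) (rule hE)
  also have "\<dots> = (\<integral>\<^sup>+w. indicator ?E w \<partial>Q)"
    by (rule int_Q[symmetric]) measurable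
  also have "\<dots> = emeasure Q ?E" by (rule nn_integral_indicator[OF sE])
  finally have "ennreal (exp (- (a2 * measure \<mu>2 H))) \<le> emeasure Q ?E" .
  then have "exp (- (a2 * measure \<mu>2 H)) \<le> measure Q ?E"
    using prob_space.finite_measure[OF pQ] by (simp add: finite_measure.emeasure_eq_measure)
  moreover have "1 - a2 * measure \<mu>2 H \<le> exp (- (a2 * measure \<mu>2 H))"
    using exp_ge_add_one_self[of "- (a2 * measure \<mu>2 H)"] by simp
  ultimately have "measure Q ?E \<ge> 1 - a2 * measure \<mu>2 (space \<mu>2 - G)" by (simp add: H_def)
  moreover have "\<forall>\<omega>\<in>space Q. \<forall>x\<in>A. 0 \<le> M \<omega> x \<and> 0 \<le> Mt \<omega> x" by (simp add: M_def Mt_def)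
  ultimately show ?thesis
    using pQ M_m d1 d2 by (intro exI[of _ Q] exI[of _ M] exI[of _ Mt] conjI)
qed

section \<open>Fields of Gamma variables\<close>

lemma sets_gamma_law [simp, measurable_cong]: "sets (gamma_law n q) = sets borel"
  by (simp add: gamma_law_def)

lemma prob_space_gamma_law: "0 < q \<Longrightarrow> prob_space (gamma_law n q)"
  by (auto simp: gamma_law_def intro: prob_space_return prob_space_erlang_density)

lemma AE_gamma_law_nonneg: "AE t in gamma_law n q. 0 \<le> t"
proof (cases n)
  case 0
  have "AE t in return borel (0 :: real). 0 \<le> t" by (subst AE_return) auto
  then show ?thesis by (simp only: 0 gamma_law_def if_True simp_thms)
next
  case (Suc k)
  have "AE t in density lborel (\<lambda>x. ennreal (erlang_density k q x)). 0 \<le> t"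
    by (subst AE_density) (auto simp: erlang_density_def)
  then show ?thesis by (simp only: Suc gamma_law_def nat.distinct if_False diff_Suc_1)
qed

text \<open>Likelihood ratio between two rates: Erlang densities differ by \<open>q ^ n\<close> and
  an exponential tilt, and for \<open>n = 0\<close> the ratio is one at the atom in zero.\<close>

lemma gamma_law_rate:
  assumes "0 < q"
  shows "gamma_law n q = density (gamma_law n 1) (\<lambda>t. ennreal (q ^ n * exp (- (q - 1) * t)))"
proof (cases n)
  case 0
  show ?thesis
  proof (rule measure_eqI)
    fix E assume "E \<in> sets (gamma_law n q)"
    then have [measurable]: "E \<in> sets borel" by simp
    show "emeasure (gamma_law n q) E = emeasure (density (gamma_law n 1) (\<lambda>t. ennreal (q ^ n * exp (- (q - 1) * t)))) E"
      using 0 by (simp add: gamma_law_def emeasure_density nn_integral_return)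
  qed simp
next
  case (Suc k)
  have "density (density lborel (\<lambda>x. ennreal (erlang_density k 1 x))) (\<lambda>t. ennreal (q ^ n * exp (- (q - 1) * t)))
     = density lborel (\<lambda>t. ennreal (erlang_density k 1 t) * ennreal (q ^ n * exp (- (q - 1) * t)))"
    by (rule density_density_eq) measurable
  also have "\<dots> = density lborel (\<lambda>t. ennreal (erlang_density k q t))"
  proof (intro density_cong AE_I2)
    fix t :: real
    have "exp (- t) * exp (- (q - 1) * t) = exp (- q * t)"
      by (simp add: exp_add[symmetric] algebra_simps)
    then show "ennreal (erlang_density k 1 t) * ennreal (q ^ n * exp (- (q - 1) * t)) = ennreal (erlang_density k q t)"
      using assms by (auto simp: ennreal_mult[symmetric] erlang_density_def Suc field_simps)
  qed auto
  finally show ?thesis using Suc by (simp add: gamma_law_def)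
qed

definition gamma_field :: "'a set \<Rightarrow> ('a \<Rightarrow> nat) \<Rightarrow> ('a \<Rightarrow> real) \<Rightarrow> ('a \<Rightarrow> real) measure" where
  "gamma_field A n q = PiM A (\<lambda>z. gamma_law (n z) (q z))"

lemma sets_gamma_field [simp, measurable_cong]: "sets (gamma_field A n q) = sets (fieldM A)"
  unfolding gamma_field_def by (rule sets_PiM_cong) auto

lemma space_gamma_field [simp]: "space (gamma_field A n q) = space (fieldM A)"
  by (rule sets_eq_imp_space_eq) simp

lemma gamma_field_cong: "(\<And>z. z \<in> A \<Longrightarrow> q z = q' z) \<Longrightarrow> gamma_field A n q = gamma_field A n q'"
  unfolding gamma_field_def by (rule PiM_cong) auto

text \<open>Positivity is asked at every index because the product locale wants probability measures
  off \<open>A\<close> too; \<open>gamma_field_rate\<close> gets down to \<open>A\<close> by setting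
  the other rates to one.\<close>

lemma gamma_field_rate_all:
  assumes "finite A" and q: "\<And>z. 0 < q z"
  shows "gamma_field A n q = density (gamma_field A n (\<lambda>_. 1)) (\<lambda>t. \<Prod>z\<in>A. ennreal (q z ^ n z * exp (- (q z - 1) * t z)))"
proof -
  interpret P: product_prob_space "\<lambda>z. gamma_law (n z) (q z)" A
    by (intro product_prob_spaceI prob_space_gamma_law q)
  interpret P1: product_prob_space "\<lambda>z. gamma_law (n z) 1" A
    by (intro product_prob_spaceI prob_space_gamma_law) simp
  show ?thesis unfolding gamma_field_def
  proof (rule P.PiM_eqI[symmetric])
    show "sets (density (Pi\<^sub>M A (\<lambda>z. gamma_law (n z) 1)) (\<lambda>t. \<Prod>z\<in>A. ennreal (q z ^ n z * exp (- (q z - 1) * t z)))) = sets (Pi\<^sub>M A (\<lambda>z. gamma_law (n z) (q z)))"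
      by (simp cong: sets_PiM_cong)
    fix E assume E: "\<And>z. z \<in> A \<Longrightarrow> E z \<in> sets (gamma_law (n z) (q z))"
    have [measurable]: "\<And>z. z \<in> A \<Longrightarrow> E z \<in> sets borel" using E by simp
    have mE: "Pi\<^sub>E A E \<in> sets (Pi\<^sub>M A (\<lambda>z. gamma_law (n z) 1))"
      using E \<open>finite A\<close> by (intro sets_PiM_I_finite) auto
    have "emeasure (density (Pi\<^sub>M A (\<lambda>z. gamma_law (n z) 1)) (\<lambda>t. \<Prod>z\<in>A. ennreal (q z ^ n z * exp (- (q z - 1) * t z)))) (Pi\<^sub>E A E)
      = (\<integral>\<^sup>+t. (\<Prod>z\<in>A. ennreal (q z ^ n z * exp (- (q z - 1) * t z))) * indicator (Pi\<^sub>E A E) t \<partial>Pi\<^sub>M A (\<lambda>z. gamma_law (n z) 1))"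
      by (rule emeasure_density[OF _ mE]) measurable
    also have "\<dots> = (\<integral>\<^sup>+t. (\<Prod>z\<in>A. ennreal (q z ^ n z * exp (- (q z - 1) * t z)) * indicator (E z) (t z)) \<partial>Pi\<^sub>M A (\<lambda>z. gamma_law (n z) 1))"
    proof (intro nn_integral_cong)
      fix t assume t: "t \<in> space (Pi\<^sub>M A (\<lambda>z. gamma_law (n z) 1))"
      have "indicator (Pi\<^sub>E A E) t = (\<Prod>z\<in>A. indicator (E z) (t z) :: ennreal)"
      proof (cases "t \<in> Pi\<^sub>E A E")
        case True
        then have "\<forall>z\<in>A. t z \<in> E z" by auto
        then show ?thesis using True by (simp add: indicator_def)
      next
        case False
        then obtain z where "z \<in> A" "t z \<notin> E z" using t by (auto simp: space_PiM)
        then show ?thesis using False \<open>finite A\<close> by (auto simp: indicator_def prod_zero_iff intro!: prod_zero[symmetric])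
      qed
      then show "(\<Prod>z\<in>A. ennreal (q z ^ n z * exp (- (q z - 1) * t z))) * indicator (Pi\<^sub>E A E) t = (\<Prod>z\<in>A. ennreal (q z ^ n z * exp (- (q z - 1) * t z)) * indicator (E z) (t z))"
        by (simp add: prod.distrib)
    qed
    also have "\<dots> = (\<Prod>z\<in>A. \<integral>\<^sup>+t. ennreal (q z ^ n z * exp (- (q z - 1) * t)) * indicator (E z) t \<partial>gamma_law (n z) 1)"
      by (rule P1.product_nn_integral_prod[OF \<open>finite A\<close>]) measurable
    also have "\<dots> = (\<Prod>z\<in>A. emeasure (gamma_law (n z) (q z)) (E z))"
    proof (intro prod.cong refl)
      fix z assume "z \<in> A"
      then have "E z \<in> sets (gamma_law (n z) 1)" using E by simp
      then show "(\<integral>\<^sup>+t. ennreal (q z ^ n z * exp (- (q z - 1) * t)) * indicator (E z) t \<partial>gamma_law (n z) 1) = emeasure (gamma_law (n z) (q z)) (E z)"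
        unfolding gamma_law_rate[OF q, of "n z"] by (intro emeasure_density[symmetric]) auto
    qed
    finally show "emeasure (density (Pi\<^sub>M A (\<lambda>z. gamma_law (n z) 1)) (\<lambda>t. \<Prod>z\<in>A. ennreal (q z ^ n z * exp (- (q z - 1) * t z)))) (Pi\<^sub>E A E)
      = (\<Prod>z\<in>A. emeasure (gamma_law (n z) (q z)) (E z))" .
  qed (fact \<open>finite A\<close>)
qed

lemma gamma_field_rate:
  assumes "finite A" and q: "\<And>z. z \<in> A \<Longrightarrow> 0 < q z"
  shows "gamma_field A n q = density (gamma_field A n (\<lambda>_. 1)) (\<lambda>t. ennreal ((\<Prod>z\<in>A. q z ^ n z) * exp (- (\<Sum>z\<in>A. (q z - 1) * t z))))"
proof -
  let ?q = "\<lambda>z. if z \<in> A then q z else 1"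
  have "gamma_field A n q = gamma_field A n ?q" by (rule gamma_field_cong) simp
  also have "\<dots> = density (gamma_field A n (\<lambda>_. 1)) (\<lambda>t. \<Prod>z\<in>A. ennreal (?q z ^ n z * exp (- (?q z - 1) * t z)))"
    using q by (intro gamma_field_rate_all assms(1)) auto
  also have "(\<lambda>t. \<Prod>z\<in>A. ennreal (?q z ^ n z * exp (- (?q z - 1) * t z))) = (\<lambda>t. ennreal ((\<Prod>z\<in>A. q z ^ n z) * exp (- (\<Sum>z\<in>A. (q z - 1) * t z))))"
  proof
    fix t
    have "(\<Prod>z\<in>A. ennreal (?q z ^ n z * exp (- (?q z - 1) * t z))) = (\<Prod>z\<in>A. ennreal (q z ^ n z * exp (- (q z - 1) * t z)))"
      by (rule prod.cong) auto
    also have "\<dots> = ennreal (\<Prod>z\<in>A. q z ^ n z * exp (- (q z - 1) * t z))"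
      using q by (intro prod_ennreal) (auto intro!: mult_nonneg_nonneg less_imp_le)
    also have "(\<Prod>z\<in>A. q z ^ n z * exp (- (q z - 1) * t z)) = (\<Prod>z\<in>A. q z ^ n z) * exp (- (\<Sum>z\<in>A. (q z - 1) * t z))"
      using assms(1) by (simp add: prod.distrib exp_sum sum_negf[symmetric] left_diff_distrib)
    finally show "(\<Prod>z\<in>A. ennreal (?q z ^ n z * exp (- (?q z - 1) * t z))) = ennreal ((\<Prod>z\<in>A. q z ^ n z) * exp (- (\<Sum>z\<in>A. (q z - 1) * t z)))" .
  qed
  finally show ?thesis .
qed

lemma prob_space_gamma_field:
  assumes "finite A" "\<And>z. z \<in> A \<Longrightarrow> 0 < q z"
  shows "prob_space (gamma_field A n q)"
  unfolding gamma_field_def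
  using assms by (intro prob_space_PiM prob_space_gamma_law)

lemma AE_gamma_field_nonneg:
  assumes "finite A" and q: "\<And>z. z \<in> A \<Longrightarrow> 0 < q z"
  shows "AE t in gamma_field A n q. \<forall>z\<in>A. 0 \<le> t z"
proof (rule AE_finite_allI[OF assms(1)])
  fix z assume z: "z \<in> A"
  show "AE t in gamma_field A n q. 0 \<le> t z"
    unfolding gamma_field_def
    by (rule AE_PiM_component[OF _ z AE_gamma_law_nonneg]) (use q in \<open>auto intro: prob_space_gamma_law\<close>)
qed

text \<open>The sign condition is built in so that a rate error can be bounded pointwise by
  \<open>\<kappa>\<close> times the total time, with no almost-sure argument.\<close>

definition good_set :: "'a set \<Rightarrow> real \<Rightarrow> ('a \<Rightarrow> real) set" where
  "good_set A T = {t \<in> space (fieldM A). (\<forall>z\<in>A. 0 \<le> t z) \<and> (\<Sum>z\<in>A. t z) \<le> T}"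

lemma good_set_measurable [measurable]: "finite A \<Longrightarrow> good_set A T \<in> sets (fieldM A)"
  unfolding good_set_def using finite_set_in_fieldM[of A] by measurable

text \<open>Exponential Markov inequality. The exponential moment of the total time comes for free:
  lowering all rates to \<open>1 - \<theta>\<close> gives a probability measure whose density is
  this exponential times \<open>(1 - \<theta>) ^ k\<close>, with \<open>k\<close> the total number
  of visits.\<close>

lemma gamma_field_chernoff:
  assumes A: "finite A" and \<theta>: "0 < \<theta>" "\<theta> < 1"
  shows "emeasure (gamma_field A n (\<lambda>_. 1)) (space (fieldM A) - good_set A T)
     \<le> ennreal (exp (- (\<theta> * T)) * (1 / (1 - \<theta>)) ^ (\<Sum>z\<in>A. n z))"
proof -
  let ?M = "gamma_field A n (\<lambda>_. 1)" and ?k = "\<Sum>z\<in>A. n z"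
  interpret M: prob_space ?M by (rule prob_space_gamma_field[OF A]) simp
  interpret Mt: prob_space "gamma_field A n (\<lambda>_. 1 - \<theta>)" by (rule prob_space_gamma_field[OF A]) (use \<theta> in simp)
  have m: "(\<lambda>t. ennreal ((1 - \<theta>) ^ ?k * exp (\<theta> * (\<Sum>z\<in>A. t z)))) \<in> borel_measurable ?M" by measurable
  have "(\<lambda>t. ennreal ((\<Prod>z\<in>A. (1 - \<theta>) ^ n z) * exp (- (\<Sum>z\<in>A. (1 - \<theta> - 1) * t z)))) = (\<lambda>t. ennreal ((1 - \<theta>) ^ ?k * exp (\<theta> * (\<Sum>z\<in>A. t z))))"
    by (simp add: power_sum[symmetric] sum_distrib_left sum_negf)
  then have "gamma_field A n (\<lambda>_. 1 - \<theta>) = density ?M (\<lambda>t. ennreal ((1 - \<theta>) ^ ?k * exp (\<theta> * (\<Sum>z\<in>A. t z))))"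
    using gamma_field_rate[OF A, of "\<lambda>_. 1 - \<theta>" n] \<theta> by simp
  then have one: "(\<integral>\<^sup>+t. ennreal ((1 - \<theta>) ^ ?k * exp (\<theta> * (\<Sum>z\<in>A. t z))) \<partial>?M) = 1"
  proof -
    have "(\<integral>\<^sup>+t. ennreal ((1 - \<theta>) ^ ?k * exp (\<theta> * (\<Sum>z\<in>A. t z))) \<partial>?M)
      = (\<integral>\<^sup>+t. ennreal ((1 - \<theta>) ^ ?k * exp (\<theta> * (\<Sum>z\<in>A. t z))) * indicator (space (fieldM A)) t \<partial>?M)"
      by (intro nn_integral_cong) simp
    also have "\<dots> = emeasure (density ?M (\<lambda>t. ennreal ((1 - \<theta>) ^ ?k * exp (\<theta> * (\<Sum>z\<in>A. t z))))) (space (fieldM A))"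
      by (rule emeasure_density[symmetric]) (use m in auto)
    finally show ?thesis using Mt.emeasure_space_1 \<open>gamma_field A n (\<lambda>_. 1 - \<theta>) = _\<close> by simp
  qed
  have "emeasure ?M (space (fieldM A) - good_set A T) = (\<integral>\<^sup>+t. indicator (space (fieldM A) - good_set A T) t \<partial>?M)"
    using good_set_measurable[OF A] by (subst nn_integral_indicator) auto
  also have "\<dots> \<le> (\<integral>\<^sup>+t. ennreal (exp (- (\<theta> * T)) * (1 / (1 - \<theta>)) ^ ?k) * ennreal ((1 - \<theta>) ^ ?k * exp (\<theta> * (\<Sum>z\<in>A. t z))) \<partial>?M)"
  proof (rule nn_integral_mono_AE)
    show "AE t in ?M. indicator (space (fieldM A) - good_set A T) t \<le> ennreal (exp (- (\<theta> * T)) * (1 / (1 - \<theta>)) ^ ?k) * ennreal ((1 - \<theta>) ^ ?k * exp (\<theta> * (\<Sum>z\<in>A. t z)))"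
      using AE_gamma_field_nonneg[OF A, of "\<lambda>_. 1" n, simplified]
    proof eventually_elim
      case (elim t)
      show ?case
      proof (cases "t \<in> space (fieldM A) - good_set A T")
        case True
        then have "T < (\<Sum>z\<in>A. t z)" using elim by (auto simp: good_set_def)
        then have "exp (\<theta> * T) \<le> exp (\<theta> * (\<Sum>z\<in>A. t z))" using \<theta> by simp
        then have e1: "1 \<le> exp (- (\<theta> * T)) * exp (\<theta> * (\<Sum>z\<in>A. t z))" by (simp add: exp_minus field_simps)
        have e2: "(1 / (1 - \<theta>)) ^ ?k * (1 - \<theta>) ^ ?k = 1" using \<theta> by (simp add: power_mult_distrib[symmetric])
        have *: "1 \<le> (exp (- (\<theta> * T)) * (1 / (1 - \<theta>)) ^ ?k) * ((1 - \<theta>) ^ ?k * exp (\<theta> * (\<Sum>z\<in>A. t z)))"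
        proof -
          have "(exp (- (\<theta> * T)) * (1 / (1 - \<theta>)) ^ ?k) * ((1 - \<theta>) ^ ?k * exp (\<theta> * (\<Sum>z\<in>A. t z)))
            = ((1 / (1 - \<theta>)) ^ ?k * (1 - \<theta>) ^ ?k) * (exp (- (\<theta> * T)) * exp (\<theta> * (\<Sum>z\<in>A. t z)))"
            by (simp only: ac_simps)
          with e1 e2 show ?thesis by (simp only: mult_1)
        qed
        show ?thesis using * \<theta> True by (subst ennreal_mult[symmetric]) (auto simp: indicator_def simp del: ennreal_1 simp add: ennreal_1[symmetric] intro!: ennreal_leI)
      qed (auto simp: indicator_def)
    qed
  qed
  also have "\<dots> = ennreal (exp (- (\<theta> * T)) * (1 / (1 - \<theta>)) ^ ?k)"
    by (subst nn_integral_cmult) (auto simp: one)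
  finally show ?thesis .
qed

text \<open>On the good set the tilt costs at most \<open>exp (- (\<kappa> * T))\<close>. The
  product of powers of the rates is kept unestimated; \<open>pathw_rates\<close> cancels it against
  the weights of the jump chain.\<close>

lemma gamma_field_compare:
  assumes A: "finite A" and q: "\<And>z. z \<in> A \<Longrightarrow> 0 < q z" "\<And>z. z \<in> A \<Longrightarrow> \<bar>q z - 1\<bar> \<le> \<kappa>" and "0 \<le> \<kappa>"
    and E: "E \<in> sets (fieldM A)" "E \<subseteq> good_set A T"
  shows "ennreal (exp (- (\<kappa> * T)) * (\<Prod>z\<in>A. q z ^ n z)) * emeasure (gamma_field A n (\<lambda>_. 1)) E \<le> emeasure (gamma_field A n q) E"
proof -
  let ?M = "gamma_field A n (\<lambda>_. 1)"
  have "ennreal (exp (- (\<kappa> * T)) * (\<Prod>z\<in>A. q z ^ n z)) * emeasure ?M E = (\<integral>\<^sup>+t. ennreal (exp (- (\<kappa> * T)) * (\<Prod>z\<in>A. q z ^ n z)) * indicator E t \<partial>?M)"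
    using E by (subst nn_integral_cmult_indicator) auto
  also have "\<dots> \<le> (\<integral>\<^sup>+t. ennreal ((\<Prod>z\<in>A. q z ^ n z) * exp (- (\<Sum>z\<in>A. (q z - 1) * t z))) * indicator E t \<partial>?M)"
  proof (intro nn_integral_mono)
    fix t
    show "ennreal (exp (- (\<kappa> * T)) * (\<Prod>z\<in>A. q z ^ n z)) * indicator E t \<le> ennreal ((\<Prod>z\<in>A. q z ^ n z) * exp (- (\<Sum>z\<in>A. (q z - 1) * t z))) * indicator E t"
    proof (cases "t \<in> E")
      case True
      then have t: "\<forall>z\<in>A. 0 \<le> t z" "(\<Sum>z\<in>A. t z) \<le> T" using E by (auto simp: good_set_def)
      have "(\<Sum>z\<in>A. (q z - 1) * t z) \<le> (\<Sum>z\<in>A. \<kappa> * t z)"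
        using q(2) t by (intro sum_mono mult_right_mono) force+
      also have "\<dots> \<le> \<kappa> * T" using t \<open>0 \<le> \<kappa>\<close> by (simp add: sum_distrib_left[symmetric] mult_left_mono)
      finally have "exp (- (\<kappa> * T)) \<le> exp (- (\<Sum>z\<in>A. (q z - 1) * t z))" by simp
      moreover have "0 \<le> (\<Prod>z\<in>A. q z ^ n z)" by (intro prod_nonneg zero_le_power less_imp_le q(1))
      ultimately have "(\<Prod>z\<in>A. q z ^ n z) * exp (- (\<kappa> * T)) \<le> (\<Prod>z\<in>A. q z ^ n z) * exp (- (\<Sum>z\<in>A. (q z - 1) * t z))"
        by (rule mult_left_mono)
      then have "exp (- (\<kappa> * T)) * (\<Prod>z\<in>A. q z ^ n z) \<le> (\<Prod>z\<in>A. q z ^ n z) * exp (- (\<Sum>z\<in>A. (q z - 1) * t z))"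
        by (simp only: mult.commute)
      then show ?thesis using True by (simp add: ennreal_leI)
    qed simp
  qed
  also have "\<dots> = emeasure (gamma_field A n q) E"
  proof -
    have "gamma_field A n q = density ?M (\<lambda>t. ennreal ((\<Prod>z\<in>A. q z ^ n z) * exp (- (\<Sum>z\<in>A. (q z - 1) * t z))))"
      by (rule gamma_field_rate[OF A]) (rule q(1))
    then show ?thesis using E by (simp add: emeasure_density)
  qed
  finally show ?thesis .
qed

section \<open>Mixtures of Gamma fields over skeletons\<close>

lemma occ_mix_kernel:
  assumes "finite A" and q: "\<And>z. z \<in> A \<Longrightarrow> 0 < q z"
  shows "(\<lambda>s. gamma_field A (cnt s) q) \<in> density (count_space UNIV) w \<rightarrow>\<^sub>M subprob_algebra (fieldM A)"
proof -
  have "gamma_field A (cnt s) q \<in> space (subprob_algebra (fieldM A))" for s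
    by (auto simp: space_subprob_algebra intro!: prob_space_imp_subprob_space prob_space_gamma_field assms)
  then show ?thesis by simp
qed

lemma occ_mix_alt: "occ_mix w cnt q A = density (count_space UNIV) (\<lambda>s. ennreal (w s)) \<bind> (\<lambda>s. gamma_field A (cnt s) q)"
  by (simp add: occ_mix_def gamma_field_def)

lemma sets_occ_mix:
  assumes "finite A" and q: "\<And>z. z \<in> A \<Longrightarrow> 0 < q z"
  shows "sets (occ_mix w cnt q A) = sets (fieldM A)"
  unfolding occ_mix_alt by (rule sets_bind_measurable[OF occ_mix_kernel[OF assms]]) auto

lemma emeasure_occ_mix:
  assumes "finite A" and q: "\<And>z. z \<in> A \<Longrightarrow> 0 < q z" and E: "E \<in> sets (fieldM A)"
  shows "emeasure (occ_mix w cnt q A) E = (\<integral>\<^sup>+s. ennreal (w s) * emeasure (gamma_field A (cnt s) q) E \<partial>count_space UNIV)"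
  unfolding occ_mix_alt
  by (subst emeasure_bind[OF _ occ_mix_kernel[OF assms(1,2)] E]) (auto simp: nn_integral_density)

lemma prob_space_occ_mix:
  assumes "finite A" and q: "\<And>z. z \<in> A \<Longrightarrow> 0 < q z"
    and w: "(\<integral>\<^sup>+s. ennreal (w s) \<partial>count_space UNIV) = 1"
  shows "prob_space (occ_mix w cnt q A)"
proof (rule prob_spaceI)
  have "space (occ_mix w cnt q A) = space (fieldM A)" using sets_occ_mix[OF assms(1,2)] by (rule sets_eq_imp_space_eq)
  moreover have "emeasure (gamma_field A (cnt s) q) (space (fieldM A)) = 1" for s
    using prob_space.emeasure_space_1[OF prob_space_gamma_field[OF assms(1,2), where n="cnt s"]] by simp
  ultimately show "emeasure (occ_mix w cnt q A) (space (occ_mix w cnt q A)) = 1"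
    by (simp add: emeasure_occ_mix[OF assms(1,2)] w)
qed

lemma AE_occ_mix_nonneg:
  assumes "finite A" and q: "\<And>z. z \<in> A \<Longrightarrow> 0 < q z"
  shows "AE t in occ_mix w cnt q A. \<forall>z\<in>A. 0 \<le> t z"
proof -
  let ?N = "{y \<in> space (fieldM A). \<not> (\<forall>z\<in>A. 0 \<le> y z)}"
  have sp: "space (occ_mix w cnt q A) = space (fieldM A)" using sets_occ_mix[OF assms(1,2)] by (rule sets_eq_imp_space_eq)
  have sN: "?N \<in> sets (fieldM A)" using finite_set_in_fieldM[OF assms(1)] by measurable
  have e0: "emeasure (gamma_field A (cnt s) q) ?N = 0" for s
    using AE_iff_measurable[of ?N "gamma_field A (cnt s) q" "\<lambda>y. \<forall>z\<in>A. 0 \<le> y z"] AE_gamma_field_nonneg[OF assms, where n="cnt s"] sN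
    by (simp only: sets_gamma_field space_gamma_field simp_thms)
  then have null: "emeasure (occ_mix w cnt q A) ?N = 0"
    by (simp only: emeasure_occ_mix[OF assms sN] e0 mult_zero_right nn_integral_const mult_zero_left)
  show ?thesis
    by (rule AE_I[OF _ null]) (use sN in \<open>simp_all only: sets_occ_mix[OF assms] sp subset_refl\<close>)
qed

section \<open>Path sums for substochastic kernels\<close>

definition lsum :: "('a list \<Rightarrow> ennreal) \<Rightarrow> ennreal" where
  "lsum f = (\<integral>\<^sup>+ys. f ys \<partial>count_space UNIV)"

definition esum :: "('a \<Rightarrow> ennreal) \<Rightarrow> ennreal" where
  "esum f = (\<integral>\<^sup>+y. f y \<partial>count_space UNIV)"

lemma esum_finite: "finite N \<Longrightarrow> (\<And>y. y \<notin> N \<Longrightarrow> f y = 0) \<Longrightarrow> esum f = sum f N"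
  unfolding esum_def by (rule nn_integral_count_space') auto

lemma lsum_cmult: "lsum (\<lambda>y. c * f y) = c * lsum f"
  unfolding lsum_def by (rule nn_integral_cmult) simp

lemma lsum_add: "lsum (\<lambda>y. f y + g y) = lsum f + lsum g"
  unfolding lsum_def by (rule nn_integral_add) auto

lemma lsum_mono: "(\<And>ys. f ys \<le> g ys) \<Longrightarrow> lsum f \<le> lsum g"
  unfolding lsum_def by (rule nn_integral_mono) auto

lemma nn_integral_count_space_image:
  assumes "inj g" and "\<And>y. y \<notin> range g \<Longrightarrow> f y = 0"
  shows "(\<integral>\<^sup>+y. f y \<partial>count_space UNIV) = (\<integral>\<^sup>+x. f (g x) \<partial>count_space UNIV)"
proof -
  have "(\<integral>\<^sup>+x. f (g x) \<partial>count_space UNIV) = (\<integral>\<^sup>+y. f y \<partial>count_space (range g))"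
    by (rule nn_integral_bij_count_space) (use assms(1) in \<open>auto simp: bij_betw_def\<close>)
  also have "\<dots> = (\<integral>\<^sup>+y. f y \<partial>count_space UNIV)"
    by (rule nn_integral_count_space_eq) (use assms(2) in auto)
  finally show ?thesis ..
qed

lemma lsum_split_nil: "lsum f = f [] + lsum (\<lambda>ys. if ys = [] then 0 else f ys)"
proof -
  have "lsum f = lsum (\<lambda>ys. f [] * indicator {[]} ys + (if ys = [] then 0 else f ys))"
    unfolding lsum_def by (intro nn_integral_cong) (auto simp: indicator_def)
  also have "\<dots> = f [] + lsum (\<lambda>ys. if ys = [] then 0 else f ys)"
    unfolding lsum_add unfolding lsum_def by (subst nn_integral_cmult_indicator) auto
  finally show ?thesis .
qed

lemma lsum_Cons: "lsum f = f [] + esum (\<lambda>x. lsum (\<lambda>ys. f (x # ys)))"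
proof -
  let ?g = "\<lambda>(x, ys). x # ys"
  have "lsum (\<lambda>ys. if ys = [] then 0 else f ys) = (\<integral>\<^sup>+p. f (?g p) \<partial>count_space UNIV)"
    unfolding lsum_def
  proof (subst nn_integral_count_space_image[of ?g])
    show "inj ?g" by (auto simp: inj_def)
    fix ys :: "'a list" assume "ys \<notin> range ?g"
    then have "ys = []" by (cases ys) (auto simp: image_iff)
    then show "(if ys = [] then 0 else f ys) = 0" by simp
  qed (intro nn_integral_cong, auto)
  also have "\<dots> = esum (\<lambda>x. lsum (\<lambda>ys. f (x # ys)))"
    unfolding esum_def lsum_def by (subst nn_integral_fst_count_space[symmetric]) simp
  finally show ?thesis using lsum_split_nil[of f] by simp
qed

lemma lsum_snoc: "lsum f = f [] + esum (\<lambda>x. lsum (\<lambda>ys. f (ys @ [x])))"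
proof -
  let ?g = "\<lambda>(x, ys). ys @ [x]"
  have "lsum (\<lambda>ys. if ys = [] then 0 else f ys) = (\<integral>\<^sup>+p. f (?g p) \<partial>count_space UNIV)"
    unfolding lsum_def
  proof (subst nn_integral_count_space_image[of ?g])
    show "inj ?g" by (auto simp: inj_def)
    fix ys :: "'a list" assume "ys \<notin> range ?g"
    then have "ys = []" by (cases ys rule: rev_cases) (auto simp: image_iff)
    then show "(if ys = [] then 0 else f ys) = 0" by simp
  qed (intro nn_integral_cong, auto)
  also have "\<dots> = esum (\<lambda>x. lsum (\<lambda>ys. f (ys @ [x])))"
    unfolding esum_def lsum_def by (subst nn_integral_fst_count_space[symmetric]) simp
  finally show ?thesis using lsum_split_nil[of f] by simp
qed

section \<open>Path weights, exit sums and the minimum principle\<close>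

fun pathw :: "('a \<Rightarrow> 'a \<Rightarrow> real) \<Rightarrow> 'a \<Rightarrow> 'a list \<Rightarrow> real" where
  "pathw K z [] = 1"
| "pathw K z (w # ys) = K z w * pathw K w ys"

lemma pw_Cons: "pw init K (z # ys) = init z * pathw K z ys"
proof -
  have "(\<Prod>i<length ys. K ((z # ys) ! i) ((z # ys) ! Suc i)) = pathw K z ys"
  proof (induction ys arbitrary: z)
    case (Cons w ys)
    show ?case using Cons.IH[of w] by (simp add: prod.lessThan_Suc_shift del: prod.lessThan_Suc)
  qed simp
  then show ?thesis by (simp add: pw_def)
qed

lemma pathw_append: "pathw K z (ys @ x # zs) = pathw K z (ys @ [x]) * pathw K x zs"
  by (induction ys arbitrary: z) auto

lemma pathw_nonneg: "(\<And>x y. 0 \<le> K x y) \<Longrightarrow> 0 \<le> pathw K z ys"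
  by (induction ys arbitrary: z) auto

lemma pathw_scale: "pathw (\<lambda>x y. c * K x y) z ys = c ^ length ys * pathw K z ys"
  by (induction ys arbitrary: z) auto

text \<open>The path with vertices \<open>z # ys\<close> runs inside \<open>V\<close> until its last vertex, which lies outside \<open>V\<close>.\<close>
fun exits :: "'a set \<Rightarrow> 'a \<Rightarrow> 'a list \<Rightarrow> bool" where
  "exits V z [] = (z \<notin> V)"
| "exits V z (w # ys) = (z \<in> V \<and> exits V w ys)"

lemma exits_iff: "exits V z ys \<longleftrightarrow> set (butlast (z # ys)) \<subseteq> V \<and> last (z # ys) \<notin> V"
  by (induction ys arbitrary: z) auto

text \<open>The expected value of \<open>b\<close> at the exit point from \<open>V\<close>; if \<open>V\<close> is never left, the contribution is zero.\<close>
definition hs :: "('a \<Rightarrow> 'a \<Rightarrow> real) \<Rightarrow> 'a set \<Rightarrow> ('a \<Rightarrow> real) \<Rightarrow> 'a \<Rightarrow> ennreal" where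
  "hs K V b z = lsum (\<lambda>ys. if exits V z ys then ennreal (pathw K z ys * b (last (z # ys))) else 0)"

locale kernel =
  fixes K :: "'a \<Rightarrow> 'a \<Rightarrow> real" and N :: "'a \<Rightarrow> 'a set"
  assumes K_nonneg: "\<And>x y. 0 \<le> K x y"
    and N_finite: "\<And>x. finite (N x)"
    and K_supp: "\<And>x y. y \<notin> N x \<Longrightarrow> K x y = 0"
begin

lemma hs_rec: 
  assumes b: "\<And>x. 0 \<le> b x"
  shows "hs K V b z = (if z \<in> V then (\<Sum>w\<in>N z. ennreal (K z w) * hs K V b w) else ennreal (b z))"
proof -
  have "hs K V b z = (if z \<notin> V then ennreal (b z) else 0) +
     esum (\<lambda>w. lsum (\<lambda>ys. if z \<in> V \<and> exits V w ys then ennreal (K z w * pathw K w ys * b (last (w # ys))) else 0))"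
    unfolding hs_def by (subst lsum_Cons) (simp cong: if_cong)
  also have "(\<lambda>w. lsum (\<lambda>ys. if z \<in> V \<and> exits V w ys then ennreal (K z w * pathw K w ys * b (last (w # ys))) else 0))
     = (\<lambda>w. if z \<in> V then ennreal (K z w) * hs K V b w else 0)"
  proof
    fix w
    show "lsum (\<lambda>ys. if z \<in> V \<and> exits V w ys then ennreal (K z w * pathw K w ys * b (last (w # ys))) else 0)
      = (if z \<in> V then ennreal (K z w) * hs K V b w else 0)"
    proof (cases "z \<in> V")
      case True
      have "(\<lambda>ys. if z \<in> V \<and> exits V w ys then ennreal (K z w * pathw K w ys * b (last (w # ys))) else 0)
        = (\<lambda>ys. ennreal (K z w) * (if exits V w ys then ennreal (pathw K w ys * b (last (w # ys))) else 0))"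
        using True K_nonneg pathw_nonneg[of K, OF K_nonneg] b
        by (auto simp: fun_eq_iff ennreal_mult[symmetric] mult.assoc)
      then show ?thesis using True by (simp add: lsum_cmult hs_def)
    qed (simp add: lsum_def)
  qed
  also have "esum (\<lambda>w. if z \<in> V then ennreal (K z w) * hs K V b w else 0) = (\<Sum>w\<in>N z. if z \<in> V then ennreal (K z w) * hs K V b w else 0)"
    by (rule esum_finite[OF N_finite]) (auto simp: K_supp)
  finally show ?thesis by simp
qed

text \<open>Exit sums are the least nonnegative solution of the Dirichlet problem: sums over paths
  of bounded length stay below every supersolution by induction, and monotone convergence passes to
  the limit. Row sums above one are allowed, as for \<open>srwP\<close> multiplied by
  \<open>1 / (1 - \<theta>)\<close>, where finiteness comes from the supersolution.\<close>

lemma hs_le: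
  assumes b: "\<And>x. 0 \<le> b x" and u: "\<And>x. 0 \<le> u x"
    and bd: "\<And>x. x \<notin> V \<Longrightarrow> b x \<le> u x"
    and super: "\<And>x. x \<in> V \<Longrightarrow> (\<Sum>y\<in>N x. K x y * u y) \<le> u x"
  shows "hs K V b z \<le> ennreal (u z)"
proof -
  define f where "f n z ys = (if length ys \<le> n \<and> exits V z ys then ennreal (pathw K z ys * b (last (z # ys))) else 0)" for n :: nat and z ys
  have bound: "lsum (f n z) \<le> ennreal (u z)" for n z
  proof (induction n arbitrary: z)
    case 0
    have "lsum (f 0 z) = f 0 z []"
      by (subst lsum_Cons) (simp add: f_def lsum_def esum_def)
    also have "\<dots> \<le> ennreal (u z)" using bd[of z] by (auto simp: f_def lsum_def esum_def intro: ennreal_leI)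
    finally show ?case .
  next
    case (Suc n)
    have "lsum (f (Suc n) z) = f (Suc n) z [] + esum (\<lambda>w. lsum (\<lambda>ys. f (Suc n) z (w # ys)))"
      by (rule lsum_Cons)
    also have "(\<lambda>w. lsum (\<lambda>ys. f (Suc n) z (w # ys))) = (\<lambda>w. if z \<in> V then ennreal (K z w) * lsum (f n w) else 0)"
    proof
      fix w
      have "(\<lambda>ys. f (Suc n) z (w # ys)) = (\<lambda>ys. (if z \<in> V then ennreal (K z w) else 0) * f n w ys)"
        using K_nonneg pathw_nonneg[of K, OF K_nonneg] b
        by (auto simp: f_def fun_eq_iff ennreal_mult[symmetric] mult.assoc)
      then show "lsum (\<lambda>ys. f (Suc n) z (w # ys)) = (if z \<in> V then ennreal (K z w) * lsum (f n w) else 0)"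
        by (simp add: lsum_cmult)
    qed
    also have "esum (\<lambda>w. if z \<in> V then ennreal (K z w) * lsum (f n w) else 0) = (\<Sum>w\<in>N z. if z \<in> V then ennreal (K z w) * lsum (f n w) else 0)"
      by (rule esum_finite[OF N_finite]) (auto simp: K_supp)
    also have "f (Suc n) z [] + \<dots> \<le> ennreal (u z)"
    proof (cases "z \<in> V")
      case True
      have "(\<Sum>w\<in>N z. ennreal (K z w) * lsum (f n w)) \<le> (\<Sum>w\<in>N z. ennreal (K z w) * ennreal (u w))"
        by (intro sum_mono mult_left_mono Suc) auto
      also have "\<dots> = ennreal (\<Sum>w\<in>N z. K z w * u w)"
        using K_nonneg u by (simp add: ennreal_mult[symmetric])
      also have "\<dots> \<le> ennreal (u z)" using super[OF True] by (rule ennreal_leI)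
      finally show ?thesis using True by (simp add: f_def)
    next
      case False
      then show ?thesis using bd[of z] by (auto simp: f_def intro: ennreal_leI)
    qed
    finally show ?case .
  qed
  have "hs K V b z = lsum (\<lambda>ys. SUP n. f n z ys)"
    unfolding hs_def
  proof (rule arg_cong[where f=lsum], rule ext)
    fix ys
    let ?c = "if exits V z ys then ennreal (pathw K z ys * b (last (z # ys))) else 0"
    have "(SUP n. f n z ys) = ?c"
    proof (rule antisym)
      show "(SUP n. f n z ys) \<le> ?c" by (intro SUP_least) (auto simp: f_def)
      have "?c = f (length ys) z ys" by (simp add: f_def)
      also have "\<dots> \<le> (SUP n. f n z ys)" by (rule SUP_upper) simp
      finally show "?c \<le> (SUP n. f n z ys)" .
    qed
    then show "?c = (SUP n. f n z ys)" ..
  qed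
  also have "\<dots> = (SUP n. lsum (f n z))"
    unfolding lsum_def by (rule nn_integral_monotone_convergence_SUP) (auto simp: incseq_def le_fun_def f_def)
  also have "\<dots> \<le> ennreal (u z)" by (intro SUP_least bound)
  finally show ?thesis .
qed

end

locale substoch_kernel = kernel +
  assumes K_sum: "\<And>x. (\<Sum>y\<in>N x. K x y) \<le> 1"
begin

text \<open>At a negative minimum over \<open>W\<close> every neighbour charged by \<open>K\<close>
  has at least that value, by \<open>bd\<close> and minimality, and by \<open>reach\<close> some
  minimiser leads to a strictly higher one; averaging contradicts \<open>super\<close>. That
  inequality is asked only where \<open>u\<close> is negative, which the reflected barrier of the
  gradient estimate relies on.\<close>

lemma min_principle:
  assumes W: "finite W"
    and super: "\<And>z. z \<in> W \<Longrightarrow> u z < 0 \<Longrightarrow> (\<Sum>y\<in>N z. K z y * u y) \<le> u z"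
    and bd: "\<And>z y. z \<in> W \<Longrightarrow> y \<notin> W \<Longrightarrow> K z y \<noteq> 0 \<Longrightarrow> 0 \<le> u y"
    and reach: "\<And>Z. Z \<subseteq> W \<Longrightarrow> Z \<noteq> {} \<Longrightarrow> \<exists>z\<in>Z. \<exists>y. y \<notin> Z \<and> K z y \<noteq> 0"
  shows "\<forall>z\<in>W. 0 \<le> u z"
proof (rule ccontr)
  assume "\<not> ?thesis"
  then obtain z0 where z0: "z0 \<in> W" "u z0 < 0" by (auto simp: not_le)
  define m where "m = Min (u ` W)"
  have mle: "m \<le> u z" if "z \<in> W" for z using W that by (auto simp: m_def)
  have m: "m < 0" using mle[OF z0(1)] z0(2) by simp
  define Z where "Z = {z \<in> W. u z = m}"
  have "m \<in> u ` W" unfolding m_def using W z0 by (intro Min_in) auto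
  then have "Z \<noteq> {}" by (auto simp: Z_def)
  then obtain z y where zy: "z \<in> Z" "y \<notin> Z" "K z y \<noteq> 0" using reach[of Z] by (auto simp: Z_def)
  have z: "z \<in> W" "u z = m" using zy by (auto simp: Z_def)
  have ge: "m \<le> u w" if "K z w \<noteq> 0" for w
    using bd[OF z(1) _ that] mle[of w] m by (cases "w \<in> W") auto
  have "m < u y"
    using bd[OF z(1) _ zy(3)] mle[of y] m zy(2) by (cases "y \<in> W") (auto simp: Z_def order.order_iff_strict)
  have yN: "y \<in> N z" using zy(3) K_supp by auto
  \<comment> \<open>Mass missing from the kernel goes the right way because \<open>m\<close> is
    negative.\<close>
  have "m \<le> m * (\<Sum>w\<in>N z. K z w)" using K_sum[of z] m by (simp add: mult_le_cancel_left1)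
  also have "\<dots> = (\<Sum>w\<in>N z. K z w * m)" by (simp add: sum_distrib_left mult.commute)
  also have "\<dots> < (\<Sum>w\<in>N z. K z w * u w)"
  proof (rule sum_strict_mono_ex1[OF N_finite])
    show "\<forall>w\<in>N z. K z w * m \<le> K z w * u w"
    proof
      fix w
      show "K z w * m \<le> K z w * u w"
        using ge[of w] K_nonneg[of z w] by (cases "K z w = 0") (auto intro: mult_left_mono)
    qed
    show "\<exists>w\<in>N z. K z w * m < K z w * u w"
      using yN \<open>m < u y\<close> zy(3) K_nonneg[of z y] by (intro bexI[of _ y]) (auto simp: mult_less_cancel_left)
  qed
  also have "\<dots> \<le> m" using super[OF z(1)] z(2) m by simp
  finally show False by simp
qed

definition hr :: "'a set \<Rightarrow> ('a \<Rightarrow> real) \<Rightarrow> 'a \<Rightarrow> real" where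
  "hr V b z = enn2real (hs K V b z)"

lemma hr_nonneg [simp]: "0 \<le> hr V b z" by (simp add: hr_def)

lemma hs_finite:
  assumes b: "\<And>x. 0 \<le> b x" "\<And>x. b x \<le> B"
  shows "hs K V b z \<le> ennreal B"
  by (rule hs_le) (use assms order_trans[OF b] K_sum in \<open>auto simp: sum_distrib_right[symmetric] intro!: mult_left_le_one_le sum_nonneg K_nonneg\<close>)

lemma hs_eq_hr:
  assumes b: "\<And>x. 0 \<le> b x" "\<And>x. b x \<le> B"
  shows "hs K V b z = ennreal (hr V b z)"
  using hs_finite[of b B V z, OF b] unfolding hr_def
  by (intro ennreal_enn2real[symmetric]) (metis ennreal_less_top le_less_trans)

lemma hr_off: "0 \<le> b z \<Longrightarrow> (\<And>x. 0 \<le> b x) \<Longrightarrow> z \<notin> V \<Longrightarrow> hr V b z = b z"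
  by (simp add: hr_def hs_rec)

lemma hr_le:
  assumes "\<And>x. 0 \<le> b x" "\<And>x. 0 \<le> u x" "\<And>x. x \<notin> V \<Longrightarrow> b x \<le> u x"
    "\<And>x. x \<in> V \<Longrightarrow> (\<Sum>y\<in>N x. K x y * u y) \<le> u x"
  shows "hr V b z \<le> u z"
  using hs_le[of b u V z, OF assms] assms(2) unfolding hr_def by (simp add: enn2real_leI)

lemma hr_rec:
  assumes b: "\<And>x. 0 \<le> b x" "\<And>x. b x \<le> B" and z: "z \<in> V"
  shows "hr V b z = (\<Sum>w\<in>N z. K z w * hr V b w)"
proof -
  have "ennreal (hr V b z) = (\<Sum>w\<in>N z. ennreal (K z w) * ennreal (hr V b w))"
    using hs_rec[of b V z, OF b(1)] z by (simp add: hs_eq_hr[of b B, OF b])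
  also have "\<dots> = ennreal (\<Sum>w\<in>N z. K z w * hr V b w)"
    using K_nonneg by (simp add: ennreal_mult[symmetric])
  finally show ?thesis using K_nonneg by (subst (asm) ennreal_inj) (auto intro!: sum_nonneg)
qed

end

section \<open>Lattice harmonic functions\<close>

lemma nbr_iff: "nbr x y \<longleftrightarrow> (\<exists>i. y = x + axis i 1 \<or> y = x + axis i (-1))"
proof
  assume "nbr x y"
  then have "(norm (rv x - rv y))\<^sup>2 = 1" by (simp add: nbr_def)
  then have "(\<Sum>i\<in>UNIV. (real_of_int (x $ i - y $ i))\<^sup>2) = 1"
    by (simp add: rv_def norm_vec_def L2_set_def sum_nonneg)
  then have "real_of_int (\<Sum>i\<in>UNIV. (x $ i - y $ i)\<^sup>2) = 1" by simp
  then have s: "(\<Sum>i\<in>UNIV. (x $ i - y $ i)\<^sup>2) = 1" by (metis of_int_eq_1_iff)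
  then obtain i where i: "(x $ i - y $ i)\<^sup>2 \<noteq> 0" by (metis (no_types, lifting) sum.neutral zero_neq_one)
  have split: "(\<Sum>i\<in>UNIV. (x $ i - y $ i)\<^sup>2) = (x $ i - y $ i)\<^sup>2 + (\<Sum>j\<in>UNIV - {i}. (x $ j - y $ j)\<^sup>2)"
    by (rule sum.remove) auto
  have "(\<Sum>j\<in>UNIV - {i}. (x $ j - y $ j)\<^sup>2) \<ge> 0" by (rule sum_nonneg) simp
  moreover have "(x $ i - y $ i)\<^sup>2 > 0" using i by simp
  ultimately have 1: "(x $ i - y $ i)\<^sup>2 = 1" "(\<Sum>j\<in>UNIV - {i}. (x $ j - y $ j)\<^sup>2) = 0"
    using s split by linarith+
  have "x $ j = y $ j" if "j \<noteq> i" for j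
    using 1(2) that by (subst (asm) sum_nonneg_eq_0_iff) auto
  moreover have "y $ i = x $ i + 1 \<or> y $ i = x $ i + (-1)" using 1(1) by (auto simp: power2_eq_1_iff)
  ultimately have "y = x + axis i 1 \<or> y = x + axis i (-1)"
    by (auto simp: vec_eq_iff axis_def)
  then show "\<exists>i. y = x + axis i 1 \<or> y = x + axis i (-1)" ..
next
  assume "\<exists>i. y = x + axis i 1 \<or> y = x + axis i (-1)"
  then obtain i where "y = x + axis i 1 \<or> y = x + axis i (-1)" ..
  then have "rv x - rv y = - axis i 1 \<or> rv x - rv y = axis i 1"
    by (auto simp: rv_def vec_eq_iff axis_def)
  then show "nbr x y" unfolding nbr_def by (auto simp: norm_axis_1)
qed

lemma nbr_sym: "nbr x y \<longleftrightarrow> nbr y x"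
  by (simp add: nbr_def norm_minus_commute)

lemma mem_nbrs: "y \<in> nbrs x \<longleftrightarrow> nbr x y"
  by (simp add: nbrs_def)

lemma nbrs_image: "nbrs x = (\<lambda>(i, s). x + axis i s) ` (UNIV \<times> {1, -1})"
  by (auto simp: nbrs_def nbr_iff image_iff)

lemma finite_nbrs [simp]: "finite (nbrs (x :: int^'d::finite))"
  by (simp add: nbrs_image)

lemma sum_nbrs:
  fixes x :: "int^'d::finite"
  shows "(\<Sum>y\<in>nbrs x. g y) = (\<Sum>i\<in>UNIV. g (x + axis i 1) + g (x + axis i (-1)))"
proof -
  have inj: "inj_on (\<lambda>(i, s :: int). x + axis i s) (UNIV \<times> {1, -1})"
    by (auto simp: inj_on_def axis_eq_axis)
  have "(\<Sum>y\<in>nbrs x. g y) = (\<Sum>p\<in>UNIV \<times> {1, -1}. g (x + axis (fst p) (snd p)))"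
    unfolding nbrs_image by (subst sum.reindex[OF inj]) (simp add: split_def)
  also have "\<dots> = (\<Sum>i\<in>UNIV. \<Sum>s\<in>{1, -1}. g (x + axis i s))"
    by (subst sum.cartesian_product) (simp add: split_def)
  finally show ?thesis by simp
qed

definition avg :: "(int^'d::finite \<Rightarrow> real) \<Rightarrow> int^'d \<Rightarrow> real" where
  "avg u x = (\<Sum>y\<in>nbrs x. u y) / (2 * real CARD('d))"

lemma card_ge_1 [simp]: "1 \<le> real CARD('d::finite)"
proof -
  have "0 < CARD('d)" by (simp add: zero_less_card_finite)
  then show ?thesis by linarith
qed

lemma avg_const [simp]: "avg (\<lambda>_. c) (x :: int^'d::finite) = c"
  unfolding avg_def sum_nbrs by simp

lemma avg_mono: "(\<And>y. y \<in> nbrs x \<Longrightarrow> u y \<le> v y) \<Longrightarrow> avg u x \<le> avg v x"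
  unfolding avg_def by (intro divide_right_mono sum_mono) auto

lemma avg_cong: "(\<And>y. y \<in> nbrs x \<Longrightarrow> u y = v y) \<Longrightarrow> avg u x = avg v x"
  unfolding avg_def by (auto intro!: arg_cong2[where f="(/)"] sum.cong)

lemma avg_add: "avg (\<lambda>y. u y + v y) x = avg u x + avg v x"
  by (simp add: avg_def sum.distrib add_divide_distrib)

lemma avg_diff: "avg (\<lambda>y. u y - v y) x = avg u x - avg v x"
  by (simp add: avg_def sum_subtractf diff_divide_distrib)

lemma avg_cmult: "avg (\<lambda>y. c * u y) x = c * avg u x"
  by (simp add: avg_def sum_distrib_left)

lemma avg_shift: "avg (\<lambda>z. u (z - y)) x = avg u (x - y)"
  by (simp add: avg_def sum_nbrs algebra_simps)

lemma avg_nonneg: "(\<And>y. y \<in> nbrs x \<Longrightarrow> 0 \<le> u y) \<Longrightarrow> 0 \<le> avg u x"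
  unfolding avg_def by (auto intro!: divide_nonneg_nonneg sum_nonneg)

lemma avg_ge_nbr:
  fixes x :: "int^'d::finite"
  assumes "\<And>y. y \<in> nbrs x \<Longrightarrow> 0 \<le> u y" and "z \<in> nbrs x"
  shows "u z / (2 * real CARD('d)) \<le> avg u x"
  unfolding avg_def using assms by (intro divide_right_mono member_le_sum) auto

lemma srwP_sum: "(\<Sum>y\<in>nbrs x. srwP x y * u y) = avg u x"
  unfolding avg_def by (subst sum_divide_distrib) (auto simp: srwP_def mem_nbrs intro!: sum.cong)

interpretation srw: substoch_kernel "srwP :: int^'d::finite \<Rightarrow> int^'d \<Rightarrow> real" nbrs
proof
  fix x :: "int^'d"
  show "(\<Sum>y\<in>nbrs x. srwP x y) \<le> 1" using srwP_sum[of x "\<lambda>_. 1"] by simp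
qed (auto simp: srwP_def mem_nbrs)

text \<open>A point with maximal \<open>i\<close>-th coordinate. It supplies the reachability
  condition of the minimum principle and, later, a boundary point of \<open>A1\<close> with positive
  equilibrium weight.\<close>

lemma finite_lattice_exit:
  fixes Z :: "(int^'d::finite) set"
  assumes "finite Z" "Z \<noteq> {}"
  shows "\<exists>z\<in>Z. z + axis i 1 \<notin> Z"
proof -
  have "Max ((\<lambda>z. z $ i) ` Z) \<in> (\<lambda>z. z $ i) ` Z" using assms by (intro Max_in) auto
  then obtain z where z: "z \<in> Z" "z $ i = Max ((\<lambda>z. z $ i) ` Z)" by auto
  have "z + axis i 1 \<notin> Z"
  proof
    assume "z + axis i 1 \<in> Z"
    then have "(z + axis i 1) $ i \<in> (\<lambda>z. z $ i) ` Z" by (rule imageI)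
    then have "(z + axis i 1) $ i \<le> Max ((\<lambda>z. z $ i) ` Z)" using assms(1) by (intro Max_ge finite_imageI)
    then show False using z by (simp add: axis_def)
  qed
  then show ?thesis using z by blast
qed

lemma srw_min_principle:
  fixes W :: "(int^'d::finite) set"
  assumes W: "finite W"
    and super: "\<And>z. z \<in> W \<Longrightarrow> u z < 0 \<Longrightarrow> avg u z \<le> u z"
    and bd: "\<And>z y. z \<in> W \<Longrightarrow> y \<notin> W \<Longrightarrow> nbr z y \<Longrightarrow> 0 \<le> u y"
  shows "z \<in> W \<Longrightarrow> 0 \<le> u z"
proof -
  have "\<forall>z\<in>W. 0 \<le> u z"
  proof (rule srw.min_principle[OF W])
    fix Z assume Z: "Z \<subseteq> W" "Z \<noteq> {}"
    obtain i :: 'd where True by auto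
    have "finite Z" using Z W finite_subset by auto
    from finite_lattice_exit[OF this Z(2), of i] obtain z where "z \<in> Z" "z + axis i 1 \<notin> Z" by auto
    then show "\<exists>z\<in>Z. \<exists>y. y \<notin> Z \<and> srwP z y \<noteq> 0"
      by (intro bexI[of _ z] exI[of _ "z + axis i 1"]) (auto simp: srwP_def nbr_iff)
  next
    fix z y assume "z \<in> W" "y \<notin> W" "srwP z y \<noteq> 0"
    then show "0 \<le> u y" using bd[of z y] by (auto simp: srwP_def split: if_splits)
  qed (use super in \<open>simp add: srwP_sum\<close>)
  then show "z \<in> W \<Longrightarrow> 0 \<le> u z" by blast
qed

lemma srw_comparison:
  fixes W :: "(int^'d::finite) set"
  assumes W: "finite W"
    and sub: "\<And>z. z \<in> W \<Longrightarrow> u z \<le> avg u z"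
    and super: "\<And>z. z \<in> W \<Longrightarrow> avg v z \<le> v z"
    and bd: "\<And>y. y \<notin> W \<Longrightarrow> (\<exists>z\<in>W. nbr z y) \<Longrightarrow> u y \<le> v y"
    and z: "z \<in> W"
  shows "u z \<le> v z"
proof -
  have "0 \<le> v z - u z"
  proof (rule srw_min_principle[OF W, of "\<lambda>z. v z - u z"])
    fix z assume "z \<in> W"
    then show "avg (\<lambda>z. v z - u z) z \<le> v z - u z"
      using sub[of z] super[of z] by (simp add: avg_diff)
  qed (use bd z in auto)
  then show ?thesis by simp
qed

lemma finite_supbox [simp]: "finite (supbox (x :: int^'d::finite) m)"
proof -
  have "supbox x m \<subseteq> (\<lambda>f. \<chi> i. f i) ` (PiE UNIV (\<lambda>i. {x $ i - m .. x $ i + m}))"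
  proof
    fix z assume z: "z \<in> supbox x m"
    have "x $ i - m \<le> z $ i \<and> z $ i \<le> x $ i + m" for i
    proof -
      have "\<bar>z $ i - x $ i\<bar> \<le> m" using z by (simp add: supbox_def)
      then show ?thesis by arith
    qed
    then have "(\<lambda>i. z $ i) \<in> PiE UNIV (\<lambda>i. {x $ i - m .. x $ i + m})" by auto
    then show "z \<in> (\<lambda>f. \<chi> i. f i) ` (PiE UNIV (\<lambda>i. {x $ i - m .. x $ i + m}))"
      by (intro image_eqI[of _ _ "\<lambda>i. z $ i"]) (simp_all only: vec_nth_inverse vec_lambda_eta)
  qed
  moreover have "finite (PiE UNIV (\<lambda>i::'d. {x $ i - m .. x $ i + m}))" by (intro finite_PiE) auto
  ultimately show ?thesis using finite_surj by blast
qed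

lemma nbr_coord: "nbr z y \<Longrightarrow> \<bar>y $ i - z $ i\<bar> \<le> 1"
  by (auto simp: nbr_iff axis_def)

lemma supbox_nbr:
  assumes "z \<in> supbox x m" "nbr z y" shows "y \<in> supbox x (m + 1)"
  unfolding supbox_def
proof (intro CollectI allI)
  fix i
  have "\<bar>z $ i - x $ i\<bar> \<le> m" using assms(1) by (simp add: supbox_def)
  with nbr_coord[OF assms(2), of i] show "\<bar>y $ i - x $ i\<bar> \<le> m + 1" by arith
qed

lemma supbox_mono: "m \<le> m' \<Longrightarrow> supbox x m \<subseteq> supbox x m'"
  unfolding supbox_def by (auto intro: order_trans)

definition sq :: "int^'d::finite \<Rightarrow> real" where
  "sq z = (\<Sum>i\<in>UNIV. (real_of_int (z $ i))\<^sup>2)"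

lemma sq_nonneg [simp]: "0 \<le> sq z" by (simp add: sq_def sum_nonneg)

lemma sq_step: "sq (z + axis i s) = sq z + 2 * real_of_int (z $ i) * of_int s + (of_int s)\<^sup>2"
proof -
  have "sq (z + axis i s) = (real_of_int (z $ i + s))\<^sup>2 + (\<Sum>j\<in>UNIV - {i}. (real_of_int (z $ j))\<^sup>2)"
    unfolding sq_def by (subst sum.remove[of _ i]) (auto simp: axis_def intro!: sum.cong)
  moreover have "sq z = (real_of_int (z $ i))\<^sup>2 + (\<Sum>j\<in>UNIV - {i}. (real_of_int (z $ j))\<^sup>2)"
    unfolding sq_def by (subst sum.remove[of _ i]) auto
  ultimately show ?thesis by (simp add: power2_eq_square algebra_simps)
qed

lemma coord_le_sq: "(real_of_int (z $ i))\<^sup>2 \<le> sq z"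
  unfolding sq_def by (rule member_le_sum) auto

section \<open>Radial barriers\<close>

lemma powr_taylor:
  fixes \<alpha> \<omega> :: real
  assumes \<alpha>: "0 < \<alpha>" and "0 < \<omega>"
  shows "\<exists>\<tau>>0. \<tau> < 1 \<and> (\<forall>t. \<bar>t\<bar> \<le> \<tau> \<longrightarrow>
     \<bar>(1 + t) powr (-\<alpha>) - (1 - \<alpha> * t + \<alpha> * (\<alpha> + 1) / 2 * t\<^sup>2)\<bar> \<le> \<omega> * t\<^sup>2)"
proof -
  have "((\<lambda>t. ((1 + t) powr (-\<alpha>) - (1 - \<alpha> * t)) / t\<^sup>2) \<longlongrightarrow> \<alpha> * (\<alpha> + 1) / 2) (at (0 :: real))"
    using \<alpha> by real_asymp (simp_all add: field_simps)
  then have "eventually (\<lambda>t. dist (((1 + t) powr (-\<alpha>) - (1 - \<alpha> * t)) / t\<^sup>2) (\<alpha> * (\<alpha> + 1) / 2) < \<omega>) (at 0)"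
    using assms(2) by (rule tendstoD)
  then obtain e where e: "0 < e" "\<And>t. t \<noteq> 0 \<Longrightarrow> \<bar>t\<bar> < e \<Longrightarrow>
     \<bar>((1 + t) powr (-\<alpha>) - (1 - \<alpha> * t)) / t\<^sup>2 - \<alpha> * (\<alpha> + 1) / 2\<bar> < \<omega>"
    unfolding eventually_at by (auto simp: dist_real_def)
  define \<tau> where "\<tau> = min (e / 2) (1 / 2)"
  have "\<bar>(1 + t) powr (-\<alpha>) - (1 - \<alpha> * t + \<alpha> * (\<alpha> + 1) / 2 * t\<^sup>2)\<bar> \<le> \<omega> * t\<^sup>2" if "\<bar>t\<bar> \<le> \<tau>" for t
  proof (cases "t = 0")
    case False
    have "\<bar>t\<bar> < e" using that e(1) by (simp add: \<tau>_def)
    from e(2)[OF False this] have "\<bar>((1 + t) powr (-\<alpha>) - (1 - \<alpha> * t)) / t\<^sup>2 - \<alpha> * (\<alpha> + 1) / 2\<bar> * t\<^sup>2 \<le> \<omega> * t\<^sup>2"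
      by (intro mult_right_mono) auto
    also have "\<bar>((1 + t) powr (-\<alpha>) - (1 - \<alpha> * t)) / t\<^sup>2 - \<alpha> * (\<alpha> + 1) / 2\<bar> * t\<^sup>2 =
      \<bar>(((1 + t) powr (-\<alpha>) - (1 - \<alpha> * t)) / t\<^sup>2 - \<alpha> * (\<alpha> + 1) / 2) * t\<^sup>2\<bar>"
      by (simp add: abs_mult)
    also have "(((1 + t) powr (-\<alpha>) - (1 - \<alpha> * t)) / t\<^sup>2 - \<alpha> * (\<alpha> + 1) / 2) * t\<^sup>2 =
      (1 + t) powr (-\<alpha>) - (1 - \<alpha> * t + \<alpha> * (\<alpha> + 1) / 2 * t\<^sup>2)"
      using False by (simp add: field_simps)
    finally show ?thesis .
  qed simp
  then show ?thesis using e(1) by (intro exI[of _ \<tau>]) (auto simp: \<tau>_def)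
qed

lemma norm_rv_sq: "(norm (rv z))\<^sup>2 = sq z"
  by (simp add: rv_def norm_vec_def L2_set_def sum_nonneg sq_def)

text \<open>The power \<open>|z| powr (- 2 * \<alpha>)\<close> smoothed at the origin. The Newtonian
  exponent would be \<open>2 * \<alpha> = d - 2\<close>; it is missed slightly on either side, which
  turns harmonicity into strict inequalities that survive discretisation.\<close>

definition radial :: "real \<Rightarrow> real \<Rightarrow> int^'d::finite \<Rightarrow> real" where
  "radial \<alpha> b z = (sq z + b) powr (-\<alpha>)"

text \<open>Centred at \<open>s\<close>, the arguments at the two neighbours in direction
  \<open>i\<close> are \<open>s * (1 + t i)\<close> and \<open>s * (1 - t i)\<close>, so first-order
  terms cancel and the squares of \<open>t i\<close> sum to \<open>4 * sq x / s^2\<close>; the point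
  \<open>x\<close> itself corresponds to \<open>s * (1 - 1 / s)\<close>. The lower bound on
  \<open>s\<close> keeps all increments below \<open>\<tau>\<close>.\<close>

lemma avg_radial:
  fixes x :: "int^'d::finite"
  assumes \<tau>: "0 < \<tau>" "\<tau> < 1" and taylor: "\<And>t. \<bar>t\<bar> \<le> \<tau> \<Longrightarrow>
     \<bar>(1 + t) powr (-\<alpha>) - (1 - \<alpha> * t + \<alpha> * (\<alpha> + 1) / 2 * t\<^sup>2)\<bar> \<le> \<omega> * t\<^sup>2"
    and s: "s = sq x + b + 1" "4 / \<tau>\<^sup>2 \<le> s" and b: "0 \<le> b"
  shows "\<bar>avg (radial \<alpha> b) x - s powr (-\<alpha>) * (1 + \<alpha> * (\<alpha> + 1) * (2 * sq x / (real CARD('d) * s\<^sup>2)))\<bar>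
      \<le> s powr (-\<alpha>) * (\<omega> * (4 * sq x / (real CARD('d) * s\<^sup>2)))" (is ?A)
    and "\<bar>radial \<alpha> b x - s powr (-\<alpha>) * (1 + \<alpha> / s + \<alpha> * (\<alpha> + 1) / 2 / s\<^sup>2)\<bar> \<le> s powr (-\<alpha>) * (\<omega> / s\<^sup>2)" (is ?B)
proof -
  let ?d = "real CARD('d)"
  have s0: "1 \<le> s" using s(1) b by simp
  have \<tau>s: "2 \<le> \<tau> * sqrt s"
  proof -
    have "4 \<le> \<tau>\<^sup>2 * s" using s(2) \<tau> by (simp add: field_simps)
    then have "sqrt 4 \<le> sqrt (\<tau>\<^sup>2 * s)" by (rule real_sqrt_le_mono)
    then show ?thesis using \<tau> by (simp add: real_sqrt_mult)
  qed
  define t where "t i = 2 * real_of_int (x $ i) / s" for i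
  have t_le: "\<bar>t i\<bar> \<le> \<tau>" for i
  proof -
    have "(real_of_int (x $ i))\<^sup>2 \<le> s" using coord_le_sq[of x i] s(1) b by simp
    then have "\<bar>real_of_int (x $ i)\<bar> \<le> sqrt s" using real_le_rsqrt by force
    then have "2 * \<bar>real_of_int (x $ i)\<bar> \<le> \<tau> * sqrt s * sqrt s" using \<tau>s s0 by (intro mult_mono) auto
    also have "\<dots> = \<tau> * s" using s0 by (simp add: mult.assoc)
    finally show ?thesis using s0 by (simp add: t_def abs_mult field_simps)
  qed
  have step: "radial \<alpha> b (x + axis i j) = s powr (-\<alpha>) * (1 + of_int j * t i) powr (-\<alpha>)" if "j = 1 \<or> j = -1" for i j
  proof -
    have "sq (x + axis i j) + b = s * (1 + of_int j * t i)"
    proof -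
      have "s * (1 + of_int j * t i) = s + 2 * real_of_int (x $ i) * of_int j" using s0 by (simp add: t_def distrib_left)
      then show ?thesis using that by (auto simp: sq_step s(1))
    qed
    moreover have "0 \<le> 1 + of_int j * t i" using t_le[of i] \<tau> that by (auto simp: abs_le_iff)
    ultimately show ?thesis using s0 by (simp add: radial_def powr_mult)
  qed
  have sumt: "(\<Sum>i\<in>UNIV. (t i)\<^sup>2) = 4 * sq x / s\<^sup>2"
    by (simp add: t_def power_divide power_mult_distrib sq_def sum_distrib_left sum_divide_distrib)
  let ?S = "\<Sum>i\<in>UNIV. (1 + t i) powr (-\<alpha>) + (1 - t i) powr (-\<alpha>)"
  have "\<bar>?S - (\<Sum>i\<in>(UNIV::'d set). 2 + \<alpha> * (\<alpha> + 1) * (t i)\<^sup>2)\<bar> \<le> (\<Sum>i\<in>(UNIV::'d set). 2 * \<omega> * (t i)\<^sup>2)"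
    unfolding sum_subtractf[symmetric]
  proof (rule order_trans[OF sum_abs sum_mono])
    fix i :: 'd
    have "\<bar>(1 + t i) powr (-\<alpha>) - (1 - \<alpha> * t i + \<alpha> * (\<alpha> + 1) / 2 * (t i)\<^sup>2)\<bar> \<le> \<omega> * (t i)\<^sup>2"
      using taylor[of "t i"] t_le[of i] by simp
    moreover have "\<bar>(1 - t i) powr (-\<alpha>) - (1 + \<alpha> * t i + \<alpha> * (\<alpha> + 1) / 2 * (t i)\<^sup>2)\<bar> \<le> \<omega> * (t i)\<^sup>2"
      using taylor[of "- t i"] t_le[of i] by simp
    ultimately show "\<bar>(1 + t i) powr (-\<alpha>) + (1 - t i) powr (-\<alpha>) - (2 + \<alpha> * (\<alpha> + 1) * (t i)\<^sup>2)\<bar> \<le> 2 * \<omega> * (t i)\<^sup>2"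
      unfolding abs_le_iff by (simp add: field_simps)
  qed
  also have "(\<Sum>i\<in>(UNIV::'d set). 2 + \<alpha> * (\<alpha> + 1) * (t i)\<^sup>2) = 2 * ?d + \<alpha> * (\<alpha> + 1) * (4 * sq x / s\<^sup>2)"
    unfolding sum.distrib sum_distrib_left[symmetric] sumt by simp
  also have "(\<Sum>i\<in>(UNIV::'d set). 2 * \<omega> * (t i)\<^sup>2) = 2 * \<omega> * (4 * sq x / s\<^sup>2)"
    unfolding sum_distrib_left[symmetric] sumt by simp
  finally have "\<bar>?S - (2 * ?d + \<alpha> * (\<alpha> + 1) * (4 * sq x / s\<^sup>2))\<bar> * (s powr (-\<alpha>) / (2 * ?d)) \<le> 2 * \<omega> * (4 * sq x / s\<^sup>2) * (s powr (-\<alpha>) / (2 * ?d))"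
    by (rule mult_right_mono) simp
  moreover have "\<bar>?S - (2 * ?d + \<alpha> * (\<alpha> + 1) * (4 * sq x / s\<^sup>2))\<bar> * (s powr (-\<alpha>) / (2 * ?d))
     = \<bar>(?S - (2 * ?d + \<alpha> * (\<alpha> + 1) * (4 * sq x / s\<^sup>2))) * (s powr (-\<alpha>) / (2 * ?d))\<bar>"
    by (simp add: abs_mult)
  moreover have "avg (radial \<alpha> b) x = ?S * (s powr (-\<alpha>) / (2 * ?d))"
  proof -
    have "(\<Sum>i\<in>UNIV. radial \<alpha> b (x + axis i 1) + radial \<alpha> b (x + axis i (-1))) = s powr (-\<alpha>) * ?S"
      by (subst sum_distrib_left, rule sum.cong) (use step[of 1] step[of "-1"] in \<open>simp_all add: distrib_left\<close>)
    then show ?thesis by (simp add: avg_def sum_nbrs)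
  qed
  moreover have "(2 * ?d + \<alpha> * (\<alpha> + 1) * (4 * sq x / s\<^sup>2)) * (s powr (-\<alpha>) / (2 * ?d)) = s powr (-\<alpha>) * (1 + \<alpha> * (\<alpha> + 1) * (2 * sq x / (?d * s\<^sup>2)))"
    using s0 by (simp add: field_simps)
  moreover have "2 * \<omega> * (4 * sq x / s\<^sup>2) * (s powr (-\<alpha>) / (2 * ?d)) = s powr (-\<alpha>) * (\<omega> * (4 * sq x / (?d * s\<^sup>2)))"
    using s0 by (simp add: field_simps)
  ultimately show ?A by (simp only: left_diff_distrib)
  have "\<tau>\<^sup>2 \<le> \<tau> * 1" using \<tau> unfolding power2_eq_square by (intro mult_left_mono) auto
  then have "1 / \<tau> \<le> 4 / \<tau>\<^sup>2" using \<tau> by (simp add: field_simps)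
  then have "1 / \<tau> \<le> s" using s(2) by simp
  then have "\<bar>- (1 / s)\<bar> \<le> \<tau>" using s0 \<tau> by (simp add: field_simps)
  from taylor[OF this] have t1: "\<bar>(1 - 1 / s) powr (-\<alpha>) - (1 + \<alpha> / s + \<alpha> * (\<alpha> + 1) / 2 / s\<^sup>2)\<bar> \<le> \<omega> / s\<^sup>2"
    by (simp add: power_divide)
  have "sq x + b = s * (1 - 1 / s)" using s0 s(1) by (simp add: field_simps)
  then have rx: "radial \<alpha> b x = s powr (-\<alpha>) * (1 - 1 / s) powr (-\<alpha>)"
    using s0 by (simp add: radial_def powr_mult)
  show ?B
    using mult_left_mono[OF t1, of "s powr (-\<alpha>)"] unfolding rx right_diff_distrib[symmetric] abs_mult by simp
qed

text \<open>To leading order the claim is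
  \<open>2 * \<alpha> * (\<alpha> + 1) < d * \<alpha>\<close>, that is
  \<open>2 * \<alpha> < d - 2\<close>. Taking \<open>b\<close> as large as the Taylor estimate
  requires makes the barrier superharmonic on the whole lattice, the origin included.\<close>

lemma radial_superharmonic:
  assumes \<alpha>: "0 < \<alpha>" "2 * \<alpha> < real CARD('d::finite) - 2"
  shows "\<exists>b\<ge>1. \<forall>x :: int^'d. avg (radial \<alpha> b) x \<le> radial \<alpha> b x"
proof -
  let ?d = "real CARD('d)"
  have pos: "0 < ?d * \<alpha> - 2 * \<alpha> * (\<alpha> + 1)"
  proof -
    have "\<alpha> * (2 * (\<alpha> + 1)) < \<alpha> * ?d" using \<alpha> by (intro mult_strict_left_mono) auto
    then show ?thesis by (simp add: algebra_simps)
  qed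
  \<comment> \<open>The first bound lets the second-order term of the value at \<open>x\<close>
    absorb its Taylor error; the second spends the gap between the leading terms.\<close>
  define \<omega> where "\<omega> = min (\<alpha> * (\<alpha> + 1) / 2) ((?d * \<alpha> - 2 * \<alpha> * (\<alpha> + 1)) / 4)"
  have \<omega>: "0 < \<omega>" "\<omega> \<le> \<alpha> * (\<alpha> + 1) / 2" "2 * (\<alpha> * (\<alpha> + 1) + 2 * \<omega>) \<le> ?d * \<alpha>"
  proof -
    show "0 < \<omega>" "\<omega> \<le> \<alpha> * (\<alpha> + 1) / 2" using pos \<alpha> by (auto simp: \<omega>_def)
    have "\<omega> \<le> (?d * \<alpha> - 2 * \<alpha> * (\<alpha> + 1)) / 4" unfolding \<omega>_def by (rule min.cobounded2)
    then have "4 * \<omega> \<le> ?d * \<alpha> - 2 * \<alpha> * (\<alpha> + 1)" by simp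
    then show "2 * (\<alpha> * (\<alpha> + 1) + 2 * \<omega>) \<le> ?d * \<alpha>" by (simp add: algebra_simps)
  qed
  obtain \<tau> where \<tau>: "0 < \<tau>" "\<tau> < 1" and taylor: "\<And>t. \<bar>t\<bar> \<le> \<tau> \<Longrightarrow>
     \<bar>(1 + t) powr (-\<alpha>) - (1 - \<alpha> * t + \<alpha> * (\<alpha> + 1) / 2 * t\<^sup>2)\<bar> \<le> \<omega> * t\<^sup>2"
    using powr_taylor[OF \<alpha>(1) \<omega>(1)] by blast
  define b where "b = 4 / \<tau>\<^sup>2"
  have b1: "1 \<le> b"
  proof -
    have "\<tau>\<^sup>2 \<le> 1" using \<tau> by (simp add: power_le_one)
    then show ?thesis using \<tau> by (simp add: b_def field_simps)
  qed
  have "avg (radial \<alpha> b) x \<le> radial \<alpha> b x" for x :: "int^'d"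
  proof -
    define s where "s = sq x + b + 1"
    have s: "4 / \<tau>\<^sup>2 \<le> s" "1 \<le> s" using b1 by (auto simp: s_def b_def)
    note R = avg_radial[OF \<tau> taylor s_def s(1)]
    have "\<alpha> * (\<alpha> + 1) * (2 * sq x / (?d * s\<^sup>2)) + \<omega> * (4 * sq x / (?d * s\<^sup>2)) = 2 * (\<alpha> * (\<alpha> + 1) + 2 * \<omega>) * (sq x / (?d * s\<^sup>2))"
      by (simp add: algebra_simps add_divide_distrib)
    also have "\<dots> \<le> ?d * \<alpha> * (s / (?d * s\<^sup>2))"
      by (rule mult_mono[OF \<omega>(3) divide_right_mono]) (use \<alpha> b1 in \<open>auto simp: s_def\<close>)
    also have "\<dots> = \<alpha> / s" using s by (simp add: power2_eq_square)
    also have "\<dots> \<le> \<alpha> / s + \<alpha> * (\<alpha> + 1) / 2 / s\<^sup>2 - \<omega> / s\<^sup>2"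
      using divide_right_mono[OF \<omega>(2), of "s\<^sup>2"] by simp
    finally have "s powr (-\<alpha>) * (1 + \<alpha> * (\<alpha> + 1) * (2 * sq x / (?d * s\<^sup>2)) + \<omega> * (4 * sq x / (?d * s\<^sup>2)))
       \<le> s powr (-\<alpha>) * (1 + \<alpha> / s + \<alpha> * (\<alpha> + 1) / 2 / s\<^sup>2 - \<omega> / s\<^sup>2)"
      by (intro mult_left_mono) auto
    with R b1 show ?thesis unfolding abs_le_iff by (simp add: distrib_left right_diff_distrib)
  qed
  then show ?thesis using b1 by blast
qed

text \<open>The gap of the leading terms is reversed, but now the lower-order terms have the wrong
  sign, so only points with \<open>S0 \<le> sq x\<close> are covered. The neighbourhood of the pole
  is handled in \<open>visit_lower\<close> by explicit paths.\<close>

lemma radial_subharmonic: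
  assumes \<alpha>: "0 < \<alpha>" "real CARD('d::finite) - 2 < 2 * \<alpha>"
  shows "\<exists>S0\<ge>1. \<forall>x :: int^'d. S0 \<le> sq x \<longrightarrow> radial \<alpha> 1 x \<le> avg (radial \<alpha> 1) x"
proof -
  let ?d = "real CARD('d)"
  have pos: "0 < 2 * \<alpha> * (\<alpha> + 1) - ?d * \<alpha>"
  proof -
    have "\<alpha> * ?d < \<alpha> * (2 * (\<alpha> + 1))" using \<alpha> by (intro mult_strict_left_mono) auto
    then show ?thesis by (simp add: algebra_simps)
  qed
  define \<omega> where "\<omega> = (2 * \<alpha> * (\<alpha> + 1) - ?d * \<alpha>) / 8"
  define P where "P = 2 * (\<alpha> * (\<alpha> + 1) - 2 * \<omega>)"
  have \<omega>: "0 < \<omega>" and P: "0 < P - ?d * \<alpha>" using pos by (auto simp: \<omega>_def P_def field_simps)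
  obtain \<tau> where \<tau>: "0 < \<tau>" "\<tau> < 1" and taylor: "\<And>t. \<bar>t\<bar> \<le> \<tau> \<Longrightarrow>
     \<bar>(1 + t) powr (-\<alpha>) - (1 - \<alpha> * t + \<alpha> * (\<alpha> + 1) / 2 * t\<^sup>2)\<bar> \<le> \<omega> * t\<^sup>2"
    using powr_taylor[OF \<alpha>(1) \<omega>(1)] by blast
  define S0 where "S0 = max 1 (max (4 / \<tau>\<^sup>2) ((P * 2 + ?d * (\<alpha> * (\<alpha> + 1) / 2 + \<omega>)) / (P - ?d * \<alpha>)))"
  have "radial \<alpha> 1 x \<le> avg (radial \<alpha> 1) x" if x: "S0 \<le> sq x" for x :: "int^'d"
  proof -
    define s where "s = sq x + 1 + 1"
    have s: "4 / \<tau>\<^sup>2 \<le> s" "1 \<le> s" using x by (auto simp: s_def S0_def)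
    note R = avg_radial[OF \<tau> taylor s_def s(1)]
    have "(P * 2 + ?d * (\<alpha> * (\<alpha> + 1) / 2 + \<omega>)) / (P - ?d * \<alpha>) \<le> s" using x by (auto simp: s_def S0_def)
    then have "P * 2 + ?d * (\<alpha> * (\<alpha> + 1) / 2 + \<omega>) \<le> s * (P - ?d * \<alpha>)"
      using P by (simp add: divide_le_eq)
    then have "?d * \<alpha> * s + ?d * (\<alpha> * (\<alpha> + 1) / 2 + \<omega>) \<le> P * sq x"
      by (simp add: s_def algebra_simps)
    then have "(?d * \<alpha> * s + ?d * (\<alpha> * (\<alpha> + 1) / 2 + \<omega>)) / (?d * s\<^sup>2) \<le> P * sq x / (?d * s\<^sup>2)"
      by (rule divide_right_mono) simp
    also have "P * sq x / (?d * s\<^sup>2) = \<alpha> * (\<alpha> + 1) * (2 * sq x / (?d * s\<^sup>2)) - \<omega> * (4 * sq x / (?d * s\<^sup>2))"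
      by (simp add: P_def algebra_simps diff_divide_distrib)
    also have "(?d * \<alpha> * s + ?d * (\<alpha> * (\<alpha> + 1) / 2 + \<omega>)) / (?d * s\<^sup>2) = \<alpha> / s + \<alpha> * (\<alpha> + 1) / 2 / s\<^sup>2 + \<omega> / s\<^sup>2"
      using s by (simp add: add_divide_distrib power2_eq_square)
    finally have "s powr (-\<alpha>) * (1 + \<alpha> / s + \<alpha> * (\<alpha> + 1) / 2 / s\<^sup>2 + \<omega> / s\<^sup>2)
       \<le> s powr (-\<alpha>) * (1 + \<alpha> * (\<alpha> + 1) * (2 * sq x / (?d * s\<^sup>2)) - \<omega> * (4 * sq x / (?d * s\<^sup>2)))"
      by (intro mult_left_mono) auto
    with R show ?thesis unfolding abs_le_iff by (simp add: distrib_left right_diff_distrib)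
  qed
  then show ?thesis by (intro exI[of _ S0]) (auto simp: S0_def)
qed

section \<open>Averages of quadratics and the gradient estimate by reflection\<close>

lemma avg_sq: "avg sq (x :: int^'d::finite) = sq x + 1"
  unfolding avg_def sum_nbrs by (simp add: sq_step sum.distrib field_simps)

lemma sum_axis_nth: "(\<Sum>j\<in>(UNIV :: 'd::finite set). g (axis j (s :: int) $ i)) = g s + (real CARD('d) - 1) * (g 0 :: real)"
  by (subst sum.remove[of _ i]) (auto simp: axis_def of_nat_diff)

lemma avg_coord: "avg (\<lambda>z. real_of_int (z $ i)) (x :: int^'d::finite) = real_of_int (x $ i)"
proof -
  have "(\<Sum>j\<in>(UNIV :: 'd set). real_of_int ((x + axis j 1) $ i) + real_of_int ((x + axis j (-1)) $ i))
    = 2 * real CARD('d) * real_of_int (x $ i)"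
    using sum_axis_nth[of real_of_int 1 i] sum_axis_nth[of real_of_int "-1" i] by (simp add: sum.distrib)
  then show ?thesis unfolding avg_def sum_nbrs by simp
qed

lemma avg_coord_sq: "avg (\<lambda>z. (real_of_int (z $ i))\<^sup>2) (x :: int^'d::finite) = (real_of_int (x $ i))\<^sup>2 + 1 / real CARD('d)"
proof -
  have "(\<Sum>j\<in>(UNIV :: 'd set). (real_of_int ((x + axis j 1) $ i))\<^sup>2 + (real_of_int ((x + axis j (-1)) $ i))\<^sup>2)
    = 2 * real CARD('d) * (real_of_int (x $ i))\<^sup>2 + 2"
    using sum_axis_nth[of "\<lambda>t. (real_of_int (x $ i + t))\<^sup>2" 1 i] sum_axis_nth[of "\<lambda>t. (real_of_int (x $ i + t))\<^sup>2" "-1" i]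
    by (simp add: sum.distrib power2_eq_square algebra_simps)
  then show ?thesis unfolding avg_def sum_nbrs by (simp add: field_simps)
qed

text \<open>Reflection in the hyperplane at the half-integer height \<open>c $ i + 1/2\<close>: it
  exchanges \<open>c\<close> and \<open>c + axis i 1\<close> and fixes no lattice point.\<close>

definition refl_coord :: "int^'d \<Rightarrow> 'd \<Rightarrow> int^'d \<Rightarrow> int^'d" where
  "refl_coord c i z = (\<chi> j. if j = i then 2 * c $ i + 1 - z $ i else z $ j)"

lemma avg_refl: "avg (\<lambda>z. u (refl_coord c i z)) (x :: int^'d::finite) = avg u (refl_coord c i x)"
proof -
  have r: "refl_coord c i (x + axis j s) = refl_coord c i x + axis j (if j = i then - s else s)" for j s
    by (auto simp: refl_coord_def vec_eq_iff axis_def)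
  show ?thesis unfolding avg_def sum_nbrs r by (auto intro!: sum.cong arg_cong2[where f="(/)"] simp: if_distrib)
qed

text \<open>The difference of \<open>u\<close> and its mirror image in the hyperplane between \<open>c\<close> and \<open>c + axis i 1\<close> is
  odd, and on one side it is dominated by a quadratic superharmonic barrier that vanishes to first order at the mirror.\<close>
lemma harmonic_gradient_one_sided:
  fixes c :: "int^'d::finite"
  assumes m: "1 \<le> m" and harm: "\<And>z. z \<in> supbox c m \<Longrightarrow> avg u z = u z"
    and u: "\<And>z. z \<in> supbox c (m + 1) \<Longrightarrow> 0 \<le> u z" "\<And>z. z \<in> supbox c (m + 1) \<Longrightarrow> u z \<le> S"
  shows "u (c + axis i 1) - u c \<le> 2 * real CARD('d) * S / real_of_int (m + 1)"
proof -
  let ?d = "real CARD('d)"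
  define M where "M = real_of_int (m + 1)"
  have M: "2 \<le> M" using m by (simp add: M_def)
  have "0 \<le> S" using u[of c] m by (auto simp: supbox_def intro: order_trans)
  \<comment> \<open>Normalised so that \<open>K * M\<^sup>2 = S\<close>, an upper bound for the
    reflected difference on the outer faces.\<close>
  define K where "K = S / M\<^sup>2"
  have K: "0 \<le> K" using \<open>0 \<le> S\<close> by (simp add: K_def)
  define t where "t z = real_of_int ((z - c) $ i)" for z :: "int^'d"
  define Q where "Q z = sq (z - c) - (t z)\<^sup>2" for z
  \<comment> \<open>The concave term lowers the average by \<open>K\<close> and \<open>Q\<close>
    raises it by \<open>K * (1 - 1/d)\<close>, so \<open>w\<close> has drift \<open>- K / d\<close>.
    Where \<open>Q\<close> vanishes, \<open>w\<close> is of first order in the distance to the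
    mirror.\<close>
  define w where "w z = K * (?d * (t z * (2 * M - t z)) + Q z)" for z
  have Q: "0 \<le> Q z" for z using coord_le_sq[of "z - c" i] by (simp add: Q_def t_def)
  have avg_w: "avg w z \<le> w z" for z
  proof -
    let ?t = "\<lambda>z. real_of_int (z $ i)"
    have w_eq: "w = (\<lambda>z. (\<lambda>z. (2 * ?d * M * K) * ?t z - (K * ?d + K) * (?t z)\<^sup>2 + K * sq z) (z - c))"
      by (auto simp: w_def Q_def t_def fun_eq_iff algebra_simps power2_eq_square)
    have "avg w z = avg (\<lambda>z. (2 * ?d * M * K) * ?t z - (K * ?d + K) * (?t z)\<^sup>2 + K * sq z) (z - c)"
      unfolding w_eq by (rule avg_shift)
    also have "\<dots> = (2 * ?d * M * K) * ?t (z - c) - (K * ?d + K) * ((?t (z - c))\<^sup>2 + 1 / ?d) + K * (sq (z - c) + 1)"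
      by (simp only: avg_add avg_diff avg_cmult avg_coord avg_coord_sq avg_sq)
    also have "\<dots> = w z - K / ?d"
      by (simp add: w_def Q_def t_def field_simps power2_eq_square)
    finally show ?thesis using K by simp
  qed
  define v where "v z = u z - u (refl_coord c i z)" for z
  \<comment> \<open>The minimum principle is run on the side \<open>1 \<le> t z\<close> only; the
    value zero beyond the mirror stands in for the odd extension.\<close>
  define D where "D z = (if 1 \<le> t z then w z - v z else 0)" for z
  define W where "W = {z \<in> supbox c m. 1 \<le> t z}"
  have t_int: "t z < 1 \<longleftrightarrow> (z - c) $ i \<le> 0" for z unfolding t_def by (simp add: not_le[symmetric]) linarith
  have box_refl: "refl_coord c i z \<in> supbox c (m + 1)" if "z \<in> supbox c (m + 1)" "1 \<le> t z" for z
    unfolding supbox_def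
  proof (intro CollectI allI)
    fix j
    have "\<bar>z $ j - c $ j\<bar> \<le> m + 1" using that by (simp add: supbox_def)
    moreover have "1 \<le> z $ i - c $ i" using that(2) by (simp add: t_def)
    ultimately show "\<bar>refl_coord c i z $ j - c $ j\<bar> \<le> m + 1" by (auto simp: refl_coord_def)
  qed
  have box_refl_m: "refl_coord c i z \<in> supbox c m" if "z \<in> supbox c m" "1 \<le> t z" for z
    unfolding supbox_def
  proof (intro CollectI allI)
    fix j
    have "\<bar>z $ j - c $ j\<bar> \<le> m" using that by (simp add: supbox_def)
    moreover have "1 \<le> z $ i - c $ i" using that(2) by (simp add: t_def)
    ultimately show "\<bar>refl_coord c i z $ j - c $ j\<bar> \<le> m" by (auto simp: refl_coord_def)
  qed
  have avg_v: "avg v z = v z" if "z \<in> W" for z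
    using that box_refl_m[of z] by (simp add: v_def[abs_def] avg_diff avg_refl harm W_def)
  have w_nonneg: "0 \<le> w z" if "z \<in> supbox c (m + 1)" "0 \<le> t z" for z
  proof -
    have "\<bar>z $ i - c $ i\<bar> \<le> m + 1" using that by (simp add: supbox_def)
    then have "t z \<le> M" by (simp add: t_def M_def)
    then show ?thesis unfolding w_def using K Q that M by (intro mult_nonneg_nonneg add_nonneg_nonneg) auto
  qed
  have "0 \<le> D (c + axis i 1)"
  proof (rule srw_min_principle[of W])
    show "finite W" by (simp add: W_def)
    show "c + axis i 1 \<in> W" using m by (auto simp: W_def supbox_def axis_def t_def)
  next
    fix z y assume z: "z \<in> W" and y: "y \<notin> W" and n: "nbr z y"
    show "0 \<le> D y"
    proof (cases "1 \<le> t y")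
      case True
      then have "y \<notin> supbox c m" using y by (simp add: W_def)
      have yb: "y \<in> supbox c (m + 1)" using z n supbox_nbr by (auto simp: W_def)
      obtain j where j: "\<not> \<bar>y $ j - c $ j\<bar> \<le> m" using \<open>y \<notin> supbox c m\<close> by (auto simp: supbox_def)
      have "\<bar>y $ j - c $ j\<bar> \<le> m + 1" using yb by (simp add: supbox_def)
      then have j': "\<bar>y $ j - c $ j\<bar> = m + 1" using j by linarith
      have tM: "t y \<le> M"
      proof -
        have "\<bar>y $ i - c $ i\<bar> \<le> m + 1" using yb by (simp add: supbox_def)
        then show ?thesis by (simp add: t_def M_def)
      qed
      \<comment> \<open>On an outer face either \<open>t y = M\<close>, where the concave term alone
        equals \<open>d * M\<^sup>2\<close>, or another coordinate has modulus \<open>M\<close> and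
        makes \<open>Q y\<close> at least \<open>M\<^sup>2\<close>.\<close>
      have "M\<^sup>2 \<le> ?d * (t y * (2 * M - t y)) + Q y"
      proof (cases "j = i")
        case True
        have "1 \<le> y $ i - c $ i" using \<open>1 \<le> t y\<close> by (simp add: t_def)
        then have "y $ i - c $ i = m + 1" using j' True by simp
        then have "t y = M" by (simp add: t_def M_def)
        moreover have "1 \<le> ?d" by simp
        then have "1 * M\<^sup>2 \<le> ?d * M\<^sup>2" by (intro mult_right_mono) auto
        ultimately show ?thesis using Q[of y] by (simp add: power2_eq_square)
      next
        case False
        have "(real_of_int (y $ j - c $ j))\<^sup>2 = M\<^sup>2"
        proof -
          have "(real_of_int (y $ j - c $ j))\<^sup>2 = (real_of_int \<bar>y $ j - c $ j\<bar>)\<^sup>2" by simp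
          then show ?thesis unfolding j' M_def .
        qed
        moreover have "(t y)\<^sup>2 + (real_of_int ((y - c) $ j))\<^sup>2 \<le> sq (y - c)"
          unfolding sq_def t_def using False
          sum_mono2[of UNIV "{i, j}" "\<lambda>k. (real_of_int ((y - c) $ k))\<^sup>2"] by simp
        ultimately have "M\<^sup>2 \<le> Q y" by (simp add: Q_def)
        moreover have "0 \<le> ?d * (t y * (2 * M - t y))" using True tM M by (intro mult_nonneg_nonneg) auto
        ultimately show ?thesis by simp
      qed
      then have "K * M\<^sup>2 \<le> w y" unfolding w_def using K by (intro mult_left_mono)
      then have "S \<le> w y" using M by (simp add: K_def)
      moreover have "v y \<le> S" using u(2)[OF yb] u(1)[OF box_refl[OF yb True]] by (simp add: v_def)
      ultimately show ?thesis by (simp add: D_def)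
    qed (simp add: D_def)
  next
    fix z assume z: "z \<in> W" and neg: "D z < 0"
    have zb: "z \<in> supbox c (m + 1)" using z supbox_mono[of m "m + 1" c] by (auto simp: W_def)
    have Dz: "D z = w z - v z" using z by (simp add: D_def W_def)
    let ?e = "z + axis i (-1)"
    have other: "1 \<le> t y" if "y \<in> nbrs z" "y \<noteq> ?e" for y
    proof -
      have "(y - c) $ i \<ge> (z - c) $ i" using that by (auto simp: mem_nbrs nbr_iff axis_def split: if_splits)
      moreover have "1 \<le> (z - c) $ i" using z by (simp add: W_def t_def)
      ultimately show ?thesis by (simp add: t_def)
    qed
    show "avg D z \<le> D z"
    proof (cases "1 \<le> t ?e")
      case True
      have "avg D z = avg (\<lambda>y. w y - v y) z"
        by (rule avg_cong) (use True other in \<open>auto simp: D_def\<close>)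
      also have "\<dots> = avg w z - v z" by (simp add: avg_diff avg_v[OF z])
      also have "\<dots> \<le> D z" using avg_w[of z] Dz by simp
      finally show ?thesis .
    next
      case False
      \<comment> \<open>Next to the mirror the neighbour \<open>?e\<close> is the image of
        \<open>z\<close>, so \<open>v ?e = - v z\<close>. Counting it as zero is admissible:
        \<open>D z < 0\<close> together with \<open>0 \<le> w z\<close> forces
        \<open>v z > 0\<close>.\<close>
      then have tz: "(z - c) $ i = 1" using z by (auto simp: W_def t_def axis_def)
      have eN: "?e \<in> nbrs z" by (auto simp: mem_nbrs nbr_iff)
      have re: "refl_coord c i ?e = z" "refl_coord c i z = ?e"
        using tz by (auto simp: refl_coord_def vec_eq_iff axis_def)
      have "v ?e = - v z" by (simp add: v_def re)
      have "0 \<le> w ?e" using zb eN tz m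
        by (intro w_nonneg) (auto simp: t_def axis_def supbox_def)
      have "0 \<le> w z" using z zb by (intro w_nonneg) (auto simp: W_def)
      have "(\<Sum>y\<in>nbrs z. D y) = (\<Sum>y\<in>nbrs z - {?e}. w y - v y)"
        using eN False other by (subst sum.remove[of _ ?e]) (auto simp: D_def intro!: sum.cong)
      also have "\<dots> = (\<Sum>y\<in>nbrs z. w y - v y) - (w ?e - v ?e)"
        using eN by (subst sum.remove[of "nbrs z" ?e]) auto
      also have "\<dots> = 2 * ?d * avg w z - 2 * ?d * avg v z - w ?e + v ?e"
        by (simp add: avg_def sum_subtractf)
      also have "\<dots> \<le> 2 * ?d * w z - 2 * ?d * v z - v z"
      proof -
        have "2 * ?d * avg w z \<le> 2 * ?d * w z" using avg_w[of z] by (intro mult_left_mono) auto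
        then show ?thesis unfolding avg_v[OF z] \<open>v ?e = - v z\<close> using \<open>0 \<le> w ?e\<close> by linarith
      qed
      also have "\<dots> \<le> 2 * ?d * D z"
        using neg Dz \<open>0 \<le> w z\<close> by (simp add: right_diff_distrib)
      finally show ?thesis by (simp add: avg_def divide_le_eq mult.commute)
    qed
  qed
  moreover have "t (c + axis i 1) = 1" by (simp add: t_def)
  moreover have "Q (c + axis i 1) = 0"
    using sq_step[of "0 :: int^'d" i 1] by (simp add: Q_def t_def sq_def)
  moreover have "refl_coord c i (c + axis i 1) = c" by (auto simp: refl_coord_def vec_eq_iff axis_def)
  ultimately have "u (c + axis i 1) - u c \<le> K * (?d * (2 * M - 1))"
    by (simp add: D_def v_def w_def)
  also have "\<dots> \<le> K * (?d * (2 * M))" using K by (intro mult_left_mono) auto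
  also have "\<dots> = 2 * ?d * S / M" using M by (simp add: K_def power2_eq_square field_simps)
  finally show ?thesis by (simp add: M_def)
qed

text \<open>The other sign is the one-sided estimate applied to \<open>S - u\<close>.\<close>

lemma harmonic_gradient:
  fixes c :: "int^'d::finite"
  assumes m: "1 \<le> m" and harm: "\<And>z. z \<in> supbox c m \<Longrightarrow> avg u z = u z"
    and u: "\<And>z. z \<in> supbox c (m + 1) \<Longrightarrow> 0 \<le> u z" "\<And>z. z \<in> supbox c (m + 1) \<Longrightarrow> u z \<le> S"
  shows "\<bar>u (c + axis i 1) - u c\<bar> \<le> 2 * real CARD('d) * S / real_of_int (m + 1)"
proof -
  have "(S - u (c + axis i 1)) - (S - u c) \<le> 2 * real CARD('d) * S / real_of_int (m + 1)"
    by (rule harmonic_gradient_one_sided[OF m, of c "\<lambda>z. S - u z"]) (use harm u in \<open>auto simp: avg_diff\<close>)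
  with harmonic_gradient_one_sided[OF m harm u, where i=i] show ?thesis by (simp add: abs_le_iff)
qed

section \<open>Equilibrium measure and entrance distribution of the simple random walk\<close>

definition hit :: "(int^'d::finite) set \<Rightarrow> int^'d \<Rightarrow> real" where
  "hit A z = srw.hr (- A) (\<lambda>_. 1) z"

lemma hit_nonneg [simp]: "0 \<le> hit A z" by (simp add: hit_def)

lemma hit_on: "z \<in> A \<Longrightarrow> hit A z = 1"
  by (simp add: hit_def srw.hr_off)

lemma hit_harmonic: "z \<notin> A \<Longrightarrow> avg (hit A) z = hit A z"
  unfolding hit_def by (subst srw.hr_rec[of "\<lambda>_. 1" 1]) (auto simp: srwP_sum hit_def[abs_def])

lemma hit_le_super:
  assumes "\<And>z. 0 \<le> F z" "\<And>z. avg F z \<le> F z" "\<And>z. z \<in> A \<Longrightarrow> 1 \<le> F z"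
  shows "hit A z \<le> F z"
  unfolding hit_def using assms by (intro srw.hr_le) (auto simp: srwP_sum)

lemma hit_le_1: "hit A z \<le> 1"
  by (rule hit_le_super[where F="\<lambda>_. 1"]) auto

lemma infsum_eq_enn2real:
  fixes f :: "'a \<Rightarrow> real"
  assumes nn: "\<And>x. x \<in> S \<Longrightarrow> 0 \<le> f x" and eq: "(\<integral>\<^sup>+x. ennreal (f x) \<partial>count_space S) = ennreal c" and c: "0 \<le> c"
  shows "infsum f S = c"
proof -
  have int: "integrable (count_space S) f"
  proof (rule integrableI_bounded)
    have "(\<integral>\<^sup>+x. ennreal (norm (f x)) \<partial>count_space S) = (\<integral>\<^sup>+x. ennreal (f x) \<partial>count_space S)"
      by (rule nn_integral_cong) (use nn in auto)
    then show "(\<integral>\<^sup>+x. ennreal (norm (f x)) \<partial>count_space S) < \<infinity>" using eq by simp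
  qed simp
  then have ab: "Infinite_Set_Sum.abs_summable_on f S" by (simp add: Infinite_Set_Sum.abs_summable_on_def)
  have "ennreal (infsetsum f S) = ennreal c"
    using nn_integral_conv_infsetsum[OF ab nn] eq by simp
  moreover have "0 \<le> infsetsum f S" using nn by (rule infsetsum_nonneg)
  ultimately have "infsetsum f S = c" using c by simp
  then show ?thesis using infsetsum_infsum[OF ab] by simp
qed

text \<open>First-step decomposition: after the initial vertex the admissible lists are exactly the
  paths that stay off \<open>K\<close> until their last vertex, so the remaining sum is an exit
  sum.\<close>

lemma retp_eq:
  fixes x :: "int^'d::finite"
  shows "retp K x = avg (hit K) x"
proof -
  let ?S = "{ys. 2 \<le> length ys \<and> hd ys = x \<and> last ys \<in> K \<and> (\<forall>i. 0 < i \<and> i < length ys - 1 \<longrightarrow> ys ! i \<notin> K)}"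
  let ?f = "pw (\<lambda>y. if y = x then 1 else 0) srwP"
  let ?g = "\<lambda>ys. ennreal (?f ys) * indicator ?S ys"
  have nn: "0 \<le> ?f ys" for ys
  proof (cases ys)
    case (Cons y zs)
    then show ?thesis by (simp add: pw_Cons pathw_nonneg srw.K_nonneg)
  qed (simp add: pw_def)
  have mem: "x' # w # zs \<in> ?S \<longleftrightarrow> x' = x \<and> exits (- K) w zs" for x' w zs
  proof -
    have "(\<forall>i. 0 < i \<and> i < length (x' # w # zs) - 1 \<longrightarrow> (x' # w # zs) ! i \<notin> K) \<longleftrightarrow> (\<forall>i<length zs. (w # zs) ! i \<notin> K)"
      by (auto simp: less_Suc_eq_0_disj nth_Cons split: nat.splits)
    also have "\<dots> \<longleftrightarrow> set (butlast (w # zs)) \<subseteq> - K"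
      by (auto simp: set_conv_nth nth_butlast simp del: butlast.simps)
    finally show ?thesis by (auto simp: exits_iff)
  qed
  have "(\<integral>\<^sup>+ys. ennreal (?f ys) \<partial>count_space ?S) = lsum ?g"
    unfolding lsum_def by (rule nn_integral_count_space_indicator) simp
  also have "\<dots> = esum (\<lambda>x'. lsum (\<lambda>ys. ?g (x' # ys)))" by (subst lsum_Cons) simp
  also have "\<dots> = (\<Sum>x'\<in>{x}. lsum (\<lambda>ys. ?g (x' # ys)))"
    by (rule esum_finite) (auto simp: indicator_def lsum_def)
  also have "\<dots> = lsum (\<lambda>ys. ?g (x # ys))" by simp
  also have "\<dots> = esum (\<lambda>w. lsum (\<lambda>zs. ?g (x # w # zs)))" by (subst lsum_Cons) simp
  also have "\<dots> = esum (\<lambda>w. ennreal (srwP x w) * hs srwP (- K) (\<lambda>_. 1) w)"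
  proof (rule arg_cong[where f=esum], rule ext)
    fix w
    have "(\<lambda>zs. ?g (x # w # zs)) = (\<lambda>zs. ennreal (srwP x w) * (if exits (- K) w zs then ennreal (pathw srwP w zs * 1) else 0))"
    proof
      fix zs
      show "?g (x # w # zs) = ennreal (srwP x w) * (if exits (- K) w zs then ennreal (pathw srwP w zs * 1) else 0)"
        using mem[of x w zs] by (simp add: indicator_def pw_Cons ennreal_mult srw.K_nonneg pathw_nonneg)
    qed
    then show "lsum (\<lambda>zs. ?g (x # w # zs)) = ennreal (srwP x w) * hs srwP (- K) (\<lambda>_. 1) w"
      by (simp only: lsum_cmult hs_def)
  qed
  also have "\<dots> = (\<Sum>w\<in>nbrs x. ennreal (srwP x w) * hs srwP (- K) (\<lambda>_. 1) w)"
    by (rule esum_finite) (auto simp: srwP_def mem_nbrs)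
  also have "\<dots> = (\<Sum>w\<in>nbrs x. ennreal (srwP x w * hit K w))"
    by (simp add: srw.hs_eq_hr[of _ 1] hit_def ennreal_mult srw.K_nonneg)
  also have "\<dots> = ennreal (avg (hit K) x)"
    by (subst sum_ennreal) (auto simp: srw.K_nonneg srwP_sum)
  finally have "(\<integral>\<^sup>+ys. ennreal (?f ys) \<partial>count_space ?S) = ennreal (avg (hit K) x)" .
  from infsum_eq_enn2real[OF nn this] show ?thesis
    unfolding retp_def by (simp add: avg_nonneg)
qed

definition esc :: "(int^'d::finite) set \<Rightarrow> int^'d \<Rightarrow> real" where
  "esc A z = 1 - hit A z"

lemma esc_bounds: "0 \<le> esc A z" "esc A z \<le> 1" using hit_le_1[of A z] by (auto simp: esc_def)

lemma esc_on: "z \<in> A \<Longrightarrow> esc A z = 0" by (simp add: esc_def hit_on)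

lemma esc_harmonic: "z \<notin> A \<Longrightarrow> avg (esc A) z = esc A z"
  by (simp add: esc_def[abs_def] avg_diff hit_harmonic)

lemma eqm_eq: "x \<in> A \<Longrightarrow> eqm A x = avg (esc A) x"
  by (simp add: eqm_def retp_eq esc_def[abs_def] avg_diff)

lemma eqm_nonneg: "0 \<le> eqm A x"
proof (cases "x \<in> A")
  case True
  then show ?thesis unfolding eqm_eq[OF True] by (intro avg_nonneg) (simp add: esc_bounds)
qed (simp add: eqm_def)

lemma eqm_le_1: "eqm A x \<le> 1"
proof (cases "x \<in> A")
  case True
  then have "eqm A x \<le> avg (\<lambda>_. 1) x" unfolding eqm_eq[OF True] by (intro avg_mono) (simp add: esc_bounds)
  then show ?thesis by simp
qed (simp add: eqm_def)

lemma eqm_interior: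
  assumes "x \<in> A" "nbrs x \<subseteq> A" shows "eqm A x = 0"
proof -
  have "avg (esc A) x = avg (\<lambda>_. 0) x" by (rule avg_cong) (use assms esc_on in auto)
  then show ?thesis using assms by (simp add: eqm_eq)
qed

text \<open>One step across the face, followed by a gambler's-ruin estimate: a linear function that
  is nonpositive up to the face and at most \<open>1/2\<close> on reaching the outside of the larger
  box lies below the escape probability.\<close>

lemma eqm_boundary_lower:
  fixes x0 :: "int^'d::finite"
  assumes l: "0 \<le> l1" "l1 < l" and far: "\<And>z. z \<notin> supbox x0 l \<Longrightarrow> 1 / 2 \<le> esc (supbox x0 l1) z"
    and x: "x \<in> supbox x0 l1" and w: "nbr x w" "w \<notin> supbox x0 l1"
  shows "1 / (4 * real CARD('d) * real_of_int (l + 1)) \<le> eqm (supbox x0 l1) x"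
proof -
  let ?A = "supbox x0 l1"
  obtain i s where ist: "w = x + axis i s" "s = 1 \<or> s = -1" using w(1) by (auto simp: nbr_iff)
  obtain j where j: "\<not> \<bar>w $ j - x0 $ j\<bar> \<le> l1" using w(2) by (auto simp: supbox_def)
  have xb: "\<bar>x $ k - x0 $ k\<bar> \<le> l1" for k using x by (simp add: supbox_def)
  have "j = i" using j xb[of j] ist by (auto simp: axis_def split: if_splits)
  then have wi: "s * (w $ i - x0 $ i) = l1 + 1" using j xb[of i] ist by (auto simp: axis_def)
  define \<beta> where "\<beta> z = (of_int s * real_of_int ((z - x0) $ i) - of_int l1) / (2 * real_of_int (l + 1))" for z :: "int^'d"
  have avg_\<beta>: "avg \<beta> z = \<beta> z" for z
  proof -
    let ?c = "1 / (2 * real_of_int (l + 1))"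
    have "\<beta> = (\<lambda>z. (\<lambda>z. (?c * of_int s) * real_of_int (z $ i) - ?c * of_int l1) (z - x0))"
      by (auto simp: \<beta>_def fun_eq_iff diff_divide_distrib)
    then have "avg \<beta> z = avg (\<lambda>z. (?c * of_int s) * real_of_int (z $ i) - ?c * of_int l1) (z - x0)"
      by (simp only: avg_shift[of "\<lambda>z. (?c * of_int s) * real_of_int (z $ i) - ?c * of_int l1"])
    also have "\<dots> = \<beta> z" by (simp only: avg_diff avg_cmult avg_coord avg_const) (simp add: \<beta>_def diff_divide_distrib)
    finally show ?thesis .
  qed
  define W where "W = {z \<in> supbox x0 l. l1 + 1 \<le> s * (z $ i - x0 $ i)}"
  have offA: "z \<notin> ?A" if "z \<in> W" for z
  proof
    assume "z \<in> ?A"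
    then have "\<bar>z $ i - x0 $ i\<bar> \<le> l1" by (simp add: supbox_def)
    then show False using that ist(2) by (auto simp: W_def)
  qed
  have "\<beta> w \<le> esc ?A w"
  proof (rule srw_comparison[of W])
    show "w \<in> W" using wi x w(1) l supbox_nbr[of x x0 l1 w] supbox_mono[of "l1 + 1" l x0] by (auto simp: W_def)
  next
    fix y assume y: "y \<notin> W" and "\<exists>z\<in>W. nbr z y"
    then obtain z where z: "z \<in> W" "nbr z y" by auto
    show "\<beta> y \<le> esc ?A y"
    proof (cases "y \<in> supbox x0 l")
      case True
      then have "s * (y $ i - x0 $ i) \<le> l1" using y by (simp add: W_def)
      then have "real_of_int (s * (y $ i - x0 $ i)) \<le> real_of_int l1" by linarith
      then have "\<beta> y \<le> 0" using l by (simp add: \<beta>_def divide_le_0_iff)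
      then show ?thesis using esc_bounds(1)[of ?A y] by linarith
    next
      case False
      have "\<bar>y $ i - x0 $ i\<bar> \<le> l + 1" using z supbox_nbr[of z x0 l y] by (auto simp: W_def supbox_def)
      then have "s * (y $ i - x0 $ i) - l1 \<le> l + 1" using ist(2) l by auto
      then have "real_of_int (s * (y $ i - x0 $ i) - l1) \<le> real_of_int (l + 1)" by linarith
      then have "\<beta> y \<le> 1 / 2" using l by (simp add: \<beta>_def divide_le_eq)
      then show ?thesis using far[OF False] by linarith
    qed
  qed (auto simp: avg_\<beta> esc_harmonic offA W_def)
  moreover have "\<beta> w = 1 / (2 * real_of_int (l + 1))"
  proof -
    have "real_of_int (s * (w $ i - x0 $ i)) = real_of_int l1 + 1" unfolding wi by simp
    then show ?thesis by (simp add: \<beta>_def)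
  qed
  ultimately have "1 / (2 * real_of_int (l + 1)) / (2 * real CARD('d)) \<le> esc ?A w / (2 * real CARD('d))"
    by (intro divide_right_mono) auto
  also have "\<dots> \<le> avg (esc ?A) x" by (rule avg_ge_nbr) (use w(1) in \<open>auto simp: esc_bounds mem_nbrs\<close>)
  finally show ?thesis unfolding eqm_eq[OF x] by (simp add: algebra_simps)
qed

text \<open>Summation by parts: finite support removes boundary terms and \<open>srwP\<close> is
  symmetric.\<close>

lemma green_identity:
  fixes u v :: "int^'d::finite \<Rightarrow> real"
  assumes A: "finite A" and "\<And>z. z \<notin> A \<Longrightarrow> u z = 0" and "\<And>z. z \<notin> A \<Longrightarrow> v z = 0"
  shows "(\<Sum>z\<in>A. u z * avg v z) = (\<Sum>z\<in>A. v z * avg u z)"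
proof -
  have e: "avg w z = (\<Sum>y\<in>A. srwP z y * w y)" if "\<And>z. z \<notin> A \<Longrightarrow> w z = 0" for w z
  proof -
    have "avg w z = (\<Sum>y\<in>nbrs z. srwP z y * w y)" by (simp add: srwP_sum)
    also have "\<dots> = (\<Sum>y\<in>nbrs z \<inter> A. srwP z y * w y)"
      by (rule sum.mono_neutral_right) (auto simp: that)
    also have "\<dots> = (\<Sum>y\<in>A. srwP z y * w y)"
      by (rule sum.mono_neutral_left) (auto simp: A srwP_def mem_nbrs)
    finally show ?thesis .
  qed
  have "(\<Sum>z\<in>A. u z * avg v z) = (\<Sum>z\<in>A. \<Sum>y\<in>A. u z * (srwP z y * v y))"
    by (simp add: e assms sum_distrib_left)
  also have "\<dots> = (\<Sum>y\<in>A. \<Sum>z\<in>A. u z * (srwP z y * v y))" by (rule sum.swap)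
  also have "\<dots> = (\<Sum>y\<in>A. v y * avg u y)"
    by (simp add: e assms sum_distrib_left) (auto intro!: sum.cong simp: srwP_def nbr_sym)
  finally show ?thesis .
qed

section \<open>Entrance distribution by Green's identity\<close>

text \<open>\<open>srw_hit A1 A2 x y\<close> is the probability that the walk from \<open>y\<close> enters \<open>A1\<close> before leaving \<open>A2\<close>, and does so at \<open>x\<close>.\<close>
definition srw_hit :: "(int^'d::finite) set \<Rightarrow> (int^'d) set \<Rightarrow> int^'d \<Rightarrow> int^'d \<Rightarrow> real" where
  "srw_hit A1 A2 x y = srw.hr (A2 - A1) (\<lambda>w. if w = x then 1 else 0) y"

text \<open>Probability to visit \<open>y\<close> before leaving \<open>A2\<close>: the Green function with pole \<open>y\<close>, up to normalization.\<close>
definition visit :: "(int^'d::finite) set \<Rightarrow> int^'d \<Rightarrow> int^'d \<Rightarrow> real" where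
  "visit A2 y = srw.hr (A2 - {y}) (\<lambda>w. if w = y then 1 else 0)"

lemma visit_pole: "visit A2 y y = 1" by (simp add: visit_def srw.hr_off)
lemma visit_off: "z \<notin> A2 \<Longrightarrow> z \<noteq> y \<Longrightarrow> visit A2 y z = 0" by (simp add: visit_def srw.hr_off)
lemma visit_nonneg [simp]: "0 \<le> visit A2 y z" by (simp add: visit_def)
lemma visit_harmonic: "z \<in> A2 \<Longrightarrow> z \<noteq> y \<Longrightarrow> avg (visit A2 y) z = visit A2 y z"
  unfolding visit_def by (subst srw.hr_rec[of _ 1]) (auto simp: srwP_sum visit_def[abs_def])
lemma visit_le_super:
  assumes "\<And>z. 0 \<le> F z" "\<And>z. avg F z \<le> F z" "1 \<le> F y"
  shows "visit A2 y z \<le> F z"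
  unfolding visit_def using assms by (intro srw.hr_le) (auto simp: srwP_sum)
lemma visit_le_1: "visit A2 y z \<le> 1"
  by (rule visit_le_super[where F="\<lambda>_. 1"]) auto

text \<open>With \<open>q\<close> the Green function of \<open>A2 - A1\<close> with pole
  \<open>y\<close> up to a factor, Green's identity against the entrance probability at
  \<open>x\<close> gives \<open>\<kappa> * srw_hit A1 A2 x y = avg q x\<close>, a discrete normal
  derivative. On the collar \<open>B - A1\<close> both \<open>q\<close> and the escape probability
  are harmonic, and both vanish on \<open>A1\<close>, so their ratio is controlled by the values
  just outside \<open>B\<close>; averaging at \<open>x\<close> turns the escape probability into
  \<open>eqm A1 x\<close>.\<close>

lemma srw_hit_eqm_bounds:
  fixes A1 A2 B :: "(int^'d::finite) set"
  assumes fin: "finite A2" and sub: "A1 \<subseteq> B" "B \<subseteq> A2" and nbrA: "\<And>x. x \<in> A1 \<Longrightarrow> nbrs x \<subseteq> B"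
    and y: "y \<in> A2" "y \<notin> B"
    and gA: "\<And>z. z \<in> A1 \<Longrightarrow> visit A2 y z \<le> gM"
    and shell: "\<And>z w. z \<notin> B \<Longrightarrow> w \<in> B \<Longrightarrow> nbr w z \<Longrightarrow> gm \<le> visit A2 y z \<and> visit A2 y z \<le> gM \<and> hit A1 z \<le> h"
    and pos: "0 < gm - gM * h" "h < 1" "0 \<le> gM"
    and e: "\<exists>x\<in>A1. 0 < eqm A1 x"
  shows "\<exists>m\<ge>gm - gM * h. \<forall>x\<in>A1. m * eqm A1 x \<le> srw_hit A1 A2 x y \<and>
     srw_hit A1 A2 x y \<le> m * (gM / ((1 - h) * (gm - gM * h))) * eqm A1 x"
proof -
  define g where "g = visit A2 y"
  define \<kappa> where "\<kappa> = 1 - avg g y"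
  define bg where "bg w = (if w \<in> A1 then g w else 0)" for w
  \<comment> \<open>The part of \<open>g\<close> due to visits to \<open>y\<close> after entering
    \<open>A1\<close>; subtracting it removes the boundary values on \<open>A1\<close>.\<close>
  define r where "r = srw.hr (A2 - A1) bg"
  define q where "q z = g z - r z" for z
  have bg: "0 \<le> bg w" "bg w \<le> 1" for w by (auto simp: bg_def g_def visit_le_1)
  have yA: "y \<notin> A1" using y sub by auto
  have r_harm: "avg r z = r z" if "z \<in> A2 - A1" for z
    unfolding r_def using srw.hr_rec[of bg 1, OF bg that] by (simp add: srwP_sum)
  have q0: "q z = 0" if "z \<notin> A2 - A1" for z
  proof -
    have "r z = bg z" unfolding r_def using that by (intro srw.hr_off) (auto simp: bg)
    then show ?thesis using that y by (auto simp: q_def bg_def g_def intro!: visit_off)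
  qed
  have q_harm: "avg q z = q z - (if z = y then \<kappa> else 0)" if "z \<in> A2 - A1" for z
  proof (cases "z = y")
    case True
    then show ?thesis using r_harm[OF that] by (simp add: q_def[abs_def] avg_diff \<kappa>_def g_def visit_pole)
  next
    case False
    then show ?thesis using r_harm[OF that] that by (simp add: q_def[abs_def] avg_diff g_def visit_harmonic)
  qed
  have p_off: "srw_hit A1 A2 x z = (if z = x then 1 else 0)" if "z \<notin> A2 - A1" for x z
    unfolding srw_hit_def using that by (subst srw.hr_off) auto
  have p_harm: "avg (srw_hit A1 A2 x) z = srw_hit A1 A2 x z" if "z \<in> A2 - A1" for x z
    unfolding srw_hit_def[abs_def] using srw.hr_rec[of "\<lambda>w. if w = x then 1 else 0" 1 z "A2 - A1"] that by (simp add: srwP_sum)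
  have key: "\<kappa> * srw_hit A1 A2 x y = avg q x" if x: "x \<in> A1" for x
  proof -
    let ?p = "srw_hit A1 A2 x"
    have xA2: "x \<in> A2" and xy: "x \<noteq> y" using x sub yA by auto
    have p0: "?p z = 0" if "z \<notin> A2" for z using that xA2 by (subst p_off) auto
    have "(\<Sum>z\<in>A2. ?p z * (q z - avg q z)) = (\<Sum>z\<in>A2. q z * (?p z - avg ?p z))"
      using green_identity[OF fin p0 q0] by (simp add: right_diff_distrib sum_subtractf mult.commute)
    moreover have "(\<Sum>z\<in>A2. q z * (?p z - avg ?p z)) = 0"
      by (rule sum.neutral) (use q0 p_harm in force)
    moreover have "(\<Sum>z\<in>A2. ?p z * (q z - avg q z)) = (\<Sum>z\<in>{x, y}. ?p z * (q z - avg q z))"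
    proof (rule sum.mono_neutral_right[OF fin])
      show "\<forall>z\<in>A2 - {x, y}. ?p z * (q z - avg q z) = 0"
      proof
        fix z assume z: "z \<in> A2 - {x, y}"
        show "?p z * (q z - avg q z) = 0"
          using z p_off[of z x] q_harm[of z] by (cases "z \<in> A1") auto
      qed
    qed (use xA2 y in auto)
    moreover have "(\<Sum>z\<in>{x, y}. ?p z * (q z - avg q z)) = (q x - avg q x) + ?p y * \<kappa>"
    proof -
      have "q y - avg q y = \<kappa>" using y yA q_harm[of y] by simp
      then show ?thesis using x xy p_off[of x x] by simp
    qed
    ultimately show ?thesis using q0[of x] x by (simp add: mult.commute)
  qed
  let ?k = "esc A1"
  have W: "finite (B - A1)" using finite_subset[OF sub(2) fin] by simp
  have r_nonneg: "0 \<le> r z" for z by (simp add: r_def)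
  have r_le: "r z \<le> gM * hit A1 z" for z
    unfolding r_def by (rule srw.hr_le)
      (use gA pos in \<open>auto simp: bg bg_def g_def hit_on srwP_sum avg_cmult hit_harmonic\<close>)
  have h_nonneg: "0 \<le> h" if "z \<notin> B" "w \<in> B" "nbr w z" for z w
    using shell[OF that] hit_nonneg[of A1 z] by linarith
  \<comment> \<open>Just outside \<open>B\<close>, \<open>q\<close> is at least \<open>gm\<close>
    minus the return term \<open>gM * h\<close>, while the escape probability is at most
    one.\<close>
  define m0 where "m0 = gm - gM * h"
  have lower: "m0 * ?k z \<le> q z" if "z \<in> B - A1" for z
  proof (rule srw_comparison[OF W _ _ _ that, of "\<lambda>z. m0 * ?k z" q])
    fix z assume "z \<in> B - A1"
    then show "m0 * ?k z \<le> avg (\<lambda>z. m0 * ?k z) z" by (simp add: avg_cmult esc_harmonic)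
    show "avg q z \<le> q z" using q_harm[of z] \<open>z \<in> B - A1\<close> sub y by auto
  next
    fix z assume z: "z \<notin> B - A1" "\<exists>w\<in>B - A1. nbr w z"
    show "m0 * ?k z \<le> q z"
    proof (cases "z \<in> A1")
      case True
      then show ?thesis using q0[of z] by (simp add: esc_on)
    next
      case False
      then obtain w where w: "z \<notin> B" "w \<in> B" "nbr w z" using z by auto
      note s = shell[OF this]
      have "gM * hit A1 z \<le> gM * h" using s pos by (intro mult_left_mono) auto
      then have "m0 \<le> q z" using s r_le[of z] by (simp add: q_def g_def m0_def)
      moreover have "m0 * ?k z \<le> m0 * 1" using pos esc_bounds(2) by (intro mult_left_mono) (auto simp: m0_def)
      ultimately show ?thesis by simp
    qed
  qed
  \<comment> \<open>Just outside \<open>B\<close>, \<open>q\<close> is at most \<open>gM\<close>,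
    while the escape probability is at least \<open>1 - h\<close>.\<close>
  define c1 where "c1 = gM / (1 - h)"
  have upper: "q z \<le> c1 * ?k z" if "z \<in> B - A1" for z
  proof (rule srw_comparison[OF W _ _ _ that, of q "\<lambda>z. c1 * ?k z"])
    fix z assume "z \<in> B - A1"
    then show "avg (\<lambda>z. c1 * ?k z) z \<le> c1 * ?k z" by (simp add: avg_cmult esc_harmonic)
    show "q z \<le> avg q z" using q_harm[of z] \<open>z \<in> B - A1\<close> sub y by auto
  next
    fix z assume z: "z \<notin> B - A1" "\<exists>w\<in>B - A1. nbr w z"
    show "q z \<le> c1 * ?k z"
    proof (cases "z \<in> A1")
      case True
      then show ?thesis using q0[of z] by (simp add: esc_on)
    next
      case False
      then obtain w where w: "z \<notin> B" "w \<in> B" "nbr w z" using z by auto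
      note s = shell[OF this]
      have "q z \<le> gM" using s r_nonneg[of z] by (simp add: q_def g_def)
      also have "gM = c1 * (1 - h)" using pos by (simp add: c1_def)
      also have "\<dots> \<le> c1 * ?k z" using s pos by (intro mult_left_mono) (auto simp: c1_def esc_def)
      finally show ?thesis .
    qed
  qed
  have bounds: "m0 * eqm A1 x \<le> \<kappa> * srw_hit A1 A2 x y" "\<kappa> * srw_hit A1 A2 x y \<le> c1 * eqm A1 x" if x: "x \<in> A1" for x
  proof -
    have "m0 * ?k z \<le> q z \<and> q z \<le> c1 * ?k z" if "z \<in> nbrs x" for z
    proof (cases "z \<in> A1")
      case True
      then show ?thesis using q0[of z] by (simp add: esc_on)
    next
      case False
      then show ?thesis using nbrA[OF x] that lower[of z] upper[of z] by auto
    qed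
    then have "avg (\<lambda>z. m0 * ?k z) x \<le> avg q x" "avg q x \<le> avg (\<lambda>z. c1 * ?k z) x" by (auto intro!: avg_mono)
    then show "m0 * eqm A1 x \<le> \<kappa> * srw_hit A1 A2 x y" "\<kappa> * srw_hit A1 A2 x y \<le> c1 * eqm A1 x"
      by (simp_all add: avg_cmult key[OF x] eqm_eq[OF x])
  qed
  \<comment> \<open>Being at most one, \<open>\<kappa>\<close> can only increase the multiplier
    \<open>m0 / \<kappa>\<close>. It is nonzero, as otherwise the lower bound would fail at a point
    of positive equilibrium weight.\<close>
  have \<kappa>: "0 < \<kappa>" "\<kappa> \<le> 1"
  proof -
    have "0 \<le> avg g y" by (rule avg_nonneg) (simp add: g_def)
    then show "\<kappa> \<le> 1" by (simp add: \<kappa>_def)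
    have "avg g y \<le> avg (\<lambda>_. 1) y" by (rule avg_mono) (simp add: g_def visit_le_1)
    then have "0 \<le> \<kappa>" by (simp add: \<kappa>_def)
    moreover obtain x where x: "x \<in> A1" "0 < eqm A1 x" using e by auto
    have "0 < m0 * eqm A1 x" using x pos by (simp add: m0_def)
    then have "\<kappa> \<noteq> 0" using bounds(1)[OF x(1)] by auto
    ultimately show "0 < \<kappa>" by simp
  qed
  show ?thesis
  proof (intro exI[of _ "m0 / \<kappa>"] conjI ballI)
    have "m0 * 1 \<le> m0 * (1 / \<kappa>)" using pos \<kappa> by (intro mult_left_mono) (auto simp: m0_def)
    then show "gm - gM * h \<le> m0 / \<kappa>" by (simp add: m0_def)
    fix x assume x: "x \<in> A1"
    show "m0 / \<kappa> * eqm A1 x \<le> srw_hit A1 A2 x y"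
      using bounds(1)[OF x] \<kappa> by (simp add: divide_le_eq mult.commute)
    have "m0 \<noteq> 0" using pos by (simp add: m0_def)
    then have "m0 / \<kappa> * (gM / ((1 - h) * m0)) = c1 / \<kappa>" by (simp add: c1_def)
    then show "srw_hit A1 A2 x y \<le> m0 / \<kappa> * (gM / ((1 - h) * (gm - gM * h))) * eqm A1 x"
      using bounds(2)[OF x] \<kappa> unfolding m0_def[symmetric] by (simp add: le_divide_eq mult.commute)
  qed
qed

section \<open>Lower, upper and oscillation bounds for visit probabilities\<close>

definition ell1 :: "int^'d::finite \<Rightarrow> nat" where
  "ell1 z = (\<Sum>i\<in>UNIV. nat \<bar>z $ i\<bar>)"

lemma ell1_closer:
  fixes z y :: "int^'d::finite"
  assumes "z \<noteq> y"
  obtains i s where "s = 1 \<or> s = -1" "ell1 (z + axis i s - y) < ell1 (z - y)"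
    "\<And>x m. z \<in> supbox x m \<Longrightarrow> y \<in> supbox x m \<Longrightarrow> z + axis i s \<in> supbox x m"
proof -
  obtain i where i: "z $ i \<noteq> y $ i" using assms by (auto simp: vec_eq_iff)
  define s :: int where "s = (if z $ i < y $ i then 1 else -1)"
  have "ell1 (z + axis i s - y) < ell1 (z - y)"
    unfolding ell1_def
  proof (rule sum_strict_mono_ex1)
    show "\<forall>j\<in>UNIV. nat \<bar>(z + axis i s - y) $ j\<bar> \<le> nat \<bar>(z - y) $ j\<bar>"
      using i by (auto simp: axis_def s_def)
    show "\<exists>j\<in>UNIV. nat \<bar>(z + axis i s - y) $ j\<bar> < nat \<bar>(z - y) $ j\<bar>"
      using i by (intro bexI[of _ i]) (auto simp: axis_def s_def)
  qed simp
  moreover have "z + axis i s \<in> supbox x m" if "z \<in> supbox x m" "y \<in> supbox x m" for x m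
    unfolding supbox_def
  proof (intro CollectI allI)
    fix j
    have "\<bar>z $ j - x $ j\<bar> \<le> m" "\<bar>y $ j - x $ j\<bar> \<le> m" using that by (auto simp: supbox_def)
    then show "\<bar>(z + axis i s) $ j - x $ j\<bar> \<le> m" using i by (auto simp: axis_def s_def)
  qed
  moreover have "s = 1 \<or> s = -1" by (simp add: s_def)
  ultimately show ?thesis using that by blast
qed

lemma ell1_le_sq: "real (ell1 z) \<le> sq z"
proof -
  have "real (nat \<bar>a\<bar>) \<le> (real_of_int a)\<^sup>2" for a :: int
  proof -
    have "\<bar>a\<bar> * 1 \<le> \<bar>a\<bar> * \<bar>a\<bar>"
    proof (cases "a = 0")
      case False
      then show ?thesis by (intro mult_left_mono) auto
    qed simp
    then have "\<bar>a\<bar> \<le> \<bar>a\<bar> * \<bar>a\<bar>" by (simp only: mult_1_right)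
    then have "real_of_int \<bar>a\<bar> \<le> real_of_int (\<bar>a\<bar> * \<bar>a\<bar>)" by (simp only: of_int_le_iff)
    then show ?thesis by (simp add: power2_eq_square)
  qed
  then show ?thesis unfolding ell1_def sq_def of_nat_sum by (intro sum_mono) auto
qed

lemma ell1_box: 
  fixes z :: "int^'d::finite"
  assumes "z \<in> supbox x m" "0 \<le> m"
  shows "real (ell1 (z - x)) \<le> real CARD('d) * real_of_int m"
proof -
  have "real (ell1 (z - x)) \<le> (\<Sum>i\<in>(UNIV::'d set). real_of_int m)"
    unfolding ell1_def of_nat_sum
  proof (rule sum_mono)
    fix i
    have "\<bar>z $ i - x $ i\<bar> \<le> m" using assms(1) by (simp add: supbox_def)
    then show "real (nat \<bar>(z - x) $ i\<bar>) \<le> real_of_int m" by simp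
  qed
  then show ?thesis by simp
qed

lemma sq_box_le:
  fixes z :: "int^'d::finite"
  assumes "z \<in> supbox x m" "0 \<le> m"
  shows "sq (z - x) \<le> real CARD('d) * (real_of_int m)\<^sup>2"
proof -
  have "sq (z - x) \<le> (\<Sum>i\<in>(UNIV::'d set). (real_of_int m)\<^sup>2)"
    unfolding sq_def
  proof (rule sum_mono)
    fix i
    have "\<bar>z $ i - x $ i\<bar> \<le> m" using assms(1) by (simp add: supbox_def)
    then have "\<bar>real_of_int ((z - x) $ i)\<bar> \<le> \<bar>real_of_int m\<bar>" using assms(2) by simp
    then show "(real_of_int ((z - x) $ i))\<^sup>2 \<le> (real_of_int m)\<^sup>2" by (rule abs_le_square_iff[THEN iffD1])
  qed
  then show ?thesis by simp
qed

lemma sq_ge_coord: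
  assumes "m \<le> \<bar>z $ i\<bar>" "0 \<le> m"
  shows "(real_of_int m)\<^sup>2 \<le> sq z"
proof -
  have "\<bar>real_of_int m\<bar> \<le> \<bar>real_of_int (z $ i)\<bar>" using assms by simp
  then have "(real_of_int m)\<^sup>2 \<le> (real_of_int (z $ i))\<^sup>2" by (rule abs_le_square_iff[THEN iffD1])
  also have "\<dots> \<le> sq z" by (rule coord_le_sq)
  finally show ?thesis .
qed

text \<open>The walk may follow a shortest lattice path to \<open>y\<close>, which can be kept
  inside the box; each step has probability \<open>1 / (2 * d)\<close>.\<close>

lemma visit_near:
  fixes y :: "int^'d::finite"
  assumes "y \<in> supbox x0 L" "z \<in> supbox x0 L"
  shows "(1 / (2 * real CARD('d))) ^ ell1 (z - y) \<le> visit (supbox x0 L) y z"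
  using assms(2)
proof (induction "ell1 (z - y)" arbitrary: z rule: less_induct)
  case less
  show ?case
  proof (cases "z = y")
    case True
    then show ?thesis by (simp add: visit_pole ell1_def)
  next
    case False
    then obtain i s where is_s: "s = 1 \<or> s = -1" and cl: "ell1 (z + axis i s - y) < ell1 (z - y)"
      and bx: "z + axis i s \<in> supbox x0 L"
      using ell1_closer[of z y] assms(1) less.prems by metis
    let ?c = "1 / (2 * real CARD('d))" and ?z = "z + axis i s"
    have "1 \<le> 2 * real CARD('d)" using card_ge_1[where 'd='d] by linarith
    then have c: "0 < ?c" "?c \<le> 1" by auto
    have "?c ^ ell1 (z - y) \<le> ?c ^ Suc (ell1 (?z - y))" using cl c by (intro power_decreasing) auto
    also have "\<dots> \<le> ?c * visit (supbox x0 L) y ?z" using less.hyps[OF cl bx] c by (simp del: times_divide_eq_left mult_1)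
    also have "\<dots> \<le> avg (visit (supbox x0 L) y) z"
      using avg_ge_nbr[of z "visit (supbox x0 L) y" ?z] is_s by (auto simp: mem_nbrs nbr_iff)
    also have "\<dots> = visit (supbox x0 L) y z" using less.prems False by (simp add: visit_harmonic)
    finally show ?thesis .
  qed
qed

lemma visit_lower:
  fixes y :: "int^'d::finite"
  assumes S0: "1 \<le> S0" and \<alpha>: "0 < \<alpha>" and sub: "\<And>x :: int^'d. S0 \<le> sq x \<Longrightarrow> radial \<alpha> 1 x \<le> avg (radial \<alpha> 1) x"
    and y: "y \<in> supbox x0 L" and \<tau>: "0 \<le> \<tau>" "\<And>w. w \<notin> supbox x0 L \<Longrightarrow> radial \<alpha> 1 (w - y) \<le> \<tau>"
    and z: "z \<in> supbox x0 L"
  shows "(1 / (2 * real CARD('d))) ^ nat \<lceil>S0\<rceil> * (radial \<alpha> 1 (z - y) - \<tau>) \<le> visit (supbox x0 L) y z"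
proof -
  let ?A = "supbox x0 L" and ?c = "(1 / (2 * real CARD('d))) ^ nat \<lceil>S0\<rceil>"
  have "1 \<le> 2 * real CARD('d)" using card_ge_1[where 'd='d] by linarith
  then have c1: "1 / (2 * real CARD('d)) \<le> 1" by simp
  have c: "0 < ?c" by simp
  have rad_le_1: "radial \<alpha> 1 w \<le> 1" for w :: "int^'d"
    using powr_mono2'[of "-\<alpha>" 1 "sq w + 1"] \<alpha> by (simp add: radial_def)
  have near: "?c * (radial \<alpha> 1 (w - y) - \<tau>) \<le> visit ?A y w" if w: "w \<in> ?A" "sq (w - y) < S0" for w
  proof -
    have "real (ell1 (w - y)) \<le> S0" using ell1_le_sq[of "w - y"] w by simp
    then have "ell1 (w - y) \<le> nat \<lceil>S0\<rceil>" by linarith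
    then have "?c \<le> (1 / (2 * real CARD('d))) ^ ell1 (w - y)" using c1 by (intro power_decreasing) auto
    also have "\<dots> \<le> visit ?A y w" by (rule visit_near[OF y w(1)])
    finally have n1: "?c * 1 \<le> visit ?A y w" by simp
    have n2: "?c * (radial \<alpha> 1 (w - y) - \<tau>) \<le> ?c * 1"
      using rad_le_1[of "w - y"] \<tau>(1) by (intro mult_left_mono) auto
    from order_trans[OF n2 n1] show ?thesis .
  qed
  show ?thesis
  proof (cases "sq (z - y) < S0")
    case True
    then show ?thesis using near z by simp
  next
    case False
    define W where "W = {w \<in> ?A. S0 \<le> sq (w - y)}"
    show ?thesis
    proof (rule srw_comparison[of W "\<lambda>w. ?c * (radial \<alpha> 1 (w - y) - \<tau>)" "visit ?A y"])
      show "finite W" by (simp add: W_def)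
      show "z \<in> W" using z False by (simp add: W_def)
    next
      fix w assume w: "w \<in> W"
      have "avg (\<lambda>w. ?c * (radial \<alpha> 1 (w - y) - \<tau>)) w = ?c * (avg (radial \<alpha> 1) (w - y) - \<tau>)"
        by (simp only: avg_cmult avg_diff avg_const avg_shift)
      then show "?c * (radial \<alpha> 1 (w - y) - \<tau>) \<le> avg (\<lambda>w. ?c * (radial \<alpha> 1 (w - y) - \<tau>)) w"
        using sub[of "w - y"] w by (simp add: W_def mult_left_mono)
      have "w \<noteq> y" using w S0 by (auto simp: W_def sq_def)
      then show "avg (visit ?A y) w \<le> visit ?A y w" using w by (simp add: W_def visit_harmonic)
    next
      fix w assume "w \<notin> W"
      show "?c * (radial \<alpha> 1 (w - y) - \<tau>) \<le> visit ?A y w"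
      proof (cases "w \<in> ?A")
        case True
        then show ?thesis using near[of w] \<open>w \<notin> W\<close> by (auto simp: W_def)
      next
        case False
        have "?c * (radial \<alpha> 1 (w - y) - \<tau>) \<le> 0" using \<tau>(2)[OF False] c by (intro mult_nonneg_nonpos) auto
        then show ?thesis using visit_nonneg[of ?A y w] by linarith
      qed
    qed
  qed
qed

lemma lattice_lipschitz:
  fixes x0 :: "int^'d::finite"
  assumes step: "\<And>c i. c \<in> supbox x0 m \<Longrightarrow> \<bar>u (c + axis i 1) - u c\<bar> \<le> \<gamma>"
    and z: "z \<in> supbox x0 m" and m: "0 \<le> m" and \<gamma>: "0 \<le> \<gamma>"
  shows "\<bar>u z - u x0\<bar> \<le> \<gamma> * real (ell1 (z - x0))"
  using z
proof (induction "ell1 (z - x0)" arbitrary: z rule: less_induct)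
  case less
  show ?case
  proof (cases "z = x0")
    case False
    have x0: "x0 \<in> supbox x0 m" using m by (simp add: supbox_def)
    obtain i s where s: "s = 1 \<or> s = -1" and cl: "ell1 (z + axis i s - x0) < ell1 (z - x0)"
      and bx: "z + axis i s \<in> supbox x0 m"
      using ell1_closer[OF False] x0 less.prems by metis
    have "\<bar>u z - u (z + axis i s)\<bar> \<le> \<gamma>"
    proof (cases "s = 1")
      case True
      then show ?thesis using step[OF less.prems, of i] by (simp add: abs_minus_commute)
    next
      case False
      then have eq: "z + axis i s + axis i 1 = z" using s by (auto simp: vec_eq_iff axis_def)
      show ?thesis using step[OF bx, of i] unfolding eq .
    qed
    moreover have "\<gamma> * (real (ell1 (z + axis i s - x0)) + 1) \<le> \<gamma> * real (ell1 (z - x0))"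
      using cl \<gamma> by (intro mult_left_mono) auto
    ultimately show ?thesis using less.hyps[OF cl bx] by (simp add: distrib_left)
  qed (simp add: ell1_def)
qed

text \<open>The superharmonic barrier bounds \<open>visit\<close> on the box of half size, whose
  points keep distance about \<open>l2 / 2\<close> from the pole. The gradient estimate on boxes of
  size comparable to \<open>l2\<close> then bounds each step, and at most \<open>d * (l + 1)\<close>
  steps lead to \<open>x0\<close>.\<close>

lemma visit_oscillation:
  fixes y x0 :: "int^'d::finite"
  assumes b: "1 \<le> b" and \<alpha>: "0 < \<alpha>" and super: "\<And>x :: int^'d. avg (radial \<alpha> b) x \<le> radial \<alpha> b x"
    and y: "y \<notin> supbox x0 (l2 - 1)" and l: "0 \<le> l" "4 * l + 12 \<le> l2" "l2 \<le> L"
    and z: "z \<in> supbox x0 (l + 1)"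
  shows "\<bar>visit (supbox x0 L) y z - visit (supbox x0 L) y x0\<bar>
     \<le> 8 * (real CARD('d))\<^sup>2 * real_of_int (l + 1) / real_of_int l2 * (b powr \<alpha> * (real_of_int l2 / 2) powr (- 2 * \<alpha>))"
proof -
  let ?u = "visit (supbox x0 L) y" and ?d = "real CARD('d)"
  define S where "S = b powr \<alpha> * (real_of_int l2 / 2) powr (- 2 * \<alpha>)"
  \<comment> \<open>Boxes of radius \<open>m + 1\<close> about points of
    \<open>supbox x0 (l + 1)\<close> stay in \<open>supbox x0 (l2 div 2)\<close>, and
    \<open>4 * l + 12 \<le> l2\<close> leaves \<open>m + 1\<close> at least
    \<open>l2 / 4\<close>.\<close>
  define m where "m = l2 div 2 - l - 2"
  have m: "1 \<le> m" "real_of_int l2 / 4 \<le> real_of_int (m + 1)" using l by (auto simp: m_def)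
  have S: "0 \<le> S" by (simp add: S_def)
  obtain i where i: "\<not> \<bar>y $ i - x0 $ i\<bar> \<le> l2 - 1" using y by (auto simp: supbox_def)
  have ub: "?u w \<le> S" if w: "w \<in> supbox x0 (l2 div 2)" for w
  proof -
    define F where "F w = b powr \<alpha> * radial \<alpha> b (w - y)" for w
    have uF: "?u w \<le> F w"
    proof (rule visit_le_super)
      fix w
      show "0 \<le> F w" by (simp add: F_def radial_def)
      have "avg F w = b powr \<alpha> * avg (radial \<alpha> b) (w - y)" by (simp only: F_def[abs_def] avg_cmult avg_shift)
      then show "avg F w \<le> F w" using super[of "w - y"] by (simp add: F_def mult_left_mono)
      show "1 \<le> F y" using b by (simp add: F_def radial_def sq_def powr_minus)
    qed
    have "\<bar>w $ i - x0 $ i\<bar> \<le> l2 div 2" using w by (simp add: supbox_def)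
    then have "l2 - l2 div 2 \<le> \<bar>(w - y) $ i\<bar>" using i by simp
    then have "(real_of_int (l2 - l2 div 2))\<^sup>2 \<le> sq (w - y)" using l by (intro sq_ge_coord) auto
    moreover have "(real_of_int l2 / 2)\<^sup>2 \<le> (real_of_int (l2 - l2 div 2))\<^sup>2" using l by (intro power_mono) auto
    ultimately have "(real_of_int l2 / 2)\<^sup>2 \<le> sq (w - y) + b" using b by linarith
    then have "radial \<alpha> b (w - y) \<le> ((real_of_int l2 / 2)\<^sup>2) powr (- \<alpha>)"
      unfolding radial_def using \<alpha> l by (intro powr_mono2') auto
    also have "((real_of_int l2 / 2)\<^sup>2) powr (- \<alpha>) = (real_of_int l2 / 2) powr (- 2 * \<alpha>)"
    proof -
      have "(real_of_int l2 / 2)\<^sup>2 = (real_of_int l2 / 2) powr real 2" using l by (subst powr_realpow) auto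
      then show ?thesis by (simp only: powr_powr) simp
    qed
    finally have "F w \<le> S" by (simp add: F_def S_def mult_left_mono)
    with uF show ?thesis by linarith
  qed
  define \<gamma> where "\<gamma> = 8 * ?d * S / real_of_int l2"
  have \<gamma>: "0 \<le> \<gamma>" using S l by (simp add: \<gamma>_def)
  have step: "\<bar>?u (c + axis j 1) - ?u c\<bar> \<le> \<gamma>" if c: "c \<in> supbox x0 (l + 1)" for c j
  proof -
    have cb: "w \<in> supbox x0 (l + 1 + k)" if "w \<in> supbox c k" for w k
      unfolding supbox_def
    proof (intro CollectI allI)
      fix j
      have "\<bar>w $ j - c $ j\<bar> \<le> k" "\<bar>c $ j - x0 $ j\<bar> \<le> l + 1" using that c by (auto simp: supbox_def)
      then show "\<bar>w $ j - x0 $ j\<bar> \<le> l + 1 + k" by arith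
    qed
    have "\<bar>?u (c + axis j 1) - ?u c\<bar> \<le> 2 * ?d * S / real_of_int (m + 1)"
    proof (rule harmonic_gradient[OF m(1)])
      fix w assume "w \<in> supbox c m"
      from cb[OF this] have w: "w \<in> supbox x0 (l2 div 2 - 1)" by (simp add: m_def)
      have "l2 div 2 - 1 \<le> L" "l2 div 2 - 1 \<le> l2 - 1" using l by linarith+
      then have "w \<in> supbox x0 L" "w \<in> supbox x0 (l2 - 1)" using w supbox_mono by blast+
      then show "avg ?u w = ?u w" using y by (intro visit_harmonic) auto
    next
      fix w assume "w \<in> supbox c (m + 1)"
      from cb[OF this] have w: "w \<in> supbox x0 (l2 div 2)" by (simp add: m_def)
      then show "?u w \<le> S" by (rule ub)
    qed simp
    also have "\<dots> \<le> 2 * ?d * S / (real_of_int l2 / 4)"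
      using m S l by (intro divide_left_mono mult_pos_pos) auto
    also have "\<dots> = \<gamma>" by (simp add: \<gamma>_def)
    finally show ?thesis .
  qed
  have "\<bar>?u z - ?u x0\<bar> \<le> \<gamma> * real (ell1 (z - x0))"
    by (rule lattice_lipschitz[OF step z _ \<gamma>]) (use l in auto)
  also have "\<dots> \<le> \<gamma> * (?d * real_of_int (l + 1))"
    using ell1_box[OF z] l \<gamma> by (intro mult_left_mono) auto
  finally show ?thesis by (simp add: \<gamma>_def S_def power2_eq_square algebra_simps)
qed

section \<open>Scales for the entrance law of the simple random walk\<close>

lemma eventually_powr_ge: "0 < e \<Longrightarrow> \<forall>\<^sub>F N in sequentially. C \<le> real N powr e"
proof -
  assume "0 < e"
  then have "filterlim (\<lambda>N. real N powr e) at_top sequentially" by real_asymp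
  then show ?thesis by (simp add: filterlim_at_top)
qed

lemma eventually_powr_small: "0 < e \<Longrightarrow> 0 < c \<Longrightarrow> \<forall>\<^sub>F N in sequentially. C * real N powr (-e) \<le> c"
proof -
  assume e: "0 < e" and c: "0 < c"
  have "\<forall>\<^sub>F N in sequentially. C / c \<le> real N powr e" by (rule eventually_powr_ge[OF e])
  then show ?thesis using eventually_gt_at_top[of 0]
  proof eventually_elim
    case (elim N)
    then have "C \<le> c * real N powr e" using c by (simp add: divide_le_eq mult.commute)
    then show ?case using elim by (simp add: powr_minus field_simps)
  qed
qed

lemma floor_half: "1 \<le> (x :: real) \<Longrightarrow> x / 2 \<le> real_of_int \<lfloor>x\<rfloor>"
proof -
  assume "1 \<le> x"
  then have "1 \<le> \<lfloor>x\<rfloor>" by (simp add: le_floor_iff)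
  then show ?thesis using real_of_int_floor_add_one_gt[of x] by linarith
qed

text \<open>The barrier normalised to be at least one on the inner box is a nonnegative
  superharmonic function and so dominates the hitting probability.\<close>

lemma hit_supbox_decay:
  fixes x0 :: "int^'d::finite"
  assumes b: "1 \<le> b" and \<alpha>: "0 < \<alpha>" and super: "\<And>x :: int^'d. avg (radial \<alpha> b) x \<le> radial \<alpha> b x"
    and l: "0 \<le> l1" "0 < l" and z: "z \<notin> supbox x0 l"
  shows "hit (supbox x0 l1) z \<le> ((real CARD('d) * (real_of_int l1)\<^sup>2 + b) / (real_of_int l)\<^sup>2) powr \<alpha>"
proof -
  let ?M = "real CARD('d) * (real_of_int l1)\<^sup>2 + b"
  have M: "0 < ?M" using b by (simp add: add_nonneg_pos)
  define F where "F w = ?M powr \<alpha> * radial \<alpha> b (w - x0)" for w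
  have "hit (supbox x0 l1) z \<le> F z"
  proof (rule hit_le_super)
    fix w
    show "0 \<le> F w" by (simp add: F_def radial_def)
    have "avg F w = ?M powr \<alpha> * avg (radial \<alpha> b) (w - x0)" by (simp only: F_def[abs_def] avg_cmult avg_shift)
    then show "avg F w \<le> F w" using super[of "w - x0"] by (simp add: F_def mult_left_mono)
    assume "w \<in> supbox x0 l1"
    from sq_box_le[OF this l(1)] have "?M powr (-\<alpha>) \<le> (sq (w - x0) + b) powr (-\<alpha>)"
      using b \<alpha> by (intro powr_mono2') (auto intro: add_nonneg_pos)
    then have "?M powr \<alpha> * ?M powr (-\<alpha>) \<le> F w" unfolding F_def radial_def by (intro mult_left_mono) auto
    then show "1 \<le> F w" using M by (simp add: powr_minus)
  qed
  also have "F z \<le> ?M powr \<alpha> * ((real_of_int l)\<^sup>2) powr (-\<alpha>)"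
  proof -
    obtain i where "\<not> \<bar>z $ i - x0 $ i\<bar> \<le> l" using z by (auto simp: supbox_def)
    then have "(real_of_int l)\<^sup>2 \<le> sq (z - x0)" using l by (intro sq_ge_coord[of _ _ i]) auto
    then have "radial \<alpha> b (z - x0) \<le> ((real_of_int l)\<^sup>2) powr (-\<alpha>)"
      unfolding radial_def using \<alpha> l b by (intro powr_mono2') auto
    then show ?thesis unfolding F_def by (intro mult_left_mono) auto
  qed
  also have "\<dots> = (?M / (real_of_int l)\<^sup>2) powr \<alpha>"
    by (simp only: powr_divide) (simp add: powr_minus divide_inverse)
  finally show ?thesis .
qed

text \<open>Bookkeeping for relative errors of size \<open>\<epsilon> / 16\<close>: the oscillation
  of the Green function in both directions and the return probability \<open>h\<close>.\<close>

lemma ratio_bound: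
  fixes \<epsilon> h v gm gM :: real
  assumes \<epsilon>: "0 < \<epsilon>" "\<epsilon> < 1" and v: "0 < v" and h: "0 \<le> h" "h \<le> \<epsilon> / 16"
    and gm: "gm = v * (1 - \<epsilon> / 16)" and gM: "gM = v * (1 + \<epsilon> / 16)"
  shows "v / 2 \<le> gm - gM * h" "0 < gm - gM * h" "gM / ((1 - h) * (gm - gM * h)) \<le> 1 + \<epsilon>"
proof -
  have "gM * h \<le> v * (1 + \<epsilon> / 16) * (\<epsilon> / 16)" unfolding gM using h v \<epsilon> by (intro mult_left_mono) auto
  also have "\<dots> \<le> v * 2 * (\<epsilon> / 16)" using v \<epsilon> by (intro mult_right_mono mult_left_mono) auto
  finally have lo: "v * (1 - 3 * \<epsilon> / 16) \<le> gm - gM * h" unfolding gm by (simp add: algebra_simps)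
  have "v * (1 / 2) \<le> v * (1 - 3 * \<epsilon> / 16)" using v \<epsilon> by (intro mult_left_mono) auto
  with lo show half: "v / 2 \<le> gm - gM * h" by simp
  then show pos: "0 < gm - gM * h" using v by linarith
  have "(1 - 4 * \<epsilon> / 16) * v \<le> (1 - h) * (gm - gM * h)"
  proof -
    have "(1 - 4 * \<epsilon> / 16) * v \<le> (1 - \<epsilon> / 16) * (v * (1 - 3 * \<epsilon> / 16))" using v \<epsilon> by (simp add: algebra_simps)
    also have "\<dots> \<le> (1 - h) * (gm - gM * h)" using lo h \<epsilon> v by (intro mult_mono) auto
    finally show ?thesis .
  qed
  moreover have "gM \<le> (1 + \<epsilon>) * ((1 - 4 * \<epsilon> / 16) * v)"
  proof -
    have "\<epsilon> * \<epsilon> \<le> \<epsilon>" using \<epsilon> by simp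
    moreover have "(1 + \<epsilon>) * (1 - 4 * \<epsilon> / 16) = 1 + 3 / 4 * \<epsilon> - \<epsilon> * \<epsilon> / 4" by (simp add: field_simps)
    ultimately have "1 + \<epsilon> / 16 \<le> (1 + \<epsilon>) * (1 - 4 * \<epsilon> / 16)" using \<epsilon> by linarith
    from mult_left_mono[OF this, of v] show ?thesis using v by (simp add: gM algebra_simps)
  qed
  ultimately have "gM \<le> (1 + \<epsilon>) * ((1 - h) * (gm - gM * h))"
    using \<epsilon> by (meson mult_left_mono order_trans add_nonneg_nonneg less_imp_le zero_le_one)
  then show "gM / ((1 - h) * (gm - gM * h)) \<le> 1 + \<epsilon>"
    using pos h \<epsilon> by (subst pos_divide_le_eq) auto
qed

text \<open>The exponents \<open>r1\<close>, \<open>\<rho>\<close>, \<open>r3\<close>,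
  \<open>r2\<close> are equally spaced by \<open>g\<close>, with \<open>\<rho>\<close> for the
  collar and \<open>r3\<close> for the shell of starting points. Seen from a pole on the shell, the
  relative oscillation over the collar is of order \<open>N powr (- g)\<close> times the loss
  \<open>N powr (2 * \<kappa> * r3)\<close> that comes from using one barrier above and another
  below.\<close>

lemma srw_hit_asymptotics:
  fixes r1 r2 \<epsilon> :: real
  assumes d3: "3 \<le> CARD('d::finite)" and r: "0 < r1" "r1 < r2" "r2 \<le> 1" and \<epsilon>: "0 < \<epsilon>" "\<epsilon> < 1"
  shows "\<exists>r3. r1 < r3 \<and> r3 < r2 \<and> (\<forall>\<^sub>F N in sequentially. \<forall>x0 :: int^'d.
     (\<forall>x\<in>Abox x0 N r1. \<not> nbrs x \<subseteq> Abox x0 N r1 \<longrightarrow> 1 / (real N)\<^sup>2 \<le> eqm (Abox x0 N r1) x) \<and>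
     (\<forall>y. y \<in> Abox x0 N r3 \<longrightarrow> y \<notin> supbox x0 (\<lfloor>real N powr r3\<rfloor> - 1) \<longrightarrow>
       (\<exists>m\<ge>real N powr (- (real CARD('d) + 1)). \<forall>x\<in>Abox x0 N r1.
          m * eqm (Abox x0 N r1) x \<le> srw_hit (Abox x0 N r1) (Abox x0 N r2) x y \<and>
          srw_hit (Abox x0 N r1) (Abox x0 N r2) x y \<le> (1 + \<epsilon>) * m * eqm (Abox x0 N r1) x)))"
proof -
  let ?d = "real CARD('d)"
  have d: "3 \<le> ?d" using d3 by simp
  define g where "g = (r2 - r1) / 3"
  define \<rho> where "\<rho> = r1 + g"
  define r3 where "r3 = r1 + 2 * g"
  have g: "0 < g" and \<rho>: "r1 < \<rho>" "\<rho> < r3" "r3 < r2" "r3 - \<rho> = g"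
  proof -
    have "3 * g = r2 - r1" by (simp add: g_def)
    then show "0 < g" "r1 < \<rho>" "\<rho> < r3" "r3 < r2" "r3 - \<rho> = g" using r unfolding \<rho>_def r3_def by linarith+
  qed
  \<comment> \<open>Offset from the Newtonian exponent. It gives
    \<open>2 * \<kappa> * r3 \<le> g / 2\<close>, so the discrepancy between the barriers uses at
    most half of the gain \<open>g\<close>.\<close>
  define \<kappa> where "\<kappa> = min (1 / 2) (g / 4)"
  have \<kappa>: "0 < \<kappa>" "\<kappa> \<le> 1 / 2" "\<kappa> \<le> g / 4" using g by (auto simp: \<kappa>_def)
  define \<alpha> where "\<alpha> = (?d - 2 - \<kappa>) / 2"
  define \<alpha>' where "\<alpha>' = (?d - 2 + \<kappa>) / 2"
  have \<alpha>: "0 < \<alpha>" "2 * \<alpha> < ?d - 2" using d \<kappa> by (auto simp: \<alpha>_def)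
  have \<alpha>': "0 < \<alpha>'" "?d - 2 < 2 * \<alpha>'" "2 * \<alpha>' \<le> ?d" using d \<kappa> by (auto simp: \<alpha>'_def)
  obtain b where b: "1 \<le> b" and super: "\<And>x :: int^'d. avg (radial \<alpha> b) x \<le> radial \<alpha> b x"
    using radial_superharmonic[OF \<alpha>] by blast
  obtain S0 where S0: "1 \<le> S0" and sub: "\<And>x :: int^'d. S0 \<le> sq x \<Longrightarrow> radial \<alpha>' 1 x \<le> avg (radial \<alpha>' 1) x"
    using radial_subharmonic[OF \<alpha>'(1,2)] by blast
  define c0 where "c0 = (1 / (2 * ?d)) ^ nat \<lceil>S0\<rceil>"
  have c0: "0 < c0" by (simp add: c0_def)
  \<comment> \<open>Lower bound for the Green function at the centre. The factor \<open>1/2\<close>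
    pays for the subtracted \<open>\<tau>\<close>, which is of the smaller order
    \<open>N powr (- 2 * \<alpha>' * r2)\<close>.\<close>
  define v0 where "v0 N = c0 / 2 * (4 * ?d + 1) powr (-\<alpha>') * real N powr (- 2 * \<alpha>' * r3)" for N :: nat
  define K where "K = 32 * ?d\<^sup>2 * b powr \<alpha> * 4 powr (2 * \<alpha>)"
  have r3pos: "0 < r3" using r g by (simp add: r3_def)
  have kr: "2 * \<kappa> * r3 \<le> g / 2"
  proof -
    have "\<kappa> * r3 \<le> \<kappa> * 1" using \<kappa> \<rho> r by (intro mult_left_mono) auto
    then show ?thesis using \<kappa> by linarith
  qed
  have f: "\<forall>\<^sub>F N in sequentially. 4 \<le> real N powr (\<rho> - r1)" "\<forall>\<^sub>F N in sequentially. 32 \<le> real N powr (r3 - \<rho>)"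
    "\<forall>\<^sub>F N in sequentially. 4 \<le> real N powr (r2 - r3)"
    "\<forall>\<^sub>F N in sequentially. 4 * (?d + b) * real N powr (- (2 * (\<rho> - r1))) \<le> (\<epsilon> / 16) powr (1 / \<alpha>)"
    "\<forall>\<^sub>F N in sequentially. (2 * 4 powr (2 * \<alpha>') * (4 * ?d + 1) powr \<alpha>') * real N powr (- (2 * \<alpha>' * (r2 - r3))) \<le> 1"
    "\<forall>\<^sub>F N in sequentially. (K * (32 / (\<epsilon> * c0)) * (4 * ?d + 1) powr \<alpha>') * real N powr (- (g - 2 * \<kappa> * r3)) \<le> 1"
    "\<forall>\<^sub>F N in sequentially. 4 / c0 * (4 * ?d + 1) powr \<alpha>' \<le> real N powr (?d + 1 - 2 * \<alpha>' * r3)"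
    "\<forall>\<^sub>F N in sequentially. 8 * ?d \<le> real N powr (2 - \<rho>)"
  proof -
    have "2 * \<alpha>' * r3 \<le> ?d * 1" using \<alpha>' \<rho> r r3pos by (intro mult_mono) auto
    then have "0 < ?d + 1 - 2 * \<alpha>' * r3" by simp
    then show "\<forall>\<^sub>F N in sequentially. 4 / c0 * (4 * ?d + 1) powr \<alpha>' \<le> real N powr (?d + 1 - 2 * \<alpha>' * r3)"
      by (rule eventually_powr_ge)
  qed ((intro eventually_powr_ge eventually_powr_small; use \<rho> g \<alpha> \<alpha>' \<epsilon> kr r in \<open>simp\<close>)+)
  show ?thesis
  proof (intro exI[of _ r3] conjI)
    show "r1 < r3" "r3 < r2" using \<rho> by auto
    show "\<forall>\<^sub>F N in sequentially. \<forall>x0 :: int^'d.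
     (\<forall>x\<in>Abox x0 N r1. \<not> nbrs x \<subseteq> Abox x0 N r1 \<longrightarrow> 1 / (real N)\<^sup>2 \<le> eqm (Abox x0 N r1) x) \<and>
     (\<forall>y. y \<in> Abox x0 N r3 \<longrightarrow> y \<notin> supbox x0 (\<lfloor>real N powr r3\<rfloor> - 1) \<longrightarrow>
       (\<exists>m\<ge>real N powr (- (?d + 1)). \<forall>x\<in>Abox x0 N r1.
          m * eqm (Abox x0 N r1) x \<le> srw_hit (Abox x0 N r1) (Abox x0 N r2) x y \<and>
          srw_hit (Abox x0 N r1) (Abox x0 N r2) x y \<le> (1 + \<epsilon>) * m * eqm (Abox x0 N r1) x))"
      using f eventually_ge_at_top[of 1]
    proof eventually_elim
      case (elim N)
      define n where "n = real N"
      have n: "1 \<le> n" using elim by (simp add: n_def)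
      note E = elim(1-8)[folded n_def]
      have ge1: "1 \<le> n powr a" if "0 \<le> a" for a using n that by (simp add: ge_one_powr_ge_zero)
      define l1 where "l1 = \<lfloor>n powr r1\<rfloor>"
      define l where "l = \<lfloor>n powr \<rho>\<rfloor>"
      define l2 where "l2 = \<lfloor>n powr r3\<rfloor>"
      define L where "L = \<lfloor>n powr r2\<rfloor>"
      have bnd: "n powr a / 2 \<le> real_of_int \<lfloor>n powr a\<rfloor>" "real_of_int \<lfloor>n powr a\<rfloor> \<le> n powr a" "1 \<le> \<lfloor>n powr a\<rfloor>" if "0 \<le> a" for a
        using floor_half[OF ge1[OF that]] ge1[OF that] by (auto simp: le_floor_iff)
      have l1: "real_of_int l1 \<le> n powr r1" "1 \<le> l1" and l: "n powr \<rho> / 2 \<le> real_of_int l" "real_of_int l \<le> n powr \<rho>" "1 \<le> l"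
        and l2: "n powr r3 / 2 \<le> real_of_int l2" "real_of_int l2 \<le> n powr r3" "1 \<le> l2"
        and L: "n powr r2 / 2 \<le> real_of_int L" "real_of_int L \<le> n powr r2"
        using bnd r \<rho> r3pos by (auto simp: l1_def l_def l2_def L_def)
      have add: "n powr a * n powr c = n powr (a + c)" for a c by (simp add: powr_add)
      have l1l: "l1 + 1 \<le> l"
      proof -
        have "n powr r1 * 4 \<le> n powr r1 * n powr (\<rho> - r1)" using E(1) by (intro mult_left_mono) auto
        then have "4 * n powr r1 \<le> n powr \<rho>" by (simp add: add mult.commute)
        then have "real_of_int l1 + 1 \<le> real_of_int l" using l1 l ge1[of r1] r by linarith
        then show ?thesis by linarith
      qed
      have ll2: "4 * l + 12 \<le> l2"
      proof -
        have "n powr \<rho> * 32 \<le> n powr \<rho> * n powr (r3 - \<rho>)" using E(2) by (intro mult_left_mono) auto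
        then have "32 * n powr \<rho> \<le> n powr r3" by (simp add: add mult.commute)
        then have "4 * real_of_int l + 12 \<le> real_of_int l2" using l l2 ge1[of \<rho>] r \<rho> by linarith
        then show ?thesis by linarith
      qed
      have l2L: "n powr r2 / 4 \<le> real_of_int L - real_of_int l2"
      proof -
        have "n powr r3 * 4 \<le> n powr r3 * n powr (r2 - r3)" using E(3) by (intro mult_left_mono) auto
        then have "4 * n powr r3 \<le> n powr r2" by (simp add: add mult.commute)
        then show ?thesis using l2 L by linarith
      qed
      then have l2L': "l2 < L" using ge1[of r2] r by simp
      define h where "h = ((?d * (real_of_int l1)\<^sup>2 + b) / (real_of_int l)\<^sup>2) powr \<alpha>"
      have h: "0 \<le> h" "h \<le> \<epsilon> / 16"
      proof -
        have "(real_of_int l1)\<^sup>2 \<le> (n powr r1)\<^sup>2" using l1 by (intro power_mono) auto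
        also have "\<dots> = n powr (2 * r1)" by (simp add: power2_eq_square add)
        finally have "?d * (real_of_int l1)\<^sup>2 + b \<le> ?d * n powr (2 * r1) + b * n powr (2 * r1)"
          using ge1[of "2 * r1"] r b by (intro add_mono mult_left_mono) auto
        then have num: "?d * (real_of_int l1)\<^sup>2 + b \<le> (?d + b) * n powr (2 * r1)" by (simp add: distrib_right)
        have "(n powr \<rho> / 2)\<^sup>2 \<le> (real_of_int l)\<^sup>2" using l by (intro power_mono) auto
        moreover have "(n powr \<rho> / 2)\<^sup>2 = n powr (2 * \<rho>) / 4" by (simp add: power2_eq_square add)
        ultimately have den: "n powr (2 * \<rho>) / 4 \<le> (real_of_int l)\<^sup>2" by simp
        have "(?d * (real_of_int l1)\<^sup>2 + b) / (real_of_int l)\<^sup>2 \<le> ((?d + b) * n powr (2 * r1)) / (n powr (2 * \<rho>) / 4)"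
          using num den b n by (intro frac_le) (auto intro!: mult_nonneg_nonneg)
        also have "\<dots> = 4 * (?d + b) * (n powr (2 * r1) * n powr (- (2 * \<rho>)))" by (simp add: powr_minus field_simps)
        also have "\<dots> = 4 * (?d + b) * n powr (- (2 * (\<rho> - r1)))" by (simp add: add algebra_simps)
        also have "\<dots> \<le> (\<epsilon> / 16) powr (1 / \<alpha>)" by (rule E(4))
        finally have "h \<le> ((\<epsilon> / 16) powr (1 / \<alpha>)) powr \<alpha>"
          unfolding h_def using b \<alpha> by (intro powr_mono2) (auto intro!: divide_nonneg_nonneg add_nonneg_nonneg)
        also have "\<dots> = \<epsilon> / 16" using \<alpha> \<epsilon> by (simp add: powr_powr)
        finally show "h \<le> \<epsilon> / 16" .
      qed (simp add: h_def)
      show ?case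
      proof (intro allI conjI ballI impI)
        fix x0 :: "int^'d"
        let ?A1 = "Abox x0 N r1" and ?A2 = "Abox x0 N r2"
        have boxes: "?A1 = supbox x0 l1" "?A2 = supbox x0 L" "Abox x0 N r3 = supbox x0 l2"
          by (auto simp: Abox_def l1_def L_def l2_def n_def)
        have hit_h: "hit (supbox x0 l1) z \<le> h" if "z \<notin> supbox x0 l" for z
          unfolding h_def using l1 l by (intro hit_supbox_decay[OF b \<alpha>(1) super _ _ that]) auto
        have bdl: "1 / n\<^sup>2 \<le> eqm (supbox x0 l1) x" if x: "x \<in> supbox x0 l1" "nbr x w" "w \<notin> supbox x0 l1" for x w
        proof -
          have "1 / (4 * ?d * real_of_int (l + 1)) \<le> eqm (supbox x0 l1) x"
          proof (rule eqm_boundary_lower[OF _ _ _ x])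
            fix z assume "z \<notin> supbox x0 l"
            from hit_h[OF this] show "1 / 2 \<le> esc (supbox x0 l1) z" using h \<epsilon> by (simp add: esc_def)
          qed (use l1 l1l in auto)
          moreover have "4 * ?d * real_of_int (l + 1) \<le> n\<^sup>2"
          proof -
            have "4 * ?d * real_of_int (l + 1) \<le> 4 * ?d * (2 * n powr \<rho>)"
              using l ge1[of \<rho>] r \<rho> d by (intro mult_left_mono) auto
            also have "\<dots> = 8 * ?d * n powr \<rho>" by simp
            also have "\<dots> \<le> n powr (2 - \<rho>) * n powr \<rho>" using E(8) by (intro mult_right_mono) auto
            also have "\<dots> = n powr real 2" by (simp add: add)
            also have "\<dots> = n\<^sup>2" using n by (subst powr_realpow) auto
            finally show ?thesis .
          qed
          then have "1 / n\<^sup>2 \<le> 1 / (4 * ?d * real_of_int (l + 1))" using l d n by (intro divide_left_mono) (auto intro!: mult_pos_pos)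
          ultimately show ?thesis by linarith
        qed
        {
          fix x assume x: "x \<in> ?A1" "\<not> nbrs x \<subseteq> ?A1"
          then obtain w where "nbr x w" "w \<notin> supbox x0 l1" unfolding boxes subset_iff mem_nbrs by blast
          with x(1) show "1 / (real N)\<^sup>2 \<le> eqm ?A1 x"
            unfolding boxes n_def[symmetric] by (intro bdl)
        }
        fix y assume y: "y \<in> Abox x0 N r3" "y \<notin> supbox x0 (\<lfloor>real N powr r3\<rfloor> - 1)"
        have y1: "y \<in> supbox x0 l2" "y \<notin> supbox x0 (l2 - 1)" using y by (auto simp: boxes l2_def n_def)
        have yL: "y \<in> supbox x0 L" using y1(1) supbox_mono[of l2 L x0] l2L' by auto
        let ?u = "visit (supbox x0 L) y"
        define v where "v = ?u x0"
        have v_ge: "v0 N \<le> v"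
        proof -
          define \<tau> where "\<tau> = ((n powr r2 / 4)\<^sup>2) powr (-\<alpha>')"
          have x0L: "x0 \<in> supbox x0 L" using l2L' l2 by (simp add: supbox_def)
          have "c0 * (radial \<alpha>' 1 (x0 - y) - \<tau>) \<le> v"
            unfolding c0_def v_def
          proof (rule visit_lower[OF S0 \<alpha>'(1) sub yL _ _ x0L])
            fix w assume "w \<notin> supbox x0 L"
            then obtain i where i: "\<not> \<bar>w $ i - x0 $ i\<bar> \<le> L" by (auto simp: supbox_def)
            have "\<bar>y $ i - x0 $ i\<bar> \<le> l2" using y1(1) by (simp add: supbox_def)
            then have "L - l2 \<le> \<bar>(w - y) $ i\<bar>" using i by simp
            then have "(real_of_int (L - l2))\<^sup>2 \<le> sq (w - y)" using l2L' by (intro sq_ge_coord) auto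
            moreover have "(n powr r2 / 4)\<^sup>2 \<le> (real_of_int (L - l2))\<^sup>2" using l2L by (intro power_mono) auto
            ultimately show "radial \<alpha>' 1 (w - y) \<le> \<tau>"
              unfolding radial_def \<tau>_def using \<alpha>' n by (intro powr_mono2') auto
          qed (auto simp: \<tau>_def)
          moreover have "v0 N \<le> c0 * (radial \<alpha>' 1 (x0 - y) - \<tau>)"
          proof -
            have "sq (x0 - y) = sq (y - x0)" by (simp add: sq_def power2_commute)
            also have "\<dots> \<le> ?d * (real_of_int l2)\<^sup>2" using y1(1) l2 by (intro sq_box_le) auto
            also have "\<dots> \<le> ?d * (n powr r3)\<^sup>2" using l2 by (intro mult_left_mono power_mono) auto
            also have "(n powr r3)\<^sup>2 = n powr (2 * r3)" by (simp add: power2_eq_square add)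
            finally have "sq (x0 - y) + 1 \<le> ?d * n powr (2 * r3) + 1" by simp
            also have "\<dots> \<le> 4 * ?d * n powr (2 * r3) + 1 * n powr (2 * r3)"
              using ge1[of "2 * r3"] r3pos d by (intro add_mono mult_right_mono) auto
            also have "\<dots> = (4 * ?d + 1) * n powr (2 * r3)" by (simp add: distrib_right)
            finally have "((4 * ?d + 1) * n powr (2 * r3)) powr (-\<alpha>') \<le> radial \<alpha>' 1 (x0 - y)"
              unfolding radial_def using \<alpha>' by (intro powr_mono2') (auto intro: add_nonneg_pos)
            moreover have "((4 * ?d + 1) * n powr (2 * r3)) powr (-\<alpha>') = (4 * ?d + 1) powr (-\<alpha>') * n powr (- 2 * \<alpha>' * r3)"
              using n by (simp add: powr_mult powr_powr mult.commute mult.left_commute)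
            ultimately have A: "(4 * ?d + 1) powr (-\<alpha>') * n powr (- 2 * \<alpha>' * r3) \<le> radial \<alpha>' 1 (x0 - y)" by simp
            have t: "\<tau> = 4 powr (2 * \<alpha>') * n powr (- 2 * \<alpha>' * r2)"
            proof -
              have "(n powr r2 / 4)\<^sup>2 = n powr (2 * r2) / 4 powr 2" by (simp add: power2_eq_square add)
              then have "\<tau> = n powr (2 * r2 * (-\<alpha>')) / 4 powr (2 * (-\<alpha>'))" by (simp only: \<tau>_def powr_divide powr_powr)
              then show ?thesis by (simp add: powr_minus divide_inverse mult.commute mult.left_commute)
            qed
            have "\<tau> \<le> (4 * ?d + 1) powr (-\<alpha>') * n powr (- 2 * \<alpha>' * r3) / 2"
            proof -
              let ?P = "(4 * ?d + 1) powr \<alpha>'"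
              have P: "0 < ?P" by simp
              have XY: "n powr (- 2 * \<alpha>' * r2) = n powr (- (2 * \<alpha>' * (r2 - r3))) * n powr (- 2 * \<alpha>' * r3)"
                unfolding add by (simp add: algebra_simps)
              have "2 * \<tau> * ?P = (2 * 4 powr (2 * \<alpha>') * ?P * n powr (- (2 * \<alpha>' * (r2 - r3)))) * n powr (- 2 * \<alpha>' * r3)"
                unfolding t XY by (simp only: ac_simps)
              also have "\<dots> \<le> 1 * n powr (- 2 * \<alpha>' * r3)"
                using E(5) by (intro mult_right_mono) auto
              finally have "2 * \<tau> * ?P \<le> n powr (- 2 * \<alpha>' * r3)" by simp
              then have "2 * \<tau> \<le> n powr (- 2 * \<alpha>' * r3) / ?P" using P by (simp only: pos_le_divide_eq)
              then show ?thesis unfolding powr_minus_divide[of "4 * ?d + 1"] by simp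
            qed
            with A have "(4 * ?d + 1) powr (-\<alpha>') * n powr (- 2 * \<alpha>' * r3) / 2 \<le> radial \<alpha>' 1 (x0 - y) - \<tau>" by linarith
            from mult_left_mono[OF this less_imp_le[OF c0]] show ?thesis by (simp add: v0_def n_def)
          qed
          ultimately show ?thesis by linarith
        qed
        have v0pos: "0 < v0 N" using c0 n by (simp add: v0_def n_def)
        then have v: "0 < v" using v_ge by linarith
        have osc: "\<bar>?u z - v\<bar> \<le> \<epsilon> / 16 * v" if z: "z \<in> supbox x0 (l + 1)" for z
        proof -
          have "\<bar>?u z - v\<bar> \<le> 8 * ?d\<^sup>2 * real_of_int (l + 1) / real_of_int l2 * (b powr \<alpha> * (real_of_int l2 / 2) powr (- 2 * \<alpha>))"
            unfolding v_def using l l2L' by (intro visit_oscillation[OF b \<alpha>(1) super y1(2) _ ll2 _ z]) auto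
          also have "\<dots> \<le> 8 * ?d\<^sup>2 * (2 * n powr \<rho>) / (n powr r3 / 2) * (b powr \<alpha> * (n powr r3 / 4) powr (- 2 * \<alpha>))"
          proof (rule mult_mono)
            show "8 * ?d\<^sup>2 * real_of_int (l + 1) / real_of_int l2 \<le> 8 * ?d\<^sup>2 * (2 * n powr \<rho>) / (n powr r3 / 2)"
              using l l2 ge1[of \<rho>] r \<rho> n by (intro frac_le mult_left_mono) auto
            have "(real_of_int l2 / 2) powr (- 2 * \<alpha>) \<le> (n powr r3 / 4) powr (- 2 * \<alpha>)"
              using l2 \<alpha> n by (intro powr_mono2') auto
            then show "b powr \<alpha> * (real_of_int l2 / 2) powr (- 2 * \<alpha>) \<le> b powr \<alpha> * (n powr r3 / 4) powr (- 2 * \<alpha>)"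
              by (rule mult_left_mono) simp
          qed auto
          also have "\<dots> = K * (n powr \<rho> * n powr (- r3) * n powr (r3 * (- 2 * \<alpha>)))"
          proof -
            have "(n powr r3 / 4) powr (- 2 * \<alpha>) = n powr (r3 * (- 2 * \<alpha>)) / 4 powr (- 2 * \<alpha>)"
              by (simp only: powr_divide powr_powr)
            also have "\<dots> = n powr (r3 * (- 2 * \<alpha>)) * 4 powr (2 * \<alpha>)" by (simp add: powr_minus_divide)
            finally have e1: "(n powr r3 / 4) powr (- 2 * \<alpha>) = n powr (r3 * (- 2 * \<alpha>)) * 4 powr (2 * \<alpha>)" .
            have e2: "8 * ?d\<^sup>2 * (2 * n powr \<rho>) / (n powr r3 / 2) = 32 * ?d\<^sup>2 * n powr \<rho> * n powr (- r3)"
              by (simp add: powr_minus_divide)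
            show ?thesis unfolding e1 e2 K_def by (simp only: ac_simps)
          qed
          \<comment> \<open>Since \<open>2 * \<alpha> = 2 * \<alpha>' - 2 * \<kappa>\<close>, the
            upper barrier is expressed through the lower one at the price of the loss term.\<close>
          also have "n powr \<rho> * n powr (- r3) * n powr (r3 * (- 2 * \<alpha>)) = n powr (- (g - 2 * \<kappa> * r3)) * n powr (- 2 * \<alpha>' * r3)"
          proof -
            have "2 * \<alpha> = 2 * \<alpha>' - 2 * \<kappa>" by (simp add: \<alpha>_def \<alpha>'_def field_simps)
            then have "- ((2 * \<alpha>) * r3) = - ((2 * \<alpha>' - 2 * \<kappa>) * r3)" by (simp only:)
            moreover have "r3 * (- 2 * \<alpha>) = - ((2 * \<alpha>) * r3)" by simp
            ultimately have "r3 * (- 2 * \<alpha>) = - ((2 * \<alpha>' - 2 * \<kappa>) * r3)" by (simp only:)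
            then have "\<rho> + - r3 + r3 * (- 2 * \<alpha>) = - (g - 2 * \<kappa> * r3) + - 2 * \<alpha>' * r3"
              unfolding \<rho>(4)[symmetric] by (simp add: left_diff_distrib)
            then show ?thesis unfolding add by (simp only:)
          qed
          also have "K * (n powr (- (g - 2 * \<kappa> * r3)) * n powr (- 2 * \<alpha>' * r3)) \<le> \<epsilon> / 16 * v0 N"
          proof -
            let ?P = "(4 * ?d + 1) powr \<alpha>'" and ?x = "n powr (- (g - 2 * \<kappa> * r3))" and ?y = "n powr (- 2 * \<alpha>' * r3)"
            have P: "0 < ?P" by simp
            have "K * (32 / (\<epsilon> * c0)) * ?P * ?x * (\<epsilon> * c0 / 32) \<le> 1 * (\<epsilon> * c0 / 32)"
              using E(6) \<epsilon> c0 by (intro mult_right_mono) auto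
            then have "K * ?x * ?P \<le> \<epsilon> * c0 / 32" using \<epsilon> c0 by (simp add: field_simps)
            then have "K * ?x \<le> \<epsilon> * c0 / 32 / ?P" using P by (simp only: pos_le_divide_eq)
            then have "K * ?x * ?y \<le> \<epsilon> * c0 / 32 / ?P * ?y" by (intro mult_right_mono) auto
            then show ?thesis unfolding v0_def n_def[symmetric] powr_minus_divide[of "4 * ?d + 1"] by (simp add: mult.assoc)
          qed
          also have "\<dots> \<le> \<epsilon> / 16 * v" using v_ge \<epsilon> by (intro mult_left_mono) auto
          finally show ?thesis .
        qed
        define gm where "gm = v * (1 - \<epsilon> / 16)"
        define gM where "gM = v * (1 + \<epsilon> / 16)"
        note RB = ratio_bound[OF \<epsilon> v h gm_def gM_def]
        have ub: "gm \<le> ?u z" "?u z \<le> gM" if "z \<in> supbox x0 (l + 1)" for z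
          using osc[OF that] unfolding gm_def gM_def abs_le_iff by (simp_all add: algebra_simps)
        have "\<exists>m\<ge>gm - gM * h. \<forall>x\<in>supbox x0 l1. m * eqm (supbox x0 l1) x \<le> srw_hit (supbox x0 l1) (supbox x0 L) x y \<and>
           srw_hit (supbox x0 l1) (supbox x0 L) x y \<le> m * (gM / ((1 - h) * (gm - gM * h))) * eqm (supbox x0 l1) x"
        proof (rule srw_hit_eqm_bounds[where B="supbox x0 l"])
          show "supbox x0 l1 \<subseteq> supbox x0 l" "supbox x0 l \<subseteq> supbox x0 L"
            using l1l ll2 l2L' l by (auto intro!: supbox_mono)
          show "nbrs x \<subseteq> supbox x0 l" if "x \<in> supbox x0 l1" for x
            using supbox_nbr[OF that] supbox_mono[OF l1l, of x0] by (auto simp: mem_nbrs)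
          show "y \<notin> supbox x0 l" using y1(2) supbox_mono[of l "l2 - 1" x0] ll2 l by auto
          show "visit (supbox x0 L) y z \<le> gM" if "z \<in> supbox x0 l1" for z
            using ub(2)[of z] that supbox_mono[of l1 "l + 1" x0] l1l by auto
          show "gm \<le> ?u z \<and> ?u z \<le> gM \<and> hit (supbox x0 l1) z \<le> h" if "z \<notin> supbox x0 l" "w \<in> supbox x0 l" "nbr w z" for z w
            using ub[OF supbox_nbr[OF that(2,3)]] hit_h[OF that(1)] by auto
          show "\<exists>x\<in>supbox x0 l1. 0 < eqm (supbox x0 l1) x"
          proof -
            obtain i :: 'd where True by auto
            have "x0 \<in> supbox x0 l1" using l1 by (simp add: supbox_def)
            then have "supbox x0 l1 \<noteq> {}" by blast
            then obtain z where z: "z \<in> supbox x0 l1" "z + axis i 1 \<notin> supbox x0 l1"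
              using finite_lattice_exit[OF finite_supbox] by blast
            have "0 < 1 / n\<^sup>2" using n by simp
            also have "\<dots> \<le> eqm (supbox x0 l1) z" by (rule bdl[OF z(1) _ z(2)]) (auto simp: nbr_iff)
            finally show ?thesis using z(1) by blast
          qed
        qed (use yL RB h \<epsilon> v in \<open>auto simp: gM_def\<close>)
        then obtain m where m: "gm - gM * h \<le> m" and mb: "\<And>x. x \<in> supbox x0 l1 \<Longrightarrow> m * eqm (supbox x0 l1) x \<le> srw_hit (supbox x0 l1) (supbox x0 L) x y \<and>
           srw_hit (supbox x0 l1) (supbox x0 L) x y \<le> m * (gM / ((1 - h) * (gm - gM * h))) * eqm (supbox x0 l1) x"
          by blast
        show "\<exists>m\<ge>real N powr (- (?d + 1)). \<forall>x\<in>?A1. m * eqm ?A1 x \<le> srw_hit ?A1 ?A2 x y \<and>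
            srw_hit ?A1 ?A2 x y \<le> (1 + \<epsilon>) * m * eqm ?A1 x"
        proof (intro exI[of _ m] conjI ballI)
          have "n powr (- (?d + 1)) \<le> v0 N / 2"
          proof -
            have "4 / c0 * (4 * ?d + 1) powr \<alpha>' * n powr (- (?d + 1)) \<le> n powr (?d + 1 - 2 * \<alpha>' * r3) * n powr (- (?d + 1))"
              using E(7) by (intro mult_right_mono) auto
            also have "\<dots> = n powr (- 2 * \<alpha>' * r3)" by (simp add: add)
            finally have "4 / c0 * (4 * ?d + 1) powr \<alpha>' * n powr (- (?d + 1)) * (c0 / 4 / (4 * ?d + 1) powr \<alpha>')
              \<le> n powr (- 2 * \<alpha>' * r3) * (c0 / 4 / (4 * ?d + 1) powr \<alpha>')" using c0 by (intro mult_right_mono) auto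
            moreover have "4 / c0 * (4 * ?d + 1) powr \<alpha>' * n powr (- (?d + 1)) * (c0 / 4 / (4 * ?d + 1) powr \<alpha>') = n powr (- (?d + 1))"
              using c0 by simp
            ultimately show ?thesis unfolding v0_def n_def[symmetric] powr_minus_divide[of "4 * ?d + 1"] by (simp add: mult.commute)
          qed
          also have "\<dots> \<le> m" using v_ge RB(1) m by linarith
          finally show "real N powr (- (?d + 1)) \<le> m" by (simp add: n_def)
          fix x assume "x \<in> ?A1"
          then have x: "x \<in> supbox x0 l1" by (simp add: boxes)
          show "m * eqm ?A1 x \<le> srw_hit ?A1 ?A2 x y" using mb[OF x] by (simp add: boxes)
          have "m * (gM / ((1 - h) * (gm - gM * h))) * eqm (supbox x0 l1) x \<le> m * (1 + \<epsilon>) * eqm (supbox x0 l1) x"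
            using RB m eqm_nonneg by (intro mult_right_mono mult_left_mono) auto
          with mb[OF x] show "srw_hit ?A1 ?A2 x y \<le> (1 + \<epsilon>) * m * eqm ?A1 x" by (simp add: boxes mult.commute)
        qed
      qed
    qed
  qed
qed

section \<open>Comparison of the confined walk with the simple random walk\<close>

text \<open>The sum is the moment \<open>E[(1 - \<theta>)\<^sup>-\<^sup>T]\<close> of the exit time \<open>T\<close>, bounded by a quadratic Lyapunov function.\<close>
lemma srw_exit_exp_moment:
  fixes x0 :: "int^'d::finite"
  assumes L: "0 \<le> L" and \<theta>: "0 \<le> \<theta>" "\<theta> < 1" "\<theta> * (2 * (real CARD('d) * (real_of_int (L + 1))\<^sup>2)) \<le> 1"
    and V: "V \<subseteq> supbox x0 L" and b: "\<And>x. 0 \<le> b x" "\<And>x. b x \<le> 1"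
  shows "hs (\<lambda>x y. 1 / (1 - \<theta>) * srwP x y) V b z \<le> 2"
proof -
  define M where "M = real CARD('d) * (real_of_int (L + 1))\<^sup>2"
  have M: "0 < M" using L by (simp add: M_def)
  \<comment> \<open>\<open>v\<close> lies between one and two on the box of radius
    \<open>L + 1\<close> and drops by \<open>1 / M\<close> on average per step; with
    \<open>\<theta> * 2 \<le> 1 / M\<close> this drop pays for the factor
    \<open>1 / (1 - \<theta>)\<close>.\<close>
  define v where "v z = 2 - sq (z - x0) / M" for z
  interpret k: kernel "\<lambda>x y. 1 / (1 - \<theta>) * srwP x (y :: int^'d)" nbrs
    by unfold_locales (use \<theta> in \<open>auto simp: srwP_def mem_nbrs\<close>)
  have v1: "1 \<le> v z" if "z \<in> supbox x0 (L + 1)" for z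
    using sq_box_le[OF that, folded M_def] L M by (simp add: v_def)
  have v2: "v z \<le> 2" for z using M by (simp add: v_def)
  have avg_v: "avg v z = v z - 1 / M" for z
  proof -
    have "v = (\<lambda>z. 2 - (1 / M) * sq (z - x0))" by (auto simp: v_def)
    then have "avg v z = 2 - (1 / M) * avg sq (z - x0)" by (simp only: avg_diff avg_const avg_cmult avg_shift)
    then show ?thesis by (simp add: avg_sq v_def add_divide_distrib)
  qed
  \<comment> \<open>Truncation at one keeps the supersolution above \<open>b\<close> far from the
    box; on \<open>V\<close> and its neighbours it changes nothing.\<close>
  have "hs (\<lambda>x y. 1 / (1 - \<theta>) * srwP x y) V b z \<le> ennreal (max 1 (v z))"
  proof (rule k.hs_le[where u="\<lambda>z. max 1 (v z)"])
    fix z assume "z \<in> V"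
    then have z: "z \<in> supbox x0 L" using V by auto
    have zv: "1 \<le> v z" using v1 z supbox_mono[of L "L + 1" x0] by auto
    have "(\<Sum>y\<in>nbrs z. 1 / (1 - \<theta>) * srwP z y * max 1 (v y)) = 1 / (1 - \<theta>) * (\<Sum>y\<in>nbrs z. srwP z y * max 1 (v y))"
      by (simp add: sum_distrib_left sum_divide_distrib mult.assoc)
    also have "\<dots> = 1 / (1 - \<theta>) * avg (\<lambda>y. max 1 (v y)) z" by (simp only: srwP_sum)
    also have "avg (\<lambda>y. max 1 (v y)) z = avg v z"
      by (rule avg_cong) (use supbox_nbr[OF z] v1 in \<open>auto simp: mem_nbrs max_def\<close>)
    also have "1 / (1 - \<theta>) * avg v z \<le> v z"
    proof -
      have "\<theta> * (2 * M) \<le> 1" using \<theta>(3) unfolding M_def .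
      then have *: "\<theta> * 2 \<le> 1 / M" using M by (simp add: pos_le_divide_eq mult.assoc)
      have "\<theta> * v z \<le> \<theta> * 2" using v2[of z] \<theta> by (intro mult_left_mono) auto
      also note *
      finally have "avg v z \<le> (1 - \<theta>) * v z" by (simp add: avg_v algebra_simps)
      then show ?thesis using \<theta> by (simp add: divide_le_eq mult.commute)
    qed
    finally show "(\<Sum>y\<in>nbrs z. 1 / (1 - \<theta>) * srwP z y * max 1 (v y)) \<le> max 1 (v z)" by simp
  qed (use b in \<open>auto intro: order_trans le_max_iff_disj[THEN iffD2]\<close>)
  also have "\<dots> \<le> 2" using v2[of z] by (subst ennreal_numeral[symmetric], intro ennreal_leI) auto
  finally show ?thesis .
qed

text \<open>Multiplying a kernel by a constant weights each path by that constant to the power of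
  its length, so a numerical inequality in the length passes to exit sums.\<close>

lemma hs_scale_split:
  assumes K: "\<And>x y. 0 \<le> K x y" and b: "\<And>x. 0 \<le> b x"
    and c: "0 \<le> c0" "0 \<le> c1" "0 \<le> a0" "0 \<le> a1" "0 \<le> a2"
    and le: "\<And>n. c0 * a0 ^ n \<le> c1 * a1 ^ n + c2 * a2 ^ n" and "0 \<le> c2"
  shows "ennreal c0 * hs (\<lambda>x y. a0 * K x y) V b z \<le>
     ennreal c1 * hs (\<lambda>x y. a1 * K x y) V b z + ennreal c2 * hs (\<lambda>x y. a2 * K x y) V b z"
  unfolding hs_def lsum_cmult[symmetric] lsum_add[symmetric]
proof (rule lsum_mono)
  fix ys
  let ?p = "pathw K z ys * b (last (z # ys))" and ?n = "length ys"
  have p: "0 \<le> ?p" using pathw_nonneg[of K, OF K] b by simp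
  have s: "pathw (\<lambda>x y. c * K x y) z ys * b (last (z # ys)) = c ^ ?n * ?p" for c
    by (simp add: pathw_scale)
  have "ennreal c0 * ennreal (a0 ^ ?n * ?p) \<le> ennreal c1 * ennreal (a1 ^ ?n * ?p) + ennreal c2 * ennreal (a2 ^ ?n * ?p)"
  proof -
    have "(c0 * a0 ^ ?n) * ?p \<le> (c1 * a1 ^ ?n + c2 * a2 ^ ?n) * ?p" using le p by (rule mult_right_mono)
    then have "ennreal (c0 * (a0 ^ ?n * ?p)) \<le> ennreal (c1 * (a1 ^ ?n * ?p) + c2 * (a2 ^ ?n * ?p))"
      by (intro ennreal_leI) (simp add: algebra_simps)
    then show ?thesis using c p \<open>0 \<le> c2\<close> by (simp add: ennreal_mult ennreal_plus)
  qed
  then show "ennreal c0 * (if exits V z ys then ennreal (pathw (\<lambda>x y. a0 * K x y) z ys * b (last (z # ys))) else 0)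
    \<le> ennreal c1 * (if exits V z ys then ennreal (pathw (\<lambda>x y. a1 * K x y) z ys * b (last (z # ys))) else 0)
     + ennreal c2 * (if exits V z ys then ennreal (pathw (\<lambda>x y. a2 * K x y) z ys * b (last (z # ys))) else 0)"
    unfolding s by auto
qed

text \<open>Cutoff at length \<open>m\<close>: shorter paths are charged \<open>a ^ m\<close>,
  longer ones are paid for by the exponential moment with base \<open>b\<close>.\<close>

lemma geometric_split_upper:
  fixes a b :: real
  assumes "1 \<le> a" "a \<le> b"
  shows "a ^ n \<le> a ^ m + (a / b) ^ m * b ^ n"
proof (cases "n \<le> m")
  case True
  have "a ^ n \<le> a ^ m" using True assms by (intro power_increasing) auto
  then show ?thesis using assms by (simp add: add_increasing2)
next
  case False
  have "(a / b) ^ n \<le> (a / b) ^ m" using False assms by (intro power_decreasing) auto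
  then have "(a / b) ^ n * b ^ n \<le> (a / b) ^ m * b ^ n" using assms by (intro mult_right_mono) auto
  moreover have "(a / b) ^ n * b ^ n = a ^ n" using assms by (simp add: power_divide)
  ultimately show ?thesis using assms by (simp add: add_increasing)
qed

text \<open>The counterpart for lower bounds: paths longer than \<open>m\<close> are added back
  through the exponential moment with base \<open>b\<close>.\<close>

lemma geometric_split_lower:
  fixes a b :: real
  assumes "0 < a" "a \<le> 1" "1 \<le> b"
  shows "a ^ m \<le> a ^ n + (1 / b) ^ m * b ^ n"
proof (cases "n \<le> m")
  case True
  have "a ^ m \<le> a ^ n" using True assms by (intro power_decreasing) auto
  then show ?thesis using assms by (simp add: add_increasing2)
next
  case False
  have "b ^ m \<le> b ^ n" using False assms by (intro power_increasing) auto
  then have "1 \<le> (1 / b) ^ m * b ^ n" using assms by (simp add: power_divide)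
  moreover have "a ^ m \<le> 1" using assms by (simp add: power_le_one)
  ultimately show ?thesis using assms by (simp add: add_increasing)
qed

section \<open>The confined walk as an irreducible finite chain\<close>

locale confined =
  fixes f :: "int^'d::finite \<Rightarrow> real" and U :: "(int^'d) set"
  assumes finU: "finite U" and fpos: "\<And>x. x \<in> U \<Longrightarrow> 0 < f x"
    and U_nbr: "\<And>x. x \<in> U \<Longrightarrow> \<exists>y\<in>U. nbr x y"
    and U_conn: "\<And>Z. Z \<subseteq> U \<Longrightarrow> Z \<noteq> {} \<Longrightarrow> Z \<noteq> U \<Longrightarrow> \<exists>z\<in>Z. \<exists>y\<in>U - Z. nbr z y"
begin

text \<open>The kernel is switched off outside \<open>U\<close>, where \<open>f\<close> is uncontrolled.\<close>
definition K :: "int^'d \<Rightarrow> int^'d \<Rightarrow> real" where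
  "K x y = (if x \<in> U then cjump f U x y else 0)"

lemma crate_pos_iff: "x \<in> U \<Longrightarrow> 0 < crate f U x y \<longleftrightarrow> y \<in> U \<and> nbr x y"
  using fpos[of x] fpos[of y] by (auto simp: crate_def)

lemma crate_nonneg: "x \<in> U \<Longrightarrow> 0 \<le> crate f U x y"
  using fpos[of x] fpos[of y] by (auto simp: crate_def less_imp_le)

lemma cq_pos: "x \<in> U \<Longrightarrow> 0 < cq f U x"
proof -
  assume x: "x \<in> U"
  then obtain y where "y \<in> U" "nbr x y" using U_nbr by blast
  then show ?thesis unfolding cq_def
    using x crate_nonneg crate_pos_iff by (intro sum_pos2[of _ y]) (auto simp: mem_nbrs)
qed

lemma K_neq_0: "K x y \<noteq> 0 \<longleftrightarrow> x \<in> U \<and> y \<in> U \<and> nbr x y"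
  using crate_pos_iff[of x y] cq_pos[of x] crate_nonneg[of x y] by (auto simp: K_def cjump_def)

lemma K_sum_1: "x \<in> U \<Longrightarrow> (\<Sum>y\<in>nbrs x. K x y) = 1"
  using cq_pos[of x] by (simp add: K_def cjump_def sum_divide_distrib[symmetric] cq_def[symmetric])

sublocale conf: substoch_kernel K nbrs
proof
  fix x y
  show "0 \<le> K x y" using crate_nonneg[of x y] cq_pos[of x] by (auto simp: K_def cjump_def intro: divide_nonneg_pos)
  show "K x y = 0" if "y \<notin> nbrs x" using that K_neq_0[of x y] by (auto simp: mem_nbrs)
  show "(\<Sum>y\<in>nbrs x. K x y) \<le> 1" by (cases "x \<in> U") (simp_all add: K_sum_1, simp add: K_def)
qed auto

lemma pathw_K: "z \<in> U \<Longrightarrow> pathw (cjump f U) z ys = pathw K z ys"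
proof (induction ys arbitrary: z)
  case (Cons w ys)
  show ?case
  proof (cases "w \<in> U")
    case True
    then show ?thesis using Cons by (simp add: K_def)
  next
    case False
    then have "cjump f U z w = 0" by (simp add: cjump_def crate_def)
    then show ?thesis using Cons.prems by (simp add: K_def)
  qed
qed simp

text \<open>The chain loses no mass in \<open>U\<close>, so reachability must come from
  connectivity: every nonempty part of the proper subset \<open>W\<close> has an edge to the rest of
  \<open>U\<close>.\<close>

lemma conf_min_principle:
  assumes W: "W \<subset> U"
    and super: "\<And>z. z \<in> W \<Longrightarrow> (\<Sum>y\<in>nbrs z. K z y * u y) \<le> u z"
    and bd: "\<And>z y. z \<in> W \<Longrightarrow> y \<in> U - W \<Longrightarrow> nbr z y \<Longrightarrow> 0 \<le> u y"
    and z: "z \<in> W"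
  shows "0 \<le> u z"
proof -
  have "\<forall>z\<in>W. 0 \<le> u z"
  proof (rule conf.min_principle)
    show "finite W" using W finU finite_subset by auto
    fix Z assume "Z \<subseteq> W" "Z \<noteq> {}"
    then obtain z y where "z \<in> Z" "y \<in> U - Z" "nbr z y" using U_conn[of Z] W by blast
    then show "\<exists>z\<in>Z. \<exists>y. y \<notin> Z \<and> K z y \<noteq> 0" using \<open>Z \<subseteq> W\<close> W K_neq_0 by blast
  qed (use super bd K_neq_0 in auto)
  then show ?thesis using z by blast
qed

definition chit :: "(int^'d) set \<Rightarrow> int^'d \<Rightarrow> int^'d \<Rightarrow> real" where
  "chit V x = conf.hr V (\<lambda>w. if w = x then 1 else 0)"

lemma chit_nonneg [simp]: "0 \<le> chit V x z" by (simp add: chit_def)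

lemma chit_off: "z \<notin> V \<Longrightarrow> chit V x z = (if z = x then 1 else 0)"
  unfolding chit_def by (subst conf.hr_off) auto

lemma chit_harm: "z \<in> V \<Longrightarrow> (\<Sum>y\<in>nbrs z. K z y * chit V x y) = chit V x z"
  unfolding chit_def by (subst (2) conf.hr_rec[of _ 1]) auto

lemma hs_chit: "hs K V (\<lambda>w. if w = x then 1 else 0) z = ennreal (chit V x z)"
  unfolding chit_def by (rule conf.hs_eq_hr[of _ 1]) auto

lemma sum_nbrs_sum: "(\<Sum>y\<in>nbrs z. K z y * (\<Sum>x\<in>A. g x y)) = (\<Sum>x\<in>A. \<Sum>y\<in>nbrs z. K z y * g x y)"
  by (simp add: sum_distrib_left) (rule sum.swap)

text \<open>A finite irreducible chain reaches \<open>A\<close> almost surely. In terms of harmonic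
  functions: the sum equals one on \<open>A\<close>, and the minimum principle applies to both
  differences from the constant one.\<close>

lemma chit_total:
  assumes A: "A \<subseteq> U" "A \<noteq> {}" and z: "z \<in> U"
  shows "(\<Sum>x\<in>A. chit (- A) x z) = 1"
proof -
  have finA: "finite A" using A finU finite_subset by auto
  define s where "s z = (\<Sum>x\<in>A. chit (- A) x z)" for z
  have on: "s z = 1" if "z \<in> A" for z
    using that finA by (simp add: s_def chit_off)
  have harm: "(\<Sum>y\<in>nbrs z. K z y * s y) = s z" if "z \<notin> A" for z
    unfolding s_def sum_nbrs_sum using that by (simp add: chit_harm)
  have "s z = 1" if z: "z \<in> U - A" for z
  proof -
    have W: "U - A \<subset> U" using A by auto
    have "0 \<le> 1 - s z"
      by (rule conf_min_principle[OF W, of "\<lambda>z. 1 - s z"])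
        (use z on harm K_sum_1 in \<open>auto simp: right_diff_distrib sum_subtractf\<close>)
    moreover have "0 \<le> s z - 1"
      by (rule conf_min_principle[OF W, of "\<lambda>z. s z - 1"])
        (use z on harm K_sum_1 in \<open>auto simp: right_diff_distrib sum_subtractf\<close>)
    ultimately show ?thesis by simp
  qed
  then show ?thesis using on z unfolding s_def by (cases "z \<in> A") auto
qed

lemma conf_exit_total:
  assumes A: "A \<subset> U" and z: "z \<in> U"
  shows "hs K A (\<lambda>_. 1) z = 1"
proof -
  define s where "s = conf.hr A (\<lambda>_. 1)"
  have on: "s z = 1" if "z \<notin> A" for z using that by (simp add: s_def conf.hr_off)
  have harm: "(\<Sum>y\<in>nbrs z. K z y * s y) = s z" if "z \<in> A" for z
    unfolding s_def using that by (subst (2) conf.hr_rec[of _ 1]) auto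
  have "s z = 1" if z: "z \<in> A" for z
  proof -
    have "0 \<le> 1 - s z"
      by (rule conf_min_principle[OF A, of "\<lambda>z. 1 - s z"])
        (use z on harm K_sum_1 A in \<open>auto simp: right_diff_distrib sum_subtractf\<close>)
    moreover have "0 \<le> s z - 1"
      by (rule conf_min_principle[OF A, of "\<lambda>z. s z - 1"])
        (use z on harm K_sum_1 A in \<open>auto simp: right_diff_distrib sum_subtractf\<close>)
    ultimately show ?thesis by simp
  qed
  then have "s z = 1" using on by (cases "z \<in> A") auto
  then show ?thesis unfolding s_def by (subst conf.hs_eq_hr[of _ 1]) auto
qed

text \<open>An interior point of \<open>A\<close> has no neighbour outside, so it cannot be the
  entrance point; its indicator already serves as a supersolution.\<close>

lemma chit_interior:
  assumes x: "nbrs x \<subseteq> A" and z: "z \<notin> A" and "x \<in> A"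
  shows "chit (- A) x z = 0"
proof -
  have "chit (- A) x z \<le> (if z = x then 1 else 0)"
    unfolding chit_def
  proof (rule conf.hr_le)
    fix z assume "z \<in> - A"
    then have "z \<notin> nbrs x" using x by auto
    then have "x \<notin> nbrs z" by (simp add: mem_nbrs nbr_sym[of x z])
    then have "(\<Sum>y\<in>nbrs z. K z y * (if y = x then 1 else 0)) = 0" by (intro sum.neutral) auto
    then show "(\<Sum>y\<in>nbrs z. K z y * (if y = x then 1 else 0)) \<le> (if z = x then 1 else 0)" by simp
  qed auto
  also have "\<dots> = 0" using z \<open>x \<in> A\<close> by auto
  finally show ?thesis using chit_nonneg[of "- A" x z] by (rule antisym)
qed

text \<open>The Doob transform: up to the local normalisation \<open>cq\<close>, the jump kernel is
  \<open>srwP\<close> conjugated by \<open>f\<close>. All neighbours must lie in \<open>U\<close>,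
  since otherwise \<open>cq\<close> would miss terms of the average.\<close>

lemma K_eq_srwP:
  assumes "z \<in> U" and sub: "nbrs z \<subseteq> U"
  shows "K z w * f z = srwP z w * f w / cq f U z" and "cq f U z = avg f z / f z"
proof -
  have fz: "0 < f z" using assms fpos by auto
  show "K z w * f z = srwP z w * f w / cq f U z"
    using assms fz by (auto simp: K_def cjump_def crate_def srwP_def mem_nbrs)
  show "cq f U z = avg f z / f z"
    unfolding cq_def avg_def using sub by (simp add: crate_def mem_nbrs sum_divide_distrib subset_iff)
qed

end

section \<open>Comparison of path weights inside the box\<close>

locale confined_box = confined f U for f :: "int^'d::finite \<Rightarrow> real" and U +
  fixes x0 :: "int^'d" and L :: int and \<kappa> :: real
  assumes L: "0 \<le> L" and boxU: "supbox x0 (L + 1) \<subseteq> U"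
    and \<kappa>: "0 \<le> \<kappa>" "\<kappa> < 1" and slow: "\<And>z y. z \<in> supbox x0 L \<Longrightarrow> nbr z y \<Longrightarrow> \<bar>f y - f z\<bar> \<le> \<kappa> * f z"
begin

lemma nbrsU: "z \<in> supbox x0 L \<Longrightarrow> z \<in> U \<and> nbrs z \<subseteq> U"
  using supbox_nbr[of z x0 L] supbox_mono[of L "L + 1" x0] boxU by (auto simp: mem_nbrs)

lemma cq_near_1: "z \<in> supbox x0 L \<Longrightarrow> \<bar>cq f U z - 1\<bar> \<le> \<kappa>"
proof -
  assume z: "z \<in> supbox x0 L"
  have fz: "0 < f z" using nbrsU[OF z] fpos by auto
  have "avg f z \<le> avg (\<lambda>_. (1 + \<kappa>) * f z) z"
  proof (rule avg_mono)
    fix y assume "y \<in> nbrs z"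
    then show "f y \<le> (1 + \<kappa>) * f z" using slow[OF z, of y] by (simp add: mem_nbrs abs_le_iff algebra_simps)
  qed
  moreover have "avg (\<lambda>_. (1 - \<kappa>) * f z) z \<le> avg f z"
  proof (rule avg_mono)
    fix y assume "y \<in> nbrs z"
    then show "(1 - \<kappa>) * f z \<le> f y" using slow[OF z, of y] by (simp add: mem_nbrs abs_le_iff algebra_simps)
  qed
  ultimately have "avg f z / f z \<le> 1 + \<kappa>" "1 - \<kappa> \<le> avg f z / f z" using fz by (simp_all add: field_simps)
  then show ?thesis using K_eq_srwP(2)[of z] nbrsU[OF z] by (simp add: abs_le_iff)
qed

text \<open>The ratios \<open>f w / f z\<close> telescope to the end points of the path, and each
  step leaves a factor \<open>1 / cq\<close> between \<open>1 / (1 + \<kappa>)\<close> and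
  \<open>1 / (1 - \<kappa>)\<close>.\<close>

lemma pathw_compare:
  assumes V: "V \<subseteq> supbox x0 L" and ex: "exits V z ys" and z: "z \<in> U"
  shows "pathw K z ys * f z \<le> (1 / (1 - \<kappa>)) ^ length ys * pathw srwP z ys * f (last (z # ys))"
    and "(1 / (1 + \<kappa>)) ^ length ys * pathw srwP z ys * f (last (z # ys)) \<le> pathw K z ys * f z"
proof -
  have "pathw K z ys * f z \<le> (1 / (1 - \<kappa>)) ^ length ys * pathw srwP z ys * f (last (z # ys)) \<and>
    (1 / (1 + \<kappa>)) ^ length ys * pathw srwP z ys * f (last (z # ys)) \<le> pathw K z ys * f z"
    using ex z
  proof (induction ys arbitrary: z)
    case (Cons w ys)
    then have zV: "z \<in> supbox x0 L" and ex: "exits V w ys" using V by auto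
    note U = nbrsU[OF zV]
    have pos: "0 \<le> pathw K z ys" "0 \<le> pathw srwP z ys" for z
      by (simp_all add: pathw_nonneg srw.K_nonneg conf.K_nonneg)
    show ?case
    proof (cases "nbr z w")
      case False
      then have "K z w = 0" "srwP z w = 0" using K_neq_0 by (auto simp: srwP_def)
      then show ?thesis by simp
    next
      case True
      then have wU: "w \<in> U" using U by (auto simp: mem_nbrs)
      note IH = Cons.IH[OF ex wU]
      let ?q = "cq f U z"
      have q: "1 - \<kappa> \<le> ?q" "?q \<le> 1 + \<kappa>" "0 < ?q" using cq_near_1[OF zV] \<kappa> by (auto simp: abs_le_iff)
      have iq: "1 / (1 + \<kappa>) \<le> 1 / ?q" "1 / ?q \<le> 1 / (1 - \<kappa>)" using q \<kappa> by (auto intro!: divide_left_mono mult_pos_pos)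
      have e: "pathw K z (w # ys) * f z = (1 / ?q) * srwP z w * (pathw K w ys * f w)"
      proof -
        have "pathw K z (w # ys) * f z = (K z w * f z) * pathw K w ys" by simp
        also have "\<dots> = (1 / ?q) * srwP z w * (pathw K w ys * f w)" unfolding K_eq_srwP(1)[OF U[THEN conjunct1] U[THEN conjunct2]] by simp
        finally show ?thesis .
      qed
      have fw: "0 \<le> pathw K w ys * f w" using pos[of w] fpos[OF wU] by simp
      \<comment> \<open>The last vertex is not known to lie in \<open>U\<close> at this point, so
        the sign is extracted from the induction hypothesis.\<close>
      have lastU: "0 \<le> pathw srwP w ys * f (last (w # ys))"
      proof -
        have "0 \<le> (1 / (1 - \<kappa>)) ^ length ys * (pathw srwP w ys * f (last (w # ys)))" using IH fw by (simp add: mult.assoc)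
        moreover have "0 < (1 / (1 - \<kappa>)) ^ length ys" using \<kappa> by simp
        ultimately show ?thesis by (simp only: zero_le_mult_iff) auto
      qed
      have "(1 / ?q) * srwP z w * (pathw K w ys * f w) \<le> (1 / (1 - \<kappa>)) * srwP z w * ((1 / (1 - \<kappa>)) ^ length ys * pathw srwP w ys * f (last (w # ys)))"
        by (rule mult_mono[OF mult_right_mono[OF iq(2)] IH[THEN conjunct1]]) (use fw \<kappa> srw.K_nonneg[of z w] in auto)
      moreover have "(1 / (1 + \<kappa>)) * srwP z w * ((1 / (1 + \<kappa>)) ^ length ys * pathw srwP w ys * f (last (w # ys))) \<le> (1 / ?q) * srwP z w * (pathw K w ys * f w)"
      proof (rule mult_mono[OF mult_right_mono[OF iq(1)] IH[THEN conjunct2]])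
        have "0 \<le> (1 / (1 + \<kappa>)) ^ length ys * (pathw srwP w ys * f (last (w # ys)))"
          using \<kappa> by (intro mult_nonneg_nonneg[OF _ lastU]) auto
        then show "0 \<le> (1 / (1 + \<kappa>)) ^ length ys * pathw srwP w ys * f (last (w # ys))" by (simp only: mult.assoc)
      qed (use q srw.K_nonneg[of z w] in auto)
      ultimately show ?thesis unfolding e by (simp add: ac_simps)
    qed
  qed simp
  then show "pathw K z ys * f z \<le> (1 / (1 - \<kappa>)) ^ length ys * pathw srwP z ys * f (last (z # ys))"
    "(1 / (1 + \<kappa>)) ^ length ys * pathw srwP z ys * f (last (z # ys)) \<le> pathw K z ys * f z" by auto
qed

text \<open>Up to length \<open>n\<close> the error per step is harmless; longer paths are absorbed
  by the exponential moment of the exit time, at most two by \<open>srw_exit_exp_moment\<close>. The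
  cutoff \<open>n\<close> stays free and is chosen of order \<open>N powr (3/4)\<close> in the
  end.\<close>

lemma chit_srw_hit_bounds:
  assumes V: "V \<subseteq> supbox x0 L" and z: "z \<in> V" and x: "x \<in> U" "x \<notin> V"
    and \<theta>: "\<kappa> \<le> \<theta>" "\<theta> < 1" "\<theta> * (2 * (real CARD('d) * (real_of_int (L + 1))\<^sup>2)) \<le> 1"
  defines "p \<equiv> srw.hr V (\<lambda>w. if w = x then 1 else 0) z"
  shows "f z * chit V x z \<le> f x * ((1 / (1 - \<kappa>)) ^ n * p + 2 * ((1 - \<theta>) / (1 - \<kappa>)) ^ n)" (is ?A)
    and "f x * ((1 / (1 + \<kappa>)) ^ n * p - 2 * (1 - \<theta>) ^ n) \<le> f z * chit V x z" (is ?B)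
proof -
  let ?b = "\<lambda>w. if w = x then 1 else 0 :: real"
  have zU: "z \<in> U" using z V nbrsU by auto
  have fz: "0 < f z" and fx: "0 < f x" using fpos zU x by auto
  define c1 where "c1 = 1 / (1 - \<kappa>)"
  define c2 where "c2 = 1 / (1 + \<kappa>)"
  define b where "b = 1 / (1 - \<theta>)"
  have c: "1 \<le> c1" "c1 \<le> b" "0 < c2" "c2 \<le> 1" "1 \<le> b"
    using \<kappa> \<theta> by (auto simp: c1_def c2_def b_def intro!: divide_left_mono mult_pos_pos)
  have hP: "hs srwP V ?b z = ennreal p" unfolding p_def by (rule srw.hs_eq_hr[of _ 1]) auto
  have hb: "hs (\<lambda>x y. b * srwP x y) V ?b z \<le> 2"
    unfolding b_def by (rule srw_exit_exp_moment[OF L _ \<theta>(2,3) V]) (use \<kappa> \<theta> in auto)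
  have p: "0 \<le> p" by (simp add: p_def)
  have up: "ennreal (f z) * hs K V ?b z \<le> ennreal (f x) * hs (\<lambda>x y. c1 * srwP x y) V ?b z"
    unfolding hs_def lsum_cmult[symmetric]
  proof (rule lsum_mono)
    fix ys
    show "ennreal (f z) * (if exits V z ys then ennreal (pathw K z ys * ?b (last (z # ys))) else 0)
      \<le> ennreal (f x) * (if exits V z ys then ennreal (pathw (\<lambda>x y. c1 * srwP x y) z ys * ?b (last (z # ys))) else 0)"
    proof (cases "exits V z ys \<and> last (z # ys) = x")
      case True
      then have "pathw K z ys * f z \<le> c1 ^ length ys * pathw srwP z ys * f x"
        using pathw_compare(1)[OF V _ zU, of ys] by (simp add: c1_def)
      then have "ennreal (f z * pathw K z ys) \<le> ennreal (f x * (c1 ^ length ys * pathw srwP z ys))"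
        by (intro ennreal_leI) (simp add: mult.commute)
      then show ?thesis using True fz fx by (simp add: pathw_scale ennreal_mult')
    qed auto
  qed
  have lo: "ennreal (f x) * hs (\<lambda>x y. c2 * srwP x y) V ?b z \<le> ennreal (f z) * hs K V ?b z"
    unfolding hs_def lsum_cmult[symmetric]
  proof (rule lsum_mono)
    fix ys
    show "ennreal (f x) * (if exits V z ys then ennreal (pathw (\<lambda>x y. c2 * srwP x y) z ys * ?b (last (z # ys))) else 0)
      \<le> ennreal (f z) * (if exits V z ys then ennreal (pathw K z ys * ?b (last (z # ys))) else 0)"
    proof (cases "exits V z ys \<and> last (z # ys) = x")
      case True
      then have "c2 ^ length ys * pathw srwP z ys * f x \<le> pathw K z ys * f z"
        using pathw_compare(2)[OF V _ zU, of ys] by (simp add: c2_def)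
      then have "ennreal (f x * (c2 ^ length ys * pathw srwP z ys)) \<le> ennreal (f z * pathw K z ys)"
        by (intro ennreal_leI) (simp add: mult.commute)
      then show ?thesis using True fz fx by (simp add: pathw_scale ennreal_mult')
    qed auto
  qed
  show ?A
  proof -
    have "ennreal 1 * hs (\<lambda>x y. c1 * srwP x y) V ?b z \<le>
       ennreal (c1 ^ n) * hs (\<lambda>x y. 1 * srwP x y) V ?b z + ennreal ((c1 / b) ^ n) * hs (\<lambda>x y. b * srwP x y) V ?b z"
      using geometric_split_upper[OF c(1,2)] c by (intro hs_scale_split) (auto simp: srw.K_nonneg)
    also have "\<dots> \<le> ennreal (c1 ^ n) * ennreal p + ennreal ((c1 / b) ^ n) * 2"
      using hb by (intro add_mono mult_left_mono) (auto simp: hP)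
    also have "\<dots> = ennreal (c1 ^ n * p + 2 * (c1 / b) ^ n)"
      using c p by (simp add: ennreal_mult ennreal_plus mult.commute)
    finally have "ennreal (f x) * hs (\<lambda>x y. c1 * srwP x y) V ?b z \<le> ennreal (f x) * ennreal (c1 ^ n * p + 2 * (c1 / b) ^ n)"
      by (intro mult_left_mono) auto
    with up have "ennreal (f z) * ennreal (chit V x z) \<le> ennreal (f x) * ennreal (c1 ^ n * p + 2 * (c1 / b) ^ n)"
      unfolding hs_chit by (rule order_trans)
    then have "ennreal (f z * chit V x z) \<le> ennreal (f x * (c1 ^ n * p + 2 * (c1 / b) ^ n))"
      using fz fx c p by (simp add: ennreal_mult)
    then have "f z * chit V x z \<le> f x * (c1 ^ n * p + 2 * (c1 / b) ^ n)"
      using fx c p by (subst (asm) ennreal_le_iff) auto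
    moreover have "c1 / b = (1 - \<theta>) / (1 - \<kappa>)" by (simp add: c1_def b_def)
    ultimately show ?A by (simp add: c1_def)
  qed
  show ?B
  proof -
    have "ennreal (c2 ^ n) * hs (\<lambda>x y. 1 * srwP x y) V ?b z \<le>
       ennreal 1 * hs (\<lambda>x y. c2 * srwP x y) V ?b z + ennreal ((1 / b) ^ n) * hs (\<lambda>x y. b * srwP x y) V ?b z"
      using geometric_split_lower[OF c(3,4,5)] c by (intro hs_scale_split) (auto simp: srw.K_nonneg)
    also have "\<dots> \<le> hs (\<lambda>x y. c2 * srwP x y) V ?b z + ennreal ((1 / b) ^ n) * 2"
      using hb by (intro add_mono mult_left_mono) auto
    finally have "ennreal (f x) * (ennreal (c2 ^ n) * ennreal p) \<le> ennreal (f x) * (hs (\<lambda>x y. c2 * srwP x y) V ?b z + ennreal ((1 / b) ^ n) * 2)"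
      unfolding hP[symmetric] by (intro mult_left_mono) auto
    also have "\<dots> \<le> ennreal (f z) * ennreal (chit V x z) + ennreal (f x) * (ennreal ((1 / b) ^ n) * 2)"
      using lo unfolding hs_chit distrib_left by (intro add_mono) auto
    also have "\<dots> = ennreal (f z * chit V x z + f x * (2 * (1 / b) ^ n))"
      using fz fx c by (simp add: ennreal_mult ennreal_plus mult.commute)
    finally have "ennreal (f x * (c2 ^ n * p)) \<le> ennreal (f z * chit V x z + f x * (2 * (1 / b) ^ n))"
      using fx c p by (simp add: ennreal_mult)
    then have "f x * (c2 ^ n * p) \<le> f z * chit V x z + f x * (2 * (1 / b) ^ n)"
      using fz fx c by (subst (asm) ennreal_le_iff) (auto intro!: add_nonneg_nonneg mult_nonneg_nonneg)
    moreover have "1 / b = 1 - \<theta>" by (simp add: b_def)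
    ultimately show ?B by (simp add: c2_def algebra_simps)
  qed
qed

text \<open>A lower bound for the ratio of two hitting probabilities that is known for walks started at the
  shell \<open>S\<close> propagates to all of \<open>U\<close> outside the shell: at a point of \<open>S\<close> where the bound is worst, the walk either
  enters \<open>A1\<close> before leaving \<open>A2\<close>, or it starts afresh outside \<open>A2\<close>.\<close>
lemma hitting_ratio_propagates:
  assumes A1: "A1 = supbox x0 l1" "0 \<le> l1" and l2: "l1 < l2 - 1" "l2 \<le> L" and A2: "A2 = supbox x0 L"
    and x: "x \<in> A1" "x' \<in> A1" and e: "0 \<le> e" "0 \<le> e'"
    and S: "S = supbox x0 l2 - supbox x0 (l2 - 1)"
    and ratio: "\<And>y. y \<in> S \<Longrightarrow> e * chit (A2 - A1) x' y \<le> e' * chit (A2 - A1) x y \<and> 0 < chit (A2 - A1) x y"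
    and z: "z \<in> U" "z \<notin> supbox x0 (l2 - 1)"
  shows "e * chit (- A1) x' z \<le> e' * chit (- A1) x z"
proof -
  define D where "D z = e' * chit (- A1) x z - e * chit (- A1) x' z" for z
  have A2U: "A2 \<subseteq> U" unfolding A2 using nbrsU by auto
  have sub: "A1 \<subseteq> supbox x0 (l2 - 1)" "supbox x0 (l2 - 1) \<subseteq> supbox x0 l2" "supbox x0 l2 \<subseteq> A2"
    unfolding A1 A2 by (rule supbox_mono; use l2 in simp)+
  have finS: "finite S" unfolding S by simp
  have finA1: "finite A1" by (simp add: A1)
  have D_harm: "(\<Sum>y\<in>nbrs z. K z y * D y) = D z" if "z \<notin> A1" for z
  proof -
    have "(\<Sum>y\<in>nbrs z. K z y * D y) = e' * (\<Sum>y\<in>nbrs z. K z y * chit (- A1) x y) - e * (\<Sum>y\<in>nbrs z. K z y * chit (- A1) x' y)"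
      by (simp add: D_def right_diff_distrib sum_subtractf sum_distrib_left mult.left_commute)
    then show ?thesis using that by (simp add: chit_harm D_def)
  qed
  have x0S: "\<exists>y\<in>S. True"
  proof -
    obtain i :: 'd where True by auto
    have "x0 + axis i l2 \<in> S" using l2 A1(2) by (auto simp: S supbox_def axis_def intro!: exI[of _ i])
    then show ?thesis by auto
  qed
  define W where "W = U - supbox x0 l2"
  have "x \<in> U" "x \<in> supbox x0 l2" using sub A2U x by blast+
  then have WU: "W \<subset> U" unfolding W_def by blast
  \<comment> \<open>A walk from further out must cross the shell before coming closer, so a lower
    bound on \<open>S\<close> extends outward by the minimum principle.\<close>
  have outer: "m \<le> D z" if m: "\<And>y. y \<in> S \<Longrightarrow> m \<le> D y" and z: "z \<in> U" "z \<notin> supbox x0 (l2 - 1)" for m z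
  proof (cases "z \<in> supbox x0 l2")
    case True
    then show ?thesis using m z by (auto simp: S)
  next
    case False
    have "0 \<le> D z - m"
    proof (rule conf_min_principle[OF WU, of "\<lambda>z. D z - m"])
      fix z assume zW: "z \<in> W"
      then have "z \<notin> A1" "z \<in> U" using sub by (auto simp: W_def)
      then show "(\<Sum>y\<in>nbrs z. K z y * (D y - m)) \<le> D z - m"
        by (simp add: right_diff_distrib sum_subtractf D_harm sum_distrib_right[symmetric] K_sum_1)
    next
      fix z y assume zW: "z \<in> W" and y: "y \<in> U - W" and n: "nbr z y"
      have "y \<in> supbox x0 l2" using y by (auto simp: W_def)
      moreover have "y \<notin> supbox x0 (l2 - 1)"
        using supbox_nbr[of y x0 "l2 - 1" z] n nbr_sym[of z y] zW by (auto simp: W_def)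
      ultimately show "0 \<le> D y - m" using m[of y] by (auto simp: S)
    qed (use False z in \<open>simp add: W_def\<close>)
    then show ?thesis by simp
  qed
  define dS where "dS = Min (D ` S)"
  have dS: "dS \<le> D y" if "y \<in> S" for y using that finS by (simp add: dS_def)
  have "dS \<in> D ` S" unfolding dS_def using finS x0S by (intro Min_in) auto
  then obtain y0 where y0: "y0 \<in> S" "D y0 = dS" by auto
  have "0 \<le> dS"
  proof (rule ccontr)
    assume neg: "\<not> 0 \<le> dS"
    let ?p = "chit (A2 - A1)"
    define bb where "bb z = e' * ?p x z - e * ?p x' z" for z
    define s where "s z = (\<Sum>x\<in>A1. ?p x z)" for z
    have WA: "A2 - A1 \<subset> U" using A2U x sub by auto
    have y0A: "y0 \<in> A2 - A1" using y0(1) sub by (auto simp: S)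
    have harm_p: "(\<Sum>y\<in>nbrs z. K z y * ?p x y) = ?p x z" if "z \<in> A2 - A1" for x z
      using that by (rule chit_harm)
    \<comment> \<open>The strong Markov property at the exit from \<open>A2 - A1\<close> as an
      inequality: with probability \<open>s\<close> the walk enters \<open>A1\<close>, which is
      accounted for by \<open>bb\<close>, and otherwise it stands outside \<open>A2\<close>, where
      \<open>D\<close> is at least \<open>dS\<close> by \<open>outer\<close>.\<close>
    have "0 \<le> D y0 - bb y0 - dS * (1 - s y0)"
    proof (rule conf_min_principle[OF WA, of "\<lambda>z. D z - bb z - dS * (1 - s z)"])
      fix z assume z: "z \<in> A2 - A1"
      then have zU: "z \<in> U" using A2U by auto
      have hb: "(\<Sum>y\<in>nbrs z. K z y * bb y) = bb z"
      proof -
        have "(\<Sum>y\<in>nbrs z. K z y * bb y) = e' * (\<Sum>y\<in>nbrs z. K z y * ?p x y) - e * (\<Sum>y\<in>nbrs z. K z y * ?p x' y)"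
          by (simp add: bb_def right_diff_distrib sum_subtractf sum_distrib_left mult.left_commute)
        then show ?thesis by (simp add: harm_p[OF z] bb_def)
      qed
      have hsum: "(\<Sum>y\<in>nbrs z. K z y * s y) = s z" unfolding s_def sum_nbrs_sum by (simp add: harm_p[OF z])
      have "(\<Sum>y\<in>nbrs z. K z y * (D y - bb y - dS * (1 - s y)))
        = (\<Sum>y\<in>nbrs z. K z y * D y) - (\<Sum>y\<in>nbrs z. K z y * bb y) - dS * ((\<Sum>y\<in>nbrs z. K z y) - (\<Sum>y\<in>nbrs z. K z y * s y))"
        by (simp add: algebra_simps sum_subtractf sum.distrib sum_distrib_left)
      then show "(\<Sum>y\<in>nbrs z. K z y * (D y - bb y - dS * (1 - s y))) \<le> D z - bb z - dS * (1 - s z)"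
        using z D_harm[of z] hb hsum K_sum_1[OF zU] by simp
    next
      fix z y assume "z \<in> A2 - A1" and y: "y \<in> U - (A2 - A1)" and "nbr z y"
      show "0 \<le> D y - bb y - dS * (1 - s y)"
      proof (cases "y \<in> A1")
        case True
        then show ?thesis using finA1 by (simp add: s_def bb_def D_def chit_off)
      next
        case False
        then have yA2: "y \<notin> A2" using y by auto
        then have "bb y = 0" using x False sub by (auto simp: bb_def chit_off)
        moreover have "s y = 0" unfolding s_def by (rule sum.neutral) (use False yA2 in \<open>auto simp: chit_off\<close>)
        moreover have "y \<notin> supbox x0 (l2 - 1)" using yA2 sub by auto
        then have "dS \<le> D y" using outer[OF dS] y by auto
        ultimately show ?thesis by simp
      qed
    qed (rule y0A)
    moreover have "0 \<le> bb y0" using ratio[OF y0(1)] by (simp add: bb_def)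
    \<comment> \<open>At the minimiser \<open>D y0 = dS\<close>, so \<open>dS\<close> is at least
      \<open>dS * (1 - s y0)\<close>; since \<open>A1\<close> is entered with positive probability,
      a negative \<open>dS\<close> is impossible.\<close>
    ultimately have "0 \<le> dS * s y0" by (simp add: y0 algebra_simps)
    moreover have "?p x y0 \<le> s y0" unfolding s_def using x finA1 by (intro member_le_sum) auto
    then have "0 < s y0" using ratio[OF y0(1)] by linarith
    ultimately show False using neg by (simp add: zero_le_mult_iff)
  qed
  then have "0 \<le> D z" using outer[of 0 z] dS z by (meson order_trans)
  then show ?thesis by (simp add: D_def)
qed

end

section \<open>Verification of the box hypotheses for the profile\<close>

lemma rv_axis: "rv (z + axis i s) = rv z + of_int s *\<^sub>R axis i 1"
  by (auto simp: rv_def vec_eq_iff axis_def)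

lemma norm_rv_box:
  fixes x0 :: "int^'d::finite"
  assumes "z \<in> supbox x0 m" "0 \<le> m"
  shows "norm (rv z) \<le> norm (rv x0) + real CARD('d) * real_of_int m"
proof -
  have "rv z = rv x0 + rv (z - x0)" by (simp add: rv_def vec_eq_iff)
  then have "norm (rv z) \<le> norm (rv x0) + norm (rv (z - x0))" by (simp add: norm_triangle_ineq)
  also have "norm (rv (z - x0)) \<le> (\<Sum>i\<in>UNIV. \<bar>rv (z - x0) $ i\<bar>)" by (rule norm_le_l1_cart)
  also have "\<dots> = real (ell1 (z - x0))" by (simp add: rv_def ell1_def)
  also have "\<dots> \<le> real CARD('d) * real_of_int m" by (rule ell1_box[OF assms])
  finally show ?thesis by simp
qed

lemma finite_norm_rv_le: "finite {z :: int^'d::finite. norm (rv z) \<le> c}"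
proof (rule finite_subset[OF _ finite_supbox[of 0 "\<lceil>c\<rceil>"]], rule subsetI)
  fix z :: "int^'d" assume "z \<in> {z. norm (rv z) \<le> c}"
  then have "norm (rv z) \<le> c" by simp
  then have "\<bar>rv z $ i\<bar> \<le> c" for i using component_le_norm_cart[of "rv z" i] by linarith
  then have "\<bar>real_of_int (z $ i)\<bar> \<le> c" for i by (simp add: rv_def)
  then show "z \<in> supbox 0 \<lceil>c\<rceil>" by (auto simp: supbox_def) (metis le_of_int_ceiling of_int_abs of_int_le_iff order_trans)
qed

text \<open>\<open>pd\<close> is defined through one-dimensional derivatives, so the mean value
  theorem is applied along an axis segment, which convexity keeps inside \<open>C\<close>.\<close>

lemma smooth_axis_mvt:
  fixes h :: "real^'d \<Rightarrow> real"
  assumes sm: "smooth_on S h" and C: "convex C" "C \<subseteq> S"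
    and B: "\<And>x. x \<in> C \<Longrightarrow> \<bar>pd [i] h x\<bar> \<le> B"
    and x: "x \<in> C" "x + t *\<^sub>R axis i 1 \<in> C" and t: "0 \<le> t"
  shows "\<bar>h (x + t *\<^sub>R axis i 1) - h x\<bar> \<le> B * t"
proof (cases "t = 0")
  case False
  then have t: "0 < t" using t by simp
  define g where "g s = h (x + s *\<^sub>R axis i 1)" for s
  have inC: "x + s *\<^sub>R axis i 1 \<in> C" if "0 \<le> s" "s \<le> t" for s
  proof -
    have "(1 - s / t) *\<^sub>R x + (s / t) *\<^sub>R (x + t *\<^sub>R axis i 1) \<in> C"
      using that t x by (intro convexD_alt[OF C(1)]) (auto simp: divide_le_eq)
    moreover have "(1 - s / t) *\<^sub>R x + (s / t) *\<^sub>R (x + t *\<^sub>R axis i 1) = x + s *\<^sub>R axis i 1"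
      using t by (simp add: scaleR_left_diff_distrib scaleR_right_distrib)
    ultimately show ?thesis by simp
  qed
  have der: "DERIV g s :> pd [i] h (x + s *\<^sub>R axis i 1)" if s: "0 \<le> s" "s \<le> t" for s
  proof -
    let ?y = "x + s *\<^sub>R axis i 1"
    let ?k = "\<lambda>r. h (?y + r *\<^sub>R axis i 1)"
    have "?y \<in> S" using inC[OF s] C(2) by auto
    moreover have "\<forall>i. \<forall>x\<in>S. (\<lambda>t. pd [] h (x + t *\<^sub>R axis i 1)) differentiable (at 0)"
      using sm unfolding smooth_on_def by blast
    ultimately have "?k differentiable (at 0)" by simp
    then have "DERIV ?k 0 :> deriv ?k 0" by (simp add: DERIV_deriv_iff_real_differentiable)
    then have "DERIV ?k (s + - s) :> pd [i] h ?y" by simp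
    then have "DERIV (\<lambda>r. ?k (r + - s)) s :> pd [i] h ?y" by (subst (asm) DERIV_shift)
    moreover have "(\<lambda>r. ?k (r + - s)) = g"
      by (auto simp: g_def fun_eq_iff algebra_simps)
    ultimately show ?thesis by simp
  qed
  obtain s where s: "0 < s" "s < t" "g t - g 0 = (t - 0) * pd [i] h (x + s *\<^sub>R axis i 1)"
    using MVT2[OF t, of g "\<lambda>s. pd [i] h (x + s *\<^sub>R axis i 1)"] der by auto
  have "\<bar>pd [i] h (x + s *\<^sub>R axis i 1)\<bar> \<le> B" using s by (intro B inC) auto
  then show ?thesis using s t by (simp add: g_def abs_mult mult.commute mult_right_mono)
qed simp

lemma lattice_toward_zero:
  fixes z :: "int^'d::finite"
  assumes "z \<noteq> 0"
  shows "\<exists>y. nbr z y \<and> sq y < sq z"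
proof -
  obtain i where i: "z $ i \<noteq> 0" using assms by (auto simp: vec_eq_iff)
  define s :: int where "s = - sgn (z $ i)"
  have s: "s = 1 \<or> s = -1" using i by (auto simp: s_def sgn_if)
  have "(z $ i) * s \<le> -1" using i by (auto simp: s_def sgn_if)
  then have "real_of_int ((z $ i) * s) \<le> real_of_int (-1)" by (simp only: of_int_le_iff)
  then have "sq (z + axis i s) < sq z" using s by (auto simp: sq_step)
  moreover have "nbr z (z + axis i s)" using s by (auto simp: nbr_iff)
  ultimately show ?thesis by blast
qed

lemma Uball_sq: "0 \<le> R \<Longrightarrow> z \<in> Uball R N \<longleftrightarrow> sq z < (real N * R)\<^sup>2"
  unfolding Uball_def norm_rv_sq[symmetric]
  using power_strict_mono[of "norm (rv z)" "real N * R" 2] power2_less_imp_less[of "norm (rv z)" "real N * R"] by auto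

text \<open>Of \<open>Z\<close> and its complement in the ball, take the one missing the origin. Its
  point of least norm has a neighbour closer to the origin, which stays in the ball and hence
  belongs to the other set.\<close>

lemma Uball_connected:
  fixes Z :: "(int^'d::finite) set"
  assumes R: "0 \<le> R" and Z: "Z \<subseteq> Uball R N" "Z \<noteq> {}" "Z \<noteq> Uball R N"
  shows "\<exists>z\<in>Z. \<exists>y\<in>Uball R N - Z. nbr z y"
proof -
  let ?U = "Uball R N :: (int^'d) set"
  have finU: "finite ?U" by (rule finite_subset[OF _ finite_norm_rv_le[of "real N * R"]]) (auto simp: Uball_def)
  define Y where "Y = (if 0 \<in> Z then ?U - Z else Z)"
  have Y: "Y \<subseteq> ?U" "Y \<noteq> {}" "0 \<notin> Y" "finite Y" using Z finU finite_subset by (auto simp: Y_def)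
  define u where "u = arg_min_on sq Y"
  have u: "u \<in> Y" "\<And>y. y \<in> Y \<Longrightarrow> sq u \<le> sq y"
    using arg_min_if_finite[OF Y(4,2), of sq] by (auto simp: u_def not_less)
  then have "u \<noteq> 0" using Y by auto
  then obtain y where y: "nbr u y" "sq y < sq u" using lattice_toward_zero by blast
  have "y \<notin> Y" using u(2) y(2) by force
  moreover have "y \<in> ?U" using y(2) u(1) Y(1) Uball_sq[OF R, of u N] Uball_sq[OF R, of y N] by auto
  ultimately show ?thesis using u(1) y(1) nbr_sym[of u y] by (auto simp: Y_def split: if_splits)
qed

lemma nbr_ordered: "nbr z y \<Longrightarrow> \<exists>i. y = z + axis i 1 \<or> z = y + axis i 1"
  unfolding nbr_iff by (auto simp: vec_eq_iff axis_def)

lemma nbhd_norm_bound: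
  assumes "compact D" "\<delta> < rD D / 2" "x \<in> nbhd D \<delta>"
  shows "norm x \<le> 3 / 2 * rD D"
proof -
  obtain y where y: "y \<in> D" "dist x y \<le> \<delta>" using assms(3) by (auto simp: nbhd_def)
  have "bdd_above (norm ` D)"
    using compact_imp_bounded[OF assms(1)] by (auto simp: bounded_iff bdd_above_def)
  then have "norm y \<le> rD D" unfolding rD_def using y(1) by (intro cSup_upper) auto
  moreover have "norm x \<le> norm y + dist x y" by (metis dist_norm norm_triangle_sub)
  ultimately show ?thesis using y(2) assms(2) by linarith
qed

text \<open>The box has sublinear size and its centre has norm at most \<open>3/8 * R * N\<close>,
  so after rescaling it lies where the profile is at least some \<open>c > 0\<close> and its partial
  derivatives are at most \<open>B\<close>. A lattice step then changes the profile by a relative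
  amount of order \<open>1 / N\<close>, and the normalisation of \<open>fN\<close> cancels.\<close>

lemma confined_box_eventually:
  fixes D :: "(real^'d::finite) set" and \<phi> :: "real^'d \<Rightarrow> real" and R \<delta> r2 \<epsilon> :: real
  assumes D: "compact D" "0 \<in> D" and \<delta>: "0 < \<delta>" "\<delta> < rD D / 2" and R: "R > 4 * rD D"
    and sm: "smooth_closure (cball 0 R) \<phi>" and supp: "closure {x. \<phi> x \<noteq> 0} = cball 0 R"
    and pos: "\<forall>x\<in>ball 0 R. \<phi> x > 0" and r2: "0 < r2" "r2 < 1" and \<epsilon>: "0 < \<epsilon>"
  shows "\<exists>C\<ge>0. \<forall>\<^sub>F N in sequentially. \<forall>x0. inverse (real N) *\<^sub>R rv x0 \<in> nbhd D \<delta> \<longrightarrow>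
     confined_box (fN \<phi> N) (Uball R N) x0 \<lfloor>real N powr r2\<rfloor> (C / real N) \<and>
     (\<forall>x\<in>supbox x0 (\<lfloor>real N powr r2\<rfloor> + 1). \<forall>y\<in>supbox x0 (\<lfloor>real N powr r2\<rfloor> + 1). fN \<phi> N x \<le> (1 + \<epsilon>) * fN \<phi> N y) \<and>
     (phiN \<phi> N x0)\<^sup>2 \<le> C"
proof -
  let ?d = "real CARD('d)"
  have rD0: "0 < rD D" using \<delta> by linarith
  then have R0: "0 < R" using R by linarith
  \<comment> \<open>Half the radius leaves room \<open>R / 8\<close> beyond
    \<open>3 * R / 8\<close>, the bound for the rescaled centre that \<open>R > 4 * rD D\<close>
    provides.\<close>
  define E where "E = cball (0 :: real^'d) (R / 2)"
  have E: "compact E" "convex E" "E \<subseteq> ball 0 R" "0 \<in> E" using R0 by (auto simp: E_def)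
  obtain S h where S: "cball 0 R \<subseteq> S" and h: "smooth_on S h" and hphi: "\<And>x. x \<in> cball 0 R \<Longrightarrow> h x = \<phi> x"
    using sm unfolding smooth_closure_def by auto
  have ES: "E \<subseteq> S" using E(3) S ball_subset_cball[of 0 R] by blast
  have hE: "h x = \<phi> x" if "x \<in> E" for x using that E(3) by (intro hphi) auto
  have cont_pd: "continuous_on E (pd is h)" for "is"
    using h ES continuous_on_subset unfolding smooth_on_def by blast
  have cont_h: "continuous_on E h" using cont_pd[of "[]"] by simp
  obtain xm where xm: "xm \<in> E" "\<And>x. x \<in> E \<Longrightarrow> h xm \<le> h x"
    using continuous_attains_inf[OF E(1) _ cont_h] E(4) by blast
  obtain xM where xM: "xM \<in> E" "\<And>x. x \<in> E \<Longrightarrow> h x \<le> h xM"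
    using continuous_attains_sup[OF E(1) _ cont_h] E(4) by blast
  define c where "c = h xm"
  have c: "0 < c" using xm(1) E(3) pos by (auto simp: c_def hE)
  have "\<exists>b. \<forall>x\<in>E. \<bar>pd [i] h x\<bar> \<le> b" for i
  proof -
    have "compact (pd [i] h ` E)" by (rule compact_continuous_image[OF cont_pd E(1)])
    then have "bounded (pd [i] h ` E)" by (rule compact_imp_bounded)
    then show ?thesis by (auto simp: bounded_iff)
  qed
  then obtain b where b: "\<And>i x. x \<in> E \<Longrightarrow> \<bar>pd [i] h x\<bar> \<le> b i" by metis
  define B where "B = (\<Sum>i\<in>UNIV. \<bar>b i\<bar>)"
  have B: "\<bar>pd [i] h x\<bar> \<le> B" if "x \<in> E" for i x
  proof -
    have "\<bar>b i\<bar> \<le> B" unfolding B_def by (rule member_le_sum) auto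
    then show ?thesis using b[OF that, of i] by linarith
  qed
  have B0: "0 \<le> B" by (simp add: B_def sum_nonneg)
  have phi_off: "\<phi> x = 0" if "x \<notin> cball 0 R" for x
    using that supp closure_subset[of "{x. \<phi> x \<noteq> 0}"] by auto
  \<comment> \<open>One constant for two purposes: the relative increment \<open>B / c\<close> and
    the square of the profile at the centre.\<close>
  define C where "C = max (B / c) ((h xM)\<^sup>2)"
  have C0: "0 \<le> C" by (simp add: C_def le_max_iff_disj)
  have ev: "\<forall>\<^sub>F N in sequentially. 24 * ?d / R \<le> real N powr (1 - r2)"
    "\<forall>\<^sub>F N in sequentially. 2 / R \<le> real N powr 1"
    "\<forall>\<^sub>F N in sequentially. C + 1 \<le> real N powr 1"
    "\<forall>\<^sub>F N in sequentially. (4 * B * ?d / c) * real N powr (- (1 - r2)) \<le> \<epsilon>"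
    by (rule eventually_powr_ge eventually_powr_small; use r2 \<epsilon> in simp)+
  show ?thesis
  proof (intro exI[of _ C] conjI C0)
    show "\<forall>\<^sub>F N in sequentially. \<forall>x0. inverse (real N) *\<^sub>R rv x0 \<in> nbhd D \<delta> \<longrightarrow>
     confined_box (fN \<phi> N) (Uball R N) x0 \<lfloor>real N powr r2\<rfloor> (C / real N) \<and>
     (\<forall>x\<in>supbox x0 (\<lfloor>real N powr r2\<rfloor> + 1). \<forall>y\<in>supbox x0 (\<lfloor>real N powr r2\<rfloor> + 1). fN \<phi> N x \<le> (1 + \<epsilon>) * fN \<phi> N y) \<and>
     (phiN \<phi> N x0)\<^sup>2 \<le> C"
      using ev eventually_ge_at_top[of 1]
    proof eventually_elim
      case (elim N)
      define n where "n = real N"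
      have n: "1 \<le> n" "0 < n" using elim by (auto simp: n_def)
      have E1: "24 * ?d / R \<le> n powr (1 - r2)" and E2: "2 / R \<le> n" and E3: "C + 1 \<le> n"
        and E4: "(4 * B * ?d / c) * n powr (- (1 - r2)) \<le> \<epsilon>"
        using elim n by (auto simp: n_def)
      let ?U = "Uball R N :: (int^'d) set" and ?f = "fN \<phi> N" and ?L = "\<lfloor>n powr r2\<rfloor>"
      have pr: "1 \<le> n powr r2" using n r2 by (simp add: ge_one_powr_ge_zero)
      have L: "0 \<le> ?L" "real_of_int ?L \<le> n powr r2" using pr by auto
      then have L3: "real_of_int (?L + 2) \<le> 3 * n powr r2" "real_of_int (?L + 1) \<le> 2 * n powr r2"
        using pr unfolding of_int_add by linarith+
      define P where "P = infsum (\<lambda>w. (phiN \<phi> N w)\<^sup>2) (UNIV :: (int^'d) set)"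
      \<comment> \<open>The sum reduces to finitely many terms since the profile vanishes off the
        closed ball, and the term at the origin is positive.\<close>
      have P: "0 < P"
      proof -
        let ?F = "{z :: int^'d. norm (rv z) \<le> n * R}"
        have z: "phiN \<phi> N w = 0" if "w \<notin> ?F" for w
          using that n unfolding phiN_def by (intro phi_off) (auto simp: n_def[symmetric] field_simps)
        have "P = infsum (\<lambda>w. (phiN \<phi> N w)\<^sup>2) ?F"
          unfolding P_def by (rule infsum_cong_neutral) (use z in auto)
        also have "\<dots> = (\<Sum>w\<in>?F. (phiN \<phi> N w)\<^sup>2)" by (rule infsum_finite[OF finite_norm_rv_le])
        also have "(phiN \<phi> N 0)\<^sup>2 \<le> \<dots>"
          using n R0 by (intro member_le_sum finite_norm_rv_le) (auto simp: rv_def zero_vec_def[symmetric])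
        moreover have "rv (0 :: int^'d) = 0" by (simp add: rv_def vec_eq_iff)
        then have "0 < phiN \<phi> N (0 :: int^'d)" using pos R0 by (simp add: phiN_def)
        then have "0 < (phiN \<phi> N (0 :: int^'d))\<^sup>2" by simp
        ultimately show ?thesis by linarith
      qed
      have f_eq: "?f z = phiN \<phi> N z / sqrt P" for z by (simp add: fN_def P_def)
      have finU: "finite ?U" by (rule finite_subset[OF _ finite_norm_rv_le[of "n * R"]]) (auto simp: Uball_def n_def)
      have phiN_pos: "0 < phiN \<phi> N z" if "z \<in> ?U" for z
        using that pos n by (auto simp: phiN_def Uball_def n_def[symmetric] field_simps)
      have conf: "confined ?f ?U"
      proof
        show "finite ?U" by (rule finU)
        show "0 < ?f x" if "x \<in> ?U" for x using phiN_pos[OF that] P by (simp add: f_eq)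
        show "\<exists>y\<in>?U. nbr x y" if x: "x \<in> ?U" for x
        proof (cases "x = 0")
          case True
          obtain i :: 'd where True by auto
          have "rv (0 + axis i 1 :: int^'d) = 0 + 1 *\<^sub>R axis i 1" by (subst rv_axis) (simp add: rv_def vec_eq_iff)
          then have "norm (rv (axis i 1 :: int^'d)) = 1" by (simp add: norm_axis_1)
          moreover have "1 < n * R" using E2 R0 by (simp add: field_simps)
          ultimately show ?thesis using True by (intro bexI[of _ "axis i 1"]) (auto simp: Uball_def n_def nbr_iff)
        next
          case False
          then obtain y where y: "nbr x y" "sq y < sq x" using lattice_toward_zero by blast
          then show ?thesis using x Uball_sq[of R x N] Uball_sq[of R y N] R0 by (intro bexI[of _ y]) auto
        qed
        show "\<exists>z\<in>Z. \<exists>y\<in>?U - Z. nbr z y" if "Z \<subseteq> ?U" "Z \<noteq> {}" "Z \<noteq> ?U" for Z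
          using Uball_connected[OF _ that] R0 by simp
      qed
      show ?case
      proof (intro allI impI)
        fix x0 :: "int^'d" assume x0: "inverse (real N) *\<^sub>R rv x0 \<in> nbhd D \<delta>"
        have "norm (inverse (real N) *\<^sub>R rv x0) \<le> 3 / 2 * rD D"
          by (rule nbhd_norm_bound[OF D(1) \<delta>(2) x0])
        moreover have "norm (inverse (real N) *\<^sub>R rv x0) = norm (rv x0) / n" by (simp add: n_def divide_inverse_commute)
        ultimately have "norm (rv x0) / n \<le> 3 / 2 * rD D" by simp
        then have x0n: "norm (rv x0) \<le> n * (3 / 8 * R)"
        proof -
          have "norm (rv x0) \<le> 3 / 2 * rD D * n" using \<open>norm (rv x0) / n \<le> _\<close> n by (simp add: divide_le_eq)
          also have "\<dots> \<le> 3 / 8 * R * n" using R n by (intro mult_right_mono) auto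
          finally show ?thesis by (simp add: mult.commute)
        qed
        have inE: "inverse n *\<^sub>R rv z \<in> E" if z: "z \<in> supbox x0 (?L + 2)" for z
        proof -
          have "norm (rv z) \<le> norm (rv x0) + ?d * real_of_int (?L + 2)"
            using L by (intro norm_rv_box[OF z]) auto
          also have "\<dots> \<le> n * (3 / 8 * R) + ?d * (3 * n powr r2)"
            by (intro add_mono mult_left_mono x0n L3(1)) auto
          also have "?d * (3 * n powr r2) \<le> n * (R / 8)"
          proof -
            have "24 * ?d \<le> n powr (1 - r2) * R" using E1 R0 by (simp add: divide_le_eq)
            then have "24 * ?d * n powr r2 \<le> n powr (1 - r2) * R * n powr r2" by (intro mult_right_mono) auto
            also have "\<dots> = n * R"
            proof -
              have "n powr (1 - r2) * n powr r2 = n" using n by (simp add: powr_add[symmetric])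
              then show ?thesis by (simp add: mult.commute mult.left_commute)
            qed
            finally show ?thesis by simp
          qed
          finally have "norm (rv z) \<le> n * (R / 2)" by (simp add: algebra_simps)
          then show ?thesis using n by (simp add: E_def field_simps)
        qed
        have phiN_h: "phiN \<phi> N z = h (inverse n *\<^sub>R rv z)" if "z \<in> supbox x0 (?L + 2)" for z
          using hE[OF inE[OF that]] by (simp add: phiN_def n_def)
        have phiN_ge: "c \<le> phiN \<phi> N z" if "z \<in> supbox x0 (?L + 2)" for z
          using xm(2)[OF inE[OF that]] by (simp add: phiN_h[OF that] c_def)
        have step: "\<bar>phiN \<phi> N (z + axis i 1) - phiN \<phi> N z\<bar> \<le> B / n"
          if z: "z \<in> supbox x0 (?L + 2)" "z + axis i 1 \<in> supbox x0 (?L + 2)" for z i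
        proof -
          have e: "inverse n *\<^sub>R rv (z + axis i 1) = inverse n *\<^sub>R rv z + inverse n *\<^sub>R axis i 1"
            by (simp add: rv_axis scaleR_right_distrib)
          have "\<bar>h (inverse n *\<^sub>R rv z + inverse n *\<^sub>R axis i 1) - h (inverse n *\<^sub>R rv z)\<bar> \<le> B * inverse n"
            by (rule smooth_axis_mvt[OF h E(2) ES B]) (use inE[OF z(1)] inE[OF z(2)] n in \<open>auto simp: e\<close>)
          then show ?thesis unfolding phiN_h[OF z(1)] phiN_h[OF z(2)] e by (simp add: divide_inverse)
        qed
        have step_nbr: "\<bar>phiN \<phi> N y - phiN \<phi> N z\<bar> \<le> B / n" if z: "z \<in> supbox x0 (?L + 1)" and nb: "nbr z y" for z y
        proof -
          have z2: "z \<in> supbox x0 (?L + 2)" using z supbox_mono[of "?L + 1" "?L + 2" x0] by auto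
          have y2: "y \<in> supbox x0 (?L + 2)" using supbox_nbr[OF z nb] by (simp only: add.assoc one_add_one)
          obtain i where "y = z + axis i 1 \<or> z = y + axis i 1" using nbr_ordered[OF nb] by blast
          then show ?thesis using step[of z i] step[of y i] z2 y2 by (auto simp: abs_minus_commute)
        qed
        have U_L: "supbox x0 (?L + 1) \<subseteq> ?U"
        proof
          fix z assume "z \<in> supbox x0 (?L + 1)"
          then have "z \<in> supbox x0 (?L + 2)" using supbox_mono[of "?L + 1" "?L + 2" x0] by auto
          then have "inverse n *\<^sub>R rv z \<in> ball 0 R" using inE E(3) by blast
          then show "z \<in> ?U" using n by (simp add: Uball_def n_def[symmetric] field_simps)
        qed
        have box: "confined_box ?f ?U x0 ?L (C / n)"
        proof (intro confined_box.intro confined_box_axioms.intro conf)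
          show "0 \<le> ?L" "supbox x0 (?L + 1) \<subseteq> ?U" by (rule L U_L)+
          show "0 \<le> C / n" "C / n < 1" using C0 n E3 by auto
          show "\<bar>?f y - ?f z\<bar> \<le> C / n * ?f z" if z: "z \<in> supbox x0 ?L" and nb: "nbr z y" for z y
          proof -
            have z1: "z \<in> supbox x0 (?L + 1)" "z \<in> supbox x0 (?L + 2)"
              using z supbox_mono[of ?L "?L + 1" x0] supbox_mono[of ?L "?L + 2" x0] by auto
            have "\<bar>phiN \<phi> N y - phiN \<phi> N z\<bar> \<le> B / n" by (rule step_nbr[OF z1(1) nb])
            also have "\<dots> = (B / c) / n * c" using c by simp
            also have "\<dots> \<le> C / n * phiN \<phi> N z"
              using phiN_ge[OF z1(2)] C0 n c B0 by (intro mult_mono divide_right_mono) (auto simp: C_def)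
            finally have "\<bar>phiN \<phi> N y - phiN \<phi> N z\<bar> / sqrt P \<le> C / n * phiN \<phi> N z / sqrt P"
              using P by (intro divide_right_mono) auto
            then show ?thesis using P by (simp add: f_eq diff_divide_distrib[symmetric])
          qed
        qed
        have rat: "?f x \<le> (1 + \<epsilon>) * ?f y" if x: "x \<in> supbox x0 (?L + 1)" and y: "y \<in> supbox x0 (?L + 1)" for x y
        proof -
          have lip: "\<bar>phiN \<phi> N z - phiN \<phi> N x0\<bar> \<le> \<epsilon> * c / 2" if z: "z \<in> supbox x0 (?L + 1)" for z
          proof -
            have "\<bar>phiN \<phi> N z - phiN \<phi> N x0\<bar> \<le> B / n * real (ell1 (z - x0))"
            proof (rule lattice_lipschitz[OF _ z])
              show "\<bar>phiN \<phi> N (c + axis i 1) - phiN \<phi> N c\<bar> \<le> B / n" if "c \<in> supbox x0 (?L + 1)" for c i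
                using that by (rule step_nbr) (auto simp: nbr_iff)
            qed (use L B0 n in auto)
            also have "\<dots> \<le> B / n * (?d * real_of_int (?L + 1))"
              using ell1_box[OF z] L B0 n by (intro mult_left_mono) auto
            also have "\<dots> \<le> B / n * (?d * (2 * n powr r2))"
              using B0 n by (intro mult_left_mono L3(2)) auto
            also have "\<dots> = (4 * B * ?d / c * n powr (- (1 - r2))) * c / 2"
            proof -
              have "n powr (- (1 - r2)) = n powr r2 / n" using n by (simp add: powr_diff)
              then show ?thesis using c by (simp add: field_simps)
            qed
            also have "\<dots> \<le> \<epsilon> * c / 2" using E4 c by (intro divide_right_mono mult_right_mono) auto
            finally show ?thesis .
          qed
          have yc: "c \<le> phiN \<phi> N y" using y supbox_mono[of "?L + 1" "?L + 2" x0] by (intro phiN_ge) auto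
          have "phiN \<phi> N x \<le> phiN \<phi> N y + \<epsilon> * c" using lip[OF x] lip[OF y] unfolding abs_le_iff by linarith
          also have "\<dots> \<le> (1 + \<epsilon>) * phiN \<phi> N y" using mult_left_mono[OF yc, of \<epsilon>] \<epsilon> by (simp add: distrib_right)
          finally have "phiN \<phi> N x / sqrt P \<le> (1 + \<epsilon>) * phiN \<phi> N y / sqrt P" using P by (intro divide_right_mono) auto
          then show ?thesis by (simp add: f_eq)
        qed
        have "x0 \<in> supbox x0 (?L + 2)" using L by (simp add: supbox_def)
        then have "0 \<le> phiN \<phi> N x0" "phiN \<phi> N x0 \<le> h xM"
          using phiN_ge[of x0] xM(2)[OF inE[of x0]] phiN_h[of x0] c by auto
        then have "(phiN \<phi> N x0)\<^sup>2 \<le> C" by (auto simp: C_def le_max_iff_disj intro: power_mono)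
        then show "confined_box ?f ?U x0 \<lfloor>real N powr r2\<rfloor> (C / real N) \<and>
          (\<forall>x\<in>supbox x0 (\<lfloor>real N powr r2\<rfloor> + 1). \<forall>y\<in>supbox x0 (\<lfloor>real N powr r2\<rfloor> + 1). ?f x \<le> (1 + \<epsilon>) * ?f y) \<and>
          (phiN \<phi> N x0)\<^sup>2 \<le> C"
          using box rat by (auto simp: n_def)
      qed
    qed
  qed
qed

section \<open>Occupation times\<close>

text \<open>The final vertex, where the trajectory has been stopped outside \<open>A2\<close>, is
  dropped, as in the counts of the occupation laws.\<close>

definition visits :: "'a list \<Rightarrow> 'a \<Rightarrow> nat" where
  "visits ys z = length (filter (\<lambda>y. y = z) (butlast ys))"

lemma visits_Cons: "visits (x # w # ys) z = (if z = x then 1 else 0) + visits (w # ys) z"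
  by (simp add: visits_def)

lemma sum_visits:
  assumes "finite A"
  shows "exits A x ys \<Longrightarrow> (\<Sum>z\<in>A. visits (x # ys) z) = length ys"
proof (induction ys arbitrary: x)
  case (Cons w ys)
  then have "x \<in> A" "exits A w ys" by auto
  have "(\<Sum>z\<in>A. visits (x # w # ys) z) = (\<Sum>z\<in>A. if z = x then 1 else 0) + (\<Sum>z\<in>A. visits (w # ys) z)"
    unfolding visits_Cons by (rule sum.distrib)
  then show ?case using Cons.IH[OF \<open>exits A w ys\<close>] \<open>x \<in> A\<close> assms by simp
qed (simp add: visits_def)

lemma pw_append: "pw init K (pre @ x # zs) = pw init K (pre @ [x]) * pathw K x zs"
proof (cases pre)
  case Nil
  then show ?thesis by (simp add: pw_Cons)
next
  case (Cons z pre')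
  then show ?thesis using pathw_append[of K z pre' x zs] by (simp add: pw_Cons)
qed

lemma skel2_Cons: "skel2_ok A2 (x # zs) \<longleftrightarrow> exits A2 x zs"
  by (auto simp: skel2_ok_def exits_iff)

lemma skel1_Cons: "skel1_ok A1 A2 (pre, x # zs) \<longleftrightarrow> set pre \<subseteq> - A1 \<and> x \<in> A1 \<and> exits A2 x zs"
  by (auto simp: skel1_ok_def exits_iff)

lemma pathw_last_in_box:
  assumes "exits (supbox x0 L) z ys" "pathw srwP z ys \<noteq> 0" "z \<in> supbox x0 (L + 1)"
  shows "last (z # ys) \<in> supbox x0 (L + 1)"
  using assms
proof (induction ys arbitrary: z)
  case (Cons w ys)
  have "nbr z w" using Cons.prems(2) by (auto simp: srwP_def split: if_splits)
  then have "w \<in> supbox x0 (L + 1)" using Cons.prems(1) supbox_nbr[of z x0 L w] by simp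
  then show ?case using Cons.IH[of w] Cons.prems by simp
qed simp

lemma srw_exit_total:
  fixes A :: "(int^'d::finite) set"
  assumes A: "finite A"
  shows "hs srwP A (\<lambda>_. 1) z = 1"
proof -
  define s where "s = srw.hr A (\<lambda>_. 1 :: real)"
  have on: "s z = 1" if "z \<notin> A" for z using that by (simp add: s_def srw.hr_off)
  have harm: "avg s z = s z" if "z \<in> A" for z
    unfolding s_def using srw.hr_rec[of "\<lambda>_. 1" 1 z A] that by (simp add: srwP_sum)
  have "s z = 1" if z: "z \<in> A" for z
  proof (rule antisym)
    show "s z \<le> 1" by (rule srw_comparison[OF A, of s "\<lambda>_. 1"]) (use z on harm in auto)
    show "1 \<le> s z" by (rule srw_comparison[OF A, of "\<lambda>_. 1" s]) (use z on harm in auto)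
  qed
  then have "s z = 1" using on by (cases "z \<in> A") auto
  then show ?thesis unfolding s_def by (subst srw.hs_eq_hr[of _ 1]) auto
qed

text \<open>In its uses \<open>g\<close> is the probability of a field event given the skeleton, so
  this is the law of the occupation field of an excursion started at \<open>x\<close>.\<close>

definition seg_sum :: "('a \<Rightarrow> 'a \<Rightarrow> real) \<Rightarrow> 'a set \<Rightarrow> ('a list \<Rightarrow> ennreal) \<Rightarrow> 'a \<Rightarrow> ennreal" where
  "seg_sum K A g x = lsum (\<lambda>zs. if exits A x zs then ennreal (pathw K x zs) * g (x # zs) else 0)"

lemma seg_sum_one: "seg_sum K A (\<lambda>_. 1) x = hs K A (\<lambda>_. 1) x"
  by (simp add: seg_sum_def hs_def cong: if_cong)

lemma sum_skel2:
  assumes "finite A1" and init: "\<And>x. 0 \<le> init x" "\<And>x. x \<notin> A1 \<Longrightarrow> init x = 0" and K: "\<And>x y. 0 \<le> K x y"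
  shows "(\<integral>\<^sup>+ys. ennreal (if skel2_ok A2 ys then pw init K ys else 0) * g ys \<partial>count_space UNIV)
    = (\<Sum>x\<in>A1. ennreal (init x) * seg_sum K A2 g x)"
proof -
  have "(\<integral>\<^sup>+ys. ennreal (if skel2_ok A2 ys then pw init K ys else 0) * g ys \<partial>count_space UNIV)
    = esum (\<lambda>x. lsum (\<lambda>zs. ennreal (if skel2_ok A2 (x # zs) then pw init K (x # zs) else 0) * g (x # zs)))"
    unfolding lsum_def[symmetric] by (subst lsum_Cons) (simp add: skel2_ok_def)
  also have "\<dots> = esum (\<lambda>x. ennreal (init x) * seg_sum K A2 g x)"
  proof (rule arg_cong[where f=esum], rule ext)
    fix x
    have "(\<lambda>zs. ennreal (if skel2_ok A2 (x # zs) then pw init K (x # zs) else 0) * g (x # zs))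
      = (\<lambda>zs. ennreal (init x) * (if exits A2 x zs then ennreal (pathw K x zs) * g (x # zs) else 0))"
      using init K by (auto simp: fun_eq_iff skel2_Cons pw_Cons ennreal_mult pathw_nonneg mult.assoc)
    then show "lsum (\<lambda>zs. ennreal (if skel2_ok A2 (x # zs) then pw init K (x # zs) else 0) * g (x # zs)) = ennreal (init x) * seg_sum K A2 g x"
      by (simp only: lsum_cmult seg_sum_def)
  qed
  also have "\<dots> = (\<Sum>x\<in>A1. ennreal (init x) * seg_sum K A2 g x)"
    by (rule esum_finite[OF assms(1)]) (simp add: init)
  finally show ?thesis .
qed

lemma exits_snoc: "exits V z (pre @ [w]) \<longleftrightarrow> z \<in> V \<and> set pre \<subseteq> V \<and> w \<notin> V"
  by (induction pre arbitrary: z) auto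

lemma hs_point_snoc:
  assumes x: "x \<notin> V" and z: "z \<in> V"
  shows "hs K V (\<lambda>w. if w = x then 1 else 0) z = lsum (\<lambda>pre. if set pre \<subseteq> V then ennreal (pathw K z (pre @ [x])) else 0)"
proof -
  let ?F = "\<lambda>ys. if exits V z ys then ennreal (pathw K z ys * (if last (z # ys) = x then 1 else 0)) else 0"
  have "hs K V (\<lambda>w. if w = x then 1 else 0) z = esum (\<lambda>w. lsum (\<lambda>pre. ?F (pre @ [w])))"
    unfolding hs_def by (subst lsum_snoc) (use z in simp)
  also have "\<dots> = (\<Sum>w\<in>{x}. lsum (\<lambda>pre. ?F (pre @ [w])))"
    by (rule esum_finite) (auto simp: lsum_def cong: if_cong)
  also have "\<dots> = lsum (\<lambda>pre. if set pre \<subseteq> V then ennreal (pathw K z (pre @ [x])) else 0)"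
    using x z by (simp add: exits_snoc cong: if_cong)
  finally show ?thesis .
qed

context confined
begin

text \<open>Strong Markov property at the entrance into \<open>A1\<close>: as \<open>g\<close>
  depends on the second list only, the weight factorises, and the prefixes sum to the entrance
  probability at \<open>x\<close>.\<close>

lemma sum_skel1:
  assumes A1: "A1 \<subseteq> A2" "A2 \<subseteq> U" and \<sigma>: "\<And>z. 0 \<le> \<sigma> z" "\<And>z. z \<notin> U - A2 \<Longrightarrow> \<sigma> z = 0"
  shows "(\<integral>\<^sup>+s. ennreal (if skel1_ok A1 A2 s then pw \<sigma> (cjump f U) (fst s @ snd s) else 0) * g (snd s) \<partial>count_space UNIV)
    = (\<Sum>x\<in>A1. ennreal (\<Sum>z\<in>U - A2. \<sigma> z * chit (- A1) x z) * seg_sum K A2 g x)"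
proof -
  let ?J = "cjump f U"
  let ?w = "\<lambda>s. ennreal (if skel1_ok A1 A2 s then pw \<sigma> ?J (fst s @ snd s) else 0) * g (snd s)"
  have finA1: "finite A1" using A1 finU by (meson finite_subset)
  have finV: "finite (U - A2)" using finU by simp
  define H where "H x = (\<Sum>z\<in>U - A2. \<sigma> z * chit (- A1) x z)" for x
  have pre_sum: "lsum (\<lambda>pre. if set pre \<subseteq> - A1 then ennreal (pw \<sigma> ?J (pre @ [x])) else 0) = ennreal (H x)" if x: "x \<in> A1" for x
  proof -
    \<comment> \<open>The empty prefix contributes nothing, because \<open>\<sigma>\<close> does not
      charge \<open>A1\<close>.\<close>
    have "\<sigma> x = 0" using x A1 \<sigma>(2) by auto
    then have "lsum (\<lambda>pre. if set pre \<subseteq> - A1 then ennreal (pw \<sigma> ?J (pre @ [x])) else 0)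
      = esum (\<lambda>z. lsum (\<lambda>pre. if set (z # pre) \<subseteq> - A1 then ennreal (pw \<sigma> ?J ((z # pre) @ [x])) else 0))"
      by (subst lsum_Cons) (simp add: pw_Cons)
    also have "\<dots> = (\<Sum>z\<in>U - A2. lsum (\<lambda>pre. if set (z # pre) \<subseteq> - A1 then ennreal (pw \<sigma> ?J ((z # pre) @ [x])) else 0))"
    proof (rule esum_finite[OF finV])
      fix z assume "z \<notin> U - A2"
      then have "(\<lambda>pre. if set (z # pre) \<subseteq> - A1 then ennreal (pw \<sigma> ?J ((z # pre) @ [x])) else 0) = (\<lambda>_. 0)"
        using \<sigma>(2) by (auto simp: fun_eq_iff pw_Cons)
      then show "lsum (\<lambda>pre. if set (z # pre) \<subseteq> - A1 then ennreal (pw \<sigma> ?J ((z # pre) @ [x])) else 0) = 0"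
        by (simp add: lsum_def)
    qed
    also have "\<dots> = (\<Sum>z\<in>U - A2. ennreal (\<sigma> z * chit (- A1) x z))"
    proof (rule sum.cong[OF refl])
      fix z assume z: "z \<in> U - A2"
      then have zA: "z \<in> - A1" using A1 by auto
      have "(\<lambda>pre. if set (z # pre) \<subseteq> - A1 then ennreal (pw \<sigma> ?J ((z # pre) @ [x])) else 0)
         = (\<lambda>pre. ennreal (\<sigma> z) * (if set pre \<subseteq> - A1 then ennreal (pathw K z (pre @ [x])) else 0))"
        using z zA \<sigma>(1) by (auto simp: fun_eq_iff pw_Cons pathw_K ennreal_mult')
      then have "lsum (\<lambda>pre. if set (z # pre) \<subseteq> - A1 then ennreal (pw \<sigma> ?J ((z # pre) @ [x])) else 0)
         = ennreal (\<sigma> z) * hs K (- A1) (\<lambda>w. if w = x then 1 else 0) z"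
        using x zA by (simp only: lsum_cmult) (simp add: hs_point_snoc)
      then show "lsum (\<lambda>pre. if set (z # pre) \<subseteq> - A1 then ennreal (pw \<sigma> ?J ((z # pre) @ [x])) else 0) = ennreal (\<sigma> z * chit (- A1) x z)"
        using \<sigma>(1) by (simp add: hs_chit ennreal_mult)
    qed
    also have "\<dots> = ennreal (H x)" unfolding H_def using \<sigma>(1) by (intro sum_ennreal) simp
    finally show ?thesis .
  qed
  have "(\<integral>\<^sup>+s. ?w s \<partial>count_space UNIV) = lsum (\<lambda>seg. lsum (\<lambda>pre. ?w (pre, seg)))"
    unfolding lsum_def by (rule nn_integral_snd_count_space[symmetric])
  also have "\<dots> = esum (\<lambda>x. lsum (\<lambda>zs. lsum (\<lambda>pre. ?w (pre, x # zs))))"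
    by (subst lsum_Cons) (simp add: skel1_ok_def lsum_def)
  also have "\<dots> = (\<Sum>x\<in>A1. lsum (\<lambda>zs. lsum (\<lambda>pre. ?w (pre, x # zs))))"
    by (rule esum_finite[OF finA1]) (simp add: skel1_Cons lsum_def)
  also have "\<dots> = (\<Sum>x\<in>A1. ennreal (H x) * seg_sum K A2 g x)"
  proof (rule sum.cong[OF refl])
    fix x assume x: "x \<in> A1"
    then have xU: "x \<in> U" using A1 by auto
    have "lsum (\<lambda>pre. ?w (pre, x # zs)) = ennreal (H x) * (if exits A2 x zs then ennreal (pathw K x zs) * g (x # zs) else 0)" for zs
    proof -
      have "(\<lambda>pre. ?w (pre, x # zs)) = (\<lambda>pre. (if exits A2 x zs then ennreal (pathw K x zs) * g (x # zs) else 0) *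
          (if set pre \<subseteq> - A1 then ennreal (pw \<sigma> ?J (pre @ [x])) else 0))"
      proof
        fix pre
        have "0 \<le> pathw K x zs" by (rule pathw_nonneg) (rule conf.K_nonneg)
        then show "?w (pre, x # zs) = (if exits A2 x zs then ennreal (pathw K x zs) * g (x # zs) else 0) *
          (if set pre \<subseteq> - A1 then ennreal (pw \<sigma> ?J (pre @ [x])) else 0)"
          using x by (simp add: skel1_Cons pw_append[of \<sigma> ?J pre x zs] pathw_K[OF xU] ennreal_mult' ennreal_mult'' ac_simps)
      qed
      then show ?thesis by (simp only: lsum_cmult pre_sum[OF x]) (simp add: mult.commute)
    qed
    then show "lsum (\<lambda>zs. lsum (\<lambda>pre. ?w (pre, x # zs))) = ennreal (H x) * seg_sum K A2 g x"
      by (simp only: lsum_cmult seg_sum_def)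
  qed
  finally show ?thesis unfolding H_def .
qed

end

section \<open>Domination of the occupation laws\<close>

context confined_box
begin

text \<open>Each step of the jump chain carries \<open>1 / cq\<close> and the Gamma likelihood ratio
  carries \<open>cq\<close> once per visit, so the two cancel along the path and only the end-point
  ratio of \<open>f\<close> remains. This is why no error growing with the path length
  arises.\<close>

lemma pathw_rates:
  assumes "exits (supbox x0 L) z ys" and "z \<in> U"
  shows "pathw K z ys * (\<Prod>w\<in>supbox x0 L. cq f U w ^ visits (z # ys) w) * f z = pathw srwP z ys * f (last (z # ys))"
  using assms
proof (induction ys arbitrary: z)
  case (Cons w ys)
  let ?A = "supbox x0 L"
  have z: "z \<in> ?A" and ex: "exits ?A w ys" using Cons.prems by auto
  note U = nbrsU[OF z]
  have q: "0 < cq f U z" using U cq_pos by auto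
  have "(\<Prod>v\<in>?A. cq f U v ^ visits (z # w # ys) v) = (\<Prod>v\<in>?A. (if v = z then cq f U z else 1) * cq f U v ^ visits (w # ys) v)"
    by (rule prod.cong) (auto simp: visits_Cons power_add)
  also have "\<dots> = cq f U z * (\<Prod>v\<in>?A. cq f U v ^ visits (w # ys) v)"
    using z by (simp add: prod.distrib)
  finally have e: "(\<Prod>v\<in>?A. cq f U v ^ visits (z # w # ys) v) = cq f U z * (\<Prod>v\<in>?A. cq f U v ^ visits (w # ys) v)" .
  have "K z w * f z * cq f U z = srwP z w * f w" using K_eq_srwP(1)[of z w] U q by simp
  then have "pathw K z (w # ys) * (\<Prod>v\<in>?A. cq f U v ^ visits (z # w # ys) v) * f z
     = srwP z w * (pathw K w ys * (\<Prod>v\<in>?A. cq f U v ^ visits (w # ys) v) * f w)"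
    unfolding e by (simp add: ac_simps)
  also have "\<dots> = srwP z w * (pathw srwP w ys * f (last (w # ys)))"
  proof (cases "w \<in> U")
    case True
    then show ?thesis using Cons.IH[OF ex] by simp
  next
    case False
    then have "srwP z w = 0" using U by (auto simp: srwP_def mem_nbrs)
    then show ?thesis by simp
  qed
  finally show ?case by simp
qed (simp add: visits_def)

text \<open>Three factors are lost: \<open>1 - \<delta>\<close> in the entrance law,
  \<open>1 - \<delta>\<close> from the values of \<open>f\<close> at the end points of the
  excursion, and \<open>exp (- (\<kappa> * T))\<close> from the holding times on the good set.
  Averaging over \<open>\<sigma>\<close> costs nothing, since the entrance bound holds from every
  point outside \<open>A2\<close>.\<close>

lemma occupation_domination:
  assumes A1: "A1 \<subseteq> A2" and A2: "A2 = supbox x0 L"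
    and \<sigma>: "\<And>z. 0 \<le> \<sigma> z" "\<And>z. z \<notin> U - A2 \<Longrightarrow> \<sigma> z = 0" "(\<Sum>z\<in>U - A2. \<sigma> z) = 1"
    and e: "\<And>x. 0 \<le> e x" "\<And>x. x \<notin> A1 \<Longrightarrow> e x = 0" and \<delta>: "0 \<le> \<delta>" "\<delta> \<le> 1"
    and hitting: "\<And>z x. z \<in> U - A2 \<Longrightarrow> x \<in> A1 \<Longrightarrow> (1 - \<delta>) * e x \<le> chit (- A1) x z"
    and osc: "\<And>x y. x \<in> supbox x0 (L + 1) \<Longrightarrow> y \<in> supbox x0 (L + 1) \<Longrightarrow> (1 - \<delta>) * f x \<le> f y"
    and E: "E \<in> sets (fieldM A2)" "E \<subseteq> good_set A2 T"
  shows "ennreal ((1 - \<delta>)\<^sup>2 * exp (- (\<kappa> * T))) *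
      emeasure (occ_mix (\<lambda>ys. if skel2_ok A2 ys then pw e srwP ys else 0) visits (\<lambda>_. 1) A2) E
    \<le> emeasure (occ_mix (\<lambda>s. if skel1_ok A1 A2 s then pw \<sigma> (cjump f U) (fst s @ snd s) else 0) (\<lambda>s. visits (snd s)) (cq f U) A2) E"
proof -
  have finA2: "finite A2" by (simp add: A2)
  have A2U: "A2 \<subseteq> U" using nbrsU by (auto simp: A2)
  have finA1: "finite A1" using A1 finA2 finite_subset by auto
  have q: "0 < cq f U z" "\<bar>cq f U z - 1\<bar> \<le> \<kappa>" if "z \<in> A2" for z
    using that A2U cq_pos cq_near_1 by (auto simp: A2)
  define H where "H x = (\<Sum>z\<in>U - A2. \<sigma> z * chit (- A1) x z)" for x
  have H: "(1 - \<delta>) * e x \<le> H x" if x: "x \<in> A1" for x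
  proof -
    have "(1 - \<delta>) * e x = (\<Sum>z\<in>U - A2. \<sigma> z * ((1 - \<delta>) * e x))"
      by (simp only: sum_distrib_right[symmetric] \<sigma>(3) mult_1)
    also have "\<dots> \<le> H x" unfolding H_def using hitting[OF _ x] \<sigma>(1) by (intro sum_mono mult_left_mono) auto
    finally show ?thesis .
  qed
  let ?g1 = "\<lambda>ys. emeasure (gamma_field A2 (visits ys) (cq f U)) E"
  let ?g2 = "\<lambda>ys. emeasure (gamma_field A2 (visits ys) (\<lambda>_. 1)) E"
  have m1: "emeasure (occ_mix (\<lambda>s. if skel1_ok A1 A2 s then pw \<sigma> (cjump f U) (fst s @ snd s) else 0) (\<lambda>s. visits (snd s)) (cq f U) A2) E
    = (\<Sum>x\<in>A1. ennreal (H x) * seg_sum K A2 ?g1 x)"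
    unfolding H_def
    by (rule trans[OF emeasure_occ_mix[OF finA2 q(1) E(1)] sum_skel1[OF A1 A2U \<sigma>(1,2), where g="?g1"]])
  have m2: "emeasure (occ_mix (\<lambda>ys. if skel2_ok A2 ys then pw e srwP ys else 0) visits (\<lambda>_. 1) A2) E
    = (\<Sum>x\<in>A1. ennreal (e x) * seg_sum srwP A2 ?g2 x)"
    by (rule trans[OF emeasure_occ_mix[OF finA2 _ E(1)] sum_skel2[OF finA1 e srw.K_nonneg, where g="?g2"]]) simp
  have seg: "ennreal ((1 - \<delta>) * exp (- (\<kappa> * T))) * seg_sum srwP A2 ?g2 x \<le> seg_sum K A2 ?g1 x" if x: "x \<in> A1" for x
    unfolding seg_sum_def lsum_cmult[symmetric]
  proof (rule lsum_mono)
    fix zs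
    have xb: "x \<in> supbox x0 (L + 1)" using x A1 supbox_mono[of L "L + 1" x0] by (auto simp: A2)
    have xU: "x \<in> U" using x A1 A2U by auto
    show "ennreal ((1 - \<delta>) * exp (- (\<kappa> * T))) * (if exits A2 x zs then ennreal (pathw srwP x zs) * ?g2 (x # zs) else 0)
      \<le> (if exits A2 x zs then ennreal (pathw K x zs) * ?g1 (x # zs) else 0)"
    proof (cases "exits A2 x zs")
      case True
      let ?P = "\<Prod>z\<in>A2. cq f U z ^ visits (x # zs) z"
      have P: "0 \<le> ?P" using q(1) by (intro prod_nonneg zero_le_power) (auto intro: less_imp_le)
      have pK: "0 \<le> pathw K x zs" and pS: "0 \<le> pathw srwP x zs"
        by (simp_all add: pathw_nonneg srw.K_nonneg conf.K_nonneg)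
      have fx: "0 < f x" using fpos xU by simp
      have "(1 - \<delta>) * pathw srwP x zs * f x \<le> pathw srwP x zs * f (last (x # zs))"
      proof (cases "pathw srwP x zs = 0")
        case False
        have "last (x # zs) \<in> supbox x0 (L + 1)"
          by (rule pathw_last_in_box) (use True xb False A2 in auto)
        then have "(1 - \<delta>) * f x \<le> f (last (x # zs))" using osc xb by blast
        from mult_left_mono[OF this pS] show ?thesis by (simp only: ac_simps)
      qed simp
      also have "\<dots> = pathw K x zs * ?P * f x" using pathw_rates[of x zs] True xU by (simp add: A2)
      finally have path: "(1 - \<delta>) * pathw srwP x zs \<le> pathw K x zs * ?P" using fx by simp
      have "ennreal ((1 - \<delta>) * exp (- (\<kappa> * T))) * (ennreal (pathw srwP x zs) * ?g2 (x # zs))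
        = ennreal (exp (- (\<kappa> * T)) * ((1 - \<delta>) * pathw srwP x zs)) * ?g2 (x # zs)"
        using \<delta> pS by (simp add: ennreal_mult ac_simps)
      also have "\<dots> \<le> ennreal (exp (- (\<kappa> * T)) * (pathw K x zs * ?P)) * ?g2 (x # zs)"
        using path by (intro mult_right_mono ennreal_leI mult_left_mono) auto
      also have "\<dots> = ennreal (pathw K x zs) * (ennreal (exp (- (\<kappa> * T)) * ?P) * ?g2 (x # zs))"
        using pK P by (simp add: ennreal_mult ac_simps)
      also have "\<dots> \<le> ennreal (pathw K x zs) * ?g1 (x # zs)"
        by (intro mult_left_mono gamma_field_compare[OF finA2 q \<kappa>(1) E]) auto
      finally show ?thesis using True by simp
    qed simp
  qed
  have "ennreal ((1 - \<delta>)\<^sup>2 * exp (- (\<kappa> * T))) * (\<Sum>x\<in>A1. ennreal (e x) * seg_sum srwP A2 ?g2 x)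
    = (\<Sum>x\<in>A1. ennreal ((1 - \<delta>) * e x) * (ennreal ((1 - \<delta>) * exp (- (\<kappa> * T))) * seg_sum srwP A2 ?g2 x))"
    using \<delta> e by (simp add: sum_distrib_left power2_eq_square ennreal_mult ac_simps)
  also have "\<dots> \<le> (\<Sum>x\<in>A1. ennreal (H x) * seg_sum K A2 ?g1 x)"
    using seg H by (intro sum_mono mult_mono ennreal_leI) auto
  finally show ?thesis unfolding m1 m2 .
qed

text \<open>Entering \<open>A1\<close> and leaving \<open>A2\<close> both happen almost surely; that
  \<open>U - A2\<close> is nonempty follows from \<open>\<sigma>\<close> having mass one.\<close>

lemma prob_space_skel1:
  assumes A1: "A1 \<subseteq> A2" "A1 \<noteq> {}" and A2: "A2 = supbox x0 L"
    and \<sigma>: "\<And>z. 0 \<le> \<sigma> z" "\<And>z. z \<notin> U - A2 \<Longrightarrow> \<sigma> z = 0" "(\<Sum>z\<in>U - A2. \<sigma> z) = 1"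
  shows "prob_space (occ_mix (\<lambda>s. if skel1_ok A1 A2 s then pw \<sigma> (cjump f U) (fst s @ snd s) else 0) (\<lambda>s. visits (snd s)) (cq f U) A2)"
proof (rule prob_space_occ_mix)
  have A2U: "A2 \<subseteq> U" using nbrsU by (auto simp: A2)
  have "U - A2 \<noteq> {}" using \<sigma>(3) by (metis sum.empty zero_neq_one)
  then have A2s: "A2 \<subset> U" using A2U by auto
  show "finite A2" by (simp add: A2)
  show "0 < cq f U z" if "z \<in> A2" for z using that A2U cq_pos by auto
  have "(\<integral>\<^sup>+s. ennreal (if skel1_ok A1 A2 s then pw \<sigma> (cjump f U) (fst s @ snd s) else 0) \<partial>count_space UNIV)
    = (\<Sum>x\<in>A1. ennreal (\<Sum>z\<in>U - A2. \<sigma> z * chit (- A1) x z))"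
    using sum_skel1[where \<sigma>=\<sigma> and g="\<lambda>_. 1", OF A1(1) A2U \<sigma>(1,2)] A1 A2U
    by (simp add: seg_sum_one conf_exit_total[OF A2s] subset_iff)
  also have "\<dots> = ennreal (\<Sum>x\<in>A1. \<Sum>z\<in>U - A2. \<sigma> z * chit (- A1) x z)"
    using \<sigma>(1) by (intro sum_ennreal sum_nonneg) auto
  also have "(\<Sum>x\<in>A1. \<Sum>z\<in>U - A2. \<sigma> z * chit (- A1) x z) = (\<Sum>z\<in>U - A2. \<sigma> z * (\<Sum>x\<in>A1. chit (- A1) x z))"
    unfolding sum_distrib_left by (rule sum.swap)
  also have "\<dots> = (\<Sum>z\<in>U - A2. \<sigma> z)"
    using chit_total[of A1] A1 A2U by (intro sum.cong) auto
  finally show "(\<integral>\<^sup>+s. ennreal (if skel1_ok A1 A2 s then pw \<sigma> (cjump f U) (fst s @ snd s) else 0) \<partial>count_space UNIV) = 1"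
    using \<sigma>(3) by simp
qed

end

lemma prob_space_skel2:
  fixes A1 A2 :: "(int^'d::finite) set"
  assumes "finite A1" "finite A2" and e: "\<And>x. 0 \<le> e x" "\<And>x. x \<notin> A1 \<Longrightarrow> e x = 0" "(\<Sum>x\<in>A1. e x) = 1"
  shows "prob_space (occ_mix (\<lambda>ys. if skel2_ok A2 ys then pw e srwP ys else 0) visits (\<lambda>_. 1) A2)"
proof (rule prob_space_occ_mix[OF assms(2)])
  show "(\<integral>\<^sup>+ys. ennreal (if skel2_ok A2 ys then pw e srwP ys else 0) \<partial>count_space UNIV) = 1"
    using sum_skel2[where init=e and K=srwP and g="\<lambda>_. 1", OF assms(1) e(1,2) srw.K_nonneg] e
    by (simp add: seg_sum_one srw_exit_total[OF assms(2)])
qed simp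

text \<open>Given the path, the Chernoff bound costs a factor \<open>1 / (1 - \<theta>)\<close> per
  visit. Absorbed into the kernel, these factors form the exponential moment of the exit time, which
  is at most two.\<close>

lemma skel2_bad_set:
  fixes x0 :: "int^'d::finite"
  assumes A2: "A2 = supbox x0 L" and L: "0 \<le> L" and "finite A1"
    and e: "\<And>x. 0 \<le> e x" "\<And>x. x \<notin> A1 \<Longrightarrow> e x = 0" "(\<Sum>x\<in>A1. e x) = 1"
    and \<theta>: "0 < \<theta>" "\<theta> < 1" "\<theta> * (2 * (real CARD('d) * (real_of_int (L + 1))\<^sup>2)) \<le> 1"
  shows "emeasure (occ_mix (\<lambda>ys. if skel2_ok A2 ys then pw e srwP ys else 0) visits (\<lambda>_. 1) A2) (space (fieldM A2) - good_set A2 T)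
    \<le> ennreal (2 * exp (- (\<theta> * T)))"
proof -
  have finA2: "finite A2" by (simp add: A2)
  let ?B = "space (fieldM A2) - good_set A2 T"
  let ?g = "\<lambda>ys. emeasure (gamma_field A2 (visits ys) (\<lambda>_. 1)) ?B"
  have B: "?B \<in> sets (fieldM A2)" using good_set_measurable[OF finA2] by auto
  have m2: "emeasure (occ_mix (\<lambda>ys. if skel2_ok A2 ys then pw e srwP ys else 0) visits (\<lambda>_. 1) A2) ?B
    = (\<Sum>x\<in>A1. ennreal (e x) * seg_sum srwP A2 ?g x)"
    by (rule trans[OF emeasure_occ_mix[OF finA2 _ B] sum_skel2[OF assms(3) e(1,2) srw.K_nonneg, where g="?g"]]) simp
  have seg: "seg_sum srwP A2 ?g x \<le> ennreal (2 * exp (- (\<theta> * T)))" for x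
  proof -
    have "seg_sum srwP A2 ?g x \<le> lsum (\<lambda>zs. ennreal (exp (- (\<theta> * T))) *
       (if exits A2 x zs then ennreal (pathw (\<lambda>x y. 1 / (1 - \<theta>) * srwP x y) x zs * 1) else 0))"
      unfolding seg_sum_def
    proof (rule lsum_mono)
      fix zs
      show "(if exits A2 x zs then ennreal (pathw srwP x zs) * ?g (x # zs) else 0) \<le> ennreal (exp (- (\<theta> * T))) *
       (if exits A2 x zs then ennreal (pathw (\<lambda>x y. 1 / (1 - \<theta>) * srwP x y) x zs * 1) else 0)"
      proof (cases "exits A2 x zs")
        case True
        have "?g (x # zs) \<le> ennreal (exp (- (\<theta> * T)) * (1 / (1 - \<theta>)) ^ length zs)"
          using gamma_field_chernoff[OF finA2 \<theta>(1,2), of "visits (x # zs)" T] sum_visits[OF finA2 True] by simp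
        then have "ennreal (pathw srwP x zs) * ?g (x # zs) \<le> ennreal (pathw srwP x zs) * ennreal (exp (- (\<theta> * T)) * (1 / (1 - \<theta>)) ^ length zs)"
          by (rule mult_left_mono) simp
        also have "\<dots> = ennreal (exp (- (\<theta> * T))) * ennreal (pathw (\<lambda>x y. 1 / (1 - \<theta>) * srwP x y) x zs * 1)"
          unfolding pathw_scale using \<theta> by (simp add: ennreal_mult[symmetric] pathw_nonneg srw.K_nonneg ac_simps del: times_divide_eq_left times_divide_eq_right power_one_over)
        finally show ?thesis using True by simp
      qed simp
    qed
    also have "\<dots> = ennreal (exp (- (\<theta> * T))) * hs (\<lambda>x y. 1 / (1 - \<theta>) * srwP x y) A2 (\<lambda>_. 1) x"
      by (simp only: lsum_cmult hs_def)
    also have "\<dots> \<le> ennreal (exp (- (\<theta> * T))) * 2"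
      using \<theta> by (intro mult_left_mono srw_exit_exp_moment[OF L _ \<theta>(2,3)]) (auto simp: A2)
    also have "\<dots> = ennreal (2 * exp (- (\<theta> * T)))" by (simp add: ennreal_mult mult.commute)
    finally show ?thesis .
  qed
  have "(\<Sum>x\<in>A1. ennreal (e x) * seg_sum srwP A2 ?g x) \<le> (\<Sum>x\<in>A1. ennreal (e x) * ennreal (2 * exp (- (\<theta> * T))))"
    using seg by (intro sum_mono mult_left_mono) auto
  also have "\<dots> = (\<Sum>x\<in>A1. ennreal (e x)) * ennreal (2 * exp (- (\<theta> * T)))" by (rule sum_distrib_right[symmetric])
  also have "(\<Sum>x\<in>A1. ennreal (e x)) = ennreal 1" unfolding e(3)[symmetric] using e(1) by (intro sum_ennreal) auto
  finally show ?thesis unfolding m2 by simp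
qed

section \<open>Entrance law of the confined walk\<close>

context confined_box
begin

text \<open>Entrance probabilities are compared in pairs \<open>x\<close>, \<open>x'\<close>: on the
  shell through the simple random walk, where the unknown multiplier \<open>m\<close> cancels, and
  outside by \<open>hitting_ratio_propagates\<close>. In the sum over \<open>x'\<close> the entrance
  probabilities add up to one and the weights to \<open>cap A1\<close>, which produces the
  normalised measure.\<close>

lemma hitting_lower_bound:
  fixes \<epsilon> \<theta> \<nu> m0 :: real
  assumes A1: "A1 = supbox x0 l1" "0 \<le> l1" and l2: "l1 < l2 - 1" "l2 \<le> L" and A2: "A2 = supbox x0 L"
    and \<epsilon>: "0 < \<epsilon>" "\<epsilon> \<le> 1 / 1000"
    and \<theta>: "\<kappa> \<le> \<theta>" "\<theta> < 1" "\<theta> * (2 * (real CARD('d) * (real_of_int (L + 1))\<^sup>2)) \<le> 1"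
    and up: "(1 / (1 - \<kappa>)) ^ n \<le> 1 + \<epsilon>" and lo: "1 - \<epsilon> \<le> (1 / (1 + \<kappa>)) ^ n"
    and tiny: "2 * ((1 - \<theta>) / (1 - \<kappa>)) ^ n \<le> \<epsilon> * (m0 * \<nu>)" and m0: "0 < m0" and \<nu>: "0 < \<nu>"
    and bdry: "\<And>x. x \<in> A1 \<Longrightarrow> \<not> nbrs x \<subseteq> A1 \<Longrightarrow> \<nu> \<le> eqm A1 x"
    and shell: "\<And>y. y \<in> supbox x0 l2 \<Longrightarrow> y \<notin> supbox x0 (l2 - 1) \<Longrightarrow>
       \<exists>m\<ge>m0. \<forall>x\<in>A1. m * eqm A1 x \<le> srw_hit A1 A2 x y \<and> srw_hit A1 A2 x y \<le> (1 + \<epsilon>) * m * eqm A1 x"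
    and osc: "\<And>x y. x \<in> supbox x0 (L + 1) \<Longrightarrow> y \<in> supbox x0 (L + 1) \<Longrightarrow> f x \<le> (1 + \<epsilon>) * f y"
    and z: "z \<in> U - A2" and x: "x \<in> A1" and cap: "0 < cap A1"
  shows "(1 - 10 * \<epsilon>) * eqm_norm A1 x \<le> chit (- A1) x z"
proof -
  have A2U: "A2 \<subseteq> U" unfolding A2 using nbrsU by auto
  have sub: "A1 \<subseteq> supbox x0 (l2 - 1)" "supbox x0 (l2 - 1) \<subseteq> supbox x0 l2" "supbox x0 l2 \<subseteq> A2"
    unfolding A1 A2 by (rule supbox_mono; use l2 in simp)+
  have A1_big: "w \<in> supbox x0 (L + 1)" "w \<in> U" if "w \<in> A1" for w
  proof -
    have "w \<in> A2" using that sub by blast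
    then show "w \<in> supbox x0 (L + 1)" "w \<in> U" using A2U supbox_mono[of L "L + 1" x0] by (auto simp: A2)
  qed
  let ?e = "eqm A1" and ?p = "chit (A2 - A1)"
  \<comment> \<open>Equilibrium weights are either zero or at least \<open>\<nu>\<close>, so
    additive errors can be turned into relative ones.\<close>
  have pos_e: "\<nu> \<le> ?e w" if "w \<in> A1" "?e w \<noteq> 0" for w
    using that bdry[of w] eqm_interior[of w A1] by blast
  have pair: "(1 - 10 * \<epsilon>) * ?e x * chit (- A1) x' z \<le> ?e x' * chit (- A1) x z" if x': "x' \<in> A1" for x'
  proof (cases "?e x = 0 \<or> ?e x' = 0")
    case True
    have zA1: "z \<notin> A1" using z sub by auto
    have "?e x' = 0 \<Longrightarrow> chit (- A1) x' z = 0"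
      using bdry[OF x'] \<nu> chit_interior[OF _ zA1 x'] by fastforce
    moreover have "0 \<le> ?e x' * chit (- A1) x z" by (intro mult_nonneg_nonneg) (auto simp: eqm_nonneg)
    ultimately show ?thesis using True by auto
  next
    case False
    then have ex: "\<nu> \<le> ?e x" "\<nu> \<le> ?e x'" using pos_e x x' by auto
    have fx: "0 < f x" "0 < f x'" using fpos A1_big x x' by auto
    show ?thesis
    proof (rule hitting_ratio_propagates[OF A1 l2 A2 x x' _ _ refl])
      show "0 \<le> (1 - 10 * \<epsilon>) * ?e x" using \<epsilon> by (intro mult_nonneg_nonneg) (auto simp: eqm_nonneg)
      show "0 \<le> ?e x'" by (rule eqm_nonneg)
      show "z \<in> U" "z \<notin> supbox x0 (l2 - 1)" using z sub by auto
      fix y assume y: "y \<in> supbox x0 l2 - supbox x0 (l2 - 1)"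
      then obtain m where m: "m0 \<le> m" and mb: "\<And>w. w \<in> A1 \<Longrightarrow> m * ?e w \<le> srw_hit A1 A2 w y"
        "\<And>w. w \<in> A1 \<Longrightarrow> srw_hit A1 A2 w y \<le> (1 + \<epsilon>) * m * ?e w"
        using shell[of y] by auto
      have yV: "y \<in> A2 - A1" using y sub by auto
      have V: "A2 - A1 \<subseteq> supbox x0 L" by (auto simp: A2)
      have fy: "0 < f y" using fpos yV A2U by auto
      note CU = chit_srw_hit_bounds[OF V yV _ _ \<theta>, of _ n, folded srw_hit_def]
      have tiny': "2 * ((1 - \<theta>) / (1 - \<kappa>)) ^ n \<le> \<epsilon> * (m * ?e w)" if "\<nu> \<le> ?e w" for w
      proof -
        have "m0 * \<nu> \<le> m * ?e w" using m m0 \<nu> that by (intro mult_mono) auto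
        then show ?thesis using tiny \<epsilon> by (meson mult_left_mono order_trans less_imp_le)
      qed
      have tiny2: "2 * (1 - \<theta>) ^ n \<le> \<epsilon> * (m * ?e w)" if "\<nu> \<le> ?e w" for w
      proof -
        have "(1 - \<theta>) * (1 - \<kappa>) \<le> (1 - \<theta>) * 1" using \<theta> \<kappa> by (intro mult_left_mono) auto
        then have "1 - \<theta> \<le> (1 - \<theta>) / (1 - \<kappa>)" using \<kappa> by (simp add: pos_le_divide_eq)
        then have "(1 - \<theta>) ^ n \<le> ((1 - \<theta>) / (1 - \<kappa>)) ^ n" using \<theta> by (intro power_mono) auto
        then show ?thesis using tiny'[OF that] by linarith
      qed
      define a where "a = m * ?e x"
      define a' where "a' = m * ?e x'"
      have a: "0 < a" "0 < a'" using m m0 ex \<nu> by (auto simp: a_def a'_def)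
      have up_x': "f y * ?p x' y \<le> f x' * ((1 + 5 * \<epsilon>) * a')"
      proof -
        have "f y * ?p x' y \<le> f x' * ((1 / (1 - \<kappa>)) ^ n * srw_hit A1 A2 x' y + 2 * ((1 - \<theta>) / (1 - \<kappa>)) ^ n)"
          using CU(1)[of x'] A1_big x' by auto
        also have "\<dots> \<le> f x' * ((1 + 5 * \<epsilon>) * a')"
        proof (intro mult_left_mono)
          have "(1 / (1 - \<kappa>)) ^ n * srw_hit A1 A2 x' y \<le> (1 + \<epsilon>) * ((1 + \<epsilon>) * a')"
            using up mb(2)[OF x'] \<kappa> \<epsilon> by (intro mult_mono) (auto simp: a'_def srw_hit_def mult.assoc)
          also have "\<dots> = (1 + 2 * \<epsilon> + \<epsilon> * \<epsilon>) * a'" by (simp add: algebra_simps)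
          also have "\<dots> \<le> (1 + 3 * \<epsilon>) * a'"
          proof -
            have "\<epsilon> * \<epsilon> \<le> \<epsilon> * 1" using \<epsilon> by (intro mult_left_mono) auto
            then show ?thesis using a by (intro mult_right_mono) auto
          qed
          finally have s1: "(1 / (1 - \<kappa>)) ^ n * srw_hit A1 A2 x' y \<le> (1 + 3 * \<epsilon>) * a'" .
          have s2: "2 * ((1 - \<theta>) / (1 - \<kappa>)) ^ n \<le> \<epsilon> * a'" using tiny'[OF ex(2)] by (simp add: a'_def)
          have "(1 + 3 * \<epsilon>) * a' + \<epsilon> * a' \<le> (1 + 5 * \<epsilon>) * a'" using a \<epsilon> by (simp add: algebra_simps)
          with s1 s2 show "(1 / (1 - \<kappa>)) ^ n * srw_hit A1 A2 x' y + 2 * ((1 - \<theta>) / (1 - \<kappa>)) ^ n \<le> (1 + 5 * \<epsilon>) * a'" by linarith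
        qed (use fx in auto)
        finally show ?thesis .
      qed
      have lo_x: "f x * ((1 - 2 * \<epsilon>) * a) \<le> f y * ?p x y"
      proof -
        have "f x * ((1 - 2 * \<epsilon>) * a) \<le> f x * ((1 / (1 + \<kappa>)) ^ n * srw_hit A1 A2 x y - 2 * (1 - \<theta>) ^ n)"
        proof (intro mult_left_mono)
          have s1: "(1 - \<epsilon>) * a \<le> (1 / (1 + \<kappa>)) ^ n * srw_hit A1 A2 x y"
            using lo mb(1)[OF x] \<kappa> \<epsilon> a by (intro mult_mono) (auto simp: a_def)
          have s2: "2 * (1 - \<theta>) ^ n \<le> \<epsilon> * a" using tiny2[OF ex(1)] by (simp add: a_def)
          have "(1 - 2 * \<epsilon>) * a = (1 - \<epsilon>) * a - \<epsilon> * a" by (simp add: algebra_simps)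
          with s1 s2 show "(1 - 2 * \<epsilon>) * a \<le> (1 / (1 + \<kappa>)) ^ n * srw_hit A1 A2 x y - 2 * (1 - \<theta>) ^ n" by linarith
        qed (use fx in auto)
        also have "\<dots> \<le> f y * ?p x y" using CU(2)[of x] A1_big x by auto
        finally show ?thesis .
      qed
      have ppos: "0 < ?p x y"
      proof -
        have "0 < f x * ((1 - 2 * \<epsilon>) * a)" using fx a \<epsilon> by (intro mult_pos_pos) auto
        then have "0 < f y * ?p x y" using lo_x by linarith
        then show ?thesis using fy by (simp add: zero_less_mult_iff)
      qed
      \<comment> \<open>The budget behind \<open>10 * \<epsilon>\<close>: the two entrance estimates
        cost \<open>1 + 5 * \<epsilon>\<close> and \<open>1 - 2 * \<epsilon>\<close>, and the
        oscillation of \<open>f\<close> between the two points another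
        \<open>1 + \<epsilon>\<close>.\<close>
      have num: "(1 - 10 * \<epsilon>) * ((1 + \<epsilon>) * (1 + 5 * \<epsilon>)) \<le> 1 - 2 * \<epsilon>"
      proof -
        have "\<epsilon> * \<epsilon> \<le> \<epsilon> * (1 / 1000)" using \<epsilon> by (intro mult_left_mono) auto
        then have "(1 + \<epsilon>) * (1 + 5 * \<epsilon>) \<le> 1 + 7 * \<epsilon>" using \<epsilon> by (simp add: algebra_simps)
        then have "(1 - 10 * \<epsilon>) * ((1 + \<epsilon>) * (1 + 5 * \<epsilon>)) \<le> (1 - 10 * \<epsilon>) * (1 + 7 * \<epsilon>)"
          using \<epsilon> by (intro mult_left_mono) auto
        also have "\<dots> = 1 - 3 * \<epsilon> - 70 * (\<epsilon> * \<epsilon>)" by (simp add: algebra_simps)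
        also have "\<dots> \<le> 1 - 2 * \<epsilon>" using \<epsilon> by (simp add: algebra_simps)
        finally show ?thesis .
      qed
      have c10: "0 \<le> (1 - 10 * \<epsilon>) * ?e x" using \<epsilon> by (intro mult_nonneg_nonneg) (auto simp: eqm_nonneg)
      have "f y * ((1 - 10 * \<epsilon>) * ?e x * ?p x' y) = ((1 - 10 * \<epsilon>) * ?e x) * (f y * ?p x' y)" by (simp add: ac_simps)
      also have "\<dots> \<le> ((1 - 10 * \<epsilon>) * ?e x) * (f x' * ((1 + 5 * \<epsilon>) * a'))"
        by (rule mult_left_mono[OF up_x' c10])
      also have "\<dots> \<le> ((1 - 10 * \<epsilon>) * ?e x) * (((1 + \<epsilon>) * f x) * ((1 + 5 * \<epsilon>) * a'))"
        using osc[OF A1_big(1)[OF x'] A1_big(1)[OF x]] \<epsilon> a by (intro mult_left_mono[OF _ c10] mult_right_mono) auto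
      also have "\<dots> = ((1 - 10 * \<epsilon>) * ((1 + \<epsilon>) * (1 + 5 * \<epsilon>))) * (?e x' * (f x * a))"
        by (simp only: a_def a'_def) (simp add: ac_simps)
      also have "\<dots> \<le> (1 - 2 * \<epsilon>) * (?e x' * (f x * a))"
        by (rule mult_right_mono[OF num]) (use fx a in \<open>auto intro!: mult_nonneg_nonneg simp: eqm_nonneg\<close>)
      also have "\<dots> = ?e x' * (f x * ((1 - 2 * \<epsilon>) * a))" by (simp add: ac_simps)
      also have "\<dots> \<le> ?e x' * (f y * ?p x y)" using lo_x eqm_nonneg by (intro mult_left_mono) auto
      finally have "f y * ((1 - 10 * \<epsilon>) * ?e x * ?p x' y) \<le> f y * (?e x' * ?p x y)" by (simp add: ac_simps)
      then show "(1 - 10 * \<epsilon>) * ?e x * ?p x' y \<le> ?e x' * ?p x y \<and> 0 < ?p x y" using fy ppos by simp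
    qed
  qed
  have "(1 - 10 * \<epsilon>) * ?e x = (\<Sum>x'\<in>A1. (1 - 10 * \<epsilon>) * ?e x * chit (- A1) x' z)"
  proof -
    have "(\<Sum>x'\<in>A1. chit (- A1) x' z) = 1" using chit_total[of A1 z] z x sub A2U by auto
    then show ?thesis by (simp add: sum_distrib_left[symmetric])
  qed
  also have "\<dots> \<le> (\<Sum>x'\<in>A1. ?e x' * chit (- A1) x z)" by (rule sum_mono) (rule pair)
  also have "\<dots> = cap A1 * chit (- A1) x z" by (simp add: cap_def sum_distrib_right)
  finally show ?thesis using cap by (simp add: eqm_norm_def pos_divide_le_eq mult.commute)
qed

end

section \<open>Remaining elementary bounds and the final choice of parameters\<close>

lemma card_supbox:
  fixes x :: "int^'d::finite"
  assumes "0 \<le> m"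
  shows "real (card (supbox x m)) \<le> (2 * real_of_int m + 1) ^ CARD('d)"
proof -
  let ?P = "PiE (UNIV :: 'd set) (\<lambda>i. {x $ i - m .. x $ i + m})"
  have "supbox x m \<subseteq> (\<lambda>f. \<chi> i. f i) ` ?P"
  proof
    fix z assume z: "z \<in> supbox x m"
    have "x $ i - m \<le> z $ i \<and> z $ i \<le> x $ i + m" for i
    proof -
      have "\<bar>z $ i - x $ i\<bar> \<le> m" using z by (simp add: supbox_def)
      then show ?thesis by arith
    qed
    then have "(\<lambda>i. z $ i) \<in> ?P" by auto
    then show "z \<in> (\<lambda>f. \<chi> i. f i) ` ?P"
      by (intro image_eqI[of _ _ "\<lambda>i. z $ i"]) (simp_all only: vec_nth_inverse vec_lambda_eta)
  qed
  then have "card (supbox x m) \<le> card ?P"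
    by (rule surj_card_le[rotated]) (intro finite_PiE; auto)
  also have "card ?P = nat (2 * m + 1) ^ CARD('d)"
    by (subst card_PiE) auto
  finally have "real (card (supbox x m)) \<le> real (nat (2 * m + 1) ^ CARD('d))" by (simp only: of_nat_le_iff)
  then show ?thesis using assms by simp
qed

lemma qsd_probability:
  assumes "finite V" and f: "\<And>x. x \<in> V \<Longrightarrow> 0 < f x" and PF: "is_PF f U V f1"
  shows "0 \<le> qsd f V f1 z" "z \<notin> V \<Longrightarrow> qsd f V f1 z = 0" "(\<Sum>z\<in>V. qsd f V f1 z) = 1"
proof -
  let ?S = "\<Sum>z\<in>V. f1 z * (f z)\<^sup>2"
  have nn: "0 \<le> f1 x" if "x \<in> V" for x using PF that by (auto simp: is_PF_def)
  obtain x where x: "x \<in> V" "f1 x \<noteq> 0" using PF by (auto simp: is_PF_def)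
  then have "0 < f1 x * (f x)\<^sup>2" using nn[of x] f[of x] by (intro mult_pos_pos) auto
  also have "\<dots> \<le> ?S" using x nn assms(1) by (intro member_le_sum) auto
  finally have S: "0 < ?S" .
  show "0 \<le> qsd f V f1 z" using nn S by (auto simp: qsd_def intro!: divide_nonneg_pos)
  show "z \<notin> V \<Longrightarrow> qsd f V f1 z = 0" by (simp add: qsd_def)
  have "(\<Sum>z\<in>V. qsd f V f1 z) = (\<Sum>z\<in>V. f1 z * (f z)\<^sup>2 / ?S)" by (rule sum.cong) (auto simp: qsd_def)
  also have "\<dots> = ?S / ?S" by (rule sum_divide_distrib[symmetric])
  finally show "(\<Sum>z\<in>V. qsd f V f1 z) = 1" using S by simp
qed

text \<open>The strict inequality \<open>1/8 < 1/4\<close> between the exponents leaves room for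
  polynomial prefactors and for the constant \<open>c\<close>.\<close>

lemma eventually_exp_beats_powr:
  fixes a c B b :: real
  assumes "0 < c" "0 < b"
  shows "\<forall>\<^sub>F N in sequentially. B * real N powr a * exp (- (c * real N powr (1 / 4))) \<le> b"
    and "\<forall>\<^sub>F N in sequentially. B * real N powr a * exp (- (c * real N powr (1 / 4))) \<le> exp (- (real N powr (1 / 8)))"
proof -
  have "((\<lambda>N. B * real N powr a * exp (- (c * real N powr (1 / 4)))) \<longlongrightarrow> 0) sequentially"
    using assms(1) by real_asymp
  from order_tendstoD(2)[OF this assms(2)]
  show "\<forall>\<^sub>F N in sequentially. B * real N powr a * exp (- (c * real N powr (1 / 4))) \<le> b"
    by eventually_elim simp
  have "((\<lambda>N. B * real N powr a * exp (- (c * real N powr (1 / 4))) * exp (real N powr (1 / 8))) \<longlongrightarrow> 0) sequentially"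
    using assms(1) by real_asymp
  from order_tendstoD(2)[OF this zero_less_one]
  show "\<forall>\<^sub>F N in sequentially. B * real N powr a * exp (- (c * real N powr (1 / 4))) \<le> exp (- (real N powr (1 / 8)))"
    by eventually_elim (simp add: exp_minus field_simps)
qed

theorem theorem5p5:
  fixes D :: "(real^'d::finite) set" and \<delta> :: real and R :: nat
    and \<phi> :: "real^'d \<Rightarrow> real" and \<epsilon> \<eta> \<delta>t :: real and r :: "nat \<Rightarrow> real"
  assumes "CARD('d) \<ge> 3"
    and "compact D" and "0 \<in> D"
    and "0 < \<delta>" and "\<delta> < min 1 (rD D / 2)"
    and "real R > 4 * rD D"
    and "smooth_closure (cball 0 (real R)) \<phi>"
    and "closure {x. \<phi> x \<noteq> 0} = cball 0 (real R)"
    and "\<forall>x\<in>ball 0 (real R). \<phi> x > 0"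
    and "harmonic_on (ball 0 (real R) - nbhd D \<delta>) \<phi>"
    and "0 < \<epsilon>" and "\<epsilon> < 1"
    and "0 < \<eta>" and "\<eta> < real R / 100"
    and "0 < r 1" and "r 1 < r 2" and "r 2 < r 3" and "r 3 < r 4" and "r 4 < r 5" and "r 5 < 1/4"
    and "r 1 * (real CARD('d) - 2) + r 5 < 1"
    and "r 1 < (real CARD('d) - 2) / (real CARD('d) - 1) * r 2"
    and "0 < \<delta>t"
    and "\<forall>N::nat. \<forall>x0::int^'d. N \<ge> 1 \<longrightarrow> inverse (real N) *\<^sub>R rv x0 \<in> nbhd D \<delta> \<longrightarrow>
           supbox x0 \<lfloor>\<delta>t * real N / 100\<rfloor> \<subseteq> Uball (real R - \<eta>) N"
  shows "\<exists>c>0. \<exists>N0::nat. \<forall>N\<ge>N0. \<forall>(x0::int^'d) f1.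
           inverse (real N) *\<^sub>R rv x0 \<in> nbhd D \<delta> \<longrightarrow>
           is_PF (fN \<phi> N) (Uball (real R) N) (Uball (real R) N - Abox x0 N (r 2)) f1 \<longrightarrow>
           (\<exists>Q :: ((int^'d \<Rightarrow> real) \<times> (int^'d \<Rightarrow> real)) measure.
            \<exists>M Mt. prob_space Q \<and>
              M \<in> Q \<rightarrow>\<^sub>M PiM (Abox x0 N (r 2)) (\<lambda>_. borel) \<and>
              Mt \<in> Q \<rightarrow>\<^sub>M PiM (Abox x0 N (r 2)) (\<lambda>_. borel) \<and>
              (\<forall>\<omega>\<in>space Q. \<forall>x\<in>Abox x0 N (r 2). 0 \<le> M \<omega> x \<and> 0 \<le> Mt \<omega> x) \<and>
              distr Q (PiM (Abox x0 N (r 2)) (\<lambda>_. borel)) M = law_eta1 \<phi> (real R) N x0 r \<epsilon> f1 \<and>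
              distr Q (PiM (Abox x0 N (r 2)) (\<lambda>_. borel)) Mt = law_eta2 \<phi> N x0 r \<epsilon> \<and>
              measure Q {\<omega>\<in>space Q. \<forall>x\<in>Abox x0 N (r 2). M \<omega> x \<ge> Mt \<omega> x}
                \<ge> 1 - exp (- (real N powr c)))"
proof -
  let ?d = "real CARD('d)" and ?r1 = "r 1" and ?r2 = "r 2"
  note hyp = assms
  have d3: "3 \<le> CARD('d)" and D: "compact D" "0 \<in> D" and \<delta>: "0 < \<delta>" "\<delta> < rD D / 2" and R: "real R > 4 * rD D"
    and \<phi>: "smooth_closure (cball 0 (real R)) \<phi>" "closure {x. \<phi> x \<noteq> 0} = cball 0 (real R)" "\<forall>x\<in>ball 0 (real R). \<phi> x > 0"
    and \<epsilon>: "0 < \<epsilon>" "\<epsilon> < 1" and r: "0 < ?r1" "?r1 < ?r2" "?r2 < 1 / 4"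
    using hyp by auto
  \<comment> \<open>Small enough that three factors \<open>1 - 10 * \<epsilon>0\<close> fit between
    the intensity factors \<open>1 + \<epsilon> / 4\<close> and
    \<open>1 + \<epsilon> / 3\<close>.\<close>
  define \<epsilon>0 where "\<epsilon>0 = \<epsilon> / 1000"
  have \<epsilon>0: "0 < \<epsilon>0" "\<epsilon>0 < 1" "\<epsilon>0 \<le> 1 / 1000" using \<epsilon> by (auto simp: \<epsilon>0_def)
  obtain r3 where r3: "?r1 < r3" "r3 < ?r2" and srw_ev: "\<forall>\<^sub>F N in sequentially. \<forall>x0 :: int^'d.
     (\<forall>x\<in>Abox x0 N ?r1. \<not> nbrs x \<subseteq> Abox x0 N ?r1 \<longrightarrow> 1 / (real N)\<^sup>2 \<le> eqm (Abox x0 N ?r1) x) \<and>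
     (\<forall>y. y \<in> Abox x0 N r3 \<longrightarrow> y \<notin> supbox x0 (\<lfloor>real N powr r3\<rfloor> - 1) \<longrightarrow>
       (\<exists>m\<ge>real N powr (- (?d + 1)). \<forall>x\<in>Abox x0 N ?r1.
          m * eqm (Abox x0 N ?r1) x \<le> srw_hit (Abox x0 N ?r1) (Abox x0 N ?r2) x y \<and>
          srw_hit (Abox x0 N ?r1) (Abox x0 N ?r2) x y \<le> (1 + \<epsilon>0) * m * eqm (Abox x0 N ?r1) x))"
    using srw_hit_asymptotics[OF d3 r(1,2) _ \<epsilon>0(1,2)] r by auto
  obtain C where C: "0 \<le> C" and conf_ev: "\<forall>\<^sub>F N in sequentially. \<forall>x0. inverse (real N) *\<^sub>R rv x0 \<in> nbhd D \<delta> \<longrightarrow>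
     confined_box (fN \<phi> N) (Uball (real R) N) x0 \<lfloor>real N powr ?r2\<rfloor> (C / real N) \<and>
     (\<forall>x\<in>supbox x0 (\<lfloor>real N powr ?r2\<rfloor> + 1). \<forall>y\<in>supbox x0 (\<lfloor>real N powr ?r2\<rfloor> + 1). fN \<phi> N x \<le> (1 + \<epsilon>0) * fN \<phi> N y) \<and>
     (phiN \<phi> N x0)\<^sup>2 \<le> C"
    using confined_box_eventually[OF D \<delta> R \<phi> _ _ \<epsilon>0(1), of ?r2] r by auto
  have ev: "\<forall>\<^sub>F N in sequentially. 4 \<le> real N powr (r3 - ?r1)"
    "\<forall>\<^sub>F N in sequentially. 16 * ?d * C \<le> real N powr (1 - 2 * ?r2)"
    "\<forall>\<^sub>F N in sequentially. C * real N powr (- (1 / 4)) \<le> \<epsilon>0 / 2"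
    by (rule eventually_powr_ge eventually_powr_small; use r r3 \<epsilon>0 in simp)+
  have ev_exp: "\<forall>\<^sub>F N in sequentially. 2 * real N powr (?d + 3) * exp (- (1 / (32 * ?d) * real N powr (1 / 4))) \<le> \<epsilon>0"
    "\<forall>\<^sub>F N in sequentially. 4 * C * 3 ^ CARD('d) * real N powr ?d * exp (- (1 / (8 * ?d) * real N powr (1 / 4))) \<le> exp (- (real N powr (1 / 8)))"
    by (rule eventually_exp_beats_powr; use \<epsilon>0 in simp)+
  show ?thesis
  proof (rule exI[of _ "1 / 8"], intro conjI)
    show "0 < (1 / 8 :: real)" by simp
    have "\<forall>\<^sub>F N in sequentially. \<forall>(x0::int^'d) f1.
           inverse (real N) *\<^sub>R rv x0 \<in> nbhd D \<delta> \<longrightarrow>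
           is_PF (fN \<phi> N) (Uball (real R) N) (Uball (real R) N - Abox x0 N (r 2)) f1 \<longrightarrow>
           (\<exists>Q :: ((int^'d \<Rightarrow> real) \<times> (int^'d \<Rightarrow> real)) measure.
            \<exists>M Mt. prob_space Q \<and>
              M \<in> Q \<rightarrow>\<^sub>M PiM (Abox x0 N (r 2)) (\<lambda>_. borel) \<and>
              Mt \<in> Q \<rightarrow>\<^sub>M PiM (Abox x0 N (r 2)) (\<lambda>_. borel) \<and>
              (\<forall>\<omega>\<in>space Q. \<forall>x\<in>Abox x0 N (r 2). 0 \<le> M \<omega> x \<and> 0 \<le> Mt \<omega> x) \<and>
              distr Q (PiM (Abox x0 N (r 2)) (\<lambda>_. borel)) M = law_eta1 \<phi> (real R) N x0 r \<epsilon> f1 \<and>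
              distr Q (PiM (Abox x0 N (r 2)) (\<lambda>_. borel)) Mt = law_eta2 \<phi> N x0 r \<epsilon> \<and>
              measure Q {\<omega>\<in>space Q. \<forall>x\<in>Abox x0 N (r 2). M \<omega> x \<ge> Mt \<omega> x}
                \<ge> 1 - exp (- (real N powr (1 / 8))))"
      using srw_ev conf_ev ev ev_exp eventually_ge_at_top[of 1]
    proof eventually_elim
      case (elim N)
      define n where "n = real N"
      have n: "1 \<le> n" "0 < n" using elim(8) by (auto simp: n_def)
      note E = elim(3-7)[folded n_def]
      show ?case
      proof (intro allI impI)
        fix x0 :: "int^'d" and f1
        assume x0: "inverse (real N) *\<^sub>R rv x0 \<in> nbhd D \<delta>"
          and PF: "is_PF (fN \<phi> N) (Uball (real R) N) (Uball (real R) N - Abox x0 N (r 2)) f1"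
        let ?f = "fN \<phi> N" and ?U = "Uball (real R) N :: (int^'d) set"
        define l1 where "l1 = \<lfloor>n powr ?r1\<rfloor>"
        define l2 where "l2 = \<lfloor>n powr r3\<rfloor>"
        define L where "L = \<lfloor>n powr ?r2\<rfloor>"
        define A1 where "A1 = Abox x0 N ?r1"
        define A2 where "A2 = Abox x0 N ?r2"
        have boxes: "A1 = supbox x0 l1" "A2 = supbox x0 L" "Abox x0 N r3 = supbox x0 l2"
          by (auto simp: A1_def A2_def Abox_def l1_def L_def l2_def n_def)
        define \<kappa> where "\<kappa> = C / n"
        have box: "confined_box ?f ?U x0 L \<kappa>"
          and osc: "\<And>x y. x \<in> supbox x0 (L + 1) \<Longrightarrow> y \<in> supbox x0 (L + 1) \<Longrightarrow> ?f x \<le> (1 + \<epsilon>0) * ?f y"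
          and phi_le: "(phiN \<phi> N x0)\<^sup>2 \<le> C"
          using elim(2) x0 by (auto simp: n_def L_def \<kappa>_def)
        interpret confined_box ?f ?U x0 L \<kappa> by (rule box)
        have ge1: "1 \<le> n powr a" if "0 \<le> a" for a using n that by (simp add: ge_one_powr_ge_zero)
        have padd: "n powr a * n powr b = n powr (a + b)" for a b by (simp add: powr_add)
        have l1: "0 \<le> l1" "real_of_int l1 \<le> n powr ?r1" using ge1[of ?r1] r by (auto simp: l1_def)
        have l12: "l1 < l2 - 1"
        proof -
          have "n powr ?r1 * 4 \<le> n powr ?r1 * n powr (r3 - ?r1)" using E(1) by (intro mult_left_mono) auto
          then have "4 * n powr ?r1 \<le> n powr r3" by (simp add: padd mult.commute)
          moreover have "n powr r3 < real_of_int l2 + 1" unfolding l2_def by (rule real_of_int_floor_add_one_gt)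
          moreover have "1 \<le> n powr ?r1" using r by (intro ge1) auto
          ultimately have "real_of_int l1 < real_of_int l2 - 1" using l1(2) by linarith
          then show ?thesis by linarith
        qed
        have l2L: "l2 \<le> L" unfolding l2_def L_def using n r3 by (intro floor_mono powr_mono) auto
        have Ln: "0 \<le> L" "real_of_int (L + 1) \<le> 2 * n powr ?r2"
        proof -
          have "1 \<le> n powr ?r2" using r by (intro ge1) auto
          then show "0 \<le> L" "real_of_int (L + 1) \<le> 2 * n powr ?r2" unfolding L_def of_int_add by auto linarith
        qed
        \<comment> \<open>Of the order of the inverse exit time, and admissible in the exponential
          moment because \<open>L + 1\<close> is at most \<open>2 * n powr (r 2)\<close>.\<close>
        define \<theta> where "\<theta> = 1 / (8 * ?d * n powr (2 * ?r2))"
        \<comment> \<open>Placed between the exit time scale \<open>n powr (2 * r 2)\<close>, below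
          \<open>n powr (1/2)\<close>, and the scale \<open>n\<close> at which the error
          \<open>\<kappa> = C / n\<close> becomes visible. It is the cutoff for the time spent and,
          rounded down to \<open>n0\<close>, for the number of steps.\<close>
        define T where "T = n powr (3 / 4)"
        define n0 where "n0 = nat \<lfloor>T\<rfloor>"
        have T1: "1 \<le> T" unfolding T_def by (rule ge1) simp
        have n0: "T / 2 \<le> real n0" "real n0 \<le> T" using floor_half[OF T1] T1 by (auto simp: n0_def)
        have big: "8 \<le> 8 * ?d * n powr (2 * ?r2)"
        proof -
          have "1 * 1 \<le> ?d * n powr (2 * ?r2)" using ge1[of "2 * ?r2"] r by (intro mult_mono) auto
          then show ?thesis by simp
        qed
        have \<theta>: "0 < \<theta>" "\<theta> < 1" "\<theta> * (2 * (?d * (real_of_int (L + 1))\<^sup>2)) \<le> 1"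
        proof -
          show "0 < \<theta>" "\<theta> < 1" using big unfolding \<theta>_def by (simp_all add: divide_less_eq)
          have "(real_of_int (L + 1))\<^sup>2 \<le> (2 * n powr ?r2)\<^sup>2" using Ln by (intro power_mono) auto
          also have "\<dots> = 4 * n powr (2 * ?r2)" by (simp add: power2_eq_square padd)
          finally have "2 * (?d * (real_of_int (L + 1))\<^sup>2) \<le> 8 * ?d * n powr (2 * ?r2)" by simp
          then have "\<theta> * (2 * (?d * (real_of_int (L + 1))\<^sup>2)) \<le> \<theta> * (8 * ?d * n powr (2 * ?r2))"
            using \<open>0 < \<theta>\<close> by (intro mult_left_mono) auto
          also have "\<dots> = 1" using n by (simp add: \<theta>_def)
          finally show "\<theta> * (2 * (?d * (real_of_int (L + 1))\<^sup>2)) \<le> 1" .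
        qed
        have \<kappa>\<theta>: "\<kappa> \<le> \<theta> / 2"
        proof -
          have "16 * ?d * C * n powr (2 * ?r2) \<le> n powr (1 - 2 * ?r2) * n powr (2 * ?r2)"
            using E(2) by (intro mult_right_mono) auto
          also have "\<dots> = n" using n by (simp add: padd)
          finally have "C * (16 * ?d * n powr (2 * ?r2)) \<le> n" by (simp add: ac_simps)
          then have "C / n \<le> 1 / (16 * ?d * n powr (2 * ?r2))" using n big by (simp add: divide_le_eq le_divide_eq)
          then show ?thesis by (simp add: \<kappa>_def \<theta>_def)
        qed
        have \<theta>T: "n powr (1 / 4) / (8 * ?d) \<le> \<theta> * T"
        proof -
          have "n powr (1 / 4) \<le> n powr (3 / 4 - 2 * ?r2)" using n r by (intro powr_mono) auto
          also have "\<dots> = T / n powr (2 * ?r2)" by (simp add: T_def powr_diff)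
          finally have "n powr (1 / 4) / (8 * ?d) \<le> T / n powr (2 * ?r2) / (8 * ?d)" by (intro divide_right_mono) auto
          then show ?thesis by (simp add: \<theta>_def ac_simps)
        qed
        have \<kappa>T: "\<kappa> * T \<le> \<epsilon>0 / 2"
        proof -
          have "\<kappa> * T = C * n powr (- (1 / 4))"
          proof -
            have "n powr (- (1 / 4)) = n powr (3 / 4) / n" using n powr_diff[of n "3 / 4" 1] by simp
            then show ?thesis by (simp add: \<kappa>_def T_def)
          qed
          then show ?thesis using E(3) by simp
        qed
        have bern: "1 - \<epsilon>0 / 2 \<le> (1 - \<kappa>) ^ n0"
        proof -
          have "\<kappa> * real n0 \<le> \<kappa> * T" using n0 \<kappa> by (intro mult_left_mono) auto
          then have "1 - \<epsilon>0 / 2 \<le> 1 + real n0 * (- \<kappa>)" using \<kappa>T by (simp add: mult.commute)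
          also have "\<dots> \<le> (1 + (- \<kappa>)) ^ n0" using \<kappa> by (intro Bernoulli_inequality) auto
          finally show ?thesis by simp
        qed
        have up: "(1 / (1 - \<kappa>)) ^ n0 \<le> 1 + \<epsilon>0"
        proof -
          have "1 \<le> (1 + \<epsilon>0) * (1 - \<epsilon>0 / 2)"
          proof -
            have "\<epsilon>0 * \<epsilon>0 \<le> \<epsilon>0 * 1" using \<epsilon>0 by (intro mult_left_mono) auto
            then show ?thesis by (simp add: algebra_simps)
          qed
          also have "\<dots> \<le> (1 + \<epsilon>0) * (1 - \<kappa>) ^ n0" using bern \<epsilon>0 by (intro mult_left_mono) auto
          finally show ?thesis using \<kappa> by (simp add: power_divide pos_divide_le_eq)
        qed
        have lo: "1 - \<epsilon>0 \<le> (1 / (1 + \<kappa>)) ^ n0"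
        proof -
          have "(1 - \<kappa>) * (1 + \<kappa>) \<le> 1" by (simp add: algebra_simps)
          then have "1 - \<kappa> \<le> 1 / (1 + \<kappa>)" using \<kappa> by (simp add: pos_le_divide_eq)
          then have "(1 - \<kappa>) ^ n0 \<le> (1 / (1 + \<kappa>)) ^ n0" using \<kappa> by (intro power_mono) auto
          then show ?thesis using bern \<epsilon>0 by linarith
        qed
        \<comment> \<open>Since \<open>\<kappa> \<le> \<theta> / 2\<close>, half of the decay
          survives the division by \<open>1 - \<kappa>\<close>. The result is exponentially small in
          \<open>n powr (1/4)\<close> and beats the polynomial lower bounds for the multiplier and
          for the boundary weights.\<close>
        have tiny: "2 * ((1 - \<theta>) / (1 - \<kappa>)) ^ n0 \<le> \<epsilon>0 * (n powr (- (?d + 1)) * (1 / n\<^sup>2))"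
        proof -
          have "1 - \<theta> \<le> (1 - \<theta> / 2) * (1 - \<theta> / 2)" by (simp add: algebra_simps)
          also have "\<dots> \<le> (1 - \<theta> / 2) * (1 - \<kappa>)" using \<kappa>\<theta> \<theta> by (intro mult_left_mono) auto
          finally have "(1 - \<theta>) / (1 - \<kappa>) \<le> 1 - \<theta> / 2" using \<kappa> by (simp add: pos_divide_le_eq)
          also have "1 - \<theta> / 2 \<le> exp (- (\<theta> / 2))" using exp_ge_add_one_self[of "- (\<theta> / 2)"] by simp
          finally have "((1 - \<theta>) / (1 - \<kappa>)) ^ n0 \<le> exp (- (\<theta> / 2)) ^ n0" using \<theta> \<kappa> by (intro power_mono) auto
          also have "\<dots> = exp (- (\<theta> / 2 * real n0))" by (simp add: exp_of_nat_mult[symmetric] mult.commute)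
          also have "\<dots> \<le> exp (- (1 / (32 * ?d) * n powr (1 / 4)))"
          proof -
            have "1 / (32 * ?d) * n powr (1 / 4) = n powr (1 / 4) / (8 * ?d) / 4" by simp
            also have "\<dots> \<le> \<theta> * T / 4" using \<theta>T by (rule divide_right_mono) simp
            also have "\<dots> = \<theta> / 2 * (T / 2)" by simp
            also have "\<dots> \<le> \<theta> / 2 * real n0" using n0 \<theta> by (intro mult_left_mono) auto
            finally have "1 / (32 * ?d) * n powr (1 / 4) \<le> \<theta> / 2 * real n0" .
            then show ?thesis by simp
          qed
          finally have s: "((1 - \<theta>) / (1 - \<kappa>)) ^ n0 \<le> exp (- (1 / (32 * ?d) * n powr (1 / 4)))" .
          have inv: "n powr (?d + 3) * (n powr (- (?d + 1)) * (1 / n\<^sup>2)) = 1"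
          proof -
            have "n\<^sup>2 = n powr 2" using n powr_realpow[of n 2] by simp
            then show ?thesis using n by (simp add: padd)
          qed
          have "2 * exp (- (1 / (32 * ?d) * n powr (1 / 4)))
            = 2 * exp (- (1 / (32 * ?d) * n powr (1 / 4))) * (n powr (?d + 3) * (n powr (- (?d + 1)) * (1 / n\<^sup>2)))"
            by (simp only: inv mult_1_right)
          also have "\<dots> = (2 * n powr (?d + 3) * exp (- (1 / (32 * ?d) * n powr (1 / 4)))) * (n powr (- (?d + 1)) * (1 / n\<^sup>2))"
            by (simp only: mult_ac)
          also have "\<dots> \<le> \<epsilon>0 * (n powr (- (?d + 1)) * (1 / n\<^sup>2))"
            using E(4) by (intro mult_right_mono) auto
          finally show ?thesis using s by linarith
        qed
        have bdry: "1 / n\<^sup>2 \<le> eqm A1 x" if "x \<in> A1" "\<not> nbrs x \<subseteq> A1" for x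
          using elim(1) that by (auto simp: A1_def n_def)
        have shell: "\<exists>m\<ge>n powr (- (?d + 1)). \<forall>x\<in>A1. m * eqm A1 x \<le> srw_hit A1 A2 x y \<and> srw_hit A1 A2 x y \<le> (1 + \<epsilon>0) * m * eqm A1 x"
          if "y \<in> supbox x0 l2" "y \<notin> supbox x0 (l2 - 1)" for y
        proof -
          have "y \<in> Abox x0 N r3" using that boxes(3) by simp
          then show ?thesis using elim(1) that(2) unfolding A1_def A2_def n_def l2_def by blast
        qed
        have A1ne: "x0 \<in> A1" using l1 by (simp add: boxes supbox_def)
        have finA: "finite A1" "finite A2" by (simp_all add: boxes)
        have A12: "A1 \<subseteq> A2" unfolding boxes using l12 l2L by (intro supbox_mono) auto
        have cap_pos: "0 < cap A1"
        proof -
          obtain x and i :: 'd where x: "x \<in> A1" "x + axis i 1 \<notin> A1" using finite_lattice_exit[OF finA(1)] A1ne by blast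
          have "0 < 1 / n\<^sup>2" using n by simp
          also have "\<dots> \<le> eqm A1 x" using x by (intro bdry) (auto simp: subset_iff mem_nbrs nbr_iff)
          also have "\<dots> \<le> cap A1" unfolding cap_def using x finA eqm_nonneg by (intro member_le_sum) auto
          finally show ?thesis .
        qed
        have cap_le: "cap A1 \<le> 3 ^ CARD('d) * n powr ?d"
        proof -
          have "cap A1 \<le> (\<Sum>x\<in>A1. 1)" unfolding cap_def by (intro sum_mono eqm_le_1)
          also have "\<dots> = real (card A1)" by simp
          also have "\<dots> \<le> (2 * real_of_int l1 + 1) ^ CARD('d)" unfolding boxes by (rule card_supbox[OF l1(1)])
          also have "\<dots> \<le> (3 * n) ^ CARD('d)"
          proof (rule power_mono)
            have "n powr ?r1 \<le> n powr 1" using n r by (intro powr_mono) auto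
            then show "2 * real_of_int l1 + 1 \<le> 3 * n" using l1 n by simp
          qed (use l1 in simp)
          also have "\<dots> = 3 ^ CARD('d) * n powr ?d" using n by (simp add: power_mult_distrib powr_realpow)
          finally show ?thesis .
        qed
        let ?\<sigma> = "qsd ?f (?U - A2) f1" and ?e = "eqm_norm A1"
        have \<sigma>: "0 \<le> ?\<sigma> z" "z \<notin> ?U - A2 \<Longrightarrow> ?\<sigma> z = 0" "(\<Sum>z\<in>?U - A2. ?\<sigma> z) = 1" for z
          using qsd_probability[OF _ _ PF[folded A2_def]] finU fpos by auto
        have e: "0 \<le> ?e x" "x \<notin> A1 \<Longrightarrow> ?e x = 0" "(\<Sum>x\<in>A1. ?e x) = 1" for x
        proof -
          show "0 \<le> ?e x" using cap_pos eqm_nonneg[of A1 x] by (simp add: eqm_norm_def)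
          show "x \<notin> A1 \<Longrightarrow> ?e x = 0" by (simp add: eqm_norm_def eqm_def)
          have "(\<Sum>x\<in>A1. ?e x) = cap A1 / cap A1"
            unfolding eqm_norm_def sum_divide_distrib[symmetric] by (simp add: cap_def)
          then show "(\<Sum>x\<in>A1. ?e x) = 1" using cap_pos by simp
        qed
        define \<delta>' where "\<delta>' = 10 * \<epsilon>0"
        have \<delta>': "0 \<le> \<delta>'" "\<delta>' \<le> 1" using \<epsilon>0 by (auto simp: \<delta>'_def)
        define \<mu>1 where "\<mu>1 = occ_mix (\<lambda>s. if skel1_ok A1 A2 s then pw ?\<sigma> (cjump ?f ?U) (fst s @ snd s) else 0) (\<lambda>s. visits (snd s)) (cq ?f ?U) A2"
        define \<mu>2 where "\<mu>2 = occ_mix (\<lambda>ys. if skel2_ok A2 ys then pw ?e srwP ys else 0) visits (\<lambda>_. 1) A2"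
        define a1 where "a1 = (1 + \<epsilon> / 3) * (phiN \<phi> N x0)\<^sup>2 * cap A1"
        define a2 where "a2 = (1 + \<epsilon> / 4) * (phiN \<phi> N x0)\<^sup>2 * cap A1"
        have laws: "law_eta1 \<phi> (real R) N x0 r \<epsilon> f1 = ppp_occ_law A2 a1 \<mu>1" "law_eta2 \<phi> N x0 r \<epsilon> = ppp_occ_law A2 a2 \<mu>2"
          unfolding law_eta1_def law_eta2_def kappa1_occ_def kappa2_occ_def Let_def a1_def a2_def \<mu>1_def \<mu>2_def A1_def A2_def visits_def[abs_def]
          by (rule refl)+
        have A2U: "A2 \<subseteq> ?U" using nbrsU by (auto simp: boxes)
        have cqA: "0 < cq ?f ?U z" if "z \<in> A2" for z using that A2U cq_pos by auto
        have p1: "prob_space \<mu>1" unfolding \<mu>1_def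
          by (rule prob_space_skel1[OF A12 _ boxes(2) \<sigma>]) (use A1ne in auto)
        have p2: "prob_space \<mu>2" unfolding \<mu>2_def by (rule prob_space_skel2[OF finA e])
        have dom: "ennreal a2 * emeasure \<mu>2 X \<le> ennreal a1 * emeasure \<mu>1 X"
          if X: "X \<in> sets (fieldM A2)" "X \<subseteq> good_set A2 T" for X
        proof -
          let ?c = "(1 - \<delta>')\<^sup>2 * exp (- (\<kappa> * T))"
          have OD: "ennreal ?c * emeasure \<mu>2 X \<le> emeasure \<mu>1 X"
            unfolding \<mu>1_def \<mu>2_def
          proof (rule occupation_domination[OF A12 boxes(2) \<sigma> e(1,2) \<delta>' _ _ X])
            fix z x assume "z \<in> ?U - A2" "x \<in> A1"
            then show "(1 - \<delta>') * ?e x \<le> chit (- A1) x z"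
              unfolding \<delta>'_def
              by (intro hitting_lower_bound[OF boxes(1) l1(1) l12 l2L boxes(2) \<epsilon>0(1,3) _ \<theta>(2,3) up lo tiny _ _ bdry shell osc _ _ cap_pos])
                (use \<kappa>\<theta> \<theta> n in auto)
          next
            fix x y assume xy: "x \<in> supbox x0 (L + 1)" "y \<in> supbox x0 (L + 1)"
            have fy: "0 < ?f y" using xy boxU fpos by auto
            have a: "(1 - \<delta>') * (1 + \<epsilon>0) \<le> 1" using \<epsilon>0 by (simp add: \<delta>'_def algebra_simps)
            have "(1 - \<delta>') * ?f x \<le> (1 - \<delta>') * ((1 + \<epsilon>0) * ?f y)" using osc[OF xy] \<delta>' by (intro mult_left_mono) auto
            also have "\<dots> = ((1 - \<delta>') * (1 + \<epsilon>0)) * ?f y" by simp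
            also have "\<dots> \<le> 1 * ?f y" using fy a by (intro mult_right_mono) auto
            finally show "(1 - \<delta>') * ?f x \<le> ?f y" by simp
          qed
          \<comment> \<open>The exponential is at least \<open>1 - \<delta>'\<close>, so
            \<open>?c\<close> is at least \<open>1 - 3 * \<delta>'\<close>, which equals
            \<open>1 - 3 * \<epsilon> / 100\<close>.\<close>
          have "1 + \<epsilon> / 4 \<le> (1 + \<epsilon> / 3) * ?c"
          proof -
            have "1 - \<delta>' \<le> exp (- (\<kappa> * T))"
              using exp_ge_add_one_self[of "- (\<kappa> * T)"] \<kappa>T \<epsilon>0 by (simp add: \<delta>'_def)
            moreover have "1 - 2 * \<delta>' \<le> (1 - \<delta>')\<^sup>2" by (simp add: power2_eq_square algebra_simps)
            ultimately have "(1 - 2 * \<delta>') * (1 - \<delta>') \<le> ?c" using \<epsilon>0 by (intro mult_mono) (auto simp: \<delta>'_def)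
            moreover have "1 - 3 * \<delta>' \<le> (1 - 2 * \<delta>') * (1 - \<delta>')" by (simp add: algebra_simps)
            ultimately have "1 - 3 * \<delta>' \<le> ?c" by linarith
            then have "(1 + \<epsilon> / 3) * (1 - 3 * \<delta>') \<le> (1 + \<epsilon> / 3) * ?c" using \<epsilon> by (intro mult_left_mono) auto
            moreover have "1 + \<epsilon> / 4 \<le> (1 + \<epsilon> / 3) * (1 - 3 * \<delta>')"
            proof -
              have "\<epsilon> * \<epsilon> \<le> \<epsilon> * 1" using \<epsilon> by (intro mult_left_mono) auto
              moreover have "(1 + \<epsilon> / 3) * (1 - 3 * \<delta>') = 1 + \<epsilon> / 3 - 3 * \<delta>' - 3 * \<delta>' * \<epsilon> / 3" by (simp add: algebra_simps)
              moreover have "3 * \<delta>' * \<epsilon> / 3 = 1 / 100 * (\<epsilon> * \<epsilon>)" by (simp add: \<delta>'_def \<epsilon>0_def)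
              moreover have "3 * \<delta>' = 3 / 100 * \<epsilon>" by (simp add: \<delta>'_def \<epsilon>0_def)
              ultimately show ?thesis using \<epsilon> by linarith
            qed
            ultimately show ?thesis by linarith
          qed
          then have "(1 + \<epsilon> / 4) * ((phiN \<phi> N x0)\<^sup>2 * cap A1) \<le> (1 + \<epsilon> / 3) * ?c * ((phiN \<phi> N x0)\<^sup>2 * cap A1)"
            using cap_pos by (intro mult_right_mono) auto
          then have "a2 \<le> a1 * ?c" by (simp add: a1_def a2_def ac_simps)
          then have "ennreal a2 * emeasure \<mu>2 X \<le> ennreal (a1 * ?c) * emeasure \<mu>2 X"
            by (intro mult_right_mono ennreal_leI) auto
          also have "\<dots> = ennreal a1 * (ennreal ?c * emeasure \<mu>2 X)"
            using \<epsilon> cap_pos by (subst ennreal_mult) (auto simp: a1_def mult.assoc)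
          also have "\<dots> \<le> ennreal a1 * emeasure \<mu>1 X" by (intro mult_left_mono OD) auto
          finally show ?thesis .
        qed
        \<comment> \<open>The intensity is at most polynomial in \<open>n\<close>, as
          \<open>cap A1\<close> is bounded by the number of sites, while excursions longer than
          \<open>T\<close> are stretched exponentially rare.\<close>
        have bad: "a2 * measure \<mu>2 (space \<mu>2 - good_set A2 T) \<le> exp (- (n powr (1 / 8)))"
        proof -
          have sp: "space \<mu>2 = space (fieldM A2)"
            unfolding \<mu>2_def by (intro sets_eq_imp_space_eq sets_occ_mix finA) simp
          have "emeasure \<mu>2 (space (fieldM A2) - good_set A2 T) \<le> ennreal (2 * exp (- (\<theta> * T)))"
            unfolding \<mu>2_def by (rule skel2_bad_set[OF boxes(2) Ln(1) finA(1) e \<theta>])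
          then have m: "measure \<mu>2 (space \<mu>2 - good_set A2 T) \<le> 2 * exp (- (\<theta> * T))"
            unfolding sp measure_def by (simp add: enn2real_leI)
          have "a2 \<le> 2 * C * (3 ^ CARD('d) * n powr ?d)"
            unfolding a2_def using \<epsilon> phi_le cap_le C cap_pos by (intro mult_mono) auto
          then have "a2 * measure \<mu>2 (space \<mu>2 - good_set A2 T) \<le> (2 * C * (3 ^ CARD('d) * n powr ?d)) * (2 * exp (- (\<theta> * T)))"
            using m C by (intro mult_mono) auto
          also have "\<dots> \<le> (2 * C * (3 ^ CARD('d) * n powr ?d)) * (2 * exp (- (1 / (8 * ?d) * n powr (1 / 4))))"
            using \<theta>T C by (intro mult_left_mono) auto
          also have "\<dots> = 4 * C * 3 ^ CARD('d) * n powr ?d * exp (- (1 / (8 * ?d) * n powr (1 / 4)))" by simp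
          also have "\<dots> \<le> exp (- (n powr (1 / 8)))" by (rule E(5))
          finally show ?thesis .
        qed
        obtain Q :: "((int^'d \<Rightarrow> real) \<times> (int^'d \<Rightarrow> real)) measure" and M Mt where Q: "prob_space Q"
          "M \<in> Q \<rightarrow>\<^sub>M fieldM A2" "Mt \<in> Q \<rightarrow>\<^sub>M fieldM A2" "\<forall>\<omega>\<in>space Q. \<forall>x\<in>A2. 0 \<le> M \<omega> x \<and> 0 \<le> Mt \<omega> x"
          "distr Q (fieldM A2) M = ppp_occ_law A2 a1 \<mu>1" "distr Q (fieldM A2) Mt = ppp_occ_law A2 a2 \<mu>2"
          "measure Q {\<omega>\<in>space Q. \<forall>x\<in>A2. M \<omega> x \<ge> Mt \<omega> x} \<ge> 1 - a2 * measure \<mu>2 (space \<mu>2 - good_set A2 T)"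
        proof -
          have "\<exists>Q :: ((int^'d \<Rightarrow> real) \<times> (int^'d \<Rightarrow> real)) measure. \<exists>M Mt. prob_space Q \<and>
             M \<in> Q \<rightarrow>\<^sub>M fieldM A2 \<and> Mt \<in> Q \<rightarrow>\<^sub>M fieldM A2 \<and>
             (\<forall>\<omega>\<in>space Q. \<forall>x\<in>A2. 0 \<le> M \<omega> x \<and> 0 \<le> Mt \<omega> x) \<and>
             distr Q (fieldM A2) M = ppp_occ_law A2 a1 \<mu>1 \<and> distr Q (fieldM A2) Mt = ppp_occ_law A2 a2 \<mu>2 \<and>
             measure Q {\<omega>\<in>space Q. \<forall>x\<in>A2. M \<omega> x \<ge> Mt \<omega> x} \<ge> 1 - a2 * measure \<mu>2 (space \<mu>2 - good_set A2 T)"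
          proof (rule poisson_coupling[OF finA(2) p1 _ _ p2 _ _ _ _ good_set_measurable[OF finA(2)] dom])
            show "sets \<mu>1 = sets (fieldM A2)" unfolding \<mu>1_def by (rule sets_occ_mix[OF finA(2) cqA])
            show "AE y in \<mu>1. \<forall>z\<in>A2. 0 \<le> y z" unfolding \<mu>1_def by (rule AE_occ_mix_nonneg[OF finA(2) cqA])
            show "sets \<mu>2 = sets (fieldM A2)" unfolding \<mu>2_def by (rule sets_occ_mix[OF finA(2)]) simp
            show "AE y in \<mu>2. \<forall>z\<in>A2. 0 \<le> y z" unfolding \<mu>2_def by (rule AE_occ_mix_nonneg[OF finA(2)]) simp
            show "0 \<le> a1" "0 \<le> a2" using \<epsilon> cap_pos by (auto simp: a1_def a2_def)
          qed
          then show thesis using that by blast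
        qed
        have "1 - exp (- (real N powr (1 / 8))) \<le> measure Q {\<omega>\<in>space Q. \<forall>x\<in>A2. M \<omega> x \<ge> Mt \<omega> x}"
          using Q(7) bad by (simp add: n_def)
        then show "\<exists>Q :: ((int^'d \<Rightarrow> real) \<times> (int^'d \<Rightarrow> real)) measure.
            \<exists>M Mt. prob_space Q \<and>
              M \<in> Q \<rightarrow>\<^sub>M PiM (Abox x0 N (r 2)) (\<lambda>_. borel) \<and>
              Mt \<in> Q \<rightarrow>\<^sub>M PiM (Abox x0 N (r 2)) (\<lambda>_. borel) \<and>
              (\<forall>\<omega>\<in>space Q. \<forall>x\<in>Abox x0 N (r 2). 0 \<le> M \<omega> x \<and> 0 \<le> Mt \<omega> x) \<and>
              distr Q (PiM (Abox x0 N (r 2)) (\<lambda>_. borel)) M = law_eta1 \<phi> (real R) N x0 r \<epsilon> f1 \<and>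
              distr Q (PiM (Abox x0 N (r 2)) (\<lambda>_. borel)) Mt = law_eta2 \<phi> N x0 r \<epsilon> \<and>
              measure Q {\<omega>\<in>space Q. \<forall>x\<in>Abox x0 N (r 2). M \<omega> x \<ge> Mt \<omega> x}
                \<ge> 1 - exp (- (real N powr (1 / 8)))"
          using Q(1-6) unfolding laws A2_def[symmetric] by blast
      qed
    qed
    then show "\<exists>N0::nat. \<forall>N\<ge>N0. \<forall>(x0::int^'d) f1.
           inverse (real N) *\<^sub>R rv x0 \<in> nbhd D \<delta> \<longrightarrow>
           is_PF (fN \<phi> N) (Uball (real R) N) (Uball (real R) N - Abox x0 N (r 2)) f1 \<longrightarrow>
           (\<exists>Q :: ((int^'d \<Rightarrow> real) \<times> (int^'d \<Rightarrow> real)) measure.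
            \<exists>M Mt. prob_space Q \<and>
              M \<in> Q \<rightarrow>\<^sub>M PiM (Abox x0 N (r 2)) (\<lambda>_. borel) \<and>
              Mt \<in> Q \<rightarrow>\<^sub>M PiM (Abox x0 N (r 2)) (\<lambda>_. borel) \<and>
              (\<forall>\<omega>\<in>space Q. \<forall>x\<in>Abox x0 N (r 2). 0 \<le> M \<omega> x \<and> 0 \<le> Mt \<omega> x) \<and>
              distr Q (PiM (Abox x0 N (r 2)) (\<lambda>_. borel)) M = law_eta1 \<phi> (real R) N x0 r \<epsilon> f1 \<and>
              distr Q (PiM (Abox x0 N (r 2)) (\<lambda>_. borel)) Mt = law_eta2 \<phi> N x0 r \<epsilon> \<and>
              measure Q {\<omega>\<in>space Q. \<forall>x\<in>Abox x0 N (r 2). M \<omega> x \<ge> Mt \<omega> x}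
                \<ge> 1 - exp (- (real N powr (1 / 8))))"
      by (simp only: eventually_sequentially)
  qed
qed

end
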